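(* Let $K$ be an abstract simplicial complex on $[m]$ and let $\underline X=\{X_i\}_{i=1}^m$ be (pointed) CW-complexes such that $H^*(X_i;\Bbbk)$ is a free $\Bbbk$-module for every $i$. The algebra structures on $B(\underline X,K)$ and $C(\underline X,K)$ coincide up to sign on products of classes with disjoint support: under the additive isomorphism $f_{\underline X}\colon C(\underline X,K)\to B(\underline X,K)$, for $x=\omega_Iy_L\otimes h$ and $x'=\omega_{I'}y_{L'}\otimes h'$ with $(I\cup L)\cap(I'\cup L')=\emptyset$ (and $h\in H^{I\cup L}$, $h'\in H^{I'\cup L'}$ tensor products of homogeneous elements) one has $f_{\underline X}(xx')=\pm f_{\underline X}(x)f_{\underline X}(x')$. In particular, if $X_i$ is a suspension space for all $i$, then the algebra structures on $B(\underline X,K)$ and $C(\underline X,K)$ are isomorphic up to sign, i.e. $f_{\underline X}(xx')=\pm f_{\underline X}(x)f_{\underline X}(x')$ for all such $x,x'$, with no condition on the supports.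
   Context: $\Bbbk$ is either $\mathbb Z$ or a field, and $[m]=\{1,\dots,m\}$. The algebra $\bar R(K)$ is generated over $\Bbbk$ by $\omega_1,\dots,\omega_m,y_1,\dots,y_m$ with relations $\omega_i^2=0$, $\omega_i\omega_j=-\omega_j\omega_i$, $y_iy_j=y_jy_i$, $\omega_iy_j=y_j\omega_i$, $y_i^2=0$, $\omega_iy_i=0$, and $\prod_{j\in\sigma}y_j=0$ for $\sigma\notin K$. It has $\Bbbk$-basis $\{\omega_Iy_L\mid L\in K,\ I\subset[m],\ I\cap L=\emptyset\}$ (products in increasing order of indices). The algebra $B(K)$ is generated over $\Bbbk$ by $s_i$ (degree $0$), $t_i$ (degree $1$), $1\le i\le m$, with relations $s_is_i=s_i$, $t_is_i=t_i$, $s_it_i=0$, $t_it_i=0$, $\prod_{j\in\sigma}t_j=0$ for $\sigma\notin K$, and for $i\ne j$: $s_is_j=s_js_i$, $t_it_j=-t_jt_i$, $s_it_j=t_js_i$. It has $\Bbbk$-basis $\{s_It_L\mid L\in K,\ I\cap L=\emptyset\}$. The support of $\omega_Iy_L$, and of $s_It_L$, is $I\cup L$; $\bar R_J(K)$ and $B_J(K)$ are the submodules spanned by basis monomials with support $J$. Let $H^J=\bigotimes_{i\in[m]}H_i$ with $H_i=\widetilde H^*(X_i;\Bbbk)$ if $i\in J$ and $H_i=\Bbbk$ if $i\notin J$. Then $$C(\underline X,K)=\bigoplus_{J\subset[m]}\bar R_J(K)\otimes H^J,\qquad B(\underline X,K)=\bigoplus_{J\subset[m]}B_J(K)\otimes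 H^J,$$ with multiplications induced by the products of $\bar R(K)$, respectively $B(K)$, and by the cup products in $H^*(X_i;\Bbbk)$; the product of elements of the $J$ and $J'$ summands lies in the $J\cup J'$ summand. $f_{\underline X}(\omega_Iy_L\otimes h)=\epsilon(I,L)\,s_It_L\otimes h$, where $\epsilon(I,L)$ is the sign of the permutation converting the concatenation $IL$ of the increasing sequences $I$ and $L$ into an increasing sequence. *)

theory Defs
  imports
    "HOL-Algebra.Module"
    "HOL-Algebra.QuotRing"
    "HOL-Homology.Homology"
    "HOL-Combinatorics.Combinatorics"
    "HOL-Library.Poly_Mapping"
begin

text \<open>
  Modules and algebras over the coefficient ring are \<^type>\<open>module\<close> records.  For a plain module
  the fields \<open>mult\<close> and \<open>one\<close> are meaningless.
\<close>

section \<open>Modules and algebras\<close>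

definition scalars :: "'k::comm_ring_1 ring" where
  "scalars = \<lparr>carrier = UNIV, monoid.mult = (*), monoid.one = 1, ring.zero = 0, ring.add = (+)\<rparr>"

definition module_span :: "('k::comm_ring_1, 'b) module \<Rightarrow> 'b set \<Rightarrow> 'b set" where
  "module_span M S = \<Inter>{N. submodule N (scalars :: 'k ring) M \<and> S \<subseteq> N}"

definition linear_map ::
  "('k::comm_ring_1, 'b) module \<Rightarrow> ('k, 'c) module \<Rightarrow> ('b \<Rightarrow> 'c) \<Rightarrow> bool" where
  "linear_map M N f \<longleftrightarrow>
     f \<in> carrier M \<rightarrow> carrier N \<and>
     (\<forall>x\<in>carrier M. \<forall>y\<in>carrier M. f (x \<oplus>\<^bsub>M\<^esub> y) = f x \<oplus>\<^bsub>N\<^esub> f y) \<and>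
     (\<forall>c. \<forall>x\<in>carrier M. f (c \<odot>\<^bsub>M\<^esub> x) = c \<odot>\<^bsub>N\<^esub> f x)"

definition linear_iso ::
  "('k::comm_ring_1, 'b) module \<Rightarrow> ('k, 'c) module \<Rightarrow> ('b \<Rightarrow> 'c) \<Rightarrow> bool" where
  "linear_iso M N f \<longleftrightarrow> linear_map M N f \<and> bij_betw f (carrier M) (carrier N)"

definition bilinear_op ::
  "('k::comm_ring_1, 'b) module \<Rightarrow> ('b \<Rightarrow> 'b \<Rightarrow> 'b) \<Rightarrow> bool" where
  "bilinear_op M \<mu> \<longleftrightarrow>
     (\<forall>x\<in>carrier M. linear_map M M (\<lambda>y. \<mu> x y)) \<and>
     (\<forall>y\<in>carrier M. linear_map M M (\<lambda>x. \<mu> x y))"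

definition is_free_module :: "('k::comm_ring_1, 'b) module \<Rightarrow> bool" where
  "is_free_module M \<longleftrightarrow>
     (\<exists>S\<subseteq>carrier M. \<forall>x\<in>carrier M. \<exists>!c :: 'b \<Rightarrow>\<^sub>0 'k.
        Poly_Mapping.keys c \<subseteq> S \<and>
        x = (\<Oplus>\<^bsub>M\<^esub>b\<in>Poly_Mapping.keys c. Poly_Mapping.lookup c b \<odot>\<^bsub>M\<^esub> b))"

text \<open>Quotient by a submodule, respectively by a two-sided ideal; the elements are cosets.\<close>

definition quotient_module :: "('k, 'b) module \<Rightarrow> 'b set \<Rightarrow> ('k, 'b set) module" where
  "quotient_module M N =
     \<lparr>carrier = carrier (M Quot N), monoid.mult = monoid.mult (M Quot N), monoid.one = monoid.one (M Quot N),
      ring.zero = ring.zero (M Quot N), ring.add = ring.add (M Quot N),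
      smult = (\<lambda>c A. \<Union>a\<in>A. N +>\<^bsub>M\<^esub> (c \<odot>\<^bsub>M\<^esub> a))\<rparr>"

definition scale_comb :: "'k::comm_ring_1 \<Rightarrow> ('b \<Rightarrow>\<^sub>0 'k) \<Rightarrow> ('b \<Rightarrow>\<^sub>0 'k)" where
  "scale_comb c p = Poly_Mapping.map ((*) c) p"

definition free_module_on :: "'b set \<Rightarrow> ('k::comm_ring_1, 'b \<Rightarrow>\<^sub>0 'k) module" where
  "free_module_on S =
     \<lparr>carrier = {p. Poly_Mapping.keys p \<subseteq> S}, monoid.mult = undefined, monoid.one = undefined,
      ring.zero = 0, ring.add = (+), smult = scale_comb\<rparr>"

text \<open>Free associative unital algebra on \<open>G\<close>: combinations of words, multiplied by concatenation.\<close>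

definition free_algebra :: "'g set \<Rightarrow> ('k::comm_ring_1, 'g list \<Rightarrow>\<^sub>0 'k) module" where
  "free_algebra G =
     \<lparr>carrier = {p. Poly_Mapping.keys p \<subseteq> lists G},
      monoid.mult = (\<lambda>p q. \<Sum>u\<in>Poly_Mapping.keys p. \<Sum>v\<in>Poly_Mapping.keys q.
                Poly_Mapping.single (u @ v) (Poly_Mapping.lookup p u * Poly_Mapping.lookup q v)),
      monoid.one = Poly_Mapping.single [] 1,
      ring.zero = 0, ring.add = (+), smult = scale_comb\<rparr>"

abbreviation word :: "'b \<Rightarrow> ('b \<Rightarrow>\<^sub>0 'k::comm_ring_1)" where
  "word w \<equiv> Poly_Mapping.single w 1"

definition presented_algebra ::
  "'g set \<Rightarrow> ('g list \<Rightarrow>\<^sub>0 'k) set \<Rightarrow> ('k::comm_ring_1, ('g list \<Rightarrow>\<^sub>0 'k) set) module" where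
  "presented_algebra G R = quotient_module (free_algebra G) (genideal (free_algebra G) R)"

definition tensor_relations ::
  "('k::comm_ring_1, 'b) module \<Rightarrow> ('k, 'c) module \<Rightarrow> ('b \<times> 'c \<Rightarrow>\<^sub>0 'k) set" where
  "tensor_relations M N =
     {word (x \<oplus>\<^bsub>M\<^esub> x', y) - word (x, y) - word (x', y) | x x' y.
        x \<in> carrier M \<and> x' \<in> carrier M \<and> y \<in> carrier N} \<union>
     {word (x, y \<oplus>\<^bsub>N\<^esub> y') - word (x, y) - word (x, y') | x y y'.
        x \<in> carrier M \<and> y \<in> carrier N \<and> y' \<in> carrier N} \<union>
     {word (c \<odot>\<^bsub>M\<^esub> x, y) - Poly_Mapping.single (x, y) c | c x y.
        x \<in> carrier M \<and> y \<in> carrier N} \<union>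
     {word (x, c \<odot>\<^bsub>N\<^esub> y) - Poly_Mapping.single (x, y) c | c x y.
        x \<in> carrier M \<and> y \<in> carrier N}"

definition tensor_module ::
  "('k::comm_ring_1, 'b) module \<Rightarrow> ('k, 'c) module \<Rightarrow> ('k, ('b \<times> 'c \<Rightarrow>\<^sub>0 'k) set) module" where
  "tensor_module M N =
     (let F = free_module_on (carrier M \<times> carrier N)
      in quotient_module F (module_span F (tensor_relations M N)))"

definition tensor ::
  "('k::comm_ring_1, 'b) module \<Rightarrow> ('k, 'c) module \<Rightarrow> 'b \<Rightarrow> 'c \<Rightarrow> ('b \<times> 'c \<Rightarrow>\<^sub>0 'k) set" where
  "tensor M N x y =
     (let F = free_module_on (carrier M \<times> carrier N)
      in module_span F (tensor_relations M N) +>\<^bsub>F\<^esub> word (x, y))"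

text \<open>Tensor product of a family \<open>(M i)\<close> indexed by a finite set \<open>S\<close>; its symbols are the
  elements of the cartesian product.\<close>

definition big_tensor_relations ::
  "'i set \<Rightarrow> ('i \<Rightarrow> ('k::comm_ring_1, 'b) module) \<Rightarrow> (('i \<Rightarrow> 'b) \<Rightarrow>\<^sub>0 'k) set" where
  "big_tensor_relations S M =
     {word (h(i := x \<oplus>\<^bsub>M i\<^esub> y)) - word (h(i := x)) - word (h(i := y)) | h i x y.
        h \<in> (\<Pi>\<^sub>E i\<in>S. carrier (M i)) \<and> i \<in> S \<and> x \<in> carrier (M i) \<and> y \<in> carrier (M i)} \<union>
     {word (h(i := c \<odot>\<^bsub>M i\<^esub> x)) - Poly_Mapping.single (h(i := x)) c | h i c x.
        h \<in> (\<Pi>\<^sub>E i\<in>S. carrier (M i)) \<and> i \<in> S \<and> x \<in> carrier (M i)}"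

definition big_tensor_module ::
  "'i set \<Rightarrow> ('i \<Rightarrow> ('k::comm_ring_1, 'b) module) \<Rightarrow> ('k, (('i \<Rightarrow> 'b) \<Rightarrow>\<^sub>0 'k) set) module" where
  "big_tensor_module S M =
     (let F = free_module_on (\<Pi>\<^sub>E i\<in>S. carrier (M i))
      in quotient_module F (module_span F (big_tensor_relations S M)))"

definition big_tensor ::
  "'i set \<Rightarrow> ('i \<Rightarrow> ('k::comm_ring_1, 'b) module) \<Rightarrow> ('i \<Rightarrow> 'b) \<Rightarrow> (('i \<Rightarrow> 'b) \<Rightarrow>\<^sub>0 'k) set" where
  "big_tensor S M h =
     (let F = free_module_on (\<Pi>\<^sub>E i\<in>S. carrier (M i))
      in module_span F (big_tensor_relations S M) +>\<^bsub>F\<^esub> word h)"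

text \<open>External direct sum over a finite index set.\<close>

definition direct_sum :: "'j set \<Rightarrow> ('j \<Rightarrow> ('k, 'b) module) \<Rightarrow> ('k, 'j \<Rightarrow> 'b) module" where
  "direct_sum S M =
     \<lparr>carrier = (\<Pi>\<^sub>E j\<in>S. carrier (M j)), monoid.mult = undefined, monoid.one = undefined,
      ring.zero = (\<lambda>j\<in>S. \<zero>\<^bsub>M j\<^esub>),
      ring.add = (\<lambda>x y. \<lambda>j\<in>S. x j \<oplus>\<^bsub>M j\<^esub> y j),
      smult = (\<lambda>c x. \<lambda>j\<in>S. c \<odot>\<^bsub>M j\<^esub> x j)\<rparr>"

definition summand_incl :: "'j set \<Rightarrow> ('j \<Rightarrow> ('k, 'b) module) \<Rightarrow> 'j \<Rightarrow> 'b \<Rightarrow> ('j \<Rightarrow> 'b)" where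
  "summand_incl S M j z = (\<lambda>j'\<in>S. if j' = j then z else \<zero>\<^bsub>M j'\<^esub>)"

section \<open>Singular cohomology and the cup product\<close>

text \<open>
  An element of the total cochain module \<open>C\<^sup>*(X)\<close> is a family \<open>c\<close> of cochains \<open>c n\<close>, only finitely
  many of them nonzero.  A cochain takes the value \<open>0\<close> outside the singular simplices of \<open>X\<close>.
\<close>

type_synonym ('a, 'k) cochain = "nat \<Rightarrow> ((nat \<Rightarrow> real) \<Rightarrow> 'a) \<Rightarrow> 'k"

definition cochains :: "'a topology \<Rightarrow> ('a, 'k::comm_ring_1) cochain set" where
  "cochains X =
     {c. (\<forall>n f. \<not> singular_simplex n X f \<longrightarrow> c n f = 0) \<and> finite {n. c n \<noteq> (\<lambda>_. 0)}}"

definition coboundary ::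
  "'a topology \<Rightarrow> ('a, 'k::comm_ring_1) cochain \<Rightarrow> ('a, 'k) cochain" where
  "coboundary X c =
     (\<lambda>n f. if n \<noteq> 0 \<and> singular_simplex n X f
            then (\<Sum>k\<le>n. (-1) ^ k * c (n - 1) (singular_face n k f)) else 0)"

definition front_face :: "nat \<Rightarrow> ((nat \<Rightarrow> real) \<Rightarrow> 'a) \<Rightarrow> ((nat \<Rightarrow> real) \<Rightarrow> 'a)" where
  "front_face p f = restrict f (standard_simplex p)"

text \<open>The face of a \<open>(p+q)\<close>-simplex spanned by its vertices \<open>p, \<dots>, p+q\<close>.\<close>

definition back_face :: "nat \<Rightarrow> nat \<Rightarrow> ((nat \<Rightarrow> real) \<Rightarrow> 'a) \<Rightarrow> ((nat \<Rightarrow> real) \<Rightarrow> 'a)" where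
  "back_face p q f = restrict (\<lambda>x. f (\<lambda>i. if i < p then 0 else x (i - p))) (standard_simplex q)"

definition cup ::
  "'a topology \<Rightarrow> ('a, 'k::comm_ring_1) cochain \<Rightarrow> ('a, 'k) cochain \<Rightarrow> ('a, 'k) cochain" where
  "cup X c d =
     (\<lambda>n f. if singular_simplex n X f
            then (\<Sum>p\<le>n. c p (front_face p f) * d (n - p) (back_face p (n - p) f)) else 0)"

definition cocycle_algebra ::
  "'a topology \<Rightarrow> ('k::comm_ring_1, ('a, 'k) cochain) module" where
  "cocycle_algebra X =
     \<lparr>carrier = {c \<in> cochains X. coboundary X c = (\<lambda>n f. 0)},
      monoid.mult = cup X,
      monoid.one = (\<lambda>n f. if n = 0 \<and> singular_simplex n X f then 1 else 0),
      ring.zero = (\<lambda>n f. 0),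
      ring.add = (\<lambda>c d n f. c n f + d n f),
      smult = (\<lambda>a c n f. a * c n f)\<rparr>"

definition coboundaries :: "'a topology \<Rightarrow> ('a, 'k::comm_ring_1) cochain set" where
  "coboundaries X = coboundary X ` cochains X"

text \<open>\<open>H\<^sup>*(X;\<bbbk>)\<close>, the direct sum of all \<open>H\<^sup>n(X;\<bbbk>)\<close>, with the cup product.\<close>

definition cohomology ::
  "'a topology \<Rightarrow> ('k::comm_ring_1, ('a, 'k) cochain set) module" where
  "cohomology X = quotient_module (cocycle_algebra X) (coboundaries X)"

definition cohomology_degree :: "'a topology \<Rightarrow> nat \<Rightarrow> ('a, 'k::comm_ring_1) cochain set set" where
  "cohomology_degree X d =
     {coboundaries X +>\<^bsub>cocycle_algebra X\<^esub> c | c.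
        c \<in> carrier (cocycle_algebra X) \<and> (\<forall>n. n \<noteq> d \<longrightarrow> c n = (\<lambda>_. 0))}"

definition restrict_cochain ::
  "'a topology \<Rightarrow> ('a, 'k::comm_ring_1) cochain \<Rightarrow> ('a, 'k) cochain" where
  "restrict_cochain A c = (\<lambda>n f. if singular_simplex n A f then c n f else 0)"

text \<open>Reduced cohomology of a pointed space: the kernel of the restriction to the basepoint,
  an ideal of \<open>H\<^sup>*(X;\<bbbk>)\<close>.\<close>

definition reduced_cohomology ::
  "'a topology \<Rightarrow> 'a \<Rightarrow> ('k::comm_ring_1, ('a, 'k) cochain set) module" where
  "reduced_cohomology X x0 =
     (cohomology X)\<lparr>carrier :=
        {coboundaries X +>\<^bsub>cocycle_algebra X\<^esub> c | c.
           c \<in> carrier (cocycle_algebra X) \<and>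
           restrict_cochain (subtopology X {x0}) c \<in> coboundaries (subtopology X {x0})}\<rparr>"

text \<open>The coefficient ring, as the scalar multiples of the unit of \<open>H\<^sup>*(X;\<bbbk>)\<close>
  (a copy of \<open>\<bbbk>\<close> when \<open>X\<close> is nonempty).\<close>

definition unit_cohomology ::
  "'a topology \<Rightarrow> ('k::comm_ring_1, ('a, 'k) cochain set) module" where
  "unit_cohomology X =
     (cohomology X)\<lparr>carrier := {c \<odot>\<^bsub>cohomology X\<^esub> \<one>\<^bsub>cohomology X\<^esub> | c. True}\<rparr>"

section \<open>CW-complexes and suspensions\<close>

definition disk :: "nat \<Rightarrow> (nat \<Rightarrow> real) set" where
  "disk n = {x \<in> topspace (Euclidean_space n). (\<Sum>i<n. (x i)\<^sup>2) \<le> 1}"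

definition open_disk :: "nat \<Rightarrow> (nat \<Rightarrow> real) set" where
  "open_disk n = {x \<in> topspace (Euclidean_space n). (\<Sum>i<n. (x i)\<^sup>2) < 1}"

abbreviation disk_topology :: "nat \<Rightarrow> (nat \<Rightarrow> real) topology" where
  "disk_topology n \<equiv> subtopology (Euclidean_space n) (disk n)"

text \<open>
  \<open>\<Phi> n\<close> is the set of characteristic maps of the closed \<open>n\<close>-cells.  The conjuncts after the first
  two say that the open cells partition \<open>X\<close>, that cell boundaries meet only finitely many cells, all
  of lower dimension (C), and that \<open>X\<close> carries the weak topology (W).
  A characteristic map restricts to a homeomorphism from the open disk to the open cell
  because \<open>X\<close> is Hausdorff.
\<close>

definition CW_structure :: "'a topology \<Rightarrow> (nat \<Rightarrow> ((nat \<Rightarrow> real) \<Rightarrow> 'a) set) \<Rightarrow> bool" where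
  "CW_structure X \<Phi> \<longleftrightarrow>
     Hausdorff_space X \<and>
     (\<forall>n. \<forall>\<phi>\<in>\<Phi> n. continuous_map (disk_topology n) X \<phi> \<and> inj_on \<phi> (open_disk n)) \<and>
     topspace X = (\<Union>n. \<Union>\<phi>\<in>\<Phi> n. \<phi> ` open_disk n) \<and>
     (\<forall>n n'. \<forall>\<phi>\<in>\<Phi> n. \<forall>\<phi>'\<in>\<Phi> n'. (n, \<phi>) \<noteq> (n', \<phi>') \<longrightarrow>
        \<phi> ` open_disk n \<inter> \<phi>' ` open_disk n' = {}) \<and>
     (\<forall>n. \<forall>\<phi>\<in>\<Phi> n. \<exists>F. finite F \<and> F \<subseteq> (SIGMA k:{..<n}. \<Phi> k) \<and>
        \<phi> ` (disk n - open_disk n) \<subseteq> (\<Union>(k, \<psi>)\<in>F. \<psi> ` open_disk k)) \<and>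
     (\<forall>A\<subseteq>topspace X.
        (\<forall>n. \<forall>\<phi>\<in>\<Phi> n. closedin (disk_topology n) {x \<in> disk n. \<phi> x \<in> A}) \<longrightarrow> closedin X A)"

definition pointed_CW_complex :: "'a topology \<Rightarrow> 'a \<Rightarrow> bool" where
  "pointed_CW_complex X x0 \<longleftrightarrow>
     (\<exists>\<Phi>. CW_structure X \<Phi> \<and> (\<exists>\<phi>\<in>\<Phi> 0. x0 \<in> \<phi> ` open_disk 0))"

abbreviation cylinder :: "'a topology \<Rightarrow> ('a \<times> real) topology" where
  "cylinder Y \<equiv> prod_topology Y (top_of_set {0..1})"

text \<open>\<open>X\<close> is homeomorphic to the unreduced suspension of \<open>Y\<close>: up to homeomorphism it is the
  quotient of the cylinder in which each of the two ends is collapsed to a point.\<close>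

definition is_unreduced_suspension :: "'b topology \<Rightarrow> 'a topology \<Rightarrow> bool" where
  "is_unreduced_suspension Y X \<longleftrightarrow>
     (\<exists>q. quotient_map (cylinder Y) X q \<and>
        (\<forall>p\<in>topspace (cylinder Y). \<forall>p'\<in>topspace (cylinder Y).
           q p = q p' \<longleftrightarrow> p = p' \<or> (snd p = 0 \<and> snd p' = 0) \<or> (snd p = 1 \<and> snd p' = 1)))"

text \<open>The reduced suspension of \<open>(Y, y0)\<close> collapses both ends and the segment over \<open>y0\<close> to a single
  point, which is the basepoint.\<close>

definition is_reduced_suspension :: "'b topology \<Rightarrow> 'b \<Rightarrow> 'a topology \<Rightarrow> 'a \<Rightarrow> bool" where
  "is_reduced_suspension Y y0 X x0 \<longleftrightarrow>
     (\<exists>q. quotient_map (cylinder Y) X q \<and> q (y0, 0) = x0 \<and>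
        (\<forall>p\<in>topspace (cylinder Y). \<forall>p'\<in>topspace (cylinder Y).
           q p = q p' \<longleftrightarrow> p = p' \<or>
             (p \<in> UNIV \<times> {0, 1} \<union> {y0} \<times> UNIV \<and> p' \<in> UNIV \<times> {0, 1} \<union> {y0} \<times> UNIV)))"

text \<open>
  Both kinds of suspension are allowed, of arbitrary nonempty spaces \<open>Y\<close>.  Taking \<open>Y\<close> on the type
  of the points of \<open>X\<close> is no restriction, because \<open>y \<mapsto> q (y, 1/2)\<close> is injective.
\<close>

definition suspension_space :: "'a topology \<Rightarrow> 'a \<Rightarrow> bool" where
  "suspension_space X x0 \<longleftrightarrow>
     (\<exists>Y :: 'a topology. topspace Y \<noteq> {} \<and> is_unreduced_suspension Y X) \<or>
     (\<exists>(Y :: 'a topology) y0. y0 \<in> topspace Y \<and> is_reduced_suspension Y y0 X x0)"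

section \<open>The algebras \<open>R(K)\<close> (barred) and \<open>B(K)\<close>\<close>

text \<open>Ghost vertices are allowed; the empty simplex always belongs to the complex.\<close>

definition simplicial_complex_on :: "nat \<Rightarrow> nat set set \<Rightarrow> bool" where
  "simplicial_complex_on m K \<longleftrightarrow>
     K \<subseteq> Pow {1..m} \<and> {} \<in> K \<and> (\<forall>\<sigma>\<in>K. \<forall>\<tau>\<subseteq>\<sigma>. \<tau> \<in> K)"

datatype R_gen = Om nat | Ym nat
datatype B_gen = Sm nat | Tm nat

definition R_relations :: "nat \<Rightarrow> nat set set \<Rightarrow> (R_gen list \<Rightarrow>\<^sub>0 'k::comm_ring_1) set" where
  "R_relations m K =
     {word [Om i, Om i] | i. i \<in> {1..m}} \<union>
     {word [Om i, Om j] + word [Om j, Om i] | i j. i \<in> {1..m} \<and> j \<in> {1..m}} \<union>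
     {word [Ym i, Ym j] - word [Ym j, Ym i] | i j. i \<in> {1..m} \<and> j \<in> {1..m}} \<union>
     {word [Om i, Ym j] - word [Ym j, Om i] | i j. i \<in> {1..m} \<and> j \<in> {1..m}} \<union>
     {word [Ym i, Ym i] | i. i \<in> {1..m}} \<union>
     {word [Om i, Ym i] | i. i \<in> {1..m}} \<union>
     {word (map Ym (sorted_list_of_set \<sigma>)) | \<sigma>. \<sigma> \<subseteq> {1..m} \<and> \<sigma> \<notin> K}"

definition B_relations :: "nat \<Rightarrow> nat set set \<Rightarrow> (B_gen list \<Rightarrow>\<^sub>0 'k::comm_ring_1) set" where
  "B_relations m K =
     {word [Sm i, Sm i] - word [Sm i] | i. i \<in> {1..m}} \<union>
     {word [Tm i, Sm i] - word [Tm i] | i. i \<in> {1..m}} \<union>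
     {word [Sm i, Tm i] | i. i \<in> {1..m}} \<union>
     {word [Tm i, Tm i] | i. i \<in> {1..m}} \<union>
     {word (map Tm (sorted_list_of_set \<sigma>)) | \<sigma>. \<sigma> \<subseteq> {1..m} \<and> \<sigma> \<notin> K} \<union>
     {word [Sm i, Sm j] - word [Sm j, Sm i] | i j. i \<in> {1..m} \<and> j \<in> {1..m} \<and> i \<noteq> j} \<union>
     {word [Tm i, Tm j] + word [Tm j, Tm i] | i j. i \<in> {1..m} \<and> j \<in> {1..m} \<and> i \<noteq> j} \<union>
     {word [Sm i, Tm j] - word [Tm j, Sm i] | i j. i \<in> {1..m} \<and> j \<in> {1..m} \<and> i \<noteq> j}"

definition R_algebra ::
  "nat \<Rightarrow> nat set set \<Rightarrow> ('k::comm_ring_1, (R_gen list \<Rightarrow>\<^sub>0 'k) set) module" where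
  "R_algebra m K = presented_algebra (Om ` {1..m} \<union> Ym ` {1..m}) (R_relations m K)"

definition B_algebra ::
  "nat \<Rightarrow> nat set set \<Rightarrow> ('k::comm_ring_1, (B_gen list \<Rightarrow>\<^sub>0 'k) set) module" where
  "B_algebra m K = presented_algebra (Sm ` {1..m} \<union> Tm ` {1..m}) (B_relations m K)"

text \<open>The monomials \<open>\<omega>\<^sub>I y\<^sub>L\<close> and \<open>s\<^sub>I t\<^sub>L\<close>.\<close>

definition R_monomial ::
  "nat \<Rightarrow> nat set set \<Rightarrow> nat set \<Rightarrow> nat set \<Rightarrow> (R_gen list \<Rightarrow>\<^sub>0 'k::comm_ring_1) set" where
  "R_monomial m K I L =
     (let F = free_algebra (Om ` {1..m} \<union> Ym ` {1..m})
      in genideal F (R_relations m K) +>\<^bsub>F\<^esub>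
           word (map Om (sorted_list_of_set I) @ map Ym (sorted_list_of_set L)))"

definition B_monomial ::
  "nat \<Rightarrow> nat set set \<Rightarrow> nat set \<Rightarrow> nat set \<Rightarrow> (B_gen list \<Rightarrow>\<^sub>0 'k::comm_ring_1) set" where
  "B_monomial m K I L =
     (let F = free_algebra (Sm ` {1..m} \<union> Tm ` {1..m})
      in genideal F (B_relations m K) +>\<^bsub>F\<^esub>
           word (map Sm (sorted_list_of_set I) @ map Tm (sorted_list_of_set L)))"

definition basis_index :: "nat \<Rightarrow> nat set set \<Rightarrow> nat set \<Rightarrow> nat set \<Rightarrow> bool" where
  "basis_index m K I L \<longleftrightarrow> L \<in> K \<and> I \<subseteq> {1..m} \<and> I \<inter> L = {}"

text \<open>The degree of \<open>s\<^sub>I t\<^sub>L\<close> is \<open>|L|\<close>.  For \<open>\<omega>\<^sub>I y\<^sub>L\<close> the generators \<open>\<omega>\<^sub>i\<close> and \<open>y\<^sub>i\<close> are given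
  degrees \<open>1\<close> and \<open>2\<close>; only parities matter, and they are those under which the commutation
  relations express graded commutativity.\<close>

definition R_degree :: "nat set \<Rightarrow> nat set \<Rightarrow> nat" where
  "R_degree I L = card I + 2 * card L"

definition B_degree :: "nat set \<Rightarrow> nat set \<Rightarrow> nat" where
  "B_degree I L = card L"

section \<open>The algebras \<open>C(X, K)\<close> and \<open>B(X, K)\<close>\<close>

definition H_factor ::
  "(nat \<Rightarrow> 'a topology) \<Rightarrow> (nat \<Rightarrow> 'a) \<Rightarrow> nat set \<Rightarrow> nat \<Rightarrow>
     ('k::comm_ring_1, ('a, 'k) cochain set) module" where
  "H_factor X x0 J i = (if i \<in> J then reduced_cohomology (X i) (x0 i) else unit_cohomology (X i))"

definition H_tensor ::
  "nat \<Rightarrow> (nat \<Rightarrow> 'a topology) \<Rightarrow> (nat \<Rightarrow> 'a) \<Rightarrow> nat set \<Rightarrow>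
     ('k::comm_ring_1, ((nat \<Rightarrow> ('a, 'k) cochain set) \<Rightarrow>\<^sub>0 'k) set) module" where
  "H_tensor m X x0 J = big_tensor_module {1..m} (H_factor X x0 J)"

definition H_pure ::
  "nat \<Rightarrow> (nat \<Rightarrow> 'a topology) \<Rightarrow> (nat \<Rightarrow> 'a) \<Rightarrow> nat set \<Rightarrow>
     (nat \<Rightarrow> ('a, 'k::comm_ring_1) cochain set) \<Rightarrow> ((nat \<Rightarrow> ('a, 'k) cochain set) \<Rightarrow>\<^sub>0 'k) set" where
  "H_pure m X x0 J \<eta> = big_tensor {1..m} (H_factor X x0 J) \<eta>"

text \<open>\<open>\<eta>\<close> is a family of homogeneous elements \<open>\<eta> i\<close> of degree \<open>d i\<close> of the factors of \<open>H\<^sup>J\<close>.\<close>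

definition H_homogeneous ::
  "nat \<Rightarrow> (nat \<Rightarrow> 'a topology) \<Rightarrow> (nat \<Rightarrow> 'a) \<Rightarrow> nat set \<Rightarrow> (nat \<Rightarrow> nat) \<Rightarrow>
     (nat \<Rightarrow> ('a, 'k::comm_ring_1) cochain set) \<Rightarrow> bool" where
  "H_homogeneous m X x0 J d \<eta> \<longleftrightarrow>
     \<eta> \<in> (\<Pi>\<^sub>E i\<in>{1..m}. carrier (H_factor X x0 J i) \<inter> cohomology_degree (X i) (d i))"

text \<open>
  The two algebras are instances of one construction: \<open>A\<close> is the algebra \<open>R(K)\<close> or \<open>B(K)\<close> and
  \<open>bmon I L\<close> are its basis monomials, of degree \<open>bdeg I L\<close>.
\<close>

definition support_part ::
  "nat \<Rightarrow> nat set set \<Rightarrow> ('k::comm_ring_1, 'r) module \<Rightarrow> (nat set \<Rightarrow> nat set \<Rightarrow> 'r) \<Rightarrow>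
     nat set \<Rightarrow> ('k, 'r) module" where
  "support_part m K A bmon J =
     A\<lparr>carrier := module_span A {bmon I L | I L. basis_index m K I L \<and> I \<union> L = J}\<rparr>"

definition poly_summand ::
  "nat \<Rightarrow> nat set set \<Rightarrow> (nat \<Rightarrow> 'a topology) \<Rightarrow> (nat \<Rightarrow> 'a) \<Rightarrow>
     ('k::comm_ring_1, 'r) module \<Rightarrow> (nat set \<Rightarrow> nat set \<Rightarrow> 'r) \<Rightarrow> nat set \<Rightarrow>
     ('k, ('r \<times> ((nat \<Rightarrow> ('a, 'k) cochain set) \<Rightarrow>\<^sub>0 'k) set \<Rightarrow>\<^sub>0 'k) set) module" where
  "poly_summand m K X x0 A bmon J = tensor_module (support_part m K A bmon J) (H_tensor m X x0 J)"

definition poly_module ::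
  "nat \<Rightarrow> nat set set \<Rightarrow> (nat \<Rightarrow> 'a topology) \<Rightarrow> (nat \<Rightarrow> 'a) \<Rightarrow>
     ('k::comm_ring_1, 'r) module \<Rightarrow> (nat set \<Rightarrow> nat set \<Rightarrow> 'r) \<Rightarrow>
     ('k, nat set \<Rightarrow> ('r \<times> ((nat \<Rightarrow> ('a, 'k) cochain set) \<Rightarrow>\<^sub>0 'k) set \<Rightarrow>\<^sub>0 'k) set) module" where
  "poly_module m K X x0 A bmon = direct_sum (Pow {1..m}) (poly_summand m K X x0 A bmon)"

text \<open>The element \<open>a \<otimes> h\<close> of the \<open>J\<close> summand.\<close>

definition poly_elem ::
  "nat \<Rightarrow> nat set set \<Rightarrow> (nat \<Rightarrow> 'a topology) \<Rightarrow> (nat \<Rightarrow> 'a) \<Rightarrow>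
     ('k::comm_ring_1, 'r) module \<Rightarrow> (nat set \<Rightarrow> nat set \<Rightarrow> 'r) \<Rightarrow> nat set \<Rightarrow>
     'r \<Rightarrow> ((nat \<Rightarrow> ('a, 'k) cochain set) \<Rightarrow>\<^sub>0 'k) set \<Rightarrow>
     (nat set \<Rightarrow> ('r \<times> ((nat \<Rightarrow> ('a, 'k) cochain set) \<Rightarrow>\<^sub>0 'k) set \<Rightarrow>\<^sub>0 'k) set)" where
  "poly_elem m K X x0 A bmon J a h =
     summand_incl (Pow {1..m}) (poly_summand m K X x0 A bmon) J
       (tensor (support_part m K A bmon J) (H_tensor m X x0 J) a h)"

text \<open>
  The sign rule for
  \<open>(a \<otimes> \<eta>\<^sub>1 \<otimes> \<dots> \<otimes> \<eta>\<^sub>m) (a' \<otimes> \<eta>'\<^sub>1 \<otimes> \<dots> \<otimes> \<eta>'\<^sub>m)\<close>,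
  where \<open>\<eta>\<^sub>i\<close> and \<open>\<eta>'\<^sub>i\<close> have degrees \<open>d i\<close> and \<open>d' i\<close> and \<open>a'\<close> has degree \<open>e'\<close>:
  \<open>a'\<close> moves past all \<open>\<eta>\<^sub>i\<close>, and \<open>\<eta>'\<^sub>j\<close> moves past the \<open>\<eta>\<^sub>i\<close> with \<open>i > j\<close>.
\<close>

definition koszul_exponent :: "nat \<Rightarrow> (nat \<Rightarrow> nat) \<Rightarrow> nat \<Rightarrow> (nat \<Rightarrow> nat) \<Rightarrow> nat" where
  "koszul_exponent m d e' d' =
     (\<Sum>i\<in>{1..m}. d i) * e' + (\<Sum>i\<in>{1..m}. \<Sum>j\<in>{1..<i}. d i * d' j)"

text \<open>The multiplication induced by \<open>A\<close> and the cup products.  It is determined on the carrier,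
  because the elements listed generate the module.\<close>

definition poly_mult ::
  "nat \<Rightarrow> nat set set \<Rightarrow> (nat \<Rightarrow> 'a topology) \<Rightarrow> (nat \<Rightarrow> 'a) \<Rightarrow>
     ('k::comm_ring_1, 'r) module \<Rightarrow> (nat set \<Rightarrow> nat set \<Rightarrow> 'r) \<Rightarrow> (nat set \<Rightarrow> nat set \<Rightarrow> nat) \<Rightarrow>
     (nat set \<Rightarrow> ('r \<times> ((nat \<Rightarrow> ('a, 'k) cochain set) \<Rightarrow>\<^sub>0 'k) set \<Rightarrow>\<^sub>0 'k) set) \<Rightarrow>
     (nat set \<Rightarrow> ('r \<times> ((nat \<Rightarrow> ('a, 'k) cochain set) \<Rightarrow>\<^sub>0 'k) set \<Rightarrow>\<^sub>0 'k) set) \<Rightarrow>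
     (nat set \<Rightarrow> ('r \<times> ((nat \<Rightarrow> ('a, 'k) cochain set) \<Rightarrow>\<^sub>0 'k) set \<Rightarrow>\<^sub>0 'k) set)" where
  "poly_mult m K X x0 A bmon bdeg =
     (SOME \<mu>. bilinear_op (poly_module m K X x0 A bmon) \<mu> \<and>
        (\<forall>I L I' L' d d' \<eta> \<eta>'.
           basis_index m K I L \<and> basis_index m K I' L' \<and>
           H_homogeneous m X x0 (I \<union> L) d \<eta> \<and> H_homogeneous m X x0 (I' \<union> L') d' \<eta>' \<longrightarrow>
           \<mu> (poly_elem m K X x0 A bmon (I \<union> L) (bmon I L) (H_pure m X x0 (I \<union> L) \<eta>))
             (poly_elem m K X x0 A bmon (I' \<union> L') (bmon I' L') (H_pure m X x0 (I' \<union> L') \<eta>')) =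
           (- 1) ^ koszul_exponent m d (bdeg I' L') d' \<odot>\<^bsub>poly_module m K X x0 A bmon\<^esub>
             poly_elem m K X x0 A bmon (I \<union> L \<union> I' \<union> L')
               (bmon I L \<otimes>\<^bsub>A\<^esub> bmon I' L')
               (H_pure m X x0 (I \<union> L \<union> I' \<union> L')
                  (\<lambda>i\<in>{1..m}. \<eta> i \<otimes>\<^bsub>cohomology (X i)\<^esub> \<eta>' i))))"

definition poly_algebra ::
  "nat \<Rightarrow> nat set set \<Rightarrow> (nat \<Rightarrow> 'a topology) \<Rightarrow> (nat \<Rightarrow> 'a) \<Rightarrow>
     ('k::comm_ring_1, 'r) module \<Rightarrow> (nat set \<Rightarrow> nat set \<Rightarrow> 'r) \<Rightarrow> (nat set \<Rightarrow> nat set \<Rightarrow> nat) \<Rightarrow>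
     ('k, nat set \<Rightarrow> ('r \<times> ((nat \<Rightarrow> ('a, 'k) cochain set) \<Rightarrow>\<^sub>0 'k) set \<Rightarrow>\<^sub>0 'k) set) module" where
  "poly_algebra m K X x0 A bmon bdeg =
     (poly_module m K X x0 A bmon)
       \<lparr>monoid.mult := poly_mult m K X x0 A bmon bdeg,
        monoid.one := poly_elem m K X x0 A bmon {} (\<one>\<^bsub>A\<^esub>)
                 (H_pure m X x0 {} (\<lambda>i\<in>{1..m}. \<one>\<^bsub>cohomology (X i)\<^esub>))\<rparr>"

definition C_algebra_X ::
  "nat \<Rightarrow> nat set set \<Rightarrow> (nat \<Rightarrow> 'a topology) \<Rightarrow> (nat \<Rightarrow> 'a) \<Rightarrow>
     ('k::comm_ring_1, nat set \<Rightarrow> ((R_gen list \<Rightarrow>\<^sub>0 'k) set \<times>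
        ((nat \<Rightarrow> ('a, 'k) cochain set) \<Rightarrow>\<^sub>0 'k) set \<Rightarrow>\<^sub>0 'k) set) module" where
  "C_algebra_X m K X x0 = poly_algebra m K X x0 (R_algebra m K) (R_monomial m K) R_degree"

definition B_algebra_X ::
  "nat \<Rightarrow> nat set set \<Rightarrow> (nat \<Rightarrow> 'a topology) \<Rightarrow> (nat \<Rightarrow> 'a) \<Rightarrow>
     ('k::comm_ring_1, nat set \<Rightarrow> ((B_gen list \<Rightarrow>\<^sub>0 'k) set \<times>
        ((nat \<Rightarrow> ('a, 'k) cochain set) \<Rightarrow>\<^sub>0 'k) set \<Rightarrow>\<^sub>0 'k) set) module" where
  "B_algebra_X m K X x0 = poly_algebra m K X x0 (B_algebra m K) (B_monomial m K) B_degree"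

text \<open>The elements \<open>\<omega>\<^sub>I y\<^sub>L \<otimes> h\<close> and \<open>s\<^sub>I t\<^sub>L \<otimes> h\<close>, for \<open>h\<close> in \<open>H\<^sup>J\<close> with \<open>J = I \<union> L\<close>.\<close>

definition C_elem ::
  "nat \<Rightarrow> nat set set \<Rightarrow> (nat \<Rightarrow> 'a topology) \<Rightarrow> (nat \<Rightarrow> 'a) \<Rightarrow> nat set \<Rightarrow> nat set \<Rightarrow>
     ((nat \<Rightarrow> ('a, 'k::comm_ring_1) cochain set) \<Rightarrow>\<^sub>0 'k) set \<Rightarrow>
     (nat set \<Rightarrow> ((R_gen list \<Rightarrow>\<^sub>0 'k) set \<times>
        ((nat \<Rightarrow> ('a, 'k) cochain set) \<Rightarrow>\<^sub>0 'k) set \<Rightarrow>\<^sub>0 'k) set)" where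
  "C_elem m K X x0 I L h =
     poly_elem m K X x0 (R_algebra m K) (R_monomial m K) (I \<union> L) (R_monomial m K I L) h"

definition B_elem ::
  "nat \<Rightarrow> nat set set \<Rightarrow> (nat \<Rightarrow> 'a topology) \<Rightarrow> (nat \<Rightarrow> 'a) \<Rightarrow> nat set \<Rightarrow> nat set \<Rightarrow>
     ((nat \<Rightarrow> ('a, 'k::comm_ring_1) cochain set) \<Rightarrow>\<^sub>0 'k) set \<Rightarrow>
     (nat set \<Rightarrow> ((B_gen list \<Rightarrow>\<^sub>0 'k) set \<times>
        ((nat \<Rightarrow> ('a, 'k) cochain set) \<Rightarrow>\<^sub>0 'k) set \<Rightarrow>\<^sub>0 'k) set)" where
  "B_elem m K X x0 I L h =
     poly_elem m K X x0 (B_algebra m K) (B_monomial m K) (I \<union> L) (B_monomial m K I L) h"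

section \<open>The comparison map\<close>

definition shuffle_sign :: "nat set \<Rightarrow> nat set \<Rightarrow> int" where
  "shuffle_sign I L =
     (let xs = sorted_list_of_set I @ sorted_list_of_set L
      in sign (THE \<pi>. \<pi> permutes {..<length xs} \<and> sorted (permute_list \<pi> xs)))"

text \<open>The linear map is determined on the carrier by its values on the elements \<open>\<omega>\<^sub>I y\<^sub>L \<otimes> h\<close>.\<close>

definition f_X ::
  "nat \<Rightarrow> nat set set \<Rightarrow> (nat \<Rightarrow> 'a topology) \<Rightarrow> (nat \<Rightarrow> 'a) \<Rightarrow>
     (nat set \<Rightarrow> ((R_gen list \<Rightarrow>\<^sub>0 'k::comm_ring_1) set \<times>
        ((nat \<Rightarrow> ('a, 'k) cochain set) \<Rightarrow>\<^sub>0 'k) set \<Rightarrow>\<^sub>0 'k) set) \<Rightarrow>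
     (nat set \<Rightarrow> ((B_gen list \<Rightarrow>\<^sub>0 'k) set \<times>
        ((nat \<Rightarrow> ('a, 'k) cochain set) \<Rightarrow>\<^sub>0 'k) set \<Rightarrow>\<^sub>0 'k) set)" where
  "f_X m K X x0 =
     (SOME f. linear_map (C_algebra_X m K X x0) (B_algebra_X m K X x0) f \<and>
        (\<forall>I L. \<forall>h\<in>carrier (H_tensor m X x0 (I \<union> L)). basis_index m K I L \<longrightarrow>
           f (C_elem m K X x0 I L h) =
             of_int (shuffle_sign I L) \<odot>\<^bsub>B_algebra_X m K X x0\<^esub> B_elem m K X x0 I L h))"

definition eq_up_to_sign :: "('k, 'b) module \<Rightarrow> 'b \<Rightarrow> 'b \<Rightarrow> bool" where
  "eq_up_to_sign M a b \<longleftrightarrow> a = b \<or> a = \<ominus>\<^bsub>M\<^esub> b"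

end

theory Submission
  imports Defs "HOL-Analysis.Abstract_Topological_Spaces"
begin

text \<open>
  Both \<open>C(X, K)\<close> and \<open>B(X, K)\<close> are sums of copies of the modules \<open>H\<^sup>J\<close>, one for each basis monomial with
  support \<open>J\<close>.  The comparison map \<open>f\<close> is, on each copy, the identity up to the sign \<open>\<epsilon>(I, L)\<close>; hence it is
  bijective, and only products need an argument (\<open>comparison_iso\<close>, \<open>comparison_mult\<close>).

  \<^emph>\<open>Products of monomials.\<close>  In \<open>R(K)\<close> as in \<open>B(K)\<close>, letters with different indices commute up to sign, so a
  product of two monomials with disjoint supports can be sorted: it is
  \<open>\<plusminus>\<close> the monomial of the unions \<open>I \<union> I'\<close> and \<open>L \<union> L'\<close> if \<open>L \<union> L' \<in> K\<close>, and \<open>0\<close> otherwise.  This rule is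
  the same for both algebras.  All remaining signs (of the shuffles, and those that come from
  moving cohomology classes past monomials and past each other) are \<open>\<plusminus>1\<close>, so \<open>f\<close> respects such products up to
  sign.  The locale \<open>signed_monomials\<close> treats the two presentations simultaneously.  That the
  sorted monomials are linearly independent is proved by letting words act on signed monomials
  (\<open>monomial_functional\<close>).

  \<^emph>\<open>Suspensions.\<close>  If the supports of the two factors share an index \<open>i\<close>, the product contains the cup product of
  two reduced classes of \<open>X\<^sub>i\<close>.  For a suspension this cup product is zero, so both sides of the asserted
  identity vanish (\<open>suspension_cup_vanishes\<close>).  The reason is the classical one: a suspension is the union of two open
  sets \<open>V\<close> and \<open>W\<close>, each of which can be contracted in \<open>X\<close>.  Contracting \<open>V\<close> replaces the first class by a
  cocycle that vanishes on the simplices in \<open>V\<close>, contracting \<open>W\<close> does the same for the second class, so their cup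
  product vanishes on all simplices that lie in \<open>V\<close> or in \<open>W\<close>; by iterated subdivision such a cocycle is a coboundary
  (\<open>small_cocycle_coboundary\<close>).  In an unreduced suspension the two cones serve as \<open>V\<close> and \<open>W\<close>.  In a reduced suspension
  the sets that are contracted to the basepoint are not open, and the CW structure supplies a neighbourhood of the
  basepoint that can be contracted afterwards (\<open>vertex_neighbourhood_collapse\<close>).

  The multiplications and \<open>f\<close> are defined by choice from their values on generators, so each of these values has
  to be shown consistent.  For the multiplication the difficulty is that its sign rule speaks of homogeneous
  elements only; since the sign depends on parities, the product can be written with the projections to
  the even and odd parts, which makes it bilinear (\<open>graded_product\<close>, \<open>poly_mult_exists\<close>).
\<close>

section \<open>Modules over a commutative ring\<close>

lemma scalars_simps [simp]:
  "carrier scalars = UNIV" "x \<otimes>\<^bsub>scalars\<^esub> y = x * y" "\<one>\<^bsub>scalars\<^esub> = 1"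
  "\<zero>\<^bsub>scalars\<^esub> = 0" "x \<oplus>\<^bsub>scalars\<^esub> y = x + y"
  by (simp_all add: scalars_def)

lemma cring_scalars: "cring (scalars :: 'k::comm_ring_1 ring)"
proof (rule cringI)
  show "abelian_group (scalars :: 'k ring)"
    by (rule abelian_groupI) (auto simp: algebra_simps intro: exI[of _ "- _"])
  show "comm_monoid (scalars :: 'k ring)"
    by (rule comm_monoidI) (auto simp: algebra_simps)
qed (auto simp: algebra_simps)

text \<open>
  The module axioms alone: quotients and tensor products carry multiplicative fields without meaning, so the axioms of
  an algebra are not available for them.
\<close>

locale kmodule = abelian_group M for M :: "('k::comm_ring_1, 'b) module" (structure) +
  assumes smult_closed [simp, intro]: "x \<in> carrier M \<Longrightarrow> c \<odot> x \<in> carrier M"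
    and smult_l_distr: "x \<in> carrier M \<Longrightarrow> (a + b) \<odot> x = a \<odot> x \<oplus> b \<odot> x"
    and smult_r_distr: "x \<in> carrier M \<Longrightarrow> y \<in> carrier M \<Longrightarrow> c \<odot> (x \<oplus> y) = c \<odot> x \<oplus> c \<odot> y"
    and smult_assoc: "x \<in> carrier M \<Longrightarrow> (a * b) \<odot> x = a \<odot> (b \<odot> x)"
    and smult_one [simp]: "x \<in> carrier M \<Longrightarrow> 1 \<odot> x = x"
begin

lemma is_kmodule: "kmodule M" ..

lemma is_module: "module scalars M"
  by (rule moduleI) (auto simp: cring_scalars abelian_group_axioms smult_l_distr smult_r_distr smult_assoc)

lemma smult_zero_left [simp]: "x \<in> carrier M \<Longrightarrow> 0 \<odot> x = \<zero>"
  using module.smult_l_null[OF is_module] by simp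

lemma smult_zero_right [simp]: "c \<odot> \<zero> = \<zero>"
  using module.smult_r_null[OF is_module] by simp

lemma smult_minus_one: "x \<in> carrier M \<Longrightarrow> (- 1) \<odot> x = \<ominus> x"
proof -
  assume x: "x \<in> carrier M"
  have "x \<oplus> (- 1) \<odot> x = (1 + (- 1)) \<odot> x" using x smult_l_distr[OF x, of 1 "-1"] by simp
  then have "x \<oplus> (- 1) \<odot> x = \<zero>" using x by simp
  then show ?thesis using x by (metis a_comm minus_equality smult_closed)
qed

lemma smult_finsum:
  "finite A \<Longrightarrow> f \<in> A \<rightarrow> carrier M \<Longrightarrow> c \<odot> finsum M f A = (\<Oplus>i\<in>A. c \<odot> f i)"
  by (induction A rule: finite_induct) (auto simp: smult_r_distr Pi_def)

lemma submodule_iff: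
  "submodule N scalars M \<longleftrightarrow> N \<subseteq> carrier M \<and> \<zero> \<in> N \<and> (\<forall>x\<in>N. \<forall>y\<in>N. x \<oplus> y \<in> N) \<and> (\<forall>c. \<forall>x\<in>N. c \<odot> x \<in> N)"
  (is "?l \<longleftrightarrow> ?r")
proof
  assume ?l
  then show ?r
    using module.submoduleE[OF is_module \<open>?l\<close>] by (simp add: submodule_def subgroup.one_closed[of N "add_monoid M", simplified])
next
  assume r: ?r
  show ?l
  proof (rule module.submoduleI[OF is_module])
    show "\<ominus> a \<in> N" if "a \<in> N" for a
      using r that smult_minus_one[of a] by (metis subsetD)
  qed (use r in auto)
qed

end

lemma kmoduleI:
  fixes M :: "('k::comm_ring_1, 'b) module" (structure)
  assumes add_closed: "\<And>x y. x \<in> carrier M \<Longrightarrow> y \<in> carrier M \<Longrightarrow> x \<oplus> y \<in> carrier M" and zero_closed: "\<zero> \<in> carrier M"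
    and assoc: "\<And>x y z. x \<in> carrier M \<Longrightarrow> y \<in> carrier M \<Longrightarrow> z \<in> carrier M \<Longrightarrow> (x \<oplus> y) \<oplus> z = x \<oplus> (y \<oplus> z)"
    and comm: "\<And>x y. x \<in> carrier M \<Longrightarrow> y \<in> carrier M \<Longrightarrow> x \<oplus> y = y \<oplus> x"
    and l_zero: "\<And>x. x \<in> carrier M \<Longrightarrow> \<zero> \<oplus> x = x"
    and closed: "\<And>c x. x \<in> carrier M \<Longrightarrow> c \<odot> x \<in> carrier M"
    and ld: "\<And>a b x. x \<in> carrier M \<Longrightarrow> (a + b) \<odot> x = a \<odot> x \<oplus> b \<odot> x"
    and rd: "\<And>c x y. x \<in> carrier M \<Longrightarrow> y \<in> carrier M \<Longrightarrow> c \<odot> (x \<oplus> y) = c \<odot> x \<oplus> c \<odot> y"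
    and sassoc: "\<And>a b x. x \<in> carrier M \<Longrightarrow> (a * b) \<odot> x = a \<odot> (b \<odot> x)"
    and one: "\<And>x. x \<in> carrier M \<Longrightarrow> 1 \<odot> x = x"
    and zero: "\<And>x. x \<in> carrier M \<Longrightarrow> 0 \<odot> x = \<zero>"
  shows "kmodule M"
proof (rule kmodule.intro)
  have inv: "(- 1) \<odot> x \<oplus> x = \<zero>" if "x \<in> carrier M" for x
    using ld[OF that, of "-1" 1] that by (simp add: one zero)
  show "abelian_group M"
  proof (rule abelian_groupI)
    show "\<exists>y\<in>carrier M. y \<oplus> x = \<zero>" if "x \<in> carrier M" for x
      using inv[OF that] closed[OF that] by (intro bexI)
  qed (assumption | rule add_closed zero_closed assoc comm l_zero)+
  show "kmodule_axioms M"
    by (rule kmodule_axioms.intro) (simp_all add: closed ld rd sassoc one)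
qed

section \<open>Linear maps\<close>

lemma linear_map_closed: "linear_map M N f \<Longrightarrow> x \<in> carrier M \<Longrightarrow> f x \<in> carrier N"
  by (auto simp: linear_map_def)

lemma linear_map_add:
  "linear_map M N f \<Longrightarrow> x \<in> carrier M \<Longrightarrow> y \<in> carrier M \<Longrightarrow> f (x \<oplus>\<^bsub>M\<^esub> y) = f x \<oplus>\<^bsub>N\<^esub> f y"
  by (auto simp: linear_map_def)

lemma linear_map_smult:
  "linear_map M N f \<Longrightarrow> x \<in> carrier M \<Longrightarrow> f (c \<odot>\<^bsub>M\<^esub> x) = c \<odot>\<^bsub>N\<^esub> f x"
  by (auto simp: linear_map_def)

lemma linear_map_zero:
  assumes "kmodule M" "kmodule N" "linear_map M N f" shows "f \<zero>\<^bsub>M\<^esub> = \<zero>\<^bsub>N\<^esub>"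
proof -
  interpret M: kmodule M by fact
  interpret N: kmodule N by fact
  have "f (0 \<odot>\<^bsub>M\<^esub> \<zero>\<^bsub>M\<^esub>) = 0 \<odot>\<^bsub>N\<^esub> f \<zero>\<^bsub>M\<^esub>" using assms(3) by (intro linear_map_smult) auto
  then show ?thesis using linear_map_closed[OF assms(3)] by simp
qed

lemma linear_map_compose:
  "linear_map M N f \<Longrightarrow> linear_map N P g \<Longrightarrow> linear_map M P (\<lambda>x. g (f x))"
  unfolding linear_map_def by (auto simp: Pi_iff)

lemma linear_map_finsum:
  assumes "kmodule M" "kmodule N" "linear_map M N f" "finite A" "g \<in> A \<rightarrow> carrier M"
  shows "f (finsum M g A) = (\<Oplus>\<^bsub>N\<^esub>i\<in>A. f (g i))"
proof -
  interpret M: kmodule M by fact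
  interpret N: kmodule N by fact
  show ?thesis using assms(4,5)
    by (induction A rule: finite_induct)
      (auto simp: Pi_def linear_map_add[OF assms(3)] linear_map_closed[OF assms(3)] linear_map_zero[OF assms(1-3)])
qed

lemma linear_map_pointwise_add:
  assumes "kmodule N" "linear_map M N f" "linear_map M N g"
  shows "linear_map M N (\<lambda>x. f x \<oplus>\<^bsub>N\<^esub> g x)"
proof -
  interpret N: kmodule N by fact
  show ?thesis using assms(2,3) unfolding linear_map_def by (auto simp: Pi_iff N.smult_r_distr N.a_ac)
qed

lemma linear_map_pointwise_smult:
  assumes "kmodule N" "linear_map M N f" shows "linear_map M N (\<lambda>x. c \<odot>\<^bsub>N\<^esub> f x)"
proof -
  interpret N: kmodule N by fact
  have "a \<odot>\<^bsub>N\<^esub> (b \<odot>\<^bsub>N\<^esub> x) = b \<odot>\<^bsub>N\<^esub> (a \<odot>\<^bsub>N\<^esub> x)" if "x \<in> carrier N" for a b x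
    using that by (metis N.smult_assoc mult.commute)
  then show ?thesis using assms(2) unfolding linear_map_def by (auto simp: Pi_iff N.smult_r_distr)
qed

lemma linear_map_pointwise_finsum:
  assumes "kmodule M" "kmodule N" "finite A" "\<And>i. i \<in> A \<Longrightarrow> linear_map M N (f i)"
  shows "linear_map M N (\<lambda>x. \<Oplus>\<^bsub>N\<^esub>i\<in>A. f i x)"
proof -
  interpret M: kmodule M by fact
  interpret N: kmodule N by fact
  have c: "f i x \<in> carrier N" if "i \<in> A" "x \<in> carrier M" for i x
    using linear_map_closed[OF assms(4)] that by blast
  show ?thesis
    unfolding linear_map_def
  proof (intro conjI ballI allI)
    fix x y assume xy: "x \<in> carrier M" "y \<in> carrier M"
    have "(\<Oplus>\<^bsub>N\<^esub>i\<in>A. f i (x \<oplus>\<^bsub>M\<^esub> y)) = (\<Oplus>\<^bsub>N\<^esub>i\<in>A. f i x \<oplus>\<^bsub>N\<^esub> f i y)"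
      using c xy by (intro N.finsum_cong') (auto simp: linear_map_add[OF assms(4)])
    then show "(\<Oplus>\<^bsub>N\<^esub>i\<in>A. f i (x \<oplus>\<^bsub>M\<^esub> y)) = (\<Oplus>\<^bsub>N\<^esub>i\<in>A. f i x) \<oplus>\<^bsub>N\<^esub> (\<Oplus>\<^bsub>N\<^esub>i\<in>A. f i y)"
      using c xy by (subst N.finsum_addf[symmetric]) auto
  next
    fix d x assume x: "x \<in> carrier M"
    have "(\<Oplus>\<^bsub>N\<^esub>i\<in>A. f i (d \<odot>\<^bsub>M\<^esub> x)) = (\<Oplus>\<^bsub>N\<^esub>i\<in>A. d \<odot>\<^bsub>N\<^esub> f i x)"
      using c x by (intro N.finsum_cong') (auto simp: linear_map_smult[OF assms(4)])
    then show "(\<Oplus>\<^bsub>N\<^esub>i\<in>A. f i (d \<odot>\<^bsub>M\<^esub> x)) = d \<odot>\<^bsub>N\<^esub> (\<Oplus>\<^bsub>N\<^esub>i\<in>A. f i x)"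
      using c x assms(3) by (subst N.smult_finsum) auto
  qed (use c in auto)
qed

lemma linear_map_kernel_submodule:
  assumes "kmodule M" "kmodule N" "linear_map M N f"
  shows "submodule {x \<in> carrier M. f x = \<zero>\<^bsub>N\<^esub>} scalars M"
proof -
  interpret M: kmodule M by fact
  interpret N: kmodule N by fact
  show ?thesis using assms
    by (auto simp: M.submodule_iff linear_map_zero linear_map_add linear_map_smult)
qed

lemma linear_map_equalizer_submodule:
  assumes "kmodule M" "kmodule N" "linear_map M N f" "linear_map M N g"
  shows "submodule {x \<in> carrier M. f x = g x} scalars M"
proof -
  interpret M: kmodule M by fact
  interpret N: kmodule N by fact
  show ?thesis using assms
    by (auto simp: M.submodule_iff linear_map_zero linear_map_add linear_map_smult)
qed

section \<open>Spans and restricted modules\<close>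

lemma (in kmodule) span_submodule: "S \<subseteq> carrier M \<Longrightarrow> submodule (module_span M S) scalars M"
proof -
  assume S: "S \<subseteq> carrier M"
  have "submodule (carrier M) scalars M" by (simp add: submodule_iff)
  then show ?thesis using S unfolding submodule_iff module_span_def by (auto simp: submodule_iff)
qed

lemma module_span_superset: "S \<subseteq> module_span M S"
  by (auto simp: module_span_def)

lemma module_span_least: "submodule N scalars M \<Longrightarrow> S \<subseteq> N \<Longrightarrow> module_span M S \<subseteq> N"
  by (auto simp: module_span_def)

lemma (in kmodule) kmodule_restrict:
  assumes "submodule N scalars M" shows "kmodule (M\<lparr>carrier := N\<rparr>)"
  using assms unfolding submodule_iff
  by (intro kmoduleI) (auto simp: subset_iff a_ac smult_l_distr smult_r_distr smult_assoc)

section \<open>Quotient modules\<close>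

context kmodule
begin

context
  fixes N assumes N: "submodule N scalars M"
begin

lemma N_abelian_subgroup: "abelian_subgroup N M"
  using N by (intro abelian_subgroupI3) (auto simp: submodule_def additive_subgroup_def abelian_group_axioms)

interpretation abelian_subgroup N M by (rule N_abelian_subgroup)

lemma quot_carrier: "carrier (quotient_module M N) = (\<lambda>x. N +> x) ` carrier M"
  by (auto simp: quotient_module_def FactRing_def A_RCOSETS_def')

lemma quot_zero: "\<zero>\<^bsub>quotient_module M N\<^esub> = N +> \<zero>"
  using N by (simp add: quotient_module_def FactRing_def submodule_iff a_coset_add_zero)

lemma quot_add:
  "x \<in> carrier M \<Longrightarrow> y \<in> carrier M \<Longrightarrow> (N +> x) \<oplus>\<^bsub>quotient_module M N\<^esub> (N +> y) = N +> (x \<oplus> y)"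
  by (simp add: quotient_module_def FactRing_def a_rcos_sum)

lemma coset_eq_iff:
  "x \<in> carrier M \<Longrightarrow> y \<in> carrier M \<Longrightarrow> N +> x = N +> y \<longleftrightarrow> x \<ominus> y \<in> N"
proof -
  assume xy: "x \<in> carrier M" "y \<in> carrier M"
  have "N +> x = N +> y \<longleftrightarrow> x \<in> N +> y"
    using xy a_repr_independence'[of x y] a_repr_independenceD[of x y] by auto
  then show "N +> x = N +> y \<longleftrightarrow> x \<ominus> y \<in> N"
    using xy by (simp add: a_rcos_module a_minus_def)
qed

lemma quot_smult: "x \<in> carrier M \<Longrightarrow> c \<odot>\<^bsub>quotient_module M N\<^esub> (N +> x) = N +> (c \<odot> x)"
proof -
  assume x: "x \<in> carrier M"
  have "N +> (c \<odot> a) = N +> (c \<odot> x)" if a: "a \<in> N +> x" for a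
  proof -
    obtain n where n: "n \<in> N" "a = n \<oplus> x" using a by (auto simp: a_r_coset_def')
    have nc: "n \<in> carrier M" using n N by (auto simp: submodule_iff)
    have "c \<odot> a \<ominus> c \<odot> x = c \<odot> n"
      using x nc n(2) by (simp add: smult_r_distr a_minus_def a_assoc r_neg)
    also have "\<dots> \<in> N" using N n by (auto simp: submodule_iff)
    finally show ?thesis using x nc n(2) by (subst coset_eq_iff) auto
  qed
  moreover have "x \<in> N +> x" using x by (simp add: a_rcos_self)
  ultimately have "(\<Union>a\<in>N +> x. N +> (c \<odot> a)) = N +> (c \<odot> x)" by blast
  then show ?thesis by (simp add: quotient_module_def)
qed

lemma kmodule_quotient: "kmodule (quotient_module M N)"
  by (rule kmoduleI)
    (auto simp: quot_carrier quot_zero quot_add quot_smult a_ac smult_l_distr smult_r_distr smult_assoc)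

lemma linear_coset: "linear_map M (quotient_module M N) (\<lambda>x. N +> x)"
  by (auto simp: linear_map_def quot_carrier quot_add quot_smult)

lemma coset_eq_zero_iff: "x \<in> carrier M \<Longrightarrow> N +> x = \<zero>\<^bsub>quotient_module M N\<^esub> \<longleftrightarrow> x \<in> N"
proof -
  assume x: "x \<in> carrier M"
  have z: "\<ominus> \<zero> = \<zero>" by (rule minus_equality) auto
  show ?thesis using x by (subst quot_zero, subst coset_eq_iff) (simp_all add: a_minus_def z)
qed

text \<open>
  The lift evaluates \<open>g\<close> at a representative; two representatives differ by an element of \<open>N\<close>, which \<open>g\<close> kills.
\<close>

lemma quot_lift:
  assumes P: "kmodule P" and g: "linear_map M P g" and z: "\<And>x. x \<in> N \<Longrightarrow> g x = \<zero>\<^bsub>P\<^esub>"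
  shows "\<exists>g'. linear_map (quotient_module M N) P g' \<and> (\<forall>x\<in>carrier M. g' (N +> x) = g x)"
proof -
  interpret P: kmodule P by fact
  define r where "r A = (SOME x. x \<in> carrier M \<and> A = N +> x)" for A
  have r: "g (r (N +> x)) = g x" if x: "x \<in> carrier M" for x
  proof -
    have rx: "r (N +> x) \<in> carrier M \<and> N +> x = N +> r (N +> x)"
      unfolding r_def by (rule someI[of _ x]) (use x in auto)
    then have d: "x \<ominus> r (N +> x) \<in> N" using x by (metis coset_eq_iff)
    have "x = (x \<ominus> r (N +> x)) \<oplus> r (N +> x)" using x rx by (simp add: a_minus_def a_assoc l_neg)
    then have "g x = g (x \<ominus> r (N +> x)) \<oplus>\<^bsub>P\<^esub> g (r (N +> x))"
      using x rx linear_map_add[OF g, of "x \<ominus> r (N +> x)" "r (N +> x)"] by simp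
    then show ?thesis using z[OF d] linear_map_closed[OF g] rx by simp
  qed
  show ?thesis
  proof (intro exI conjI)
    show "linear_map (quotient_module M N) P (\<lambda>A. g (r A))"
      unfolding linear_map_def using g
      by (auto simp: quot_carrier quot_add quot_smult r linear_map_closed linear_map_add linear_map_smult)
  qed (use r in auto)
qed

end
end

section \<open>Free modules\<close>

lemma lookup_scale_comb [simp]: "Poly_Mapping.lookup (scale_comb c p) u = c * Poly_Mapping.lookup p u"
  by (simp add: scale_comb_def Poly_Mapping.map.rep_eq when_def)

lemma keys_scale_comb: "Poly_Mapping.keys (scale_comb c p) \<subseteq> Poly_Mapping.keys p"
  by (auto simp: in_keys_iff)

lemma scale_comb_single: "scale_comb c (Poly_Mapping.single u d) = Poly_Mapping.single u (c * d)"
  by (rule poly_mapping_eqI) (simp add: lookup_single when_def)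

lemma free_module_on_simps [simp]:
  "carrier (free_module_on S) = {p. Poly_Mapping.keys p \<subseteq> S}"
  "\<zero>\<^bsub>free_module_on S\<^esub> = 0" "p \<oplus>\<^bsub>free_module_on S\<^esub> q = p + q" "c \<odot>\<^bsub>free_module_on S\<^esub> p = scale_comb c p"
  by (simp_all add: free_module_on_def)

lemma kmodule_free: "kmodule (free_module_on S)"
proof (rule kmoduleI, goal_cases)
  case (1 x y) then show ?case using keys_add[of x y] by auto
next
  case (6 c x) then show ?case using keys_scale_comb[of c x] by auto
qed (auto intro!: poly_mapping_eqI simp: lookup_add algebra_simps)

definition lin_ext :: "('k::comm_ring_1, 'c) module \<Rightarrow> ('b \<Rightarrow> 'c) \<Rightarrow> ('b \<Rightarrow>\<^sub>0 'k) \<Rightarrow> 'c" where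
  "lin_ext P g p = (\<Oplus>\<^bsub>P\<^esub>u\<in>Poly_Mapping.keys p. Poly_Mapping.lookup p u \<odot>\<^bsub>P\<^esub> g u)"

lemma lin_ext_superset:
  assumes "kmodule P" "finite S" "Poly_Mapping.keys p \<subseteq> S" "g \<in> S \<rightarrow> carrier P"
  shows "lin_ext P g p = (\<Oplus>\<^bsub>P\<^esub>u\<in>S. Poly_Mapping.lookup p u \<odot>\<^bsub>P\<^esub> g u)"
proof -
  interpret P: kmodule P by fact
  show ?thesis unfolding lin_ext_def
    using assms by (intro P.add.finprod_mono_neutral_cong_left) (auto simp: in_keys_iff Pi_iff)
qed

lemma linear_lin_ext:
  fixes P :: "('k::comm_ring_1, 'c) module" and g :: "'b \<Rightarrow> 'c"
  assumes "kmodule P" "g \<in> S \<rightarrow> carrier P"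
  shows "linear_map (free_module_on S) P (lin_ext P g)"
proof -
  interpret P: kmodule P by fact
  have ss: "lin_ext P g p = (\<Oplus>\<^bsub>P\<^esub>u\<in>T. Poly_Mapping.lookup p u \<odot>\<^bsub>P\<^esub> g u)"
    if "finite T" "Poly_Mapping.keys p \<subseteq> T" "T \<subseteq> S" for p T
    using that assms by (intro lin_ext_superset) auto
  have gc: "u \<in> S \<Longrightarrow> g u \<in> carrier P" for u using assms by auto
  show ?thesis
    unfolding linear_map_def
  proof (intro conjI ballI allI)
    show "lin_ext P g \<in> carrier (free_module_on S) \<rightarrow> carrier P"
      using gc by (auto simp: lin_ext_def subset_iff intro!: P.finsum_closed P.smult_closed)
  next
    fix p q :: "'b \<Rightarrow>\<^sub>0 'k" assume pq: "p \<in> carrier (free_module_on S)" "q \<in> carrier (free_module_on S)"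
    let ?T = "Poly_Mapping.keys p \<union> Poly_Mapping.keys q"
    have "lin_ext P g (p + q) = (\<Oplus>\<^bsub>P\<^esub>u\<in>?T. Poly_Mapping.lookup (p + q) u \<odot>\<^bsub>P\<^esub> g u)"
      using pq keys_add[of p q] by (intro ss) auto
    also have "\<dots> = (\<Oplus>\<^bsub>P\<^esub>u\<in>?T. Poly_Mapping.lookup p u \<odot>\<^bsub>P\<^esub> g u \<oplus>\<^bsub>P\<^esub> Poly_Mapping.lookup q u \<odot>\<^bsub>P\<^esub> g u)"
      using pq gc by (intro P.finsum_cong') (auto simp: lookup_add P.smult_l_distr)
    also have "\<dots> = lin_ext P g p \<oplus>\<^bsub>P\<^esub> lin_ext P g q"
      using pq gc by (subst P.finsum_addf) (auto simp: ss[of ?T])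
    finally show "lin_ext P g (p \<oplus>\<^bsub>free_module_on S\<^esub> q) = lin_ext P g p \<oplus>\<^bsub>P\<^esub> lin_ext P g q" by simp
  next
    fix c and p :: "'b \<Rightarrow>\<^sub>0 'k" assume p: "p \<in> carrier (free_module_on S)"
    let ?T = "Poly_Mapping.keys p"
    have "lin_ext P g (scale_comb c p) = (\<Oplus>\<^bsub>P\<^esub>u\<in>?T. Poly_Mapping.lookup (scale_comb c p) u \<odot>\<^bsub>P\<^esub> g u)"
      using p keys_scale_comb[of c p] by (intro ss) auto
    also have "\<dots> = (\<Oplus>\<^bsub>P\<^esub>u\<in>?T. c \<odot>\<^bsub>P\<^esub> (Poly_Mapping.lookup p u \<odot>\<^bsub>P\<^esub> g u))"
      using p gc by (intro P.finsum_cong') (auto simp: P.smult_assoc subset_iff)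
    also have "\<dots> = c \<odot>\<^bsub>P\<^esub> lin_ext P g p"
      using p gc by (subst P.smult_finsum[symmetric]) (auto simp: lin_ext_def subset_iff)
    finally show "lin_ext P g (c \<odot>\<^bsub>free_module_on S\<^esub> p) = c \<odot>\<^bsub>P\<^esub> lin_ext P g p" by simp
  qed
qed

lemma lin_ext_single:
  assumes "kmodule P" "g u \<in> carrier P"
  shows "lin_ext P g (Poly_Mapping.single u c) = c \<odot>\<^bsub>P\<^esub> g u"
proof -
  interpret P: kmodule P by fact
  show ?thesis using assms(2) by (simp add: lin_ext_superset[OF assms(1), of "{u}"])
qed

lemma poly_mapping_sum_single: "(\<Sum>u\<in>Poly_Mapping.keys p. Poly_Mapping.single u (Poly_Mapping.lookup p u)) = p"
  by (rule poly_mapping_eqI) (simp add: lookup_sum lookup_single when_def sum.delta in_keys_iff)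

text \<open>
  Every element of a free module is the sum of its terms.
\<close>

lemma free_module_generated:
  assumes N: "submodule N scalars (free_module_on S)" and w: "\<And>u. u \<in> S \<Longrightarrow> word u \<in> N"
    and p: "Poly_Mapping.keys p \<subseteq> S"
  shows "p \<in> N"
proof -
  interpret kmodule "free_module_on S" by (rule kmodule_free)
  have N': "0 \<in> N" "\<And>x y. x \<in> N \<Longrightarrow> y \<in> N \<Longrightarrow> x + y \<in> N" "\<And>c x. x \<in> N \<Longrightarrow> scale_comb c x \<in> N"
    using N by (auto simp: submodule_iff)
  have "(\<Sum>u\<in>T. Poly_Mapping.single u (c u)) \<in> N" if "finite T" "T \<subseteq> S" for T c
    using that
  proof (induction T rule: finite_induct)
    case (insert u T)
    have "Poly_Mapping.single u (c u) = scale_comb (c u) (word u)" by (simp add: scale_comb_single)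
    then show ?case using insert N' w by auto
  qed (simp add: N')
  from this[of "Poly_Mapping.keys p" "Poly_Mapping.lookup p"] p show ?thesis
    by (simp add: poly_mapping_sum_single)
qed

lemma free_module_eqI:
  assumes "kmodule P" "linear_map (free_module_on S) P f" "linear_map (free_module_on S) P g"
    and "\<And>u. u \<in> S \<Longrightarrow> f (word u) = g (word u)" and "Poly_Mapping.keys p \<subseteq> S"
  shows "f p = g p"
  using free_module_generated[OF linear_map_equalizer_submodule[OF kmodule_free assms(1-3)], of p] assms(4,5)
  by auto

section \<open>Presentations: quotients of free modules\<close>

text \<open>
  The universal property of the module with generators \<open>S\<close> and relators \<open>R\<close>.  Both tensor products are of this form.
\<close>

lemma presented_lift:
  assumes "kmodule P" "R \<subseteq> carrier (free_module_on S)" "g \<in> S \<rightarrow> carrier P"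
    and "\<And>r. r \<in> R \<Longrightarrow> lin_ext P g r = \<zero>\<^bsub>P\<^esub>"
  defines "F \<equiv> free_module_on S"
  shows "\<exists>g'. linear_map (quotient_module F (module_span F R)) P g' \<and>
    (\<forall>u\<in>S. g' (module_span F R +>\<^bsub>F\<^esub> word u) = g u)"
proof -
  interpret F: kmodule F unfolding F_def by (rule kmodule_free)
  interpret P: kmodule P by fact
  have sub: "submodule (module_span F R) scalars F"
    using assms(2) by (intro F.span_submodule) (simp add: F_def)
  have lin: "linear_map F P (lin_ext P g)" using linear_lin_ext[OF assms(1,3)] by (simp add: F_def)
  have "module_span F R \<subseteq> {x \<in> carrier F. lin_ext P g x = \<zero>\<^bsub>P\<^esub>}"
    using assms(2,4) by (intro module_span_least linear_map_kernel_submodule F.is_kmodule assms(1) lin) (auto simp: F_def)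
  then obtain g' where g': "linear_map (quotient_module F (module_span F R)) P g'"
      "\<forall>x\<in>carrier F. g' (module_span F R +>\<^bsub>F\<^esub> x) = lin_ext P g x"
    using F.quot_lift[OF sub assms(1) lin] by blast
  have "g' (module_span F R +>\<^bsub>F\<^esub> word u) = g u" if "u \<in> S" for u
  proof -
    have "word u \<in> carrier F" "g u \<in> carrier P" using that assms(3) by (auto simp: F_def)
    then show ?thesis using g'(2) lin_ext_single[OF assms(1), of g u 1] by simp
  qed
  then show ?thesis using g' by blast
qed

lemma presented_eqI:
  assumes "kmodule P" "R \<subseteq> carrier (free_module_on S)"
  defines "F \<equiv> free_module_on S"
  assumes "linear_map (quotient_module F (module_span F R)) P f" "linear_map (quotient_module F (module_span F R)) P g"
    and "\<And>u. u \<in> S \<Longrightarrow> f (module_span F R +>\<^bsub>F\<^esub> word u) = g (module_span F R +>\<^bsub>F\<^esub> word u)"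
    and "x \<in> carrier (quotient_module F (module_span F R))"
  shows "f x = g x"
proof -
  interpret F: kmodule F unfolding F_def by (rule kmodule_free)
  have sub: "submodule (module_span F R) scalars F"
    using assms(2) by (intro F.span_submodule) (simp add: F_def)
  obtain p where p: "p \<in> carrier F" "x = module_span F R +>\<^bsub>F\<^esub> p"
    using assms(7) by (auto simp: F.quot_carrier[OF sub])
  note lin = linear_map_compose[OF F.linear_coset[OF sub] assms(4)] linear_map_compose[OF F.linear_coset[OF sub] assms(5)]
  show ?thesis unfolding p(2)
    by (rule free_module_eqI[OF assms(1) lin[unfolded F_def], folded F_def]) (use p(1) assms(6) in \<open>auto simp: F_def\<close>)
qed

lemma presented_kmodule:
  assumes "R \<subseteq> carrier (free_module_on S)"
  defines "F \<equiv> free_module_on S"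
  shows "kmodule (quotient_module F (module_span F R))"
    and "linear_map F (quotient_module F (module_span F R)) (\<lambda>x. module_span F R +>\<^bsub>F\<^esub> x)"
    and "x \<in> module_span F R \<Longrightarrow> module_span F R +>\<^bsub>F\<^esub> x = \<zero>\<^bsub>quotient_module F (module_span F R)\<^esub>"
proof -
  interpret F: kmodule F unfolding F_def by (rule kmodule_free)
  have sub: "submodule (module_span F R) scalars F"
    using assms(1) by (intro F.span_submodule) (simp add: F_def)
  show "kmodule (quotient_module F (module_span F R))" using sub by (rule F.kmodule_quotient)
  show "linear_map F (quotient_module F (module_span F R)) (\<lambda>x. module_span F R +>\<^bsub>F\<^esub> x)" using sub by (rule F.linear_coset)
  show "x \<in> module_span F R \<Longrightarrow> module_span F R +>\<^bsub>F\<^esub> x = \<zero>\<^bsub>quotient_module F (module_span F R)\<^esub>"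
    using F.coset_eq_zero_iff[OF sub, of x] sub by (auto simp: F.submodule_iff)
qed

text \<open>A linear functional kills the relator of an additivity relation exactly when the relation holds for the values.\<close>

lemma relator_zero_add:
  assumes "kmodule P" "linear_map (free_module_on S) P \<phi>" "a \<in> S" "b \<in> S" "c \<in> S"
  shows "\<phi> (word a - word b - word c) = \<zero>\<^bsub>P\<^esub> \<longleftrightarrow> \<phi> (word a) = \<phi> (word b) \<oplus>\<^bsub>P\<^esub> \<phi> (word c)"
proof -
  interpret P: kmodule P by fact
  let ?F = "free_module_on S"
  have w: "word a \<in> carrier ?F" "word b \<in> carrier ?F" "word c \<in> carrier ?F" using assms by auto
  have d: "word a - word b - word c \<in> carrier ?F"
    using w by (auto simp: subset_iff in_keys_iff lookup_minus lookup_single when_def split: if_splits)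
  have "word a = (word a - word b - word c) + (word b + word c)" by (simp add: algebra_simps)
  then have "\<phi> (word a) = \<phi> ((word a - word b - word c) \<oplus>\<^bsub>?F\<^esub> (word b \<oplus>\<^bsub>?F\<^esub> word c))" by simp
  also have "\<dots> = \<phi> (word a - word b - word c) \<oplus>\<^bsub>P\<^esub> (\<phi> (word b) \<oplus>\<^bsub>P\<^esub> \<phi> (word c))"
  proof -
    interpret F: kmodule ?F by (rule kmodule_free)
    show ?thesis using linear_map_add[OF assms(2) d F.a_closed[OF w(2,3)]] linear_map_add[OF assms(2) w(2,3)] by simp
  qed
  finally have eq: "\<phi> (word a) = \<phi> (word a - word b - word c) \<oplus>\<^bsub>P\<^esub> (\<phi> (word b) \<oplus>\<^bsub>P\<^esub> \<phi> (word c))" .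
  have "x = \<zero>\<^bsub>P\<^esub> \<longleftrightarrow> z = y" if "x \<in> carrier P" "y \<in> carrier P" "z = x \<oplus>\<^bsub>P\<^esub> y" for x y z
    using that P.add.r_cancel_one'[of y x] by auto
  from this[OF _ _ eq] show ?thesis using linear_map_closed[OF assms(2)] w d by blast
qed

lemma relator_zero_smult:
  assumes "kmodule P" "linear_map (free_module_on S) P \<phi>" "a \<in> S" "b \<in> S"
  shows "\<phi> (word a - Poly_Mapping.single b k) = \<zero>\<^bsub>P\<^esub> \<longleftrightarrow> \<phi> (word a) = k \<odot>\<^bsub>P\<^esub> \<phi> (word b)"
proof -
  interpret P: kmodule P by fact
  let ?F = "free_module_on S"
  have w: "word a \<in> carrier ?F" "word b \<in> carrier ?F" using assms by auto
  have s: "Poly_Mapping.single b k = k \<odot>\<^bsub>?F\<^esub> word b" by (simp add: scale_comb_single)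
  have sc: "Poly_Mapping.single b k \<in> carrier ?F" using assms by (auto split: if_splits)
  have d: "word a - Poly_Mapping.single b k \<in> carrier ?F"
    using w by (auto simp: subset_iff in_keys_iff lookup_minus lookup_single when_def split: if_splits)
  have "\<phi> (word a) = \<phi> ((word a - Poly_Mapping.single b k) \<oplus>\<^bsub>?F\<^esub> Poly_Mapping.single b k)" by simp
  also have "\<dots> = \<phi> (word a - Poly_Mapping.single b k) \<oplus>\<^bsub>P\<^esub> \<phi> (Poly_Mapping.single b k)"
    by (rule linear_map_add[OF assms(2) d sc])
  also have "\<phi> (Poly_Mapping.single b k) = k \<odot>\<^bsub>P\<^esub> \<phi> (word b)"
    unfolding s by (rule linear_map_smult[OF assms(2) w(2)])
  finally have eq: "\<phi> (word a) = \<phi> (word a - Poly_Mapping.single b k) \<oplus>\<^bsub>P\<^esub> k \<odot>\<^bsub>P\<^esub> \<phi> (word b)" .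
  have "x = \<zero>\<^bsub>P\<^esub> \<longleftrightarrow> z = y" if "x \<in> carrier P" "y \<in> carrier P" "z = x \<oplus>\<^bsub>P\<^esub> y" for x y z
    using that P.add.r_cancel_one'[of y x] by auto
  from this[OF _ _ eq] show ?thesis using linear_map_closed[OF assms(2)] w d by blast
qed

section \<open>Tensor products of two modules\<close>

lemma tensor_relations_subset:
  assumes "kmodule M" "kmodule N"
  shows "tensor_relations M N \<subseteq> carrier (free_module_on (carrier M \<times> carrier N))"
proof -
  interpret M: kmodule M by fact
  interpret N: kmodule N by fact
  show ?thesis unfolding tensor_relations_def
    by (auto simp: in_keys_iff lookup_minus lookup_single when_def split: if_splits)
qed

context
  fixes M :: "('k::comm_ring_1, 'b) module" and N :: "('k, 'c) module"
  assumes M: "kmodule M" and N: "kmodule N"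
begin

interpretation M: kmodule M by (rule M)
interpretation N: kmodule N by (rule N)

abbreviation "FMN \<equiv> free_module_on (carrier M \<times> carrier N) :: ('k, 'b \<times> 'c \<Rightarrow>\<^sub>0 'k) module"

lemma tensor_module_eq: "tensor_module M N = quotient_module FMN (module_span FMN (tensor_relations M N))"
  by (simp add: tensor_module_def Let_def)

lemma tensor_eq: "tensor M N x y = module_span FMN (tensor_relations M N) +>\<^bsub>FMN\<^esub> word (x, y)"
  by (simp add: tensor_def Let_def)

lemma kmodule_tensor: "kmodule (tensor_module M N)"
  unfolding tensor_module_eq by (rule presented_kmodule[OF tensor_relations_subset[OF M N]])

lemma linear_tensor_coset: "linear_map FMN (tensor_module M N) (\<lambda>x. module_span FMN (tensor_relations M N) +>\<^bsub>FMN\<^esub> x)"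
  unfolding tensor_module_eq by (rule presented_kmodule[OF tensor_relations_subset[OF M N]])

lemma tensor_relator: "r \<in> tensor_relations M N \<Longrightarrow> module_span FMN (tensor_relations M N) +>\<^bsub>FMN\<^esub> r = \<zero>\<^bsub>tensor_module M N\<^esub>"
  unfolding tensor_module_eq by (rule presented_kmodule(3)[OF tensor_relations_subset[OF M N]]) (rule subsetD[OF module_span_superset])

lemma tensor_closed: "x \<in> carrier M \<Longrightarrow> y \<in> carrier N \<Longrightarrow> tensor M N x y \<in> carrier (tensor_module M N)"
  unfolding tensor_eq by (rule linear_map_closed[OF linear_tensor_coset]) simp

lemma linear_tensor_left: "y \<in> carrier N \<Longrightarrow> linear_map M (tensor_module M N) (\<lambda>x. tensor M N x y)"
  unfolding linear_map_def
proof (intro conjI ballI allI, goal_cases)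
  case 1 then show ?case using tensor_closed by blast
next
  case (2 a b)
  have rel: "word (a \<oplus>\<^bsub>M\<^esub> b, y) - word (a, y) - word (b, y) \<in> tensor_relations M N"
    unfolding tensor_relations_def using 2 by blast
  show ?case unfolding tensor_eq
    by (rule iffD1[OF relator_zero_add[OF kmodule_tensor linear_tensor_coset] tensor_relator[OF rel]]) (use 2 in auto)
next
  case (3 c a)
  have rel: "word (c \<odot>\<^bsub>M\<^esub> a, y) - Poly_Mapping.single (a, y) c \<in> tensor_relations M N"
    unfolding tensor_relations_def using 3 by blast
  show ?case unfolding tensor_eq
    by (rule iffD1[OF relator_zero_smult[OF kmodule_tensor linear_tensor_coset] tensor_relator[OF rel]]) (use 3 in auto)
qed

lemma linear_tensor_right: "x \<in> carrier M \<Longrightarrow> linear_map N (tensor_module M N) (\<lambda>y. tensor M N x y)"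
  unfolding linear_map_def
proof (intro conjI ballI allI, goal_cases)
  case 1 then show ?case using tensor_closed by blast
next
  case (2 a b)
  have rel: "word (x, a \<oplus>\<^bsub>N\<^esub> b) - word (x, a) - word (x, b) \<in> tensor_relations M N"
    unfolding tensor_relations_def using 2 by blast
  show ?case unfolding tensor_eq
    by (rule iffD1[OF relator_zero_add[OF kmodule_tensor linear_tensor_coset] tensor_relator[OF rel]]) (use 2 in auto)
next
  case (3 c a)
  have rel: "word (x, c \<odot>\<^bsub>N\<^esub> a) - Poly_Mapping.single (x, a) c \<in> tensor_relations M N"
    unfolding tensor_relations_def using 3 by blast
  show ?case unfolding tensor_eq
    by (rule iffD1[OF relator_zero_smult[OF kmodule_tensor linear_tensor_coset] tensor_relator[OF rel]]) (use 3 in auto)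
qed

text \<open>
  Bilinearity of \<open>\<beta>\<close> says exactly that its linear extension kills the defining relators.
\<close>

lemma tensor_lift:
  assumes P: "kmodule P"
    and l: "\<And>y. y \<in> carrier N \<Longrightarrow> linear_map M P (\<lambda>x. \<beta> x y)"
    and r: "\<And>x. x \<in> carrier M \<Longrightarrow> linear_map N P (\<lambda>y. \<beta> x y)"
  shows "\<exists>g. linear_map (tensor_module M N) P g \<and> (\<forall>x\<in>carrier M. \<forall>y\<in>carrier N. g (tensor M N x y) = \<beta> x y)"
proof -
  have c: "case_prod \<beta> \<in> carrier M \<times> carrier N \<rightarrow> carrier P"
    using linear_map_closed[OF l] by auto
  have lw: "lin_ext P (case_prod \<beta>) (word u) = case_prod \<beta> u" if "u \<in> carrier M \<times> carrier N" for u
  proof -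
    interpret P: kmodule P by fact
    have "case_prod \<beta> u \<in> carrier P" using c that by blast
    then show ?thesis by (simp add: lin_ext_single[OF P])
  qed
  note rl = relator_zero_add[OF P linear_lin_ext[OF P c]] relator_zero_smult[OF P linear_lin_ext[OF P c]]
  have "lin_ext P (case_prod \<beta>) t = \<zero>\<^bsub>P\<^esub>" if "t \<in> tensor_relations M N" for t
    using that unfolding tensor_relations_def
    by (auto simp: rl lw linear_map_add[OF l] linear_map_add[OF r] linear_map_smult[OF l] linear_map_smult[OF r])
  from presented_lift[OF P tensor_relations_subset[OF M N] c this]
  show ?thesis unfolding tensor_module_eq tensor_eq by fastforce
qed

lemma tensor_eqI:
  assumes "kmodule P" "linear_map (tensor_module M N) P f" "linear_map (tensor_module M N) P g"
    and "\<And>x y. x \<in> carrier M \<Longrightarrow> y \<in> carrier N \<Longrightarrow> f (tensor M N x y) = g (tensor M N x y)"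
    and "z \<in> carrier (tensor_module M N)"
  shows "f z = g z"
  using presented_eqI[OF assms(1) tensor_relations_subset[OF M N], of f g z] assms(2-)
  unfolding tensor_module_eq tensor_eq by auto

end

section \<open>Tensor products of families\<close>

context
  fixes S :: "'i set" and M :: "'i \<Rightarrow> ('k::comm_ring_1, 'b) module"
  assumes M: "\<And>i. i \<in> S \<Longrightarrow> kmodule (M i)"
begin

abbreviation "FS \<equiv> free_module_on (\<Pi>\<^sub>E i\<in>S. carrier (M i)) :: ('k, ('i \<Rightarrow> 'b) \<Rightarrow>\<^sub>0 'k) module"
abbreviation "NS \<equiv> module_span FS (big_tensor_relations S M)"

lemma family_update: "h \<in> (\<Pi>\<^sub>E i\<in>S. carrier (M i)) \<Longrightarrow> i \<in> S \<Longrightarrow> x \<in> carrier (M i) \<Longrightarrow> h(i := x) \<in> (\<Pi>\<^sub>E i\<in>S. carrier (M i))"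
  by (auto simp: PiE_iff extensional_def)

lemma big_tensor_relations_subset: "big_tensor_relations S M \<subseteq> carrier FS"
proof -
  have add_cl: "x \<oplus>\<^bsub>M i\<^esub> y \<in> carrier (M i)" if "i \<in> S" "x \<in> carrier (M i)" "y \<in> carrier (M i)" for i x y
  proof - interpret kmodule "M i" using M that by blast show ?thesis using that by simp qed
  have s: "c \<odot>\<^bsub>M i\<^esub> x \<in> carrier (M i)" if "i \<in> S" "x \<in> carrier (M i)" for i x c
  proof - interpret kmodule "M i" using M that by blast show ?thesis using that by simp qed
  have k1: "Poly_Mapping.keys (word u - word v - word w :: ('i \<Rightarrow> 'b) \<Rightarrow>\<^sub>0 'k) \<subseteq> {u, v, w}" for u v w
    by (auto simp: in_keys_iff lookup_minus lookup_single when_def split: if_splits)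
  have k2: "Poly_Mapping.keys (word u - Poly_Mapping.single v c :: ('i \<Rightarrow> 'b) \<Rightarrow>\<^sub>0 'k) \<subseteq> {u, v}" for u v c
    by (auto simp: in_keys_iff lookup_minus lookup_single when_def split: if_splits)
  show ?thesis
  proof
    fix r assume "r \<in> big_tensor_relations S M"
    then consider (a) h i x y where "r = word (h(i := x \<oplus>\<^bsub>M i\<^esub> y)) - word (h(i := x)) - word (h(i := y))"
        "h \<in> (\<Pi>\<^sub>E i\<in>S. carrier (M i))" "i \<in> S" "x \<in> carrier (M i)" "y \<in> carrier (M i)"
      | (b) h i c x where "r = word (h(i := c \<odot>\<^bsub>M i\<^esub> x)) - Poly_Mapping.single (h(i := x)) c"
        "h \<in> (\<Pi>\<^sub>E i\<in>S. carrier (M i))" "i \<in> S" "x \<in> carrier (M i)"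
      unfolding big_tensor_relations_def by auto
    then show "r \<in> carrier FS"
    proof cases
      case a
      have "{h(i := x \<oplus>\<^bsub>M i\<^esub> y), h(i := x), h(i := y)} \<subseteq> (\<Pi>\<^sub>E i\<in>S. carrier (M i))"
        using family_update[OF a(2,3)] a(4,5) add_cl[OF a(3-5)] by blast
      then show ?thesis using k1 a(1) by (metis (no_types, lifting) free_module_on_simps(1) mem_Collect_eq order_trans)
    next
      case b
      have "{h(i := c \<odot>\<^bsub>M i\<^esub> x), h(i := x)} \<subseteq> (\<Pi>\<^sub>E i\<in>S. carrier (M i))"
        using family_update[OF b(2,3)] b(4) s[OF b(3,4)] by blast
      then show ?thesis using k2 b(1) by (metis (no_types, lifting) free_module_on_simps(1) mem_Collect_eq order_trans)
    qed
  qed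
qed

lemma big_tensor_module_eq: "big_tensor_module S M = quotient_module FS NS"
  by (simp add: big_tensor_module_def Let_def)

lemma big_tensor_eq: "big_tensor S M h = NS +>\<^bsub>FS\<^esub> word h"
  by (simp add: big_tensor_def Let_def)

lemma kmodule_big_tensor: "kmodule (big_tensor_module S M)"
  unfolding big_tensor_module_eq by (rule presented_kmodule[OF big_tensor_relations_subset])

lemma linear_big_tensor_coset: "linear_map FS (big_tensor_module S M) (\<lambda>x. NS +>\<^bsub>FS\<^esub> x)"
  unfolding big_tensor_module_eq by (rule presented_kmodule[OF big_tensor_relations_subset])

lemma big_tensor_relator: "r \<in> big_tensor_relations S M \<Longrightarrow> NS +>\<^bsub>FS\<^esub> r = \<zero>\<^bsub>big_tensor_module S M\<^esub>"
  unfolding big_tensor_module_eq by (rule presented_kmodule(3)[OF big_tensor_relations_subset]) (rule subsetD[OF module_span_superset])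

lemma big_tensor_closed: "h \<in> (\<Pi>\<^sub>E i\<in>S. carrier (M i)) \<Longrightarrow> big_tensor S M h \<in> carrier (big_tensor_module S M)"
  unfolding big_tensor_eq by (rule linear_map_closed[OF linear_big_tensor_coset]) simp

lemma linear_big_tensor_slot:
  assumes h: "h \<in> (\<Pi>\<^sub>E i\<in>S. carrier (M i))" and i: "i \<in> S"
  shows "linear_map (M i) (big_tensor_module S M) (\<lambda>x. big_tensor S M (h(i := x)))"
proof -
  interpret kmodule "M i" using M i by blast
  note u = family_update[OF h i]
  show ?thesis unfolding linear_map_def
  proof (intro conjI ballI allI, goal_cases)
    case 1 then show ?case using big_tensor_closed u by blast
  next
    case (2 a b)
    have rel: "word (h(i := a \<oplus>\<^bsub>M i\<^esub> b)) - word (h(i := a)) - word (h(i := b)) \<in> big_tensor_relations S M"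
      unfolding big_tensor_relations_def using 2 h i by blast
    show ?case unfolding big_tensor_eq
      by (rule iffD1[OF relator_zero_add[OF kmodule_big_tensor linear_big_tensor_coset] big_tensor_relator[OF rel]]) (use 2 u in auto)
  next
    case (3 c a)
    have rel: "word (h(i := c \<odot>\<^bsub>M i\<^esub> a)) - Poly_Mapping.single (h(i := a)) c \<in> big_tensor_relations S M"
      unfolding big_tensor_relations_def using 3 h i by blast
    show ?case unfolding big_tensor_eq
      by (rule iffD1[OF relator_zero_smult[OF kmodule_big_tensor linear_big_tensor_coset] big_tensor_relator[OF rel]]) (use 3 u in auto)
  qed
qed

lemma big_tensor_zero_slot:
  assumes h: "h \<in> (\<Pi>\<^sub>E i\<in>S. carrier (M i))" and i: "i \<in> S" "h i = \<zero>\<^bsub>M i\<^esub>"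
  shows "big_tensor S M h = \<zero>\<^bsub>big_tensor_module S M\<^esub>"
  using linear_map_zero[OF M[OF i(1)] kmodule_big_tensor linear_big_tensor_slot[OF h i(1)]] i(2)
  by (metis fun_upd_triv)

lemma big_tensor_lift:
  assumes P: "kmodule P"
    and c: "\<And>h. h \<in> (\<Pi>\<^sub>E i\<in>S. carrier (M i)) \<Longrightarrow> \<beta> h \<in> carrier P"
    and l: "\<And>h i. h \<in> (\<Pi>\<^sub>E i\<in>S. carrier (M i)) \<Longrightarrow> i \<in> S \<Longrightarrow> linear_map (M i) P (\<lambda>x. \<beta> (h(i := x)))"
  shows "\<exists>g. linear_map (big_tensor_module S M) P g \<and> (\<forall>h\<in>(\<Pi>\<^sub>E i\<in>S. carrier (M i)). g (big_tensor S M h) = \<beta> h)"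
proof -
  have c': "\<beta> \<in> (\<Pi>\<^sub>E i\<in>S. carrier (M i)) \<rightarrow> carrier P" using c by blast
  have lw: "lin_ext P \<beta> (word u) = \<beta> u" if "u \<in> (\<Pi>\<^sub>E i\<in>S. carrier (M i))" for u
  proof -
    interpret P: kmodule P by fact
    show ?thesis using c[OF that] by (simp add: lin_ext_single[OF P])
  qed
  note rl = relator_zero_add[OF P linear_lin_ext[OF P c']] relator_zero_smult[OF P linear_lin_ext[OF P c']]
  have "lin_ext P \<beta> r = \<zero>\<^bsub>P\<^esub>" if r: "r \<in> big_tensor_relations S M" for r
  proof -
    from r consider (a) h i x y where "r = word (h(i := x \<oplus>\<^bsub>M i\<^esub> y)) - word (h(i := x)) - word (h(i := y))"
        "h \<in> (\<Pi>\<^sub>E i\<in>S. carrier (M i))" "i \<in> S" "x \<in> carrier (M i)" "y \<in> carrier (M i)"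
      | (b) h i c x where "r = word (h(i := c \<odot>\<^bsub>M i\<^esub> x)) - Poly_Mapping.single (h(i := x)) c"
        "h \<in> (\<Pi>\<^sub>E i\<in>S. carrier (M i))" "i \<in> S" "x \<in> carrier (M i)"
      unfolding big_tensor_relations_def by auto
    then show ?thesis
    proof cases
      case a
      interpret kmodule "M i" using M a by blast
      note u = family_update[OF a(2,3)]
      show ?thesis unfolding a(1) using a u
        by (subst rl(1)) (simp_all add: lw linear_map_add[OF l[OF a(2,3)]])
    next
      case b
      interpret kmodule "M i" using M b by blast
      note u = family_update[OF b(2,3)]
      show ?thesis unfolding b(1) using b u
        by (subst rl(2)) (simp_all add: lw linear_map_smult[OF l[OF b(2,3)]])
    qed
  qed
  from presented_lift[OF P big_tensor_relations_subset c' this]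
  show ?thesis unfolding big_tensor_module_eq big_tensor_eq by blast
qed

lemma big_tensor_eqI:
  assumes "kmodule P" "linear_map (big_tensor_module S M) P f" "linear_map (big_tensor_module S M) P g"
    and "\<And>h. h \<in> (\<Pi>\<^sub>E i\<in>S. carrier (M i)) \<Longrightarrow> f (big_tensor S M h) = g (big_tensor S M h)"
    and "z \<in> carrier (big_tensor_module S M)"
  shows "f z = g z"
  using presented_eqI[OF assms(1) big_tensor_relations_subset, of f g z] assms(2-)
  unfolding big_tensor_module_eq big_tensor_eq by auto

end

text \<open>
  A map that is linear in each entry of two families induces a bilinear map on the tensor products: lift in the second
  family first.  These lifts depend linearly on each entry of the first family, because they are determined by their values on
  pure tensors, and can therefore be lifted once more.
\<close>

lemma big_tensor_bilinear_lift:
  assumes M: "\<And>i. i \<in> S \<Longrightarrow> kmodule (M i)" and N: "\<And>i. i \<in> T \<Longrightarrow> kmodule (N i)" and P: "kmodule P"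
    and c: "\<And>h h'. h \<in> (\<Pi>\<^sub>E i\<in>S. carrier (M i)) \<Longrightarrow> h' \<in> (\<Pi>\<^sub>E i\<in>T. carrier (N i)) \<Longrightarrow> \<beta> h h' \<in> carrier P"
    and l: "\<And>h h' i. h \<in> (\<Pi>\<^sub>E i\<in>S. carrier (M i)) \<Longrightarrow> h' \<in> (\<Pi>\<^sub>E i\<in>T. carrier (N i)) \<Longrightarrow> i \<in> S \<Longrightarrow>
      linear_map (M i) P (\<lambda>x. \<beta> (h(i := x)) h')"
    and r: "\<And>h h' i. h \<in> (\<Pi>\<^sub>E i\<in>S. carrier (M i)) \<Longrightarrow> h' \<in> (\<Pi>\<^sub>E i\<in>T. carrier (N i)) \<Longrightarrow> i \<in> T \<Longrightarrow>
      linear_map (N i) P (\<lambda>x. \<beta> h (h'(i := x)))"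
  shows "\<exists>b. (\<forall>y\<in>carrier (big_tensor_module T N). linear_map (big_tensor_module S M) P (\<lambda>x. b x y)) \<and>
    (\<forall>x\<in>carrier (big_tensor_module S M). linear_map (big_tensor_module T N) P (\<lambda>y. b x y)) \<and>
    (\<forall>h\<in>(\<Pi>\<^sub>E i\<in>S. carrier (M i)). \<forall>h'\<in>(\<Pi>\<^sub>E i\<in>T. carrier (N i)). b (big_tensor S M h) (big_tensor T N h') = \<beta> h h')"
proof -
  let ?S = "\<Pi>\<^sub>E i\<in>S. carrier (M i)" and ?T = "\<Pi>\<^sub>E i\<in>T. carrier (N i)"
  let ?A = "big_tensor_module S M" and ?B = "big_tensor_module T N"
  interpret P: kmodule P by fact
  interpret A: kmodule ?A by (rule kmodule_big_tensor) (rule M)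
  interpret B: kmodule ?B by (rule kmodule_big_tensor) (rule N)
  have "\<forall>h\<in>?S. \<exists>g. linear_map ?B P g \<and> (\<forall>h'\<in>?T. g (big_tensor T N h') = \<beta> h h')"
    by (intro ballI big_tensor_lift N P c r) auto
  then obtain g where g: "\<And>h. h \<in> ?S \<Longrightarrow> linear_map ?B P (g h)"
      "\<And>h h'. h \<in> ?S \<Longrightarrow> h' \<in> ?T \<Longrightarrow> g h (big_tensor T N h') = \<beta> h h'"
    by metis
  have gl: "linear_map (M i) P (\<lambda>x. g (h(i := x)) y)" if h: "h \<in> ?S" and i: "i \<in> S" and y: "y \<in> carrier ?B" for h i y
  proof -
    interpret Mi: kmodule "M i" using M i by blast
    note u = family_update[OF M h i, simplified]
    show ?thesis unfolding linear_map_def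
    proof (intro conjI ballI allI, goal_cases)
      case 1 then show ?case using linear_map_closed[OF g(1) y] u by blast
    next
      case (2 a b)
      show ?case
        using 2 u y h i
        by (intro big_tensor_eqI[OF N P g(1) linear_map_pointwise_add[OF P g(1) g(1)] _ y])
          (simp_all add: g(2) linear_map_add[OF l])
    next
      case (3 c a)
      show ?case
        using 3 u y h i
        by (intro big_tensor_eqI[OF N P g(1) linear_map_pointwise_smult[OF P g(1)] _ y])
          (simp_all add: g(2) linear_map_smult[OF l])
    qed
  qed
  have "\<forall>y\<in>carrier ?B. \<exists>b. linear_map ?A P b \<and> (\<forall>h\<in>?S. b (big_tensor S M h) = g h y)"
    by (intro ballI big_tensor_lift M P gl) (auto intro: linear_map_closed[OF g(1)])
  then obtain b where b: "\<And>y. y \<in> carrier ?B \<Longrightarrow> linear_map ?A P (b y)"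
      "\<And>h y. h \<in> ?S \<Longrightarrow> y \<in> carrier ?B \<Longrightarrow> b y (big_tensor S M h) = g h y"
    by metis
  have "linear_map ?B P (\<lambda>y. b y x)" if x: "x \<in> carrier ?A" for x
    unfolding linear_map_def
  proof (intro conjI ballI allI, goal_cases)
    case 1 then show ?case using linear_map_closed[OF b(1) x] by blast
  next
    case (2 y z)
    show ?case
      using 2 by (intro big_tensor_eqI[OF M P b(1) linear_map_pointwise_add[OF P b(1) b(1)] _ x])
        (simp_all add: b(2) linear_map_add[OF g(1)])
  next
    case (3 c y)
    show ?case
      using 3 by (intro big_tensor_eqI[OF M P b(1) linear_map_pointwise_smult[OF P b(1)] _ x])
        (simp_all add: b(2) linear_map_smult[OF g(1)])
  qed
  moreover have "big_tensor T N h' \<in> carrier ?B" if "h' \<in> ?T" for h'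
    using that by (intro big_tensor_closed N) auto
  ultimately show ?thesis using b g(2) by (intro exI[of _ "\<lambda>x y. b y x"]) auto
qed

section \<open>Cochains and their coboundaries\<close>

definition cochain_eval :: "('b \<Rightarrow> 'k::comm_ring_1) \<Rightarrow> ('b \<Rightarrow>\<^sub>0 int) \<Rightarrow> 'k" where
  "cochain_eval c z = (\<Sum>f\<in>Poly_Mapping.keys z. of_int (Poly_Mapping.lookup z f) * c f)"

lemma cochain_eval_superset:
  assumes "finite T" "Poly_Mapping.keys z \<subseteq> T"
  shows "cochain_eval c z = (\<Sum>f\<in>T. of_int (Poly_Mapping.lookup z f) * c f)"
  unfolding cochain_eval_def using assms by (intro sum.mono_neutral_left) (auto simp: in_keys_iff)

lemma cochain_eval_0 [simp]: "cochain_eval c 0 = 0"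
  by (simp add: cochain_eval_def)

lemma cochain_eval_add: "cochain_eval c (z + w) = cochain_eval c z + cochain_eval c w"
proof -
  let ?T = "Poly_Mapping.keys z \<union> Poly_Mapping.keys w"
  have T: "finite ?T" "Poly_Mapping.keys z \<subseteq> ?T" "Poly_Mapping.keys w \<subseteq> ?T" "Poly_Mapping.keys (z + w) \<subseteq> ?T"
    using keys_add[of z w] by auto
  show ?thesis
    unfolding T(2-4)[THEN cochain_eval_superset[OF T(1)]] by (simp only: lookup_add of_int_add distrib_right sum.distrib)
qed

lemma cochain_eval_cmul: "cochain_eval c (frag_cmul a z) = of_int a * cochain_eval c z"
proof -
  have k: "Poly_Mapping.keys (frag_cmul a z) \<subseteq> Poly_Mapping.keys z" by (rule keys_cmul)
  have "cochain_eval c (frag_cmul a z) = (\<Sum>f\<in>Poly_Mapping.keys z. of_int (Poly_Mapping.lookup (frag_cmul a z) f) * c f)"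
    by (rule cochain_eval_superset[OF finite_keys k])
  also have "\<dots> = (\<Sum>f\<in>Poly_Mapping.keys z. of_int a * (of_int (Poly_Mapping.lookup z f) * c f))"
    by (intro sum.cong refl) (simp add: mult.assoc)
  also have "\<dots> = of_int a * cochain_eval c z" by (simp only: cochain_eval_def sum_distrib_left)
  finally show ?thesis .
qed

lemma cochain_eval_minus: "cochain_eval c (- z) = - cochain_eval c z"
  using cochain_eval_cmul[of c "-1" z] by (simp only: frag_cmul_minus_one of_int_minus of_int_1 mult_minus_left mult_1)

lemma cochain_eval_diff: "cochain_eval c (z - w) = cochain_eval c z - cochain_eval c w"
  using cochain_eval_add[of c z "- w"] by (simp add: cochain_eval_minus)

lemma cochain_eval_sum: "cochain_eval c (sum z I) = (\<Sum>i\<in>I. cochain_eval c (z i))"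
  by (induction I rule: infinite_finite_induct) (auto simp: cochain_eval_add)

lemma cochain_eval_of [simp]: "cochain_eval c (frag_of f) = c f"
  by (simp add: cochain_eval_def)

lemma coboundary_eval:
  assumes "singular_simplex n X f"
  shows "coboundary X c n f = cochain_eval (c (n - 1)) (chain_boundary n (frag_of f))"
  using assms by (simp add: coboundary_def chain_boundary_of cochain_eval_sum cochain_eval_cmul)

text \<open>
  Evaluation on chains makes the coboundary adjoint to the boundary of singular chains, so that
  statements about chains, such as \<open>\<partial>\<partial> = 0\<close> and the subdivision homotopy, apply to cochains.
\<close>

lemma coboundary_eval_chain:
  assumes "singular_chain n X z"
  shows "cochain_eval (coboundary X c n) z = cochain_eval (c (n - 1)) (chain_boundary n z)"
  using assms unfolding singular_chain_def
  by (induction rule: frag_induction)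
    (auto simp: coboundary_eval cochain_eval_diff chain_boundary_diff)

lemma coboundary_coboundary: "coboundary X (coboundary X c) = (\<lambda>n f. 0)"
proof (intro ext)
  fix n f
  show "coboundary X (coboundary X c) n f = 0"
  proof (cases "singular_simplex n X f")
    case True
    then have f: "singular_chain n X (frag_of f)" by (simp add: singular_chain_of)
    have "coboundary X (coboundary X c) n f = cochain_eval (coboundary X c (n - 1)) (chain_boundary n (frag_of f))"
      using True by (rule coboundary_eval)
    also have "\<dots> = cochain_eval (c (n - 1 - 1)) (chain_boundary (n - 1) (chain_boundary n (frag_of f)))"
      using singular_chain_boundary[OF f] by (intro coboundary_eval_chain) simp
    also have "\<dots> = 0" using chain_boundary_boundary[OF f] by simp
    finally show ?thesis .
  qed (simp add: coboundary_def)
qed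

lemma cochainsI:
  "(\<And>n f. \<not> singular_simplex n X f \<Longrightarrow> c n f = 0) \<Longrightarrow> finite {n. c n \<noteq> (\<lambda>_. 0)} \<Longrightarrow> c \<in> cochains X"
  by (simp add: cochains_def)

lemma cochains_outside: "c \<in> cochains X \<Longrightarrow> \<not> singular_simplex n X f \<Longrightarrow> c n f = 0"
  by (simp add: cochains_def)

lemma cochains_finite: "c \<in> cochains X \<Longrightarrow> finite {n. c n \<noteq> (\<lambda>_. 0)}"
  by (simp add: cochains_def)

text \<open>
  Cochains have only finitely many nonzero degrees; an operation that acts degree by degree preserves this.
\<close>

lemma cochains_degreewise:
  assumes c: "c \<in> cochains X" and "\<And>n f. \<not> singular_simplex n Y f \<Longrightarrow> d n f = 0"
    and "\<And>n. c n = (\<lambda>_. 0) \<Longrightarrow> d n = (\<lambda>_. 0)"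
  shows "d \<in> cochains Y"
  using assms(2) by (rule cochainsI) (auto intro: finite_subset[OF _ cochains_finite[OF c]] assms(3))

lemma cochains_zero: "(\<lambda>n f. 0) \<in> cochains X"
  by (auto simp: cochains_def)

lemma cochains_add:
  assumes "c \<in> cochains X" "d \<in> cochains X" shows "(\<lambda>n f. c n f + d n f) \<in> cochains X"
proof (rule cochainsI)
  show "finite {n. (\<lambda>f. c n f + d n f) \<noteq> (\<lambda>_. 0)}"
    by (rule finite_subset[of _ "{n. c n \<noteq> (\<lambda>_. 0)} \<union> {n. d n \<noteq> (\<lambda>_. 0)}"])
      (use assms in \<open>auto simp: cochains_finite\<close>)
qed (use assms in \<open>auto simp: cochains_outside\<close>)

lemma cochains_smult: "c \<in> cochains X \<Longrightarrow> (\<lambda>n f. a * c n f) \<in> cochains X"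
  by (rule cochains_degreewise[of c X]) (auto simp: cochains_outside)

lemma cochains_coboundary:
  assumes "c \<in> cochains X" shows "coboundary X c \<in> cochains X"
proof (rule cochainsI)
  have "n \<in> Suc ` {n. c n \<noteq> (\<lambda>_. 0)}" if "coboundary X c n \<noteq> (\<lambda>_. 0)" for n
  proof (cases n)
    case (Suc k)
    have "c k \<noteq> (\<lambda>_. 0)"
    proof
      assume "c k = (\<lambda>_. 0)"
      then have "coboundary X c n = (\<lambda>_. 0)" by (simp add: coboundary_def Suc fun_eq_iff)
      with that show False by blast
    qed
    then show ?thesis using Suc by blast
  qed (use that in \<open>simp add: coboundary_def\<close>)
  then have "{n. coboundary X c n \<noteq> (\<lambda>_. 0)} \<subseteq> Suc ` {n. c n \<noteq> (\<lambda>_. 0)}" by (intro subsetI) simp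
  then show "finite {n. coboundary X c n \<noteq> (\<lambda>_. 0)}"
    by (rule finite_subset) (rule finite_imageI[OF cochains_finite[OF assms]])
qed (auto simp: coboundary_def)

lemma coboundary_add: "coboundary X (\<lambda>n f. c n f + d n f) = (\<lambda>n f. coboundary X c n f + coboundary X d n f)"
  by (auto simp: coboundary_def fun_eq_iff algebra_simps sum.distrib)

lemma coboundary_smult: "coboundary X (\<lambda>n f. a * c n f) = (\<lambda>n f. a * coboundary X c n f)"
  by (auto simp: coboundary_def fun_eq_iff algebra_simps sum_distrib_left)

lemma coboundary_zero: "coboundary X (\<lambda>n f. 0) = (\<lambda>n f. 0)"
  by (auto simp: coboundary_def fun_eq_iff)

section \<open>The Leibniz rule\<close>

definition shift_coords :: "nat \<Rightarrow> (nat \<Rightarrow> real) \<Rightarrow> nat \<Rightarrow> real" where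
  "shift_coords p x = (\<lambda>i. if i < p then 0 else x (i - p))"

lemma back_face_eq: "back_face p q f = restrict (\<lambda>x. f (shift_coords p x)) (standard_simplex q)"
  by (simp add: back_face_def shift_coords_def)

lemma shift_coords_in_simplex:
  assumes "x \<in> standard_simplex q" shows "shift_coords p x \<in> standard_simplex (p + q)"
proof -
  have "(\<Sum>i\<le>p + q. shift_coords p x i) = (\<Sum>i\<in>(+) p ` {..q}. shift_coords p x i)"
  proof (intro sum.mono_neutral_right ballI)
    fix i assume i: "i \<in> {..p + q} - (+) p ` {..q}"
    then have "i < p" by (auto simp: image_iff) (metis add_diff_inverse_nat atMost_iff le_diff_conv add.commute)
    then show "shift_coords p x i = 0" by (simp add: shift_coords_def)
  qed auto
  also have "\<dots> = (\<Sum>i\<le>q. x i)" by (subst sum.reindex) (auto simp: shift_coords_def)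
  finally show ?thesis using assms by (auto simp: standard_simplex_def shift_coords_def)
qed

lemma singular_simplex_back_face:
  assumes "singular_simplex (p + q) X f" shows "singular_simplex q X (back_face p q f)"
proof -
  let ?PT = "powertop_real UNIV"
  have "continuous_map (subtopology ?PT (standard_simplex q)) (subtopology ?PT (standard_simplex (p + q))) (shift_coords p)"
    unfolding continuous_map_in_subtopology
  proof
    have "continuous_map ?PT euclideanreal (\<lambda>x. shift_coords p x i)" for i
      unfolding shift_coords_def by (auto intro: continuous_map_product_projection)
    then have "continuous_map ?PT ?PT (shift_coords p)"
      by (simp add: continuous_map_componentwise_UNIV)
    then show "continuous_map (subtopology ?PT (standard_simplex q)) ?PT (shift_coords p)"
      by (rule continuous_map_from_subtopology)
  qed (use shift_coords_in_simplex in auto)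
  from continuous_map_compose[OF this] show ?thesis
    using assms by (auto simp: singular_simplex_def back_face_eq o_def)
qed

lemma singular_simplex_front_face:
  assumes "singular_simplex n X f" "p \<le> n" shows "singular_simplex p X (front_face p f)"
proof -
  have "continuous_map (subtopology (powertop_real UNIV) (standard_simplex p)) X f"
    using assms standard_simplex_mono[OF assms(2)]
    by (auto simp: singular_simplex_def intro: continuous_map_from_subtopology_mono)
  then show ?thesis by (auto simp: singular_simplex_def front_face_def)
qed

lemma front_face_face_le:
  assumes "k \<le> p" "p < n"
  shows "front_face p (singular_face n k f) = singular_face (Suc p) k (front_face (Suc p) f)"
proof
  fix x
  have "x \<in> standard_simplex p \<Longrightarrow> x \<in> standard_simplex (n - 1) \<and> simplical_face k x \<in> standard_simplex (Suc p)"
    using subsetD[OF standard_simplex_mono[of p "n - 1"], of x] simplical_face_in_standard_simplex[of "Suc p" k x] assms by auto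
  then show "front_face p (singular_face n k f) x = singular_face (Suc p) k (front_face (Suc p) f) x"
    by (auto simp: front_face_def singular_face_def)
qed

lemma simplical_face_beyond: "x \<in> standard_simplex p \<Longrightarrow> p < k \<Longrightarrow> simplical_face k x = x"
  by (auto simp: simplical_face_def standard_simplex_def fun_eq_iff)

lemma front_face_face_gt:
  assumes "p < k" "p < n" shows "front_face p (singular_face n k f) = front_face p f"
proof
  fix x
  show "front_face p (singular_face n k f) x = front_face p f x"
    using subsetD[OF standard_simplex_mono[of p "n - 1"], of x] assms simplical_face_beyond[of x p k]
    by (auto simp: front_face_def singular_face_def)
qed

lemma face_front_face_last: "singular_face (Suc p) (Suc p) (front_face (Suc p) f) = front_face p f"
proof
  fix x
  show "singular_face (Suc p) (Suc p) (front_face (Suc p) f) x = front_face p f x"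
    using standard_simplex_mono[of p "Suc p"] simplical_face_beyond[of x p "Suc p"]
    by (auto simp: front_face_def singular_face_def)
qed

lemma back_face_face_le:
  assumes "k \<le> p" shows "back_face p q (singular_face (Suc (p + q)) k f) = back_face (Suc p) q f"
proof
  fix x
  have "simplical_face k (shift_coords p x) = shift_coords (Suc p) x"
    using assms by (auto simp: simplical_face_def shift_coords_def fun_eq_iff)
  then show "back_face p q (singular_face (Suc (p + q)) k f) x = back_face (Suc p) q f x"
    using shift_coords_in_simplex[of x q p] by (auto simp: back_face_eq singular_face_def)
qed

lemma simplical_face_shift: "simplical_face (p + j) (shift_coords p x) = shift_coords p (simplical_face j x)"
proof
  fix i
  consider "i < p" | "p \<le> i" "i < p + j" | "i = p + j" | "i > p + j" by linarith
  then show "simplical_face (p + j) (shift_coords p x) i = shift_coords p (simplical_face j x) i"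
    by cases (auto simp: simplical_face_def shift_coords_def)
qed

lemma back_face_face_gt:
  assumes "j \<le> Suc q"
  shows "back_face p q (singular_face (Suc (p + q)) (p + j) f) = singular_face (Suc q) j (back_face p (Suc q) f)"
proof
  fix x
  show "back_face p q (singular_face (Suc (p + q)) (p + j) f) x = singular_face (Suc q) j (back_face p (Suc q) f) x"
    using shift_coords_in_simplex[of x q p] simplical_face_in_standard_simplex[of "Suc q" j x] assms
    by (auto simp: back_face_eq singular_face_def simplical_face_shift)
qed

lemma face_back_face_first: "singular_face (Suc q) 0 (back_face p (Suc q) f) = back_face (Suc p) q f"
  using back_face_face_gt[of 0 q p f] back_face_face_le[of p p q f] by simp

definition sign_cochain :: "('a, 'k::comm_ring_1) cochain \<Rightarrow> ('a, 'k) cochain" where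
  "sign_cochain c = (\<lambda>n f. (-1) ^ n * c n f)"

text \<open>
  The faces \<open>k \<le> p\<close> of a simplex are faces of its front part and the faces \<open>k > p\<close> are faces of its back part.  The
  right-hand side contains two further terms for each \<open>p\<close>, from the last face of the front part and from the first face
  of the back part; they have opposite signs and cancel.
\<close>

lemma coboundary_cup:
  "coboundary X (cup X c d) =
    (\<lambda>n f. cup X (coboundary X c) d n f + cup X (sign_cochain c) (coboundary X d) n f)"
proof (intro ext)
  fix n f
  show "coboundary X (cup X c d) n f = cup X (coboundary X c) d n f + cup X (sign_cochain c) (coboundary X d) n f"
  proof (cases "singular_simplex n X f \<and> n \<noteq> 0")
    case False
    then consider "\<not> singular_simplex n X f" | "n = 0" by blast
    then show ?thesis by cases (simp_all add: coboundary_def cup_def)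
  next
    case True
    then obtain N where n: "n = Suc N" and f: "singular_simplex (Suc N) X f" using not0_implies_Suc by auto
    define u where "u p k = c p (singular_face (Suc p) k (front_face (Suc p) f))" for p k
    define v where "v p = d (N - p) (back_face (Suc p) (N - p) f)" for p
    define w where "w p = c p (front_face p f)" for p
    define z where "z p j = d (N - p) (singular_face (Suc (N - p)) j (back_face p (Suc (N - p)) f))" for p j
    have ss: "singular_simplex N X (singular_face (Suc N) k f)" if "k \<le> Suc N" for k
      using singular_simplex_singular_face[OF f, of k] that by simp
    have "coboundary X (cup X c d) n f = (\<Sum>k\<le>Suc N. (-1) ^ k * (\<Sum>p\<le>N.
        c p (front_face p (singular_face (Suc N) k f)) * d (N - p) (back_face p (N - p) (singular_face (Suc N) k f))))"
      using f by (simp add: n coboundary_def cup_def ss del: sum.atMost_Suc)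
    also have "\<dots> = (\<Sum>p\<le>N. \<Sum>k\<le>Suc N. (-1) ^ k *
        (c p (front_face p (singular_face (Suc N) k f)) * d (N - p) (back_face p (N - p) (singular_face (Suc N) k f))))"
      unfolding sum_distrib_left by (rule sum.swap)
    also have "\<dots> = (\<Sum>p\<le>N. (\<Sum>k\<le>Suc p. (-1) ^ k * u p k) * v p + (-1) ^ p * w p * (\<Sum>j\<le>Suc (N - p). (-1) ^ j * z p j))"
    proof (rule sum.cong[OF refl])
      fix p assume "p \<in> {..N}"
      then have p: "p \<le> N" by simp
      let ?g = "\<lambda>k. (-1) ^ k * (c p (front_face p (singular_face (Suc N) k f)) * d (N - p) (back_face p (N - p) (singular_face (Suc N) k f)))"
      have split: "{..Suc N} = {..p} \<union> (+) p ` {1..Suc (N - p)}"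
      proof -
        have "k \<in> (+) p ` {1..Suc (N - p)}" if "k \<le> Suc N" "\<not> k \<le> p" for k
          using that p by (intro image_eqI[of _ _ "k - p"]) auto
        then show ?thesis using p by auto
      qed
      have "(\<Sum>k\<le>Suc N. ?g k) = (\<Sum>k\<le>p. ?g k) + (\<Sum>k\<in>(+) p ` {1..Suc (N - p)}. ?g k)"
        unfolding split by (rule sum.union_disjoint) auto
      also have "(\<Sum>k\<le>p. ?g k) = (\<Sum>k\<le>p. (-1) ^ k * u p k) * v p"
        unfolding sum_distrib_right
      proof (rule sum.cong[OF refl])
        fix k assume k: "k \<in> {..p}"
        have "back_face p (N - p) (singular_face (Suc N) k f) = back_face (Suc p) (N - p) f"
          using back_face_face_le[of k p "N - p" f] k p by simp
        then show "?g k = (-1) ^ k * u p k * v p"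
          using front_face_face_le[of k p "Suc N" f] k p by (simp add: u_def v_def mult.assoc)
      qed
      also have "(\<Sum>k\<in>(+) p ` {1..Suc (N - p)}. ?g k) = (\<Sum>j\<in>{1..Suc (N - p)}. (-1) ^ p * w p * ((-1) ^ j * z p j))"
      proof (subst sum.reindex, simp, rule sum.cong[OF refl])
        fix j assume j: "j \<in> {1..Suc (N - p)}"
        have "back_face p (N - p) (singular_face (Suc N) (p + j) f) = singular_face (Suc (N - p)) j (back_face p (Suc (N - p)) f)"
          using back_face_face_gt[of j "N - p" p f] j p by simp
        then show "(?g \<circ> (+) p) j = (-1) ^ p * w p * ((-1) ^ j * z p j)"
          using front_face_face_gt[of p "p + j" "Suc N" f] j p by (simp add: w_def z_def power_add mult_ac)
      qed
      also have "\<dots> = (-1) ^ p * w p * ((\<Sum>j\<le>Suc (N - p). (-1) ^ j * z p j) - z p 0)"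
      proof -
        have "{..Suc (N - p)} = insert 0 {1..Suc (N - p)}" by auto
        then show ?thesis by (simp add: sum_distrib_left del: sum.atMost_Suc sum.cl_ivl_Suc)
      qed
      also have "(\<Sum>k\<le>p. (-1) ^ k * u p k) * v p = (\<Sum>k\<le>Suc p. (-1) ^ k * u p k) * v p + (-1) ^ p * w p * z p 0"
        by (simp add: algebra_simps u_def w_def v_def z_def face_front_face_last face_back_face_first)
      finally show "(\<Sum>k\<le>Suc N. ?g k) = (\<Sum>k\<le>Suc p. (-1) ^ k * u p k) * v p + (-1) ^ p * w p * (\<Sum>j\<le>Suc (N - p). (-1) ^ j * z p j)"
        by (simp add: algebra_simps)
    qed
    also have "\<dots> = (\<Sum>p\<le>N. (\<Sum>k\<le>Suc p. (-1) ^ k * u p k) * v p) + (\<Sum>p\<le>N. (-1) ^ p * w p * (\<Sum>j\<le>Suc (N - p). (-1) ^ j * z p j))"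
      by (rule sum.distrib)
    also have "(\<Sum>p\<le>N. (\<Sum>k\<le>Suc p. (-1) ^ k * u p k) * v p) = cup X (coboundary X c) d n f"
    proof -
      have "cup X (coboundary X c) d n f = (\<Sum>p\<le>Suc N. coboundary X c p (front_face p f) * d (Suc N - p) (back_face p (Suc N - p) f))"
        using f by (simp add: n cup_def del: sum.atMost_Suc)
      also have "\<dots> = (\<Sum>p\<le>N. coboundary X c (Suc p) (front_face (Suc p) f) * d (N - p) (back_face (Suc p) (N - p) f))"
        by (subst sum.atMost_Suc_shift) (simp add: coboundary_def)
      also have "\<dots> = (\<Sum>p\<le>N. (\<Sum>k\<le>Suc p. (-1) ^ k * u p k) * v p)"
        using singular_simplex_front_face[OF f]
        by (intro sum.cong refl) (simp add: coboundary_def u_def v_def del: sum.atMost_Suc)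
      finally show ?thesis by simp
    qed
    also have "(\<Sum>p\<le>N. (-1) ^ p * w p * (\<Sum>j\<le>Suc (N - p). (-1) ^ j * z p j)) = cup X (sign_cochain c) (coboundary X d) n f"
    proof -
      have "cup X (sign_cochain c) (coboundary X d) n f =
          (\<Sum>p\<le>N. sign_cochain c p (front_face p f) * coboundary X d (Suc N - p) (back_face p (Suc N - p) f))"
        using f by (simp add: n cup_def coboundary_def)
      also have "\<dots> = (\<Sum>p\<le>N. (-1) ^ p * w p * (\<Sum>j\<le>Suc (N - p). (-1) ^ j * z p j))"
      proof (rule sum.cong[OF refl])
        fix p assume "p \<in> {..N}"
        then have p: "p \<le> N" by simp
        have "singular_simplex (Suc (N - p)) X (back_face p (Suc (N - p)) f)"
          using singular_simplex_back_face[of p "Suc (N - p)" X f] f p by simp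
        then show "sign_cochain c p (front_face p f) * coboundary X d (Suc N - p) (back_face p (Suc N - p) f)
            = (-1) ^ p * w p * (\<Sum>j\<le>Suc (N - p). (-1) ^ j * z p j)"
          using p by (simp add: Suc_diff_le sign_cochain_def coboundary_def w_def z_def del: sum.atMost_Suc)
      qed
      finally show ?thesis by simp
    qed
    finally show ?thesis .
  qed
qed


section \<open>Cohomology as a module with a bilinear product\<close>

lemma cocycle_algebra_simps [simp]:
  "\<zero>\<^bsub>cocycle_algebra X\<^esub> = (\<lambda>n f. 0)"
  "c \<oplus>\<^bsub>cocycle_algebra X\<^esub> d = (\<lambda>n f. c n f + d n f)"
  "a \<odot>\<^bsub>cocycle_algebra X\<^esub> c = (\<lambda>n f. a * c n f)"
  by (simp_all add: cocycle_algebra_def)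

lemma cocycles_eq: "carrier (cocycle_algebra X) = {c \<in> cochains X. coboundary X c = (\<lambda>n f. 0)}"
  by (simp add: cocycle_algebra_def)

lemma kmodule_cocycles: "kmodule (cocycle_algebra X :: ('k::comm_ring_1, ('a, 'k) cochain) module)"
  by (rule kmoduleI)
    (auto simp: cocycles_eq cochains_zero cochains_add cochains_smult coboundary_add coboundary_smult coboundary_zero
      algebra_simps)

lemma coboundaries_submodule:
  "submodule (coboundaries X) scalars (cocycle_algebra X :: ('k::comm_ring_1, ('a, 'k) cochain) module)"
proof -
  interpret kmodule "cocycle_algebra X :: ('k, ('a, 'k) cochain) module" by (rule kmodule_cocycles)
  show ?thesis unfolding submodule_iff
  proof (intro conjI ballI allI)
    show "coboundaries X \<subseteq> carrier (cocycle_algebra X)"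
      by (auto simp: cocycles_eq coboundaries_def cochains_coboundary coboundary_coboundary)
    have "(\<lambda>n f. 0) = coboundary X (\<lambda>n f. 0)" by (simp add: coboundary_zero)
    then show "\<zero>\<^bsub>cocycle_algebra X\<^esub> \<in> coboundaries X"
      unfolding coboundaries_def cocycle_algebra_simps using cochains_zero by (rule image_eqI)
  next
    fix x y :: "('a, 'k) cochain" assume "x \<in> coboundaries X" "y \<in> coboundaries X"
    then obtain c d where "c \<in> cochains X" "d \<in> cochains X" "x = coboundary X c" "y = coboundary X d"
      by (auto simp: coboundaries_def)
    then show "x \<oplus>\<^bsub>cocycle_algebra X\<^esub> y \<in> coboundaries X"
      using cochains_add[of c X d] by (auto simp: coboundaries_def coboundary_add intro!: image_eqI[of _ _ "\<lambda>n f. c n f + d n f"])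
  next
    fix a :: 'k and x :: "('a, 'k) cochain" assume "x \<in> coboundaries X"
    then obtain c where "c \<in> cochains X" "x = coboundary X c" by (auto simp: coboundaries_def)
    then show "a \<odot>\<^bsub>cocycle_algebra X\<^esub> x \<in> coboundaries X"
      using cochains_smult[of c X a] by (auto simp: coboundaries_def coboundary_smult intro!: image_eqI[of _ _ "\<lambda>n f. a * c n f"])
  qed
qed

lemma coboundaries_cocycle: "c \<in> coboundaries X \<Longrightarrow> c \<in> carrier (cocycle_algebra X)"
  by (auto simp: cocycles_eq coboundaries_def cochains_coboundary coboundary_coboundary)

abbreviation cocycles :: "'a topology \<Rightarrow> ('a, 'k::comm_ring_1) cochain set" where
  "cocycles X \<equiv> carrier (cocycle_algebra X)"

definition cohomology_class :: "'a topology \<Rightarrow> ('a, 'k::comm_ring_1) cochain \<Rightarrow> ('a, 'k) cochain set" where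
  "cohomology_class X c = coboundaries X +>\<^bsub>cocycle_algebra X\<^esub> c"

lemma kmodule_cohomology: "kmodule (cohomology X :: ('k::comm_ring_1, ('a, 'k) cochain set) module)"
  unfolding cohomology_def by (rule kmodule.kmodule_quotient[OF kmodule_cocycles coboundaries_submodule])

lemma linear_cohomology_class:
  "linear_map (cocycle_algebra X) (cohomology X :: ('k::comm_ring_1, ('a, 'k) cochain set) module) (cohomology_class X)"
  using kmodule.linear_coset[OF kmodule_cocycles coboundaries_submodule]
  by (simp add: cohomology_def cohomology_class_def[abs_def])

lemma cohomology_carrier: "carrier (cohomology X) = cohomology_class X ` cocycles X"
  using kmodule.quot_carrier[OF kmodule_cocycles coboundaries_submodule]
  by (simp add: cohomology_def cohomology_class_def[abs_def])

lemma cohomology_class_eq_zero_iff: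
  "c \<in> cocycles X \<Longrightarrow> cohomology_class X c = \<zero>\<^bsub>cohomology X\<^esub> \<longleftrightarrow> c \<in> coboundaries X"
  using kmodule.coset_eq_zero_iff[OF kmodule_cocycles coboundaries_submodule]
  by (simp add: cohomology_def cohomology_class_def)

lemma cocycles_minus:
  assumes "x \<in> cocycles X" "y \<in> cocycles X"
  shows "x \<ominus>\<^bsub>cocycle_algebra X\<^esub> y = (\<lambda>n f. x n f - y n f :: 'k::comm_ring_1)"
proof -
  interpret kmodule "cocycle_algebra X :: ('k, ('a, 'k) cochain) module" by (rule kmodule_cocycles)
  show ?thesis using smult_minus_one[OF assms(2)] by (simp add: a_minus_def flip: smult_minus_one[OF assms(2)])
qed

lemma cohomology_class_eq_iff:
  assumes "c \<in> cocycles X" "d \<in> cocycles X"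
  shows "cohomology_class X c = cohomology_class X d \<longleftrightarrow> (\<lambda>n f. c n f - d n f :: 'k::comm_ring_1) \<in> coboundaries X"
  using kmodule.coset_eq_iff[OF kmodule_cocycles coboundaries_submodule assms] cocycles_minus[OF assms]
  by (simp add: cohomology_class_def)

lemma cohomology_class_self: "c \<in> cocycles X \<Longrightarrow> c \<in> cohomology_class X c"
  unfolding cohomology_class_def
  using abelian_subgroup.a_rcos_self[OF kmodule.N_abelian_subgroup[OF kmodule_cocycles coboundaries_submodule]] .

lemma in_cohomology_classD:
  assumes "c \<in> cocycles X" "a \<in> cohomology_class X c"
  shows "a \<in> cocycles X \<and> cohomology_class X a = cohomology_class X (c :: ('a, 'k::comm_ring_1) cochain)"
proof -
  interpret abelian_subgroup "coboundaries X" "cocycle_algebra X :: ('k, ('a, 'k) cochain) module"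
    by (rule kmodule.N_abelian_subgroup[OF kmodule_cocycles coboundaries_submodule])
  show ?thesis
    using assms a_repr_independence'[of a c] a_elemrcos_carrier[of c a] by (auto simp: cohomology_class_def)
qed

lemma cup_add_left: "cup X (\<lambda>n f. c n f + c' n f) d = (\<lambda>n f. cup X c d n f + cup X c' d n f)"
  by (auto simp: cup_def fun_eq_iff algebra_simps sum.distrib)

lemma cup_add_right: "cup X c (\<lambda>n f. d n f + d' n f) = (\<lambda>n f. cup X c d n f + cup X c d' n f)"
  by (auto simp: cup_def fun_eq_iff algebra_simps sum.distrib)

lemma cup_smult_left: "cup X (\<lambda>n f. a * c n f) d = (\<lambda>n f. a * cup X c d n f)"
  by (auto simp: cup_def fun_eq_iff algebra_simps sum_distrib_left)

lemma cup_smult_right: "cup X c (\<lambda>n f. a * d n f) = (\<lambda>n f. a * cup X c d n f)"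
  by (auto simp: cup_def fun_eq_iff algebra_simps sum_distrib_left)

lemma cup_zero: "cup X (\<lambda>n f. 0) d = (\<lambda>n f. 0)" "cup X c (\<lambda>n f. 0) = (\<lambda>n f. 0)"
  by (auto simp: cup_def fun_eq_iff)

lemma cochains_cup:
  assumes "c \<in> cochains X" "d \<in> cochains X" shows "cup X c d \<in> cochains X"
proof (rule cochainsI)
  let ?C = "{n. c n \<noteq> (\<lambda>_. 0)}" and ?D = "{n. d n \<noteq> (\<lambda>_. 0)}"
  have "n \<in> (\<lambda>(p, q). p + q) ` (?C \<times> ?D)" if "cup X c d n \<noteq> (\<lambda>_. 0)" for n
  proof -
    from that obtain f where "cup X c d n f \<noteq> 0" by auto
    then obtain p where p: "p \<le> n" "c p (front_face p f) * d (n - p) (back_face p (n - p) f) \<noteq> 0"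
      by (auto simp: cup_def split: if_splits elim!: sum.not_neutral_contains_not_neutral)
    then have "p \<in> ?C" "n - p \<in> ?D" by force+
    then show ?thesis using p(1) by (intro image_eqI[of _ _ "(p, n - p)"]) auto
  qed
  then show "finite {n. cup X c d n \<noteq> (\<lambda>_. 0)}"
    by (rule finite_subset[OF subsetI finite_imageI[OF finite_cartesian_product[OF cochains_finite[OF assms(1)] cochains_finite[OF assms(2)]]]]) simp
qed (simp add: cup_def)

lemma cochains_sign: "c \<in> cochains X \<Longrightarrow> sign_cochain c \<in> cochains X"
  by (rule cochains_degreewise[of c X]) (auto simp: cochains_outside sign_cochain_def)

lemma sign_sign_cochain [simp]: "sign_cochain (sign_cochain c) = c"
  by (simp add: sign_cochain_def)

lemma coboundary_sign: "coboundary X (sign_cochain c) = (\<lambda>n f. - sign_cochain (coboundary X c) n f)"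
proof (intro ext)
  fix n f show "coboundary X (sign_cochain c) n f = - sign_cochain (coboundary X c) n f"
  proof (cases n)
    case (Suc m)
    have "(\<Sum>k\<in>A. (-1) ^ k * ((-1) ^ m * c m (g k))) = (-1) ^ m * (\<Sum>k\<in>A. (-1) ^ k * c m (g k))" for A g
      unfolding sum_distrib_left by (intro sum.cong refl) (rule mult.left_commute)
    then show ?thesis by (simp add: Suc coboundary_def sign_cochain_def del: sum.atMost_Suc)
  qed (simp add: coboundary_def sign_cochain_def)
qed

lemma cocycles_cup:
  assumes "c \<in> cocycles X" "d \<in> cocycles X" shows "cup X c d \<in> cocycles X"
  using assms by (simp add: cocycles_eq cochains_cup coboundary_cup cup_zero)

lemma cup_coboundary_left:
  assumes "c \<in> coboundaries X" "d \<in> cocycles X" shows "cup X c d \<in> coboundaries X"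
proof -
  obtain a where a: "a \<in> cochains X" "c = coboundary X a" using assms by (auto simp: coboundaries_def)
  have "cup X c d = coboundary X (cup X a d)" using assms(2) a by (simp add: cocycles_eq coboundary_cup cup_zero)
  then show ?thesis using a assms by (auto simp: cocycles_eq coboundaries_def cochains_cup)
qed

lemma cup_coboundary_right:
  assumes "c \<in> cocycles X" "d \<in> coboundaries X" shows "cup X c d \<in> coboundaries X"
proof -
  obtain b where b: "b \<in> cochains X" "d = coboundary X b" using assms by (auto simp: coboundaries_def)
  have "coboundary X (sign_cochain c) = (\<lambda>n f. 0)" using assms(1) unfolding coboundary_sign by (simp add: cocycles_eq sign_cochain_def)
  then have "cup X c d = coboundary X (cup X (sign_cochain c) b)" using b by (simp add: coboundary_cup cup_zero)
  then show ?thesis using b assms by (auto simp: cocycles_eq coboundaries_def cochains_cup cochains_sign)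
qed

text \<open>
  By the Leibniz rule the cup product of a cocycle and a coboundary is a coboundary, so the product of two cosets lies in
  a single coset.
\<close>

lemma cohomology_mult:
  assumes c: "c \<in> cocycles X" and d: "d \<in> cocycles X"
  shows "cohomology_class X c \<otimes>\<^bsub>cohomology X\<^esub> cohomology_class X d = cohomology_class X (cup X c d :: ('a, 'k::comm_ring_1) cochain)"
proof -
  interpret Z: kmodule "cocycle_algebra X :: ('k, ('a, 'k) cochain) module" by (rule kmodule_cocycles)
  have "cohomology_class X (cup X a b) = cohomology_class X (cup X c d)"
    if "a \<in> cohomology_class X c" "b \<in> cohomology_class X d" for a b
  proof -
    note a = in_cohomology_classD[OF c that(1)] and b = in_cohomology_classD[OF d that(2)]
    have ac: "(\<lambda>n f. a n f - c n f) \<in> coboundaries X" using a c cohomology_class_eq_iff by blast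
    have bd: "(\<lambda>n f. b n f - d n f) \<in> coboundaries X" using b d cohomology_class_eq_iff by blast
    have "(\<lambda>n f. cup X (\<lambda>n f. a n f - c n f) b n f + cup X c (\<lambda>n f. b n f - d n f) n f) \<in> coboundaries X"
    proof -
      have "cup X (\<lambda>n f. a n f - c n f) b \<in> coboundaries X" using cup_coboundary_left[OF ac] b by blast
      moreover have "cup X c (\<lambda>n f. b n f - d n f) \<in> coboundaries X" using cup_coboundary_right[OF c bd] .
      ultimately show ?thesis using coboundaries_submodule[of X, where 'k = 'k] unfolding Z.submodule_iff by simp
    qed
    moreover have "(\<lambda>n f. cup X (\<lambda>n f. a n f - c n f) b n f + cup X c (\<lambda>n f. b n f - d n f) n f) = (\<lambda>n f. cup X a b n f - cup X c d n f)"
      by (auto simp: cup_def fun_eq_iff algebra_simps simp flip: sum.distrib sum_subtractf)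
    ultimately show ?thesis using a b c d by (simp add: cohomology_class_eq_iff cocycles_cup)
  qed
  moreover have "c \<in> cohomology_class X c" "d \<in> cohomology_class X d" using cohomology_class_self c d by blast+
  ultimately have "(\<Union>a\<in>cohomology_class X c. \<Union>b\<in>cohomology_class X d. cohomology_class X (cup X a b)) = cohomology_class X (cup X c d)"
    by blast
  then show ?thesis
    by (simp add: cohomology_def quotient_module_def FactRing_def rcoset_mult_def cohomology_class_def cocycle_algebra_def)
qed

lemma cohomology_zero: "\<zero>\<^bsub>cohomology X\<^esub> = cohomology_class X (\<lambda>n f. 0)"
  using linear_map_zero[OF kmodule_cocycles kmodule_cohomology linear_cohomology_class, of X, symmetric] by simp

lemma cohomology_add:
  "c \<in> cocycles X \<Longrightarrow> d \<in> cocycles X \<Longrightarrow>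
    cohomology_class X c \<oplus>\<^bsub>cohomology X\<^esub> cohomology_class X d = cohomology_class X (\<lambda>n f. c n f + d n f)"
  using linear_map_add[OF linear_cohomology_class, of c X d] by simp

lemma cohomology_smult:
  "c \<in> cocycles X \<Longrightarrow> a \<odot>\<^bsub>cohomology X\<^esub> cohomology_class X c = cohomology_class X (\<lambda>n f. a * c n f)"
  using linear_map_smult[OF linear_cohomology_class, of c X a] by simp

lemma cohomology_class_cases:
  assumes "x \<in> carrier (cohomology X)"
  obtains c where "c \<in> cocycles X" "x = cohomology_class X c"
  using assms by (auto simp: cohomology_carrier)

lemma cocycles_add: "c \<in> cocycles X \<Longrightarrow> d \<in> cocycles X \<Longrightarrow> (\<lambda>n f. c n f + d n f) \<in> cocycles X"
  by (simp add: cocycles_eq cochains_add coboundary_add)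

lemma cocycles_smult: "c \<in> cocycles X \<Longrightarrow> (\<lambda>n f. a * c n f) \<in> cocycles X"
  by (simp add: cocycles_eq cochains_smult coboundary_smult)

lemma linear_cohomology_mult_left:
  assumes "y \<in> carrier (cohomology X)"
  shows "linear_map (cohomology X) (cohomology X) (\<lambda>x. x \<otimes>\<^bsub>cohomology X\<^esub> y :: ('a, 'k::comm_ring_1) cochain set)"
proof -
  obtain d where d: "d \<in> cocycles X" "y = cohomology_class X d" using assms by (rule cohomology_class_cases)
  show ?thesis unfolding linear_map_def
    by (auto elim!: cohomology_class_cases simp: d cohomology_mult cohomology_add cohomology_smult cocycles_cup cocycles_add cocycles_smult cup_add_left cup_smult_left cohomology_carrier)
qed

lemma linear_cohomology_mult_right:
  assumes "x \<in> carrier (cohomology X)"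
  shows "linear_map (cohomology X) (cohomology X) (\<lambda>y. x \<otimes>\<^bsub>cohomology X\<^esub> y :: ('a, 'k::comm_ring_1) cochain set)"
proof -
  obtain d where d: "d \<in> cocycles X" "x = cohomology_class X d" using assms by (rule cohomology_class_cases)
  show ?thesis unfolding linear_map_def
    by (auto elim!: cohomology_class_cases simp: d cohomology_mult cohomology_add cohomology_smult cocycles_cup cocycles_add cocycles_smult cup_add_right cup_smult_right cohomology_carrier)
qed

section \<open>Even and odd parts\<close>

text \<open>
  The coboundary exchanges even and odd cochains, so the projections to the two parts descend to linear maps on
  cohomology.  They turn a sign that depends on the parity of a degree into a linear operation.
\<close>

definition parity_cochain :: "bool \<Rightarrow> ('a, 'k::comm_ring_1) cochain \<Rightarrow> ('a, 'k) cochain" where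
  "parity_cochain b c = (\<lambda>n f. if odd n = b then c n f else 0)"

lemma coboundary_parity: "coboundary X (parity_cochain b c) = parity_cochain (\<not> b) (coboundary X c)"
proof (intro ext)
  fix n f show "coboundary X (parity_cochain b c) n f = parity_cochain (\<not> b) (coboundary X c) n f"
    by (cases n) (auto simp: coboundary_def parity_cochain_def simp del: sum.atMost_Suc)
qed

lemma cochains_parity: "c \<in> cochains X \<Longrightarrow> parity_cochain b c \<in> cochains X"
  by (rule cochains_degreewise[of c X]) (auto simp: cochains_outside parity_cochain_def)

lemma parity_zero: "parity_cochain b (\<lambda>n f. 0) = (\<lambda>n f. 0)"
  by (simp add: parity_cochain_def fun_eq_iff)

lemma cocycles_parity: "c \<in> cocycles X \<Longrightarrow> parity_cochain b c \<in> cocycles X"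
  by (simp add: cocycles_eq cochains_parity coboundary_parity parity_zero)

lemma coboundaries_parity: "c \<in> coboundaries X \<Longrightarrow> parity_cochain b c \<in> coboundaries X"
proof -
  assume "c \<in> coboundaries X"
  then obtain a where a: "a \<in> cochains X" "c = coboundary X a" by (auto simp: coboundaries_def)
  have "parity_cochain b c = coboundary X (parity_cochain (\<not> b) a)" by (simp add: a coboundary_parity)
  then show ?thesis using a cochains_parity by (auto simp: coboundaries_def)
qed

lemma parity_part_exists:
  "\<exists>P. linear_map (cohomology X) (cohomology X) P \<and>
    (\<forall>c\<in>cocycles X. P (cohomology_class X c) = cohomology_class X (parity_cochain b c :: ('a, 'k::comm_ring_1) cochain))"
proof -
  have l: "linear_map (cocycle_algebra X) (cocycle_algebra X) (parity_cochain b :: ('a, 'k) cochain \<Rightarrow> _)"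
    unfolding linear_map_def using cocycles_parity[of _ X] by (auto simp: parity_cochain_def fun_eq_iff)
  have "\<exists>P. linear_map (quotient_module (cocycle_algebra X) (coboundaries X)) (cohomology X) P \<and>
    (\<forall>c\<in>cocycles X. P (coboundaries X +>\<^bsub>cocycle_algebra X\<^esub> c) = cohomology_class X (parity_cochain b c :: ('a, 'k) cochain))"
  proof (rule kmodule.quot_lift[OF kmodule_cocycles coboundaries_submodule kmodule_cohomology linear_map_compose[OF l linear_cohomology_class]])
    fix c :: "('a, 'k) cochain" assume "c \<in> coboundaries X"
    then have p: "parity_cochain b c \<in> coboundaries X" by (rule coboundaries_parity)
    then have "parity_cochain b c \<in> cocycles X"
      by (rule coboundaries_cocycle)
    then show "cohomology_class X (parity_cochain b c) = \<zero>\<^bsub>cohomology X\<^esub>"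
      using p by (simp add: cohomology_class_eq_zero_iff)
  qed
  then show ?thesis by (simp add: cohomology_def cohomology_class_def)
qed

definition parity_part ::
  "'a topology \<Rightarrow> bool \<Rightarrow> ('a, 'k::comm_ring_1) cochain set \<Rightarrow> ('a, 'k) cochain set" where
  "parity_part X b = (SOME P. linear_map (cohomology X) (cohomology X) P \<and>
    (\<forall>c\<in>cocycles X. P (cohomology_class X c) = cohomology_class X (parity_cochain b c)))"

lemma linear_parity_part: "linear_map (cohomology X) (cohomology X) (parity_part X b)"
  and parity_part_class: "c \<in> cocycles X \<Longrightarrow> parity_part X b (cohomology_class X c) = cohomology_class X (parity_cochain b c)"
  unfolding parity_part_def using someI_ex[OF parity_part_exists[of X b]] by blast+

lemma parity_part_homogeneous:
  assumes "\<eta> \<in> cohomology_degree X d"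
  shows "parity_part X b \<eta> = (if odd d = b then \<eta> else \<zero>\<^bsub>cohomology X\<^esub>)"
proof -
  obtain c where c: "c \<in> cocycles X" "\<And>n. n \<noteq> d \<Longrightarrow> c n = (\<lambda>_. 0)" "\<eta> = cohomology_class X c"
    using assms by (auto simp: cohomology_degree_def cohomology_class_def)
  have "parity_cochain b c = (if odd d = b then c else (\<lambda>n f. 0))"
  proof (intro ext)
    fix n f show "parity_cochain b c n f = (if odd d = b then c else (\<lambda>n f. 0)) n f"
      using c(2)[of n] by (cases "n = d") (auto simp: parity_cochain_def)
  qed
  then show ?thesis using c(1,3) by (cases "odd d = b") (simp_all add: parity_part_class cohomology_zero)
qed

section \<open>Reduced cohomology and the unit part\<close>

lemma singular_simplex_into_space: "singular_simplex n (subtopology X A) f \<Longrightarrow> singular_simplex n X f"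
  by (simp add: singular_simplex_subtopology)

lemma coboundary_restrict:
  "coboundary (subtopology X A) (restrict_cochain (subtopology X A) c) = restrict_cochain (subtopology X A) (coboundary X c)"
proof (intro ext)
  fix n f
  show "coboundary (subtopology X A) (restrict_cochain (subtopology X A) c) n f = restrict_cochain (subtopology X A) (coboundary X c) n f"
    using singular_simplex_singular_face[of n "subtopology X A" f]
    by (auto simp: coboundary_def restrict_cochain_def singular_simplex_into_space)
qed

text \<open>
  Front and back faces of a simplex in \<open>A\<close> lie in \<open>A\<close>; hence the classes that restrict to zero form an ideal.
\<close>

lemma cup_restrict:
  "cup (subtopology X A) (restrict_cochain (subtopology X A) c) (restrict_cochain (subtopology X A) d) =
    restrict_cochain (subtopology X A) (cup X c d)"
proof (intro ext)
  fix n f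
  show "cup (subtopology X A) (restrict_cochain (subtopology X A) c) (restrict_cochain (subtopology X A) d) n f =
    restrict_cochain (subtopology X A) (cup X c d) n f"
    using singular_simplex_front_face[of n "subtopology X A" f] singular_simplex_back_face[of _ "n - _" "subtopology X A" f]
    by (auto simp: cup_def restrict_cochain_def singular_simplex_into_space intro!: sum.cong)
qed

lemma cochains_restrict: "c \<in> cochains X \<Longrightarrow> restrict_cochain Y c \<in> cochains Y"
  by (rule cochains_degreewise[of c X]) (auto simp: restrict_cochain_def)

lemma restrict_zero: "restrict_cochain Y (\<lambda>n f. 0) = (\<lambda>n f. 0)"
  by (simp add: restrict_cochain_def fun_eq_iff)

lemma cocycles_restrict: "c \<in> cocycles X \<Longrightarrow> restrict_cochain (subtopology X A) c \<in> cocycles (subtopology X A)"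
  by (simp add: cocycles_eq cochains_restrict[of c X] coboundary_restrict restrict_zero)

lemma restrict_add: "restrict_cochain Y (\<lambda>n f. c n f + d n f) = (\<lambda>n f. restrict_cochain Y c n f + restrict_cochain Y d n f)"
  by (simp add: restrict_cochain_def fun_eq_iff)

lemma restrict_smult: "restrict_cochain Y (\<lambda>n f. a * c n f) = (\<lambda>n f. a * restrict_cochain Y c n f)"
  by (simp add: restrict_cochain_def fun_eq_iff)

lemma restrict_parity: "restrict_cochain Y (parity_cochain b c) = parity_cochain b (restrict_cochain Y c)"
  by (simp add: restrict_cochain_def parity_cochain_def fun_eq_iff)

definition reduced_cocycles :: "'a topology \<Rightarrow> 'a \<Rightarrow> ('a, 'k::comm_ring_1) cochain set" where
  "reduced_cocycles X x0 = {c \<in> cocycles X. restrict_cochain (subtopology X {x0}) c \<in> coboundaries (subtopology X {x0})}"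

lemma reduced_carrier: "carrier (reduced_cohomology X x0) = cohomology_class X ` reduced_cocycles X x0"
  by (auto simp: reduced_cohomology_def reduced_cocycles_def cohomology_class_def)

lemma coboundaries_closed:
  fixes c d :: "('a, 'k::comm_ring_1) cochain"
  shows "(\<lambda>n f. 0 :: 'k) \<in> coboundaries X"
    and "c \<in> coboundaries X \<Longrightarrow> d \<in> coboundaries X \<Longrightarrow> (\<lambda>n f. c n f + d n f) \<in> coboundaries X"
    and "c \<in> coboundaries X \<Longrightarrow> (\<lambda>n f. a * c n f) \<in> coboundaries X"
  using coboundaries_submodule[of X, where 'k = 'k] unfolding kmodule.submodule_iff[OF kmodule_cocycles] by simp_all

lemma reduced_submodule:
  "submodule (carrier (reduced_cohomology X x0)) scalars (cohomology X :: ('k::comm_ring_1, ('a, 'k) cochain set) module)"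
proof -
  interpret kmodule "cohomology X :: ('k, ('a, 'k) cochain set) module" by (rule kmodule_cohomology)
  have "(\<lambda>n f. 0) \<in> reduced_cocycles X x0"
    by (simp add: reduced_cocycles_def cocycles_eq cochains_zero coboundary_zero restrict_zero coboundaries_closed)
  moreover have "(\<lambda>n f. c n f + d n f) \<in> reduced_cocycles X x0" if "c \<in> reduced_cocycles X x0" "d \<in> reduced_cocycles X x0" for c d :: "('a, 'k) cochain"
    using that cocycles_add[of c X d] by (simp add: reduced_cocycles_def restrict_add coboundaries_closed)
  moreover have "(\<lambda>n f. a * c n f) \<in> reduced_cocycles X x0" if "c \<in> reduced_cocycles X x0" for c :: "('a, 'k) cochain" and a
    using that cocycles_smult[of c X a] by (simp add: reduced_cocycles_def restrict_smult coboundaries_closed)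
  moreover have "c \<in> cocycles X" if "c \<in> reduced_cocycles X x0" for c :: "('a, 'k) cochain"
    using that by (simp add: reduced_cocycles_def)
  ultimately show ?thesis unfolding submodule_iff reduced_carrier
    by (auto simp: cohomology_zero cohomology_add cohomology_smult cohomology_carrier)
qed

lemma one_cocycle:
  "(\<lambda>n f. if n = 0 \<and> singular_simplex n X f then 1 else 0 :: 'k::comm_ring_1) \<in> cocycles X" (is "?o \<in> _")
proof -
  have "?o \<in> cochains X"
    by (rule cochainsI) (auto intro!: finite_subset[of _ "{0}"] simp: fun_eq_iff split: if_splits)
  moreover have "coboundary X ?o n f = 0" for n f
  proof (cases "n = 1 \<and> singular_simplex n X f")
    case True
    then show ?thesis using singular_simplex_singular_face[of 1 X f 0] singular_simplex_singular_face[of 1 X f 1]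
      by (simp add: coboundary_def)
  next
    case False
    then show ?thesis by (cases "n = 1") (auto simp: coboundary_def intro!: sum.neutral)
  qed
  ultimately show ?thesis by (auto simp: cocycles_eq fun_eq_iff)
qed

lemma cohomology_one: "\<one>\<^bsub>cohomology X\<^esub> = cohomology_class X (\<lambda>n f. if n = 0 \<and> singular_simplex n X f then 1 else 0)"
  by (simp add: cohomology_def quotient_module_def FactRing_def cohomology_class_def cocycle_algebra_def)

lemma one_cup_one:
  "cup X (\<lambda>n f. if n = 0 \<and> singular_simplex n X f then 1 else 0) (\<lambda>n f. if n = 0 \<and> singular_simplex n X f then 1 else 0)
    = (\<lambda>n f. if n = 0 \<and> singular_simplex n X f then 1 else 0 :: 'k::comm_ring_1)"
proof (intro ext, goal_cases)
  case (1 n f)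
  show ?case
  proof (cases "singular_simplex n X f")
    case True
    show ?thesis
    proof (cases "n = 0")
      case True
      then show ?thesis using \<open>singular_simplex n X f\<close> singular_simplex_front_face[of 0 X f 0] singular_simplex_back_face[of 0 0 X f]
        by (simp add: cup_def)
    next
      case False
      then show ?thesis using \<open>singular_simplex n X f\<close> by (auto simp: cup_def intro!: sum.neutral)
    qed
  qed (simp add: cup_def)
qed

lemma cohomology_one_closed: "\<one>\<^bsub>cohomology X\<^esub> \<in> carrier (cohomology X)"
  using one_cocycle[of X] unfolding cohomology_one cohomology_carrier by (rule imageI)

lemma cohomology_one_one: "\<one>\<^bsub>cohomology X\<^esub> \<otimes>\<^bsub>cohomology X\<^esub> \<one>\<^bsub>cohomology X\<^esub> = \<one>\<^bsub>cohomology X\<^esub>"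
  unfolding cohomology_one cohomology_mult[OF one_cocycle one_cocycle] one_cup_one ..

lemma unit_submodule:
  "submodule (carrier (unit_cohomology X)) scalars (cohomology X :: ('k::comm_ring_1, ('a, 'k) cochain set) module)"
proof -
  interpret kmodule "cohomology X :: ('k, ('a, 'k) cochain set) module" by (rule kmodule_cohomology)
  have o: "\<one>\<^bsub>cohomology X\<^esub> \<in> carrier (cohomology X :: ('k, ('a, 'k) cochain set) module)" by (rule cohomology_one_closed)
  have "\<zero>\<^bsub>cohomology X\<^esub> = (0 :: 'k) \<odot>\<^bsub>cohomology X\<^esub> \<one>\<^bsub>cohomology X\<^esub>" using smult_zero_left[OF o] by simp
  moreover have "a \<odot>\<^bsub>cohomology X\<^esub> \<one>\<^bsub>cohomology X\<^esub> \<oplus>\<^bsub>cohomology X\<^esub> b \<odot>\<^bsub>cohomology X\<^esub> \<one>\<^bsub>cohomology X\<^esub> = (a + b) \<odot>\<^bsub>cohomology X\<^esub> \<one>\<^bsub>cohomology X\<^esub>" for a b :: 'k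
    by (simp add: smult_l_distr[OF o])
  moreover have "a \<odot>\<^bsub>cohomology X\<^esub> (b \<odot>\<^bsub>cohomology X\<^esub> \<one>\<^bsub>cohomology X\<^esub>) = (a * b) \<odot>\<^bsub>cohomology X\<^esub> \<one>\<^bsub>cohomology X\<^esub>" for a b :: 'k
    by (simp add: smult_assoc[OF o])
  ultimately show ?thesis unfolding submodule_iff unit_cohomology_def
    using o by (auto simp del: smult_zero_left)
qed

lemma H_factor_submodule: "submodule (carrier (H_factor X x0 J i)) scalars (cohomology (X i))"
  by (simp add: H_factor_def reduced_submodule unit_submodule)

lemma H_factor_eq: "H_factor X x0 J i = (cohomology (X i))\<lparr>carrier := carrier (H_factor X x0 J i)\<rparr>"
  by (simp add: H_factor_def reduced_cohomology_def unit_cohomology_def)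

lemma H_factor_ops [simp]:
  "ring.add (H_factor X x0 J i) = ring.add (cohomology (X i))" "smult (H_factor X x0 J i) = smult (cohomology (X i))"
  "ring.zero (H_factor X x0 J i) = ring.zero (cohomology (X i))"
  by (simp_all add: H_factor_def reduced_cohomology_def unit_cohomology_def)

lemma kmodule_H_factor: "kmodule (H_factor X x0 J i)"
  by (subst H_factor_eq) (rule kmodule.kmodule_restrict[OF kmodule_cohomology H_factor_submodule])

lemma H_factor_subset: "x \<in> carrier (H_factor X x0 J i) \<Longrightarrow> x \<in> carrier (cohomology (X i))"
  by (rule kmodule.submodule_iff[OF kmodule_cohomology, THEN iffD1, OF H_factor_submodule, THEN conjunct1, THEN subsetD])

lemma reduced_mult:
  assumes "x \<in> carrier (reduced_cohomology X x0)" "y \<in> carrier (cohomology X)"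
  shows "x \<otimes>\<^bsub>cohomology X\<^esub> y \<in> carrier (reduced_cohomology X x0)" "y \<otimes>\<^bsub>cohomology X\<^esub> x \<in> carrier (reduced_cohomology X x0)"
proof -
  obtain c d where c: "c \<in> reduced_cocycles X x0" "x = cohomology_class X c" and d: "d \<in> cocycles X" "y = cohomology_class X d"
    using assms by (auto simp: reduced_carrier cohomology_carrier)
  have cz: "c \<in> cocycles X" using c by (simp add: reduced_cocycles_def)
  have "cup X c d \<in> reduced_cocycles X x0"
    using c(1) cocycles_cup[OF cz d(1)] cup_coboundary_left[OF _ cocycles_restrict[OF d(1)], of "restrict_cochain (subtopology X {x0}) c" "{x0}"]
    by (simp add: reduced_cocycles_def cup_restrict)
  then show "x \<otimes>\<^bsub>cohomology X\<^esub> y \<in> carrier (reduced_cohomology X x0)"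
    using cz c(2) d by (auto simp: reduced_carrier cohomology_mult)
  have "cup X d c \<in> reduced_cocycles X x0"
    using c(1) cocycles_cup[OF d(1) cz] cup_coboundary_right[OF cocycles_restrict[OF d(1)], of "restrict_cochain (subtopology X {x0}) c" "{x0}"]
    by (simp add: reduced_cocycles_def cup_restrict)
  then show "y \<otimes>\<^bsub>cohomology X\<^esub> x \<in> carrier (reduced_cohomology X x0)"
    using cz c(2) d by (auto simp: reduced_carrier cohomology_mult)
qed

lemma H_factor_mult:
  assumes "x \<in> carrier (H_factor X x0 J i)" "y \<in> carrier (H_factor X x0 J' i)"
  shows "x \<otimes>\<^bsub>cohomology (X i)\<^esub> y \<in> carrier (H_factor X x0 (J \<union> J') i)"
proof (cases "i \<in> J \<or> i \<in> J'")
  case True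
  then show ?thesis using assms reduced_mult H_factor_subset[OF assms(1)] H_factor_subset[OF assms(2)]
    by (auto simp: H_factor_def)
next
  case False
  then obtain a b where ab: "x = a \<odot>\<^bsub>cohomology (X i)\<^esub> \<one>\<^bsub>cohomology (X i)\<^esub>" "y = b \<odot>\<^bsub>cohomology (X i)\<^esub> \<one>\<^bsub>cohomology (X i)\<^esub>"
    using assms by (auto simp: H_factor_def unit_cohomology_def)
  note o = cohomology_one_closed[of "X i"]
  have "x \<otimes>\<^bsub>cohomology (X i)\<^esub> y = a \<odot>\<^bsub>cohomology (X i)\<^esub> (\<one>\<^bsub>cohomology (X i)\<^esub> \<otimes>\<^bsub>cohomology (X i)\<^esub> y)"
    unfolding ab(1) using H_factor_subset[OF assms(2)] o by (rule linear_map_smult[OF linear_cohomology_mult_left])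
  also have "\<one>\<^bsub>cohomology (X i)\<^esub> \<otimes>\<^bsub>cohomology (X i)\<^esub> y = b \<odot>\<^bsub>cohomology (X i)\<^esub> (\<one>\<^bsub>cohomology (X i)\<^esub> \<otimes>\<^bsub>cohomology (X i)\<^esub> \<one>\<^bsub>cohomology (X i)\<^esub>)"
    unfolding ab(2) using o o by (rule linear_map_smult[OF linear_cohomology_mult_right])
  finally have "x \<otimes>\<^bsub>cohomology (X i)\<^esub> y = (a * b) \<odot>\<^bsub>cohomology (X i)\<^esub> \<one>\<^bsub>cohomology (X i)\<^esub>"
    by (simp add: cohomology_one_one kmodule.smult_assoc[OF kmodule_cohomology cohomology_one_closed])
  then show ?thesis using False by (auto simp: H_factor_def unit_cohomology_def)
qed

lemma parity_one:
  "parity_cochain b (\<lambda>n f. if n = 0 \<and> singular_simplex n X f then 1 else 0 :: 'k::comm_ring_1) =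
    (\<lambda>n f. of_bool (\<not> b) * (if n = 0 \<and> singular_simplex n X f then 1 else 0))"
  by (auto simp: parity_cochain_def fun_eq_iff)

lemma H_factor_parity:
  assumes "x \<in> carrier (H_factor X x0 J i)" shows "parity_part (X i) b x \<in> carrier (H_factor X x0 J i)"
proof (cases "i \<in> J")
  case True
  then obtain c where c: "c \<in> reduced_cocycles (X i) (x0 i)" "x = cohomology_class (X i) c"
    using assms by (auto simp: H_factor_def reduced_carrier)
  have cz: "c \<in> cocycles (X i)" using c by (simp add: reduced_cocycles_def)
  have "parity_cochain b c \<in> reduced_cocycles (X i) (x0 i)"
    using c(1) cocycles_parity[OF cz] by (simp add: reduced_cocycles_def restrict_parity coboundaries_parity)
  then show ?thesis using True cz c(2) by (auto simp: H_factor_def reduced_carrier parity_part_class)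
next
  case False
  then obtain a where a: "x = a \<odot>\<^bsub>cohomology (X i)\<^esub> \<one>\<^bsub>cohomology (X i)\<^esub>"
    using assms by (auto simp: H_factor_def unit_cohomology_def)
  have "a \<odot>\<^bsub>cohomology (X i)\<^esub> parity_part (X i) b \<one>\<^bsub>cohomology (X i)\<^esub> =
      a \<odot>\<^bsub>cohomology (X i)\<^esub> (of_bool (\<not> b) \<odot>\<^bsub>cohomology (X i)\<^esub> \<one>\<^bsub>cohomology (X i)\<^esub>)"
    unfolding cohomology_one parity_part_class[OF one_cocycle] parity_one cohomology_smult[OF one_cocycle] ..
  then have "parity_part (X i) b x = (a * of_bool (\<not> b)) \<odot>\<^bsub>cohomology (X i)\<^esub> \<one>\<^bsub>cohomology (X i)\<^esub>"
    by (simp only: a linear_map_smult[OF linear_parity_part cohomology_one_closed]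
      kmodule.smult_assoc[OF kmodule_cohomology cohomology_one_closed])
  then show ?thesis using False by (auto simp: H_factor_def unit_cohomology_def)
qed

section \<open>Direct sums\<close>

lemma direct_sum_simps [simp]:
  "carrier (direct_sum S M) = (\<Pi>\<^sub>E j\<in>S. carrier (M j))"
  "\<zero>\<^bsub>direct_sum S M\<^esub> = (\<lambda>j\<in>S. \<zero>\<^bsub>M j\<^esub>)"
  "x \<oplus>\<^bsub>direct_sum S M\<^esub> y = (\<lambda>j\<in>S. x j \<oplus>\<^bsub>M j\<^esub> y j)"
  "c \<odot>\<^bsub>direct_sum S M\<^esub> x = (\<lambda>j\<in>S. c \<odot>\<^bsub>M j\<^esub> x j)"
  by (simp_all add: direct_sum_def)

context
  fixes S :: "'j set" and M :: "'j \<Rightarrow> ('k::comm_ring_1, 'b) module"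
  assumes M: "\<And>j. j \<in> S \<Longrightarrow> kmodule (M j)" and S: "finite S"
begin

lemma summand_abelian_monoid: "j \<in> S \<Longrightarrow> abelian_monoid (M j)"
  using M by (simp add: kmodule_def abelian_group_def)

lemmas summand_rules =
  abelian_monoid.a_closed[OF summand_abelian_monoid] abelian_monoid.zero_closed[OF summand_abelian_monoid]
  abelian_monoid.a_assoc[OF summand_abelian_monoid]
  abelian_monoid.l_zero[OF summand_abelian_monoid] abelian_monoid.r_zero[OF summand_abelian_monoid]
  kmodule.smult_closed[OF M] kmodule.smult_l_distr[OF M] kmodule.smult_r_distr[OF M] kmodule.smult_assoc[OF M]
  kmodule.smult_one[OF M] kmodule.smult_zero_left[OF M] kmodule.smult_zero_right[OF M]

lemma kmodule_direct_sum: "kmodule (direct_sum S M)"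
proof (rule kmoduleI)
  note summand_rules[simp]
  show "\<zero>\<^bsub>direct_sum S M\<^esub> \<in> carrier (direct_sum S M)" by auto
  fix x y z assume x: "x \<in> carrier (direct_sum S M)" and y: "y \<in> carrier (direct_sum S M)"
  {
    fix z assume z: "z \<in> carrier (direct_sum S M)"
    show "x \<oplus>\<^bsub>direct_sum S M\<^esub> y \<oplus>\<^bsub>direct_sum S M\<^esub> z = x \<oplus>\<^bsub>direct_sum S M\<^esub> (y \<oplus>\<^bsub>direct_sum S M\<^esub> z)"
      using x y z by (auto intro!: restrict_ext simp: PiE_iff)
  }
  show "x \<oplus>\<^bsub>direct_sum S M\<^esub> y \<in> carrier (direct_sum S M)" using x y by (auto simp: PiE_iff)
  show "x \<oplus>\<^bsub>direct_sum S M\<^esub> y = y \<oplus>\<^bsub>direct_sum S M\<^esub> x"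
    using x y abelian_monoid.a_comm[OF summand_abelian_monoid] by (auto intro!: restrict_ext simp: PiE_iff)
  fix c d :: 'k
  show "c \<odot>\<^bsub>direct_sum S M\<^esub> (x \<oplus>\<^bsub>direct_sum S M\<^esub> y) = c \<odot>\<^bsub>direct_sum S M\<^esub> x \<oplus>\<^bsub>direct_sum S M\<^esub> c \<odot>\<^bsub>direct_sum S M\<^esub> y"
    using x y by (auto intro!: restrict_ext simp: PiE_iff)
  show "c \<odot>\<^bsub>direct_sum S M\<^esub> x \<in> carrier (direct_sum S M)" using x by (auto simp: PiE_iff)
  show "(c + d) \<odot>\<^bsub>direct_sum S M\<^esub> x = c \<odot>\<^bsub>direct_sum S M\<^esub> x \<oplus>\<^bsub>direct_sum S M\<^esub> d \<odot>\<^bsub>direct_sum S M\<^esub> x"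
    using x by (auto intro!: restrict_ext simp: PiE_iff)
  show "c * d \<odot>\<^bsub>direct_sum S M\<^esub> x = c \<odot>\<^bsub>direct_sum S M\<^esub> (d \<odot>\<^bsub>direct_sum S M\<^esub> x)"
    using x by (auto intro!: restrict_ext simp: PiE_iff)
  show "0 \<odot>\<^bsub>direct_sum S M\<^esub> x = \<zero>\<^bsub>direct_sum S M\<^esub>" using x by (auto intro!: restrict_ext simp: PiE_iff)
  show "\<zero>\<^bsub>direct_sum S M\<^esub> \<oplus>\<^bsub>direct_sum S M\<^esub> x = x" "1 \<odot>\<^bsub>direct_sum S M\<^esub> x = x"
    using x by (auto simp: fun_eq_iff PiE_iff extensional_def)
qed

lemma linear_component: "j \<in> S \<Longrightarrow> linear_map (direct_sum S M) (M j) (\<lambda>x. x j)"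
  by (auto simp: linear_map_def)

lemma linear_summand_incl:
  assumes "j \<in> S" shows "linear_map (M j) (direct_sum S M) (summand_incl S M j)"
proof -
  note summand_rules[simp]
  show ?thesis using assms by (auto simp: linear_map_def summand_incl_def fun_eq_iff)
qed

lemma direct_sum_expand:
  assumes x: "x \<in> carrier (direct_sum S M)"
  shows "x = (\<Oplus>\<^bsub>direct_sum S M\<^esub>j\<in>S. summand_incl S M j (x j))"
proof -
  interpret D: kmodule "direct_sum S M" by (rule kmodule_direct_sum)
  have xj: "x j \<in> carrier (M j)" if "j \<in> S" for j using x that by auto
  have inc: "summand_incl S M j (x j) \<in> carrier (direct_sum S M)" if "j \<in> S" for j
    using linear_map_closed[OF linear_summand_incl[OF that] xj[OF that]] .
  let ?s = "\<Oplus>\<^bsub>direct_sum S M\<^esub>j\<in>S. summand_incl S M j (x j)"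
  have s: "?s \<in> carrier (direct_sum S M)" using inc by (intro D.finsum_closed) auto
  show ?thesis
  proof (rule PiE_ext[OF x[unfolded direct_sum_simps] s[unfolded direct_sum_simps]])
    fix k assume k: "k \<in> S"
    interpret J: kmodule "M k" using M[OF k] .
    have "?s k = (\<Oplus>\<^bsub>M k\<^esub>j\<in>S. summand_incl S M j (x j) k)"
      using inc by (intro linear_map_finsum[OF kmodule_direct_sum M[OF k] linear_component[OF k] S]) auto
    also have "\<dots> = (\<Oplus>\<^bsub>M k\<^esub>j\<in>S. if k = j then x j else \<zero>\<^bsub>M k\<^esub>)"
      using k xj by (intro J.finsum_cong') (auto simp: summand_incl_def)
    also have "\<dots> = x k"
    proof -
      have "(\<Oplus>\<^bsub>M k\<^esub>j\<in>S. if k = j then x j else \<zero>\<^bsub>M k\<^esub>) = (\<Oplus>\<^bsub>M k\<^esub>j\<in>S. if k = j then x k else \<zero>\<^bsub>M k\<^esub>)"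
        by (rule arg_cong[of _ _ "\<lambda>f. finsum (M k) f S"]) auto
      then show ?thesis using J.finsum_singleton[OF k S, of "\<lambda>_. x k"] xj[OF k] by simp
    qed
    finally show "x k = ?s k" by simp
  qed
qed

lemma direct_sum_eqI:
  assumes "kmodule Q" "linear_map (direct_sum S M) Q f" "linear_map (direct_sum S M) Q g"
    and eq: "\<And>j z. j \<in> S \<Longrightarrow> z \<in> carrier (M j) \<Longrightarrow> f (summand_incl S M j z) = g (summand_incl S M j z)"
    and x: "x \<in> carrier (direct_sum S M)"
  shows "f x = g x"
proof -
  interpret Q: kmodule Q by fact
  have xj: "x j \<in> carrier (M j)" if "j \<in> S" for j using x that by auto
  have inc: "(\<lambda>j. summand_incl S M j (x j)) \<in> S \<rightarrow> carrier (direct_sum S M)"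
    using linear_map_closed[OF linear_summand_incl xj] by blast
  have "f x = (\<Oplus>\<^bsub>Q\<^esub>j\<in>S. f (summand_incl S M j (x j)))"
    by (subst direct_sum_expand[OF x]) (rule linear_map_finsum[OF kmodule_direct_sum assms(1,2) S inc])
  also have "\<dots> = (\<Oplus>\<^bsub>Q\<^esub>j\<in>S. g (summand_incl S M j (x j)))"
    using inc linear_map_closed[OF assms(3)] eq xj by (intro Q.finsum_cong') (auto simp: Pi_iff)
  also have "\<dots> = g x"
    by (subst (2) direct_sum_expand[OF x]) (rule linear_map_finsum[OF kmodule_direct_sum assms(1,3) S inc, symmetric])
  finally show ?thesis .
qed

end

section \<open>The product on tensor products of cohomology modules\<close>

lemma minus_one_power_mult: "(- 1 :: 'k::comm_ring_1) ^ (a * b) = (if odd a \<and> odd b then - 1 else 1)"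
  by (simp add: minus_one_power_iff)

text \<open>
  The sign is a product of factors that depend only on parities.
\<close>

lemma koszul_sign:
  "(- 1 :: 'k::comm_ring_1) ^ koszul_exponent m d e d' =
    (\<Prod>i\<in>{1..m}. if odd (d i) \<and> odd e then - 1 else 1) *
    (\<Prod>i\<in>{1..m}. \<Prod>j\<in>{1..<i}. if odd (d i) \<and> odd (d' j) then - 1 else 1)"
  unfolding koszul_exponent_def power_add sum_distrib_right power_sum minus_one_power_mult ..

lemma koszul_sign_cong:
  assumes "\<And>i. i \<in> {1..m} \<Longrightarrow> odd (d i) = odd (c i)" "\<And>i. i \<in> {1..m} \<Longrightarrow> odd (d' i) = odd (c' i)"
  shows "(- 1 :: 'k::comm_ring_1) ^ koszul_exponent m d e d' = (- 1) ^ koszul_exponent m c e c'"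
  unfolding koszul_sign using assms by (intro arg_cong2[of _ _ _ _ "(*)"] prod.cong refl) auto

lemma kmodule_H_tensor: "kmodule (H_tensor m X x0 J)"
  unfolding H_tensor_def by (rule kmodule_big_tensor) (rule kmodule_H_factor)

lemma H_pure_closed:
  "\<eta> \<in> (\<Pi>\<^sub>E i\<in>{1..m}. carrier (H_factor X x0 J i)) \<Longrightarrow> H_pure m X x0 J \<eta> \<in> carrier (H_tensor m X x0 J)"
  unfolding H_tensor_def H_pure_def by (rule big_tensor_closed) (rule kmodule_H_factor)

lemma H_pure_zero:
  "\<eta> \<in> (\<Pi>\<^sub>E i\<in>{1..m}. carrier (H_factor X x0 J i)) \<Longrightarrow> i \<in> {1..m} \<Longrightarrow> \<eta> i = \<zero>\<^bsub>cohomology (X i)\<^esub> \<Longrightarrow>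
    H_pure m X x0 J \<eta> = \<zero>\<^bsub>H_tensor m X x0 J\<^esub>"
  unfolding H_tensor_def H_pure_def by (rule big_tensor_zero_slot) (auto intro: kmodule_H_factor)

lemma linear_H_factorI:
  assumes "linear_map (cohomology (X i)) (cohomology (X i)) f"
    and "\<And>x. x \<in> carrier (H_factor X x0 J i) \<Longrightarrow> f x \<in> carrier (H_factor X x0 J' i)"
  shows "linear_map (H_factor X x0 J i) (H_factor X x0 J' i) f"
  unfolding linear_map_def using assms
  by (auto simp: linear_map_add[OF assms(1)] linear_map_smult[OF assms(1)] H_factor_subset)

text \<open>
  The pure tensor of the products of the components of \<open>\<eta>\<close> that are odd exactly at the indices in \<open>E\<close>, and of \<open>\<eta>'\<close> that are
  odd exactly at the indices in \<open>E'\<close>.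
\<close>

definition parity_pure ::
  "nat \<Rightarrow> (nat \<Rightarrow> 'a topology) \<Rightarrow> (nat \<Rightarrow> 'a) \<Rightarrow> nat set \<Rightarrow> nat set \<Rightarrow> nat set \<Rightarrow>
     (nat \<Rightarrow> ('a, 'k::comm_ring_1) cochain set) \<Rightarrow> (nat \<Rightarrow> ('a, 'k) cochain set) \<Rightarrow> ((nat \<Rightarrow> ('a, 'k) cochain set) \<Rightarrow>\<^sub>0 'k) set" where
  "parity_pure m X x0 J E E' \<eta> \<eta>' = H_pure m X x0 J
     (\<lambda>i\<in>{1..m}. parity_part (X i) (i \<in> E) (\<eta> i) \<otimes>\<^bsub>cohomology (X i)\<^esub> parity_part (X i) (i \<in> E') (\<eta>' i))"

text \<open>
  Summing over all parity patterns, each with its sign, gives an expression that is linear in every entry.  On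
  homogeneous entries a single pattern contributes, namely the parities of the degrees.
\<close>

definition graded_product ::
  "nat \<Rightarrow> (nat \<Rightarrow> 'a topology) \<Rightarrow> (nat \<Rightarrow> 'a) \<Rightarrow> nat set \<Rightarrow> nat \<Rightarrow>
     (nat \<Rightarrow> ('a, 'k::comm_ring_1) cochain set) \<Rightarrow> (nat \<Rightarrow> ('a, 'k) cochain set) \<Rightarrow> ((nat \<Rightarrow> ('a, 'k) cochain set) \<Rightarrow>\<^sub>0 'k) set" where
  "graded_product m X x0 J e \<eta> \<eta>' =
     finsum (H_tensor m X x0 J) (\<lambda>(E, E').
        (- 1) ^ koszul_exponent m (\<lambda>i. of_bool (i \<in> E)) e (\<lambda>i. of_bool (i \<in> E')) \<odot>\<^bsub>H_tensor m X x0 J\<^esub>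
          parity_pure m X x0 J E E' \<eta> \<eta>') (Pow {1..m} \<times> Pow {1..m})"

context
  fixes m :: nat and X :: "nat \<Rightarrow> 'a topology" and x0 :: "nat \<Rightarrow> 'a" and J J' :: "nat set"
begin

abbreviation "FJ \<equiv> \<Pi>\<^sub>E i\<in>{1..m}. carrier (H_factor X x0 J i :: ('k::comm_ring_1, ('a, 'k) cochain set) module)"
abbreviation "FJ' \<equiv> \<Pi>\<^sub>E i\<in>{1..m}. carrier (H_factor X x0 J' i :: ('k::comm_ring_1, ('a, 'k) cochain set) module)"
abbreviation "HJJ \<equiv> H_tensor m X x0 (J \<union> J') :: ('k::comm_ring_1, ((nat \<Rightarrow> ('a, 'k) cochain set) \<Rightarrow>\<^sub>0 'k) set) module"

lemma parity_factors:
  fixes \<eta> \<eta>' :: "nat \<Rightarrow> ('a, 'k::comm_ring_1) cochain set"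
  assumes "\<eta> \<in> FJ" "\<eta>' \<in> FJ'"
  shows "(\<lambda>i\<in>{1..m}. parity_part (X i) (i \<in> E) (\<eta> i) \<otimes>\<^bsub>cohomology (X i)\<^esub> parity_part (X i) (i \<in> E') (\<eta>' i))
    \<in> (\<Pi>\<^sub>E i\<in>{1..m}. carrier (H_factor X x0 (J \<union> J') i))"
  using assms by (auto intro!: H_factor_mult H_factor_parity dest: PiE_mem)

lemma linear_parity_mult:
  assumes "y \<in> carrier (H_factor X x0 J' i)"
  shows "linear_map (H_factor X x0 J i) (H_factor X x0 (J \<union> J') i)
    (\<lambda>x. parity_part (X i) b x \<otimes>\<^bsub>cohomology (X i)\<^esub> y)"
  using assms by (intro linear_H_factorI linear_map_compose[OF linear_parity_part linear_cohomology_mult_left])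
    (auto intro!: H_factor_mult H_factor_parity H_factor_subset)

lemma linear_mult_parity:
  assumes "x \<in> carrier (H_factor X x0 J i)"
  shows "linear_map (H_factor X x0 J' i) (H_factor X x0 (J \<union> J') i)
    (\<lambda>y. x \<otimes>\<^bsub>cohomology (X i)\<^esub> parity_part (X i) b y)"
  using assms by (intro linear_H_factorI linear_map_compose[OF linear_parity_part linear_cohomology_mult_right])
    (auto intro!: H_factor_mult H_factor_parity H_factor_subset)

lemma linear_H_pure_slot:
  assumes "h \<in> (\<Pi>\<^sub>E i\<in>{1..m}. carrier (H_factor X x0 (J \<union> J') i))" "i \<in> {1..m}"
  shows "linear_map (H_factor X x0 (J \<union> J') i) HJJ (\<lambda>x. H_pure m X x0 (J \<union> J') (h(i := x)))"
  unfolding H_tensor_def H_pure_def by (rule linear_big_tensor_slot[OF kmodule_H_factor assms])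

lemma linear_parity_pure_left:
  fixes \<eta> \<eta>' :: "nat \<Rightarrow> ('a, 'k::comm_ring_1) cochain set"
  assumes h: "\<eta> \<in> FJ" "\<eta>' \<in> FJ'" and i: "i \<in> {1..m}"
  shows "linear_map (H_factor X x0 J i) HJJ (\<lambda>x. parity_pure m X x0 (J \<union> J') E E' (\<eta>(i := x)) \<eta>')"
proof -
  let ?w = "\<lambda>i\<in>{1..m}. parity_part (X i) (i \<in> E) (\<eta> i) \<otimes>\<^bsub>cohomology (X i)\<^esub> parity_part (X i) (i \<in> E') (\<eta>' i)"
  let ?y = "parity_part (X i) (i \<in> E') (\<eta>' i)"
  have y: "?y \<in> carrier (H_factor X x0 J' i)" using h i by (auto intro!: H_factor_parity)
  have "parity_pure m X x0 (J \<union> J') E E' (\<eta>(i := x)) \<eta>' =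
      H_pure m X x0 (J \<union> J') (?w(i := parity_part (X i) (i \<in> E) x \<otimes>\<^bsub>cohomology (X i)\<^esub> ?y))" for x
    unfolding parity_pure_def using i by (intro arg_cong[of _ _ "H_pure m X x0 (J \<union> J')"] ext) auto
  then show ?thesis
    using linear_map_compose[OF linear_parity_mult[OF y] linear_H_pure_slot[OF parity_factors[OF h] i]] by simp
qed

lemma linear_parity_pure_right:
  fixes \<eta> \<eta>' :: "nat \<Rightarrow> ('a, 'k::comm_ring_1) cochain set"
  assumes h: "\<eta> \<in> FJ" "\<eta>' \<in> FJ'" and i: "i \<in> {1..m}"
  shows "linear_map (H_factor X x0 J' i) HJJ (\<lambda>x. parity_pure m X x0 (J \<union> J') E E' \<eta> (\<eta>'(i := x)))"
proof -
  let ?w = "\<lambda>i\<in>{1..m}. parity_part (X i) (i \<in> E) (\<eta> i) \<otimes>\<^bsub>cohomology (X i)\<^esub> parity_part (X i) (i \<in> E') (\<eta>' i)"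
  let ?x = "parity_part (X i) (i \<in> E) (\<eta> i)"
  have x: "?x \<in> carrier (H_factor X x0 J i)" using h i by (auto intro!: H_factor_parity)
  have "parity_pure m X x0 (J \<union> J') E E' \<eta> (\<eta>'(i := y)) =
      H_pure m X x0 (J \<union> J') (?w(i := ?x \<otimes>\<^bsub>cohomology (X i)\<^esub> parity_part (X i) (i \<in> E') y))" for y
    unfolding parity_pure_def using i by (intro arg_cong[of _ _ "H_pure m X x0 (J \<union> J')"] ext) auto
  then show ?thesis
    using linear_map_compose[OF linear_mult_parity[OF x] linear_H_pure_slot[OF parity_factors[OF h] i]] by simp
qed

lemma parity_pure_closed:
  fixes \<eta> \<eta>' :: "nat \<Rightarrow> ('a, 'k::comm_ring_1) cochain set"
  assumes "\<eta> \<in> FJ" "\<eta>' \<in> FJ'" shows "parity_pure m X x0 (J \<union> J') E E' \<eta> \<eta>' \<in> carrier HJJ"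
  unfolding parity_pure_def by (rule H_pure_closed[OF parity_factors[OF assms]])

lemma graded_product_bilinear:
  "\<exists>b. (\<forall>y\<in>carrier (H_tensor m X x0 J'). linear_map (H_tensor m X x0 J) HJJ (\<lambda>x. b x y)) \<and>
    (\<forall>x\<in>carrier (H_tensor m X x0 J). linear_map (H_tensor m X x0 J') HJJ (\<lambda>y. b x y)) \<and>
    (\<forall>\<eta>\<in>FJ. \<forall>\<eta>'\<in>FJ'. b (H_pure m X x0 J \<eta>) (H_pure m X x0 J' \<eta>') = (graded_product m X x0 (J \<union> J') e \<eta> \<eta>'
      :: ((nat \<Rightarrow> ('a, 'k::comm_ring_1) cochain set) \<Rightarrow>\<^sub>0 'k) set))"
proof -
  interpret H: kmodule "HJJ :: ('k, ((nat \<Rightarrow> ('a, 'k) cochain set) \<Rightarrow>\<^sub>0 'k) set) module" by (rule kmodule_H_tensor)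
  show ?thesis
    unfolding H_tensor_def[of m X x0 J] H_tensor_def[of m X x0 J'] H_pure_def[of m X x0 J] H_pure_def[of m X x0 J']
  proof (rule big_tensor_bilinear_lift[OF kmodule_H_factor kmodule_H_factor kmodule_H_tensor])
    fix h h' :: "nat \<Rightarrow> ('a, 'k) cochain set" and i assume h: "h \<in> FJ" "h' \<in> FJ'"
    show "graded_product m X x0 (J \<union> J') e h h' \<in> carrier HJJ"
      unfolding graded_product_def using parity_pure_closed[OF h] by (intro H.finsum_closed) auto
    show "linear_map (H_factor X x0 J i) HJJ (\<lambda>x. graded_product m X x0 (J \<union> J') e (h(i := x)) h')" if "i \<in> {1..m}"
      unfolding graded_product_def
      by (intro linear_map_pointwise_finsum kmodule_H_factor kmodule_H_tensor)
        (use linear_parity_pure_left[OF h that] in \<open>auto intro!: linear_map_pointwise_smult[OF kmodule_H_tensor]\<close>)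
    show "linear_map (H_factor X x0 J' i) HJJ (\<lambda>x. graded_product m X x0 (J \<union> J') e h (h'(i := x)))" if "i \<in> {1..m}"
      unfolding graded_product_def
      by (intro linear_map_pointwise_finsum kmodule_H_factor kmodule_H_tensor)
        (use linear_parity_pure_right[OF h that] in \<open>auto intro!: linear_map_pointwise_smult[OF kmodule_H_tensor]\<close>)
  qed
qed

lemma graded_product_homogeneous:
  fixes \<eta> \<eta>' :: "nat \<Rightarrow> ('a, 'k::comm_ring_1) cochain set"
  assumes "H_homogeneous m X x0 J d \<eta>" "H_homogeneous m X x0 J' d' \<eta>'"
  shows "graded_product m X x0 (J \<union> J') e \<eta> \<eta>' =
    (- 1) ^ koszul_exponent m d e d' \<odot>\<^bsub>HJJ\<^esub> H_pure m X x0 (J \<union> J') (\<lambda>i\<in>{1..m}. \<eta> i \<otimes>\<^bsub>cohomology (X i)\<^esub> \<eta>' i)"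
proof -
  interpret H: kmodule "HJJ :: ('k, ((nat \<Rightarrow> ('a, 'k) cochain set) \<Rightarrow>\<^sub>0 'k) set) module" by (rule kmodule_H_tensor)
  have h: "\<eta> \<in> FJ" "\<eta>' \<in> FJ'" using assms by (auto simp: H_homogeneous_def)
  have hd: "\<eta> i \<in> cohomology_degree (X i) (d i)" "\<eta>' i \<in> cohomology_degree (X i) (d' i)"
    "\<eta> i \<in> carrier (cohomology (X i))" "\<eta>' i \<in> carrier (cohomology (X i))" if "i \<in> {1..m}" for i
    using assms that by (auto simp: H_homogeneous_def PiE_iff intro: H_factor_subset)
  define E0 where "E0 = {i \<in> {1..m}. odd (d i)}"
  define E1 where "E1 = {i \<in> {1..m}. odd (d' i)}"
  let ?t = "\<lambda>(E, E'). (- 1) ^ koszul_exponent m (\<lambda>i. of_bool (i \<in> E)) e (\<lambda>i. of_bool (i \<in> E')) \<odot>\<^bsub>HJJ\<^esub>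
          parity_pure m X x0 (J \<union> J') E E' \<eta> \<eta>'"
  have par: "parity_part (X i) (i \<in> E) (\<eta> i) = (if (i \<in> E) = (i \<in> E0) then \<eta> i else \<zero>\<^bsub>cohomology (X i)\<^esub>)"
    "parity_part (X i) (i \<in> E) (\<eta>' i) = (if (i \<in> E) = (i \<in> E1) then \<eta>' i else \<zero>\<^bsub>cohomology (X i)\<^esub>)"
    if "i \<in> {1..m}" for i E
    using parity_part_homogeneous[OF hd(1)[OF that]] parity_part_homogeneous[OF hd(2)[OF that]] that
    by (auto simp: E0_def E1_def)
  have zero: "parity_pure m X x0 (J \<union> J') E E' \<eta> \<eta>' = \<zero>\<^bsub>HJJ\<^esub>"
    if E: "E \<subseteq> {1..m}" "E' \<subseteq> {1..m}" "(E, E') \<noteq> (E0, E1)" for E E'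
  proof -
    have "E0 \<subseteq> {1..m}" "E1 \<subseteq> {1..m}" by (auto simp: E0_def E1_def)
    then obtain i where i: "i \<in> {1..m}" "(i \<in> E) \<noteq> (i \<in> E0) \<or> (i \<in> E') \<noteq> (i \<in> E1)" using E by blast
    have z: "\<zero>\<^bsub>cohomology (X i)\<^esub> \<otimes>\<^bsub>cohomology (X i)\<^esub> y = \<zero>\<^bsub>cohomology (X i)\<^esub>" "y \<otimes>\<^bsub>cohomology (X i)\<^esub> \<zero>\<^bsub>cohomology (X i)\<^esub> = \<zero>\<^bsub>cohomology (X i)\<^esub>"
      if "y \<in> carrier (cohomology (X i))" for y
      using linear_map_zero[OF kmodule_cohomology kmodule_cohomology linear_cohomology_mult_left[OF that]]
        linear_map_zero[OF kmodule_cohomology kmodule_cohomology linear_cohomology_mult_right[OF that]] by auto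
    have c: "parity_part (X i) b (\<eta> i) \<in> carrier (cohomology (X i))" "parity_part (X i) b (\<eta>' i) \<in> carrier (cohomology (X i))" for b
      using linear_map_closed[OF linear_parity_part] hd[OF i(1)] by auto
    have "parity_part (X i) (i \<in> E) (\<eta> i) = \<zero>\<^bsub>cohomology (X i)\<^esub> \<or> parity_part (X i) (i \<in> E') (\<eta>' i) = \<zero>\<^bsub>cohomology (X i)\<^esub>"
      unfolding par[OF i(1)] using i(2) by presburger
    then have "parity_part (X i) (i \<in> E) (\<eta> i) \<otimes>\<^bsub>cohomology (X i)\<^esub> parity_part (X i) (i \<in> E') (\<eta>' i) = \<zero>\<^bsub>cohomology (X i)\<^esub>"
      by (elim disjE) (simp_all only: z c)
    then show ?thesis unfolding parity_pure_def
      by (intro H_pure_zero[OF parity_factors[OF h] i(1)]) (use i(1) in simp)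
  qed
  have tc: "?t p \<in> carrier HJJ" for p using parity_pure_closed[OF h] by (cases p) auto
  have E01: "(E0, E1) \<in> Pow {1..m} \<times> Pow {1..m}" by (auto simp: E0_def E1_def)
  have "graded_product m X x0 (J \<union> J') e \<eta> \<eta>' = (\<Oplus>\<^bsub>HJJ\<^esub>p\<in>Pow {1..m} \<times> Pow {1..m}. ?t p)"
    unfolding graded_product_def by (rule arg_cong[of _ _ "\<lambda>f. finsum HJJ f _"]) auto
  also have "\<dots> = (\<Oplus>\<^bsub>HJJ\<^esub>p\<in>Pow {1..m} \<times> Pow {1..m}. if (E0, E1) = p then ?t p else \<zero>\<^bsub>HJJ\<^esub>)"
  proof (rule H.finsum_cong'[OF refl])
    fix p assume "p \<in> Pow {1..m} \<times> Pow {1..m}"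
    then obtain E E' where p: "p = (E, E')" "E \<subseteq> {1..m}" "E' \<subseteq> {1..m}" by (cases p) simp
    show "?t p = (if (E0, E1) = p then ?t p else \<zero>\<^bsub>HJJ\<^esub>)"
    proof (cases "(E0, E1) = p")
      case False
      then have "(E, E') \<noteq> (E0, E1)" using p(1) by metis
      then show ?thesis using zero[OF p(2,3)] p(1) False by simp
    qed simp
  next
    show "(\<lambda>p. if (E0, E1) = p then ?t p else \<zero>\<^bsub>HJJ\<^esub>) \<in> Pow {1..m} \<times> Pow {1..m} \<rightarrow> carrier HJJ"
    proof (rule funcsetI)
      fix p show "(if (E0, E1) = p then ?t p else \<zero>\<^bsub>HJJ\<^esub>) \<in> carrier HJJ"
      proof (cases "(E0, E1) = p")
        case True show ?thesis unfolding if_P[OF True] by (rule tc)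
      next
        case False show ?thesis unfolding if_not_P[OF False] by (rule H.zero_closed)
      qed
    qed
  qed
  also have "\<dots> = ?t (E0, E1)"
    using tc by (intro H.finsum_singleton[OF E01, of ?t]) auto
  also have "\<dots> = (- 1) ^ koszul_exponent m (\<lambda>i. of_bool (i \<in> E0)) e (\<lambda>i. of_bool (i \<in> E1)) \<odot>\<^bsub>HJJ\<^esub>
      parity_pure m X x0 (J \<union> J') E0 E1 \<eta> \<eta>'"
    by (simp only: prod.case)
  also have "parity_pure m X x0 (J \<union> J') E0 E1 \<eta> \<eta>' = H_pure m X x0 (J \<union> J') (\<lambda>i\<in>{1..m}. \<eta> i \<otimes>\<^bsub>cohomology (X i)\<^esub> \<eta>' i)"
    unfolding parity_pure_def by (intro arg_cong[of _ _ "H_pure m X x0 (J \<union> J')"] restrict_ext) (simp add: par)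
  also have "(- 1 :: 'k) ^ koszul_exponent m (\<lambda>i. of_bool (i \<in> E0)) e (\<lambda>i. of_bool (i \<in> E1)) = (- 1) ^ koszul_exponent m d e d'"
    by (rule koszul_sign_cong) (auto simp: E0_def E1_def)
  finally show ?thesis .
qed

end

section \<open>Polyhedral product modules over an algebra with a monomial basis\<close>

text \<open>
  What the construction of \<open>C(X, K)\<close> and \<open>B(X, K)\<close> uses of the algebra: the monomials have coordinate functionals,
  hence are independent, and products of monomials are \<open>0\<close> or \<open>\<plusminus>\<close> a monomial whose support is the union of the supports.
\<close>

locale monomial_algebra =
  fixes m :: nat and K :: "nat set set" and A :: "('k::comm_ring_1, 'r) module"
    and bmon :: "nat set \<Rightarrow> nat set \<Rightarrow> 'r"
  assumes K: "K \<subseteq> Pow {1..m}" and A: "kmodule A"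
    and bmon_closed: "basis_index m K I L \<Longrightarrow> bmon I L \<in> carrier A"
    and coordinate: "basis_index m K I L \<Longrightarrow> \<exists>\<phi>. (\<forall>x\<in>carrier A. \<forall>y\<in>carrier A. \<phi> (x \<oplus>\<^bsub>A\<^esub> y) = \<phi> x + \<phi> y) \<and>
      (\<forall>c. \<forall>x\<in>carrier A. \<phi> (c \<odot>\<^bsub>A\<^esub> x) = c * \<phi> x) \<and>
      (\<forall>I' L'. basis_index m K I' L' \<longrightarrow> \<phi> (bmon I' L') = of_bool (I = I' \<and> L = L'))"
    and bmon_mult: "basis_index m K I L \<Longrightarrow> basis_index m K I' L' \<Longrightarrow>
      bmon I L \<otimes>\<^bsub>A\<^esub> bmon I' L' = \<zero>\<^bsub>A\<^esub> \<or>
      (\<exists>I'' L'' c. basis_index m K I'' L'' \<and> I'' \<union> L'' = I \<union> L \<union> I' \<union> L' \<and> (c = 1 \<or> c = - 1) \<and>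
        bmon I L \<otimes>\<^bsub>A\<^esub> bmon I' L' = c \<odot>\<^bsub>A\<^esub> bmon I'' L'')"
begin

lemma basis_index_subset: "basis_index m K I L \<Longrightarrow> I \<union> L \<in> Pow {1..m}"
  using K by (auto simp: basis_index_def)

lemma finite_basis: "finite {(I, L). basis_index m K I L}"
  by (rule finite_subset[of _ "Pow {1..m} \<times> Pow {1..m}"]) (use basis_index_subset in \<open>auto simp: basis_index_def\<close>)

abbreviation "AJ \<equiv> support_part m K A bmon"

lemma support_generators: "{bmon I L | I L. basis_index m K I L \<and> I \<union> L = J} \<subseteq> carrier A"
  using bmon_closed by auto

lemma support_submodule: "submodule (carrier (AJ J)) scalars A"
  unfolding support_part_def using kmodule.span_submodule[OF A support_generators] by simp

lemma support_part_simps [simp]: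
  "ring.add (AJ J) = ring.add A" "ring.zero (AJ J) = ring.zero A" "smult (AJ J) = smult A"
  by (simp_all add: support_part_def)

lemma kmodule_support: "kmodule (AJ J)"
proof -
  have "AJ J = A\<lparr>carrier := carrier (AJ J)\<rparr>" by (simp add: support_part_def)
  then show ?thesis using kmodule.kmodule_restrict[OF A support_submodule] by metis
qed

lemma support_subset: "x \<in> carrier (AJ J) \<Longrightarrow> x \<in> carrier A"
  using support_submodule[of J] kmodule.submodule_iff[OF A] by auto

lemma bmon_support: "basis_index m K I L \<Longrightarrow> I \<union> L = J \<Longrightarrow> bmon I L \<in> carrier (AJ J)"
  using module_span_superset[of "{bmon I L | I L. basis_index m K I L \<and> I \<union> L = J}" A]
  by (auto simp: support_part_def)

lemma support_eqI:
  assumes "kmodule Q" "linear_map (AJ J) Q f" "linear_map (AJ J) Q g"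
    and eq: "\<And>I L. basis_index m K I L \<Longrightarrow> I \<union> L = J \<Longrightarrow> f (bmon I L) = g (bmon I L)" and x: "x \<in> carrier (AJ J)"
  shows "f x = g x"
proof -
  interpret A: kmodule A by (rule A)
  interpret S: kmodule "AJ J" by (rule kmodule_support)
  have "submodule {x \<in> carrier (AJ J). f x = g x} scalars (AJ J)"
    by (rule linear_map_equalizer_submodule[OF kmodule_support assms(1-3)])
  then have "submodule {x \<in> carrier (AJ J). f x = g x} scalars A"
    unfolding S.submodule_iff A.submodule_iff using support_subset[of _ J] by auto
  moreover have "{bmon I L | I L. basis_index m K I L \<and> I \<union> L = J} \<subseteq> {x \<in> carrier (AJ J). f x = g x}"
    using eq bmon_support by auto
  ultimately have "module_span A {bmon I L | I L. basis_index m K I L \<and> I \<union> L = J} \<subseteq> {x \<in> carrier (AJ J). f x = g x}"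
    by (rule module_span_least)
  then show ?thesis using x by (auto simp: support_part_def)
qed

lemma bmon_mult_support:
  assumes "basis_index m K I L" "basis_index m K I' L'"
  shows "bmon I L \<otimes>\<^bsub>A\<^esub> bmon I' L' \<in> carrier (AJ (I \<union> L \<union> I' \<union> L'))"
proof -
  interpret S: kmodule "AJ (I \<union> L \<union> I' \<union> L')" by (rule kmodule_support)
  from bmon_mult[OF assms] show ?thesis
    using S.zero_closed S.smult_closed[OF bmon_support] by fastforce
qed

context
  fixes X :: "nat \<Rightarrow> 'a topology" and x0 :: "nat \<Rightarrow> 'a"
begin

abbreviation "HT J \<equiv> H_tensor m X x0 J :: ('k, ((nat \<Rightarrow> ('a, 'k) cochain set) \<Rightarrow>\<^sub>0 'k) set) module"
abbreviation "PS \<equiv> poly_summand m K X x0 A bmon"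
abbreviation "PM \<equiv> poly_module m K X x0 A bmon"
abbreviation "pelem \<equiv> poly_elem m K X x0 A bmon"
abbreviation "gen I L \<equiv> pelem (I \<union> L) (bmon I L)"

lemma kmodule_PS: "kmodule (PS J)"
  unfolding poly_summand_def by (rule kmodule_tensor[OF kmodule_support kmodule_H_tensor])

lemma kmodule_PM: "kmodule PM"
  unfolding poly_module_def by (rule kmodule_direct_sum) (rule kmodule_PS, simp)

lemma linear_incl: "J \<in> Pow {1..m} \<Longrightarrow> linear_map (PS J) PM (summand_incl (Pow {1..m}) PS J)"
  unfolding poly_module_def by (rule linear_summand_incl) (auto intro: kmodule_PS)

lemma linear_elem_right:
  assumes J: "J \<in> Pow {1..m}" and a: "a \<in> carrier (AJ J)" shows "linear_map (HT J) PM (pelem J a)"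
proof -
  have "linear_map (HT J) (PS J) (tensor (AJ J) (HT J) a)"
    unfolding poly_summand_def by (rule linear_tensor_right[OF kmodule_support kmodule_H_tensor a])
  from linear_map_compose[OF this linear_incl[OF J]] show ?thesis by (simp add: poly_elem_def[abs_def])
qed

lemma linear_elem_left:
  assumes J: "J \<in> Pow {1..m}" and h: "h \<in> carrier (HT J)" shows "linear_map (AJ J) PM (\<lambda>a. pelem J a h)"
proof -
  have "linear_map (AJ J) (PS J) (\<lambda>a. tensor (AJ J) (HT J) a h)"
    unfolding poly_summand_def by (rule linear_tensor_left[OF kmodule_support kmodule_H_tensor h])
  from linear_map_compose[OF this linear_incl[OF J]] show ?thesis by (simp add: poly_elem_def)
qed

lemma linear_gen: "basis_index m K I L \<Longrightarrow> linear_map (HT (I \<union> L)) PM (gen I L)"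
  by (rule linear_elem_right[OF basis_index_subset bmon_support[OF _ refl]])

lemma poly_eqI:
  assumes Q: "kmodule Q" and f: "linear_map PM Q f" and g: "linear_map PM Q g"
    and eq: "\<And>I L h. basis_index m K I L \<Longrightarrow> h \<in> carrier (HT (I \<union> L)) \<Longrightarrow> f (gen I L h) = g (gen I L h)"
    and x: "x \<in> carrier PM"
  shows "f x = g x"
proof (rule direct_sum_eqI[OF kmodule_PS _ Q f[unfolded poly_module_def] g[unfolded poly_module_def] _ x[unfolded poly_module_def]])
  fix J z assume J: "J \<in> Pow {1..m}" and z: "z \<in> carrier (PS J)"
  note fi = linear_map_compose[OF linear_incl[OF J] f] and gi = linear_map_compose[OF linear_incl[OF J] g]
  show "f (summand_incl (Pow {1..m}) PS J z) = g (summand_incl (Pow {1..m}) PS J z)"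
  proof (rule tensor_eqI[OF kmodule_support kmodule_H_tensor Q fi[unfolded poly_summand_def] gi[unfolded poly_summand_def] _ z[unfolded poly_summand_def], folded poly_summand_def])
    fix a h assume a: "a \<in> carrier (AJ J)" and h: "h \<in> carrier (HT J)"
    have "f (pelem J a h) = g (pelem J a h)"
    proof (rule support_eqI[OF Q linear_map_compose[OF linear_elem_left[OF J h] f] linear_map_compose[OF linear_elem_left[OF J h] g] _ a])
      fix I L assume "basis_index m K I L" "I \<union> L = J"
      then show "f (pelem J (bmon I L) h) = g (pelem J (bmon I L) h)" using eq[of I L h] h by simp
    qed
    then show "f (summand_incl (Pow {1..m}) PS J (tensor (AJ J) (HT J) a h)) = g (summand_incl (Pow {1..m}) PS J (tensor (AJ J) (HT J) a h))"
      by (simp add: poly_elem_def)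
  qed
qed simp

text \<open>
  The coordinate functional of a monomial, tensored with the identity of \<open>H\<^sup>J\<close>, projects to the copy of \<open>H\<^sup>J\<close> that belongs to
  the monomial.
\<close>

lemma poly_projection:
  assumes b: "basis_index m K I L"
  shows "\<exists>\<pi>. linear_map PM (HT (I \<union> L)) \<pi> \<and> (\<forall>I' L'. \<forall>h\<in>carrier (HT (I' \<union> L')). basis_index m K I' L' \<longrightarrow>
    \<pi> (gen I' L' h) = (if I = I' \<and> L = L' then h else \<zero>\<^bsub>HT (I \<union> L)\<^esub>))"
proof -
  let ?J = "I \<union> L"
  interpret H: kmodule "HT ?J" by (rule kmodule_H_tensor)
  obtain \<phi> where \<phi>: "\<And>x y. x \<in> carrier A \<Longrightarrow> y \<in> carrier A \<Longrightarrow> \<phi> (x \<oplus>\<^bsub>A\<^esub> y) = \<phi> x + \<phi> y"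
    "\<And>c x. x \<in> carrier A \<Longrightarrow> \<phi> (c \<odot>\<^bsub>A\<^esub> x) = c * \<phi> x"
    "\<And>I' L'. basis_index m K I' L' \<Longrightarrow> \<phi> (bmon I' L') = of_bool (I = I' \<and> L = L')"
    using coordinate[OF b] by blast
  have "\<exists>t. linear_map (tensor_module (AJ ?J) (HT ?J)) (HT ?J) t \<and>
      (\<forall>a\<in>carrier (AJ ?J). \<forall>h\<in>carrier (HT ?J). t (tensor (AJ ?J) (HT ?J) a h) = \<phi> a \<odot>\<^bsub>HT ?J\<^esub> h)"
  proof (rule tensor_lift[OF kmodule_support kmodule_H_tensor kmodule_H_tensor])
    show "linear_map (AJ ?J) (HT ?J) (\<lambda>a. \<phi> a \<odot>\<^bsub>HT ?J\<^esub> h)" if "h \<in> carrier (HT ?J)" for h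
      using that by (auto simp: linear_map_def \<phi>(1,2) support_subset H.smult_l_distr H.smult_assoc)
    show "linear_map (HT ?J) (HT ?J) (\<lambda>h. \<phi> a \<odot>\<^bsub>HT ?J\<^esub> h)" for a
      by (intro linear_map_pointwise_smult[OF kmodule_H_tensor]) (simp add: linear_map_def)
  qed
  then obtain t where t: "linear_map (PS ?J) (HT ?J) t"
    "\<And>a h. a \<in> carrier (AJ ?J) \<Longrightarrow> h \<in> carrier (HT ?J) \<Longrightarrow> t (tensor (AJ ?J) (HT ?J) a h) = \<phi> a \<odot>\<^bsub>HT ?J\<^esub> h"
    unfolding poly_summand_def by blast
  have J: "?J \<in> Pow {1..m}" using b by (rule basis_index_subset)
  have "linear_map PM (PS ?J) (\<lambda>x. x ?J)" unfolding poly_module_def using J by (rule linear_component[rotated -1]) (auto intro: kmodule_PS)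
  from linear_map_compose[OF this t(1)] have lin: "linear_map PM (HT ?J) (\<lambda>x. t (x ?J))" .
  have "t (gen I' L' h ?J) = (if I = I' \<and> L = L' then h else \<zero>\<^bsub>HT ?J\<^esub>)"
    if h: "h \<in> carrier (HT (I' \<union> L'))" and b': "basis_index m K I' L'" for I' L' h
  proof (cases "I' \<union> L' = ?J")
    case True
    have h': "h \<in> carrier (HT ?J)" using h True by simp
    have "gen I' L' h ?J = tensor (AJ ?J) (HT ?J) (bmon I' L') h"
      using J by (simp add: poly_elem_def summand_incl_def True)
    then have "t (gen I' L' h ?J) = \<phi> (bmon I' L') \<odot>\<^bsub>HT ?J\<^esub> h"
      by (simp only: t(2)[OF bmon_support[OF b' True] h'])
    also have "\<dots> = (if I = I' \<and> L = L' then h else \<zero>\<^bsub>HT ?J\<^esub>)"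
    proof -
      have "of_bool P \<odot>\<^bsub>HT ?J\<^esub> h = (if P then h else \<zero>\<^bsub>HT ?J\<^esub>)" for P using h' by (cases P) simp_all
      then show ?thesis unfolding \<phi>(3)[OF b'] .
    qed
    finally show ?thesis .
  next
    case False
    then have "gen I' L' h ?J = \<zero>\<^bsub>PS ?J\<^esub>" using J by (auto simp: poly_elem_def summand_incl_def)
    then show ?thesis using False linear_map_zero[OF kmodule_PS kmodule_H_tensor t(1)] by (metis (full_types))
  qed
  then show ?thesis using lin by blast
qed

text \<open>
  The module is the direct sum of its copies of \<open>H\<^sup>J\<close>, so linear maps can be prescribed on each copy.
\<close>

lemma poly_extend:
  assumes Q: "kmodule Q" and \<phi>: "\<And>I L. basis_index m K I L \<Longrightarrow> linear_map (HT (I \<union> L)) Q (\<phi> I L)"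
  shows "\<exists>f. linear_map PM Q f \<and> (\<forall>I L. \<forall>h\<in>carrier (HT (I \<union> L)). basis_index m K I L \<longrightarrow> f (gen I L h) = \<phi> I L h)"
proof -
  interpret Q: kmodule Q by (rule Q)
  let ?B = "{(I, L). basis_index m K I L}"
  obtain \<pi> where \<pi>: "\<And>I L. basis_index m K I L \<Longrightarrow> linear_map PM (HT (I \<union> L)) (\<pi> I L)"
    "\<And>I L I' L' h. basis_index m K I L \<Longrightarrow> basis_index m K I' L' \<Longrightarrow> h \<in> carrier (HT (I' \<union> L')) \<Longrightarrow>
      \<pi> I L (gen I' L' h) = (if I = I' \<and> L = L' then h else \<zero>\<^bsub>HT (I \<union> L)\<^esub>)"
    using poly_projection by metis
  let ?f = "\<lambda>x. \<Oplus>\<^bsub>Q\<^esub>p\<in>?B. \<phi> (fst p) (snd p) (\<pi> (fst p) (snd p) x)"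
  have "linear_map PM Q ?f"
    by (intro linear_map_pointwise_finsum[OF kmodule_PM Q finite_basis] linear_map_compose[OF \<pi>(1) \<phi>]) auto
  moreover have "?f (gen I L h) = \<phi> I L h" if h: "h \<in> carrier (HT (I \<union> L))" and b: "basis_index m K I L" for I L h
  proof -
    have c: "\<phi> I L h \<in> carrier Q" using linear_map_closed[OF \<phi>[OF b] h] .
    have "\<phi> a a' (\<pi> a a' (gen I L h)) = (if (I, L) = (a, a') then \<phi> I L h else \<zero>\<^bsub>Q\<^esub>)" if "basis_index m K a a'" for a a'
      using linear_map_zero[OF kmodule_H_tensor Q \<phi>[OF that]] \<pi>(2)[OF that b h] by (cases "a = I \<and> a' = L") auto
    then have "?f (gen I L h) = (\<Oplus>\<^bsub>Q\<^esub>p\<in>?B. if (I, L) = p then \<phi> I L h else \<zero>\<^bsub>Q\<^esub>)"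
      using c by (intro Q.finsum_cong'[OF refl]) (simp_all add: Pi_iff split_beta prod_eq_iff)
    also have "\<dots> = \<phi> I L h"
      using b c finite_basis by (intro Q.finsum_singleton[of "(I, L)" ?B "\<lambda>_. \<phi> I L h"]) auto
    finally show ?thesis .
  qed
  ultimately show ?thesis by blast
qed

lemma H_homogeneous_factors: "H_homogeneous m X x0 J d \<eta> \<Longrightarrow> \<eta> \<in> (\<Pi>\<^sub>E i\<in>{1..m}. carrier (H_factor X x0 J i))"
  by (auto simp: H_homogeneous_def)

text \<open>
  For fixed monomials the product is the graded product followed by multiplication with the product of the
  monomials.  Extending linearly in the second factor and then in the first gives the multiplication.
\<close>

lemma poly_mult_exists:
  fixes bdeg :: "nat set \<Rightarrow> nat set \<Rightarrow> nat"
  shows "\<exists>\<mu>. bilinear_op PM \<mu> \<and>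
        (\<forall>I L I' L' d d' \<eta> \<eta>'.
           basis_index m K I L \<and> basis_index m K I' L' \<and>
           H_homogeneous m X x0 (I \<union> L) d \<eta> \<and> H_homogeneous m X x0 (I' \<union> L') d' \<eta>' \<longrightarrow>
           \<mu> (pelem (I \<union> L) (bmon I L) (H_pure m X x0 (I \<union> L) \<eta>))
             (pelem (I' \<union> L') (bmon I' L') (H_pure m X x0 (I' \<union> L') \<eta>')) =
           (- 1) ^ koszul_exponent m d (bdeg I' L') d' \<odot>\<^bsub>PM\<^esub>
             pelem (I \<union> L \<union> I' \<union> L')
               (bmon I L \<otimes>\<^bsub>A\<^esub> bmon I' L')
               (H_pure m X x0 (I \<union> L \<union> I' \<union> L')
                  (\<lambda>i\<in>{1..m}. \<eta> i \<otimes>\<^bsub>cohomology (X i)\<^esub> \<eta>' i)))"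
proof -
  interpret P: kmodule PM by (rule kmodule_PM)
  define is_product where "is_product J J' e b \<longleftrightarrow>
    (\<forall>y\<in>carrier (HT J'). linear_map (HT J) (HT (J \<union> J')) (\<lambda>x. b x y)) \<and>
    (\<forall>x\<in>carrier (HT J). linear_map (HT J') (HT (J \<union> J')) (\<lambda>y. b x y)) \<and>
    (\<forall>\<eta>\<in>(\<Pi>\<^sub>E i\<in>{1..m}. carrier (H_factor X x0 J i)). \<forall>\<eta>'\<in>(\<Pi>\<^sub>E i\<in>{1..m}. carrier (H_factor X x0 J' i)).
      b (H_pure m X x0 J \<eta>) (H_pure m X x0 J' \<eta>') = graded_product m X x0 (J \<union> J') e \<eta> \<eta>')" for J J' e b
  define \<kappa> where "\<kappa> J J' e = (SOME b. is_product J J' e b)" for J J' e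
  have k: "is_product J J' e (\<kappa> J J' e)" for J J' e
    unfolding \<kappa>_def by (rule someI_ex[of "is_product J J' e"]) (unfold is_product_def, rule graded_product_bilinear)
  note k = k[unfolded is_product_def]
  have \<kappa>1: "linear_map (HT J) (HT (J \<union> J')) (\<lambda>x. \<kappa> J J' e x y)" if "y \<in> carrier (HT J')" for J J' e y
    using k[where J = J and J' = J' and e = e, THEN conjunct1] that by (rule bspec)
  have \<kappa>2: "linear_map (HT J') (HT (J \<union> J')) (\<lambda>y. \<kappa> J J' e x y)" if "x \<in> carrier (HT J)" for J J' e x
    using k[where J = J and J' = J' and e = e, THEN conjunct2, THEN conjunct1] that by (rule bspec)
  have \<kappa>3: "\<kappa> J J' e (H_pure m X x0 J \<eta>) (H_pure m X x0 J' \<eta>') = graded_product m X x0 (J \<union> J') e \<eta> \<eta>'"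
    if "\<eta> \<in> (\<Pi>\<^sub>E i\<in>{1..m}. carrier (H_factor X x0 J i))" "\<eta>' \<in> (\<Pi>\<^sub>E i\<in>{1..m}. carrier (H_factor X x0 J' i))" for J J' e \<eta> \<eta>'
    by (rule bspec[OF bspec[OF k[where J = J and J' = J' and e = e, THEN conjunct2, THEN conjunct2] that(1)] that(2)])
  define \<theta> where "\<theta> I L h I' L' h' = pelem (I \<union> L \<union> (I' \<union> L')) (bmon I L \<otimes>\<^bsub>A\<^esub> bmon I' L')
      (\<kappa> (I \<union> L) (I' \<union> L') (bdeg I' L') h h')" for I L h I' L' h'
  have el: "linear_map (HT (I \<union> L \<union> (I' \<union> L'))) PM (pelem (I \<union> L \<union> (I' \<union> L')) (bmon I L \<otimes>\<^bsub>A\<^esub> bmon I' L'))"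
    if "basis_index m K I L" "basis_index m K I' L'" for I L I' L'
    by (rule linear_elem_right)
      (use bmon_mult_support[OF that] basis_index_subset[OF that(1)] basis_index_subset[OF that(2)] in \<open>auto simp: Un_assoc\<close>)
  have \<theta>1: "linear_map (HT (I \<union> L)) PM (\<lambda>h. \<theta> I L h I' L' h')"
    if "basis_index m K I L" "basis_index m K I' L'" "h' \<in> carrier (HT (I' \<union> L'))" for I L I' L' h'
    unfolding \<theta>_def by (rule linear_map_compose[OF \<kappa>1[OF that(3)] el[OF that(1,2)]])
  have \<theta>2: "linear_map (HT (I' \<union> L')) PM (\<lambda>h'. \<theta> I L h I' L' h')"
    if "basis_index m K I L" "basis_index m K I' L'" "h \<in> carrier (HT (I \<union> L))" for I L I' L' h
    unfolding \<theta>_def by (rule linear_map_compose[OF \<kappa>2[OF that(3)] el[OF that(1,2)]])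
  define is_ext where "is_ext I L h g \<longleftrightarrow> linear_map PM PM g \<and>
      (\<forall>I' L'. \<forall>h'\<in>carrier (HT (I' \<union> L')). basis_index m K I' L' \<longrightarrow> g (gen I' L' h') = \<theta> I L h I' L' h')" for I L h g
  define g where "g I L h = (SOME g. is_ext I L h g)" for I L h
  have "is_ext I L h (g I L h)" if bh: "basis_index m K I L" "h \<in> carrier (HT (I \<union> L))" for I L h
    unfolding g_def
  proof (rule someI_ex[of "is_ext I L h"], unfold is_ext_def, rule poly_extend[OF kmodule_PM])
    fix I' L' assume "basis_index m K I' L'"
    then show "linear_map (HT (I' \<union> L')) PM (\<theta> I L h I' L')" using \<theta>2[OF bh(1) _ bh(2)] by simp
  qed
  then have g: "\<And>I L h. basis_index m K I L \<Longrightarrow> h \<in> carrier (HT (I \<union> L)) \<Longrightarrow> linear_map PM PM (g I L h)"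
    "\<And>I L h I' L' h'. basis_index m K I L \<Longrightarrow> h \<in> carrier (HT (I \<union> L)) \<Longrightarrow> basis_index m K I' L' \<Longrightarrow> h' \<in> carrier (HT (I' \<union> L')) \<Longrightarrow>
      g I L h (gen I' L' h') = \<theta> I L h I' L' h'"
    unfolding is_ext_def by simp_all
  have gl: "linear_map (HT (I \<union> L)) PM (\<lambda>h. g I L h y)" if b: "basis_index m K I L" and y: "y \<in> carrier PM" for I L y
    unfolding linear_map_def
  proof (intro conjI ballI allI, goal_cases)
    case 1 then show ?case using linear_map_closed[OF g(1)[OF b] y] by blast
  next
    case (2 h k)
    interpret H: kmodule "HT (I \<union> L)" by (rule kmodule_H_tensor)
    show ?case
      by (rule poly_eqI[OF kmodule_PM g(1)[OF b] linear_map_pointwise_add[OF kmodule_PM g(1)[OF b] g(1)[OF b]] _ y])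
        (use 2 in \<open>simp_all add: g(2)[OF b] linear_map_add[OF \<theta>1[OF b]]\<close>)
  next
    case (3 c h)
    interpret H: kmodule "HT (I \<union> L)" by (rule kmodule_H_tensor)
    show ?case
      by (rule poly_eqI[OF kmodule_PM g(1)[OF b] linear_map_pointwise_smult[OF kmodule_PM g(1)[OF b]] _ y])
        (use 3 in \<open>simp_all add: g(2)[OF b] linear_map_smult[OF \<theta>1[OF b]]\<close>)
  qed
  define is_left where "is_left y b \<longleftrightarrow> linear_map PM PM b \<and>
      (\<forall>I L. \<forall>h\<in>carrier (HT (I \<union> L)). basis_index m K I L \<longrightarrow> b (gen I L h) = g I L h y)" for y b
  define b where "b y = (SOME b. is_left y b)" for y
  have "is_left y (b y)" if y: "y \<in> carrier PM" for y
    unfolding b_def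
    by (rule someI_ex[of "is_left y"], unfold is_left_def, rule poly_extend[OF kmodule_PM gl[OF _ y]])
  then have b: "\<And>y. y \<in> carrier PM \<Longrightarrow> linear_map PM PM (b y)"
    "\<And>y I L h. y \<in> carrier PM \<Longrightarrow> basis_index m K I L \<Longrightarrow> h \<in> carrier (HT (I \<union> L)) \<Longrightarrow> b y (gen I L h) = g I L h y"
    unfolding is_left_def by simp_all
  have bl: "linear_map PM PM (\<lambda>y. b y x)" if x: "x \<in> carrier PM" for x
    unfolding linear_map_def
  proof (intro conjI ballI allI, goal_cases)
    case 1 then show ?case using linear_map_closed[OF b(1) x] by blast
  next
    case (2 y z)
    show ?case
      by (rule poly_eqI[OF kmodule_PM b(1) linear_map_pointwise_add[OF kmodule_PM b(1) b(1)] _ x])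
        (use 2 in \<open>simp_all add: b(2) linear_map_add[OF g(1)]\<close>)
  next
    case (3 c y)
    show ?case
      by (rule poly_eqI[OF kmodule_PM b(1) linear_map_pointwise_smult[OF kmodule_PM b(1)] _ x])
        (use 3 in \<open>simp_all add: b(2) linear_map_smult[OF g(1)]\<close>)
  qed
  show ?thesis
  proof (rule exI[of _ "\<lambda>x y. b y x"], intro conjI allI impI, goal_cases)
    case 1
    show ?case unfolding bilinear_op_def using b(1) bl by (intro conjI ballI)
  next
    case (2 I L I' L' d d' \<eta> \<eta>')
    then have bi: "basis_index m K I L" "basis_index m K I' L'"
      and hom: "H_homogeneous m X x0 (I \<union> L) d \<eta>" "H_homogeneous m X x0 (I' \<union> L') d' \<eta>'" by auto
    note fac = H_homogeneous_factors[OF hom(1)] H_homogeneous_factors[OF hom(2)]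
    note pc = H_pure_closed[OF fac(1)] H_pure_closed[OF fac(2)]
    have assoc: "I \<union> L \<union> I' \<union> L' = I \<union> L \<union> (I' \<union> L')" by auto
    have prodfac: "(\<lambda>i\<in>{1..m}. \<eta> i \<otimes>\<^bsub>cohomology (X i)\<^esub> \<eta>' i) \<in> (\<Pi>\<^sub>E i\<in>{1..m}. carrier (H_factor X x0 (I \<union> L \<union> (I' \<union> L')) i))"
      using fac by (auto intro!: H_factor_mult dest: PiE_mem)
    have "b (gen I' L' (H_pure m X x0 (I' \<union> L') \<eta>')) (gen I L (H_pure m X x0 (I \<union> L) \<eta>)) =
        \<theta> I L (H_pure m X x0 (I \<union> L) \<eta>) I' L' (H_pure m X x0 (I' \<union> L') \<eta>')"
      using linear_map_closed[OF linear_gen[OF bi(2)] pc(2)] bi pc by (simp add: b(2) g(2))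
    also have "\<dots> = pelem (I \<union> L \<union> (I' \<union> L')) (bmon I L \<otimes>\<^bsub>A\<^esub> bmon I' L') (graded_product m X x0 (I \<union> L \<union> (I' \<union> L')) (bdeg I' L') \<eta> \<eta>')"
      unfolding \<theta>_def by (simp only: \<kappa>3[OF fac])
    also have "\<dots> = (- 1) ^ koszul_exponent m d (bdeg I' L') d' \<odot>\<^bsub>PM\<^esub> pelem (I \<union> L \<union> (I' \<union> L')) (bmon I L \<otimes>\<^bsub>A\<^esub> bmon I' L')
       (H_pure m X x0 (I \<union> L \<union> (I' \<union> L')) (\<lambda>i\<in>{1..m}. \<eta> i \<otimes>\<^bsub>cohomology (X i)\<^esub> \<eta>' i))"
      unfolding graded_product_homogeneous[OF hom]
      by (rule linear_map_smult[OF el[OF bi] H_pure_closed[OF prodfac]])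
    finally show ?case unfolding assoc .
  qed
qed

end

end

section \<open>The free algebra is a ring\<close>

definition word_mult :: "('g list \<Rightarrow>\<^sub>0 'k::comm_ring_1) \<Rightarrow> ('g list \<Rightarrow>\<^sub>0 'k) \<Rightarrow> ('g list \<Rightarrow>\<^sub>0 'k)" where
  "word_mult p q = (\<Sum>u\<in>Poly_Mapping.keys p. \<Sum>v\<in>Poly_Mapping.keys q.
     Poly_Mapping.single (u @ v) (Poly_Mapping.lookup p u * Poly_Mapping.lookup q v))"

lemma word_mult_superset:
  assumes "finite U" "Poly_Mapping.keys p \<subseteq> U" "finite V" "Poly_Mapping.keys q \<subseteq> V"
  shows "word_mult p q = (\<Sum>u\<in>U. \<Sum>v\<in>V. Poly_Mapping.single (u @ v) (Poly_Mapping.lookup p u * Poly_Mapping.lookup q v))"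
proof -
  have "word_mult p q = (\<Sum>u\<in>Poly_Mapping.keys p. \<Sum>v\<in>V. Poly_Mapping.single (u @ v) (Poly_Mapping.lookup p u * Poly_Mapping.lookup q v))"
    unfolding word_mult_def by (intro sum.cong refl sum.mono_neutral_left assms ballI) (simp add: in_keys_iff)
  also have "\<dots> = (\<Sum>u\<in>U. \<Sum>v\<in>V. Poly_Mapping.single (u @ v) (Poly_Mapping.lookup p u * Poly_Mapping.lookup q v))"
    by (intro sum.mono_neutral_left assms ballI) (simp add: in_keys_iff)
  finally show ?thesis .
qed

lemma word_mult_add_left: "word_mult (p + p') q = word_mult p q + word_mult p' q"
proof -
  let ?U = "Poly_Mapping.keys p \<union> Poly_Mapping.keys p'"
  have U: "finite ?U" "Poly_Mapping.keys p \<subseteq> ?U" "Poly_Mapping.keys p' \<subseteq> ?U" "Poly_Mapping.keys (p + p') \<subseteq> ?U"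
    using keys_add[of p p'] by auto
  show ?thesis
    unfolding U(2-4)[THEN word_mult_superset[OF U(1) _ finite_keys order_refl]]
    by (simp only: lookup_add distrib_right single_add sum.distrib)
qed

lemma word_mult_add_right: "word_mult p (q + q') = word_mult p q + word_mult p q'"
proof -
  let ?U = "Poly_Mapping.keys q \<union> Poly_Mapping.keys q'"
  have U: "finite ?U" "Poly_Mapping.keys q \<subseteq> ?U" "Poly_Mapping.keys q' \<subseteq> ?U" "Poly_Mapping.keys (q + q') \<subseteq> ?U"
    using keys_add[of q q'] by auto
  show ?thesis
    unfolding U(2-4)[THEN word_mult_superset[OF finite_keys order_refl U(1)]]
    by (simp only: lookup_add distrib_left single_add sum.distrib)
qed

lemma word_mult_zero [simp]: "word_mult 0 q = 0" "word_mult p 0 = 0"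
  by (simp_all add: word_mult_def)

lemma word_mult_single [simp]:
  "word_mult (Poly_Mapping.single u a) (Poly_Mapping.single v b) = Poly_Mapping.single (u @ v) (a * b)"
  by (simp add: word_mult_superset[of "{u}" _ "{v}"])

lemma word_mult_sum_left: "word_mult (sum f S) q = (\<Sum>i\<in>S. word_mult (f i) q)"
  by (induction S rule: infinite_finite_induct) (simp_all add: word_mult_add_left)

lemma word_mult_sum_right: "word_mult p (sum f S) = (\<Sum>i\<in>S. word_mult p (f i))"
  by (induction S rule: infinite_finite_induct) (simp_all add: word_mult_add_right)

lemma word_mult_assoc: "word_mult (word_mult p q) r = word_mult p (word_mult q r)"
proof -
  let ?s = "\<lambda>p. \<Sum>u\<in>Poly_Mapping.keys p. Poly_Mapping.single u (Poly_Mapping.lookup p u)"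
  have "word_mult (word_mult (?s p) (?s q)) (?s r) = word_mult (?s p) (word_mult (?s q) (?s r))"
    by (simp only: word_mult_sum_left word_mult_sum_right word_mult_single append_assoc mult.assoc)
  then show ?thesis by (simp only: poly_mapping_sum_single)
qed

lemma word_mult_one: "word_mult (word []) p = p" "word_mult p (word []) = p"
proof -
  let ?s = "\<lambda>p. \<Sum>u\<in>Poly_Mapping.keys p. Poly_Mapping.single u (Poly_Mapping.lookup p u)"
  have "word_mult (word []) (?s p) = ?s p" "word_mult (?s p) (word []) = ?s p"
    by (simp_all only: word_mult_sum_left word_mult_sum_right word_mult_single append_Nil append_Nil2 mult_1 mult_1_right)
  then show "word_mult (word []) p = p" "word_mult p (word []) = p" by (simp_all only: poly_mapping_sum_single)
qed

lemma word_mult_scale_left: "scale_comb c p = word_mult (Poly_Mapping.single [] c) p"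
proof -
  let ?s = "\<lambda>p. \<Sum>u\<in>Poly_Mapping.keys p. Poly_Mapping.single u (Poly_Mapping.lookup p u)"
  have "word_mult (Poly_Mapping.single [] c) (?s p) = (\<Sum>u\<in>Poly_Mapping.keys p. Poly_Mapping.single u (c * Poly_Mapping.lookup p u))"
    by (simp only: word_mult_sum_right word_mult_single append_Nil)
  also have "\<dots> = scale_comb c p"
    by (rule poly_mapping_eqI) (simp add: lookup_sum lookup_single when_def in_keys_iff)
  finally show ?thesis by (simp only: poly_mapping_sum_single)
qed

lemma keys_word_mult: "Poly_Mapping.keys (word_mult p q) \<subseteq> {u @ v | u v. u \<in> Poly_Mapping.keys p \<and> v \<in> Poly_Mapping.keys q}"
proof -
  have "Poly_Mapping.keys (word_mult p q) \<subseteq> (\<Union>u\<in>Poly_Mapping.keys p. \<Union>v\<in>Poly_Mapping.keys q. {u @ v})"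
    unfolding word_mult_def
    by (rule order_trans[OF keys_sum], rule UN_mono[OF order_refl], rule order_trans[OF keys_sum], rule UN_mono[OF order_refl]) simp
  then show ?thesis by blast
qed

lemma free_algebra_simps [simp]:
  "carrier (free_algebra G) = {p. Poly_Mapping.keys p \<subseteq> lists G}"
  "p \<otimes>\<^bsub>free_algebra G\<^esub> q = word_mult p q" "\<one>\<^bsub>free_algebra G\<^esub> = word []"
  "\<zero>\<^bsub>free_algebra G\<^esub> = 0" "p \<oplus>\<^bsub>free_algebra G\<^esub> q = p + q" "c \<odot>\<^bsub>free_algebra G\<^esub> p = scale_comb c p"
  by (simp_all add: free_algebra_def word_mult_def)

lemma word_mult_closed:
  "p \<in> carrier (free_algebra G) \<Longrightarrow> q \<in> carrier (free_algebra G) \<Longrightarrow> word_mult p q \<in> carrier (free_algebra G)"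
proof -
  assume pq: "p \<in> carrier (free_algebra G)" "q \<in> carrier (free_algebra G)"
  have "w \<in> lists G" if "w \<in> Poly_Mapping.keys (word_mult p q)" for w
  proof -
    from subsetD[OF keys_word_mult that] obtain u v where "w = u @ v" "u \<in> Poly_Mapping.keys p" "v \<in> Poly_Mapping.keys q"
      by (elim CollectE exE conjE)
    then show ?thesis using pq by (simp add: subset_iff)
  qed
  then show ?thesis by (simp add: subset_iff)
qed

lemma kmodule_free_algebra: "kmodule (free_algebra G)"
proof -
  interpret kmodule "free_module_on (lists G)" by (rule kmodule_free)
  show ?thesis
    by (rule kmoduleI)
      (use a_closed zero_closed a_assoc a_comm l_zero smult_closed smult_l_distr smult_r_distr smult_assoc smult_one smult_zero_left
        in \<open>simp_all add: subset_iff add.assoc add.commute\<close>)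
qed

text \<open>
  As a module the free algebra is the free module on the words.
\<close>

lemma linear_map_free_algebra: "linear_map (free_algebra G) P f = linear_map (free_module_on (lists G)) P f"
  by (simp add: linear_map_def)

lemma ring_free_algebra: "ring (free_algebra G)"
proof (rule ringI)
  show "abelian_group (free_algebra G)" by (rule kmodule.axioms(1)[OF kmodule_free_algebra])
  show "Group.monoid (free_algebra G)"
    by (rule monoidI) (simp_all add: word_mult_assoc word_mult_one word_mult_closed[simplified])
qed (simp_all add: word_mult_add_left word_mult_add_right)

lemma free_algebra_generated:
  assumes N: "submodule N scalars (free_algebra G)" and w: "\<And>u. u \<in> lists G \<Longrightarrow> word u \<in> N"
    and p: "p \<in> carrier (free_algebra G)"
  shows "p \<in> N"
proof (rule free_module_generated[of N "lists G"])
  show "submodule N scalars (free_module_on (lists G))"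
    using N unfolding kmodule.submodule_iff[OF kmodule_free_algebra] kmodule.submodule_iff[OF kmodule_free] by simp
qed (use w p in auto)

lemma linear_word_mult_left: "x \<in> carrier (free_algebra G) \<Longrightarrow> linear_map (free_algebra G) (free_algebra G) (\<lambda>p. word_mult p x)"
  unfolding linear_map_def
  by (intro conjI ballI allI) (auto simp: word_mult_add_left word_mult_scale_left word_mult_assoc simp del: free_algebra_simps(1) intro: word_mult_closed)

lemma word_mult_scale_right: "word_mult x (scale_comb c p) = scale_comb c (word_mult x p)"
proof -
  let ?s = "\<lambda>p. \<Sum>u\<in>Poly_Mapping.keys p. Poly_Mapping.single u (Poly_Mapping.lookup p u)"
  have "word_mult (?s x) (word_mult (Poly_Mapping.single [] c) (?s p)) = word_mult (Poly_Mapping.single [] c) (word_mult (?s x) (?s p))"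
    by (simp only: word_mult_sum_left word_mult_sum_right word_mult_single append_Nil mult.left_commute)
  then show ?thesis by (simp only: poly_mapping_sum_single word_mult_scale_left)
qed

lemma linear_word_mult_right: "x \<in> carrier (free_algebra G) \<Longrightarrow> linear_map (free_algebra G) (free_algebra G) (\<lambda>p. word_mult x p)"
  unfolding linear_map_def
  by (intro conjI ballI allI) (auto simp: word_mult_add_right word_mult_scale_right simp del: free_algebra_simps(1) intro: word_mult_closed)

lemma word_closed: "w \<in> lists G \<Longrightarrow> word w \<in> carrier (free_algebra G)"
  by simp

section \<open>Algebras presented by generators and relations\<close>

context
  fixes G :: "'g set" and R :: "('g list \<Rightarrow>\<^sub>0 'k::comm_ring_1) set"
  assumes R: "R \<subseteq> carrier (free_algebra G)"
begin

abbreviation "FA \<equiv> free_algebra G :: ('k, 'g list \<Rightarrow>\<^sub>0 'k) module"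
abbreviation "RI \<equiv> genideal FA R"
abbreviation "PA \<equiv> presented_algebra G R"

lemma ideal_relations: "ideal RI FA"
  by (rule ring.genideal_ideal[OF ring_free_algebra R])

lemma submodule_relations: "submodule RI scalars FA"
  unfolding kmodule.submodule_iff[OF kmodule_free_algebra]
proof (intro conjI ballI allI)
  interpret I: ideal RI FA by (rule ideal_relations)
  show "RI \<subseteq> carrier FA" using I.a_subset .
  show "\<zero>\<^bsub>FA\<^esub> \<in> RI" by (rule additive_subgroup.zero_closed[OF I.is_additive_subgroup])
  show "x \<oplus>\<^bsub>FA\<^esub> y \<in> RI" if "x \<in> RI" "y \<in> RI" for x y using that by (rule additive_subgroup.a_closed[OF I.is_additive_subgroup])
  show "c \<odot>\<^bsub>FA\<^esub> x \<in> RI" if "x \<in> RI" for c x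
    using I.I_l_closed[OF that, of "Poly_Mapping.single [] c"] by (simp add: word_mult_scale_left)
qed

lemma kmodule_presented: "kmodule PA"
  unfolding presented_algebra_def by (rule kmodule.kmodule_quotient[OF kmodule_free_algebra submodule_relations])

definition word_class :: "'g list \<Rightarrow> ('g list \<Rightarrow>\<^sub>0 'k) set" where
  "word_class w = RI +>\<^bsub>FA\<^esub> word w"

lemma word_class_closed: "w \<in> lists G \<Longrightarrow> word_class w \<in> carrier PA"
  unfolding presented_algebra_def word_class_def kmodule.quot_carrier[OF kmodule_free_algebra submodule_relations]
  by (rule imageI) simp

lemma word_class_mult:
  assumes "u \<in> lists G" "v \<in> lists G" shows "word_class u \<otimes>\<^bsub>PA\<^esub> word_class v = word_class (u @ v)"
  using ideal.rcoset_mult_add[OF ideal_relations, of "word u" "word v"] assms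
  by (simp add: presented_algebra_def word_class_def quotient_module_def FactRing_def)

lemma word_class_relation:
  assumes r: "word x - Poly_Mapping.single y c \<in> R" and G: "u \<in> lists G" "v \<in> lists G" "x \<in> lists G" "y \<in> lists G"
  shows "word_class (u @ x @ v) = c \<odot>\<^bsub>PA\<^esub> word_class (u @ y @ v)"
proof -
  interpret I: ideal RI FA by (rule ideal_relations)
  interpret F: kmodule FA by (rule kmodule_free_algebra)
  have "word x - Poly_Mapping.single y c \<in> RI" using ring.genideal_self[OF ring_free_algebra R] r by blast
  from I.I_l_closed[OF I.I_r_closed[OF this word_closed[OF G(2)]] word_closed[OF G(1)]]
  have "word_mult (word u) (word_mult (word x - Poly_Mapping.single y c) (word v)) \<in> RI" by simp
  moreover have "word_mult (word u) (word_mult (word x - Poly_Mapping.single y c) (word v)) = word (u @ x @ v) - Poly_Mapping.single (u @ y @ v) c"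
  proof -
    have "word x - Poly_Mapping.single y c = word x + Poly_Mapping.single y (- c)" by (simp add: single_uminus)
    then have "word_mult (word u) (word_mult (word x - Poly_Mapping.single y c) (word v)) = word (u @ x @ v) + Poly_Mapping.single (u @ y @ v) (- c)"
      by (simp only: word_mult_add_left word_mult_add_right word_mult_single append_assoc mult_1 mult_1_right)
    then show ?thesis by (simp add: single_uminus)
  qed
  ultimately have d: "word (u @ x @ v) - Poly_Mapping.single (u @ y @ v) c \<in> RI" by simp
  have cl: "word (u @ x @ v) \<in> carrier FA" "word (u @ y @ v) \<in> carrier FA" using G by auto
  have s: "c \<odot>\<^bsub>FA\<^esub> word (u @ y @ v) = Poly_Mapping.single (u @ y @ v) c" by (simp add: scale_comb_single)
  have "word (u @ x @ v) \<ominus>\<^bsub>FA\<^esub> c \<odot>\<^bsub>FA\<^esub> word (u @ y @ v) = word (u @ x @ v) - Poly_Mapping.single (u @ y @ v) c"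
  proof -
    have "\<ominus>\<^bsub>FA\<^esub> Poly_Mapping.single (u @ y @ v) c = Poly_Mapping.single (u @ y @ v) (- c)"
      by (rule I.minus_equality) (use G in \<open>auto simp: single_add[symmetric]\<close>)
    then show ?thesis unfolding s a_minus_def by (simp add: single_uminus)
  qed
  then have "RI +>\<^bsub>FA\<^esub> word (u @ x @ v) = RI +>\<^bsub>FA\<^esub> (c \<odot>\<^bsub>FA\<^esub> word (u @ y @ v))"
    using d by (subst F.coset_eq_iff[OF submodule_relations cl(1) F.smult_closed[OF cl(2)]]) simp
  then show ?thesis
    by (simp only: presented_algebra_def word_class_def F.quot_smult[OF submodule_relations cl(2)])
qed

end

definition scalar_module :: "('k::comm_ring_1, 'k) module" where
  "scalar_module = \<lparr>carrier = UNIV, monoid.mult = (*), monoid.one = 1, ring.zero = 0, ring.add = (+), smult = (*)\<rparr>"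

lemma scalar_module_simps [simp]:
  "carrier scalar_module = UNIV" "\<zero>\<^bsub>scalar_module\<^esub> = 0" "x \<oplus>\<^bsub>scalar_module\<^esub> y = x + y" "c \<odot>\<^bsub>scalar_module\<^esub> x = c * x"
  by (simp_all add: scalar_module_def)

lemma kmodule_scalar: "kmodule scalar_module"
  by (rule kmoduleI) (auto simp: algebra_simps)

abbreviation word_functional :: "('g list \<Rightarrow> 'k::comm_ring_1) \<Rightarrow> ('g list \<Rightarrow>\<^sub>0 'k) \<Rightarrow> 'k" where
  "word_functional f \<equiv> lin_ext scalar_module f"

lemma linear_word_functional: "linear_map (free_algebra G) scalar_module (word_functional f)"
  unfolding linear_map_free_algebra by (rule linear_lin_ext[OF kmodule_scalar]) simp

lemma word_functional_single [simp]: "word_functional f (Poly_Mapping.single w c) = c * f w"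
  by (simp add: lin_ext_single[OF kmodule_scalar])

lemma word_functional_diff: "word_functional f (p - q) = word_functional f p - word_functional f q"
proof -
  have l: "linear_map (free_algebra UNIV) scalar_module (word_functional f)" by (rule linear_word_functional)
  have "word_functional f ((p - q) + q) = word_functional f (p - q) + word_functional f q"
    using linear_map_add[OF l, of "p - q" q] by simp
  then show ?thesis by simp
qed

text \<open>
  A functional on words descends to the presented algebra if it kills \<open>u r v\<close> for every relator \<open>r\<close> and all words \<open>u\<close>, \<open>v\<close>:
  such products span the ideal.
\<close>

lemma presented_functional:
  fixes R :: "('g list \<Rightarrow>\<^sub>0 'k::comm_ring_1) set" and G :: "'g set"
  assumes R: "R \<subseteq> carrier (free_algebra G)"
    and v: "\<And>r u v. r \<in> R \<Longrightarrow> u \<in> lists G \<Longrightarrow> v \<in> lists G \<Longrightarrow> word_functional (\<lambda>w. f (u @ w @ v)) r = 0"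
  shows "\<exists>\<phi>. linear_map (presented_algebra G R) scalar_module \<phi> \<and> (\<forall>w\<in>lists G. \<phi> (word_class G R w) = f w)"
proof -
  let ?F = "free_algebra G :: ('k, 'g list \<Rightarrow>\<^sub>0 'k) module"
  interpret F: kmodule ?F by (rule kmodule_free_algebra)
  let ?\<phi> = "\<lambda>u v. word_functional (\<lambda>w. f (u @ w @ v))"
  define N where "N = {p \<in> carrier ?F. \<forall>u\<in>lists G. \<forall>v\<in>lists G. ?\<phi> u v p = 0}"
  have L: "linear_map ?F scalar_module (?\<phi> u v)" for u v by (rule linear_word_functional)
  have N: "submodule N scalars ?F"
    unfolding F.submodule_iff N_def
    using linear_map_add[OF L] linear_map_smult[OF L] linear_map_zero[OF kmodule_free_algebra kmodule_scalar L] F.a_closed F.smult_closed F.zero_closed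
    by (simp del: free_algebra_simps(1))
  have eqI: "f p = g p" if "linear_map ?F scalar_module f" "linear_map ?F scalar_module g" "\<And>w. w \<in> lists G \<Longrightarrow> f (word w) = g (word w)" "p \<in> carrier ?F"
    for f g :: "('g list \<Rightarrow>\<^sub>0 'k) \<Rightarrow> 'k" and p
    using free_module_eqI[OF kmodule_scalar, of "lists G" f g p] that by (simp add: linear_map_free_algebra)
  have left: "word_mult x p \<in> N" if p: "p \<in> N" and x: "x \<in> carrier ?F" for x p
  proof -
    have pc: "p \<in> carrier ?F" using p by (simp add: N_def)
    have "?\<phi> u v (word_mult x p) = 0" if uv: "u \<in> lists G" "v \<in> lists G" for u v
    proof -
      have "x \<in> {x \<in> carrier ?F. ?\<phi> u v (word_mult x p) = 0}"
      proof (rule free_algebra_generated[OF _ _ x])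
        show "submodule {x \<in> carrier ?F. ?\<phi> u v (word_mult x p) = 0} scalars ?F"
          using linear_map_kernel_submodule[OF kmodule_free_algebra kmodule_scalar linear_map_compose[OF linear_word_mult_left[OF pc] L]] by simp
        fix w assume w: "w \<in> lists G"
        have "?\<phi> u v (word_mult (word w) p) = ?\<phi> (u @ w) v p"
          by (rule eqI[OF linear_map_compose[OF linear_word_mult_right[OF word_closed[OF w]] L] L _ pc]) simp
        also have "\<dots> = 0" using p[unfolded N_def, THEN CollectD, THEN conjunct2, rule_format, of "u @ w" v] uv w by simp
        finally show "word w \<in> {x \<in> carrier ?F. ?\<phi> u v (word_mult x p) = 0}" using w by simp
      qed
      then show ?thesis by simp
    qed
    then show ?thesis using word_mult_closed[OF x pc] by (simp add: N_def)
  qed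
  have right: "word_mult p x \<in> N" if p: "p \<in> N" and x: "x \<in> carrier ?F" for x p
  proof -
    have pc: "p \<in> carrier ?F" using p by (simp add: N_def)
    have "?\<phi> u v (word_mult p x) = 0" if uv: "u \<in> lists G" "v \<in> lists G" for u v
    proof -
      have "x \<in> {x \<in> carrier ?F. ?\<phi> u v (word_mult p x) = 0}"
      proof (rule free_algebra_generated[OF _ _ x])
        show "submodule {x \<in> carrier ?F. ?\<phi> u v (word_mult p x) = 0} scalars ?F"
          using linear_map_kernel_submodule[OF kmodule_free_algebra kmodule_scalar linear_map_compose[OF linear_word_mult_right[OF pc] L]] by simp
        fix w assume w: "w \<in> lists G"
        have "?\<phi> u v (word_mult p (word w)) = ?\<phi> u (w @ v) p"
          by (rule eqI[OF linear_map_compose[OF linear_word_mult_left[OF word_closed[OF w]] L] L _ pc]) simp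
        also have "\<dots> = 0" using p[unfolded N_def, THEN CollectD, THEN conjunct2, rule_format, of u "w @ v"] uv w by simp
        finally show "word w \<in> {x \<in> carrier ?F. ?\<phi> u v (word_mult p x) = 0}" using w by simp
      qed
      then show ?thesis by simp
    qed
    then show ?thesis using word_mult_closed[OF pc x] by (simp add: N_def)
  qed
  have "ideal N ?F"
    by (rule idealI[OF ring_free_algebra]) (use N left right in \<open>auto simp: submodule_def\<close>)
  moreover have "R \<subseteq> N"
  proof
    fix r assume r: "r \<in> R"
    then have "r \<in> carrier ?F" using R by blast
    then show "r \<in> N" using v[OF r] unfolding N_def by blast
  qed
  ultimately have IN: "genideal ?F R \<subseteq> N" by (rule ring.genideal_minimal[OF ring_free_algebra])
  have "\<exists>\<phi>. linear_map (quotient_module ?F (genideal ?F R)) scalar_module \<phi> \<and> (\<forall>x\<in>carrier ?F. \<phi> (genideal ?F R +>\<^bsub>?F\<^esub> x) = word_functional f x)"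
  proof (rule F.quot_lift[OF submodule_relations[OF R] kmodule_scalar linear_word_functional])
    fix x assume "x \<in> genideal ?F R"
    then have "\<forall>u\<in>lists G. \<forall>v\<in>lists G. ?\<phi> u v x = 0" using subsetD[OF IN] unfolding N_def by blast
    from this[rule_format, of "[]" "[]"] show "word_functional f x = \<zero>\<^bsub>scalar_module\<^esub>" by simp
  qed
  then obtain \<phi> where \<phi>: "linear_map (quotient_module ?F (genideal ?F R)) scalar_module \<phi>"
    "\<And>x. x \<in> carrier ?F \<Longrightarrow> \<phi> (genideal ?F R +>\<^bsub>?F\<^esub> x) = word_functional f x" by blast
  have "\<phi> (word_class G R w) = f w" if "w \<in> lists G" for w
    unfolding word_class_def[OF R] \<phi>(2)[OF word_closed[OF that]] by simp
  then show ?thesis using \<phi>(1) unfolding presented_algebra_def by blast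
qed


section \<open>Algebras with a basis of signed monomials\<close>

text \<open>
  The common form of \<open>R(K)\<close> and \<open>B(K)\<close>.  The letters \<open>a i\<close> stand for \<open>\<omega>\<^sub>i\<close> or \<open>s\<^sub>i\<close>, and \<open>b i\<close> for \<open>y\<^sub>i\<close> or \<open>t\<^sub>i\<close>.  Two letters
  with different indices commute up to the sign \<open>sa\<close> (for \<open>a\<close>, \<open>a\<close>), \<open>sb\<close> (for \<open>b\<close>, \<open>b\<close>) or \<open>1\<close>; the constant \<open>\<epsilon>\<close> records whether
  a letter \<open>a i\<close> that follows \<open>a i\<close> or \<open>b i\<close> is absorbed (\<open>\<epsilon> = 1\<close>, in \<open>B(K)\<close>) or kills the word (\<open>\<epsilon> = 0\<close>, in \<open>R(K)\<close>).  If letters are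
  absorbed, moving them must not produce signs, which is the last condition.
\<close>

locale signed_monomials =
  fixes m :: nat and K :: "nat set set" and a b :: "nat \<Rightarrow> 'g" and sa sb \<epsilon> :: "'k::comm_ring_1"
  assumes K: "simplicial_complex_on m K"
    and inj_a: "a i = a j \<longleftrightarrow> i = j" and inj_b: "b i = b j \<longleftrightarrow> i = j" and a_neq_b: "a i \<noteq> b j"
    and signs: "sa = 1 \<or> sa = - 1" "sb = 1 \<or> sb = - 1" and \<epsilon>: "\<epsilon> = 0 \<or> \<epsilon> = 1" "\<epsilon> = 0 \<or> sa = 1"
begin

inductive relation :: "'g list \<Rightarrow> 'g list \<Rightarrow> 'k \<Rightarrow> bool" where
  aa: "i \<in> {1..m} \<Longrightarrow> j \<in> {1..m} \<Longrightarrow> i \<noteq> j \<Longrightarrow> relation [a i, a j] [a j, a i] sa"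
| bb: "i \<in> {1..m} \<Longrightarrow> j \<in> {1..m} \<Longrightarrow> i \<noteq> j \<Longrightarrow> relation [b i, b j] [b j, b i] sb"
| ab_comm: "i \<in> {1..m} \<Longrightarrow> j \<in> {1..m} \<Longrightarrow> i \<noteq> j \<Longrightarrow> relation [a i, b j] [b j, a i] 1"
| a2: "i \<in> {1..m} \<Longrightarrow> relation [a i, a i] [a i] \<epsilon>"
| ba: "i \<in> {1..m} \<Longrightarrow> relation [b i, a i] [b i] \<epsilon>"
| ab0: "i \<in> {1..m} \<Longrightarrow> relation [a i, b i] [] 0"
| b2: "i \<in> {1..m} \<Longrightarrow> relation [b i, b i] [] 0"
| face: "\<sigma> \<subseteq> {1..m} \<Longrightarrow> \<sigma> \<notin> K \<Longrightarrow> relation (map b (sorted_list_of_set \<sigma>)) [] 0"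

definition relators :: "('g list \<Rightarrow>\<^sub>0 'k) set" where
  "relators = {word x - Poly_Mapping.single y c | x y c. relation x y c}"

definition Gen :: "'g set" where "Gen = a ` {1..m} \<union> b ` {1..m}"

lemma Gen_simps [simp]: "a i \<in> Gen \<longleftrightarrow> i \<in> {1..m}" "b i \<in> Gen \<longleftrightarrow> i \<in> {1..m}"
proof -
  show "a i \<in> Gen \<longleftrightarrow> i \<in> {1..m}" unfolding Gen_def using inj_a a_neq_b by (metis Un_iff imageE imageI)
  show "b i \<in> Gen \<longleftrightarrow> i \<in> {1..m}" unfolding Gen_def using inj_b a_neq_b by (metis Un_iff imageE imageI)
qed

lemma Gen_cases: "g \<in> Gen \<Longrightarrow> \<exists>i\<in>{1..m}. g = a i \<or> g = b i"
  by (auto simp: Gen_def)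

lemma relation_words: "relation x y c \<Longrightarrow> x \<in> lists Gen \<and> y \<in> lists Gen"
proof (induction rule: relation.induct)
  case (face \<sigma>)
  then show ?case using finite_subset[OF face(1)] by (auto simp: subset_iff)
qed auto

lemma relators_closed: "relators \<subseteq> carrier (free_algebra Gen)"
proof -
  have "Poly_Mapping.keys (word x - Poly_Mapping.single y c :: 'g list \<Rightarrow>\<^sub>0 'k) \<subseteq> {x, y}" for x y c
    by (auto simp: in_keys_iff lookup_minus lookup_single when_def split: if_splits)
  moreover have "{x, y} \<subseteq> lists Gen" if "relation x y c" for x y c using relation_words[OF that] by simp
  ultimately have "Poly_Mapping.keys (word x - Poly_Mapping.single y c :: 'g list \<Rightarrow>\<^sub>0 'k) \<subseteq> lists Gen" if "relation x y c" for x y c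
    using that by (meson order_trans)
  then show ?thesis unfolding relators_def free_algebra_simps(1) by blast
qed

definition signed_algebra :: "('k, ('g list \<Rightarrow>\<^sub>0 'k) set) module" where "signed_algebra = presented_algebra Gen relators"
definition word_cl :: "'g list \<Rightarrow> ('g list \<Rightarrow>\<^sub>0 'k) set" where "word_cl = word_class Gen relators"

lemma K_subset: "L \<in> K \<Longrightarrow> L \<subseteq> {1..m}" and K_down: "L \<in> K \<Longrightarrow> S \<subseteq> L \<Longrightarrow> S \<in> K" and K_empty: "{} \<in> K"
  using K by (auto simp: simplicial_complex_on_def)

lemma kmodule_signed_algebra: "kmodule signed_algebra"
  unfolding signed_algebra_def by (rule kmodule_presented[OF relators_closed])

text \<open>
  The right action of a letter on a signed monomial, given by a coefficient and two index sets.  The sign counts the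
  letters of the same kind that the new letter has to pass to reach its place.  A product that vanishes because of
  a repeated index or of a missing face keeps its index sets and gets the coefficient \<open>0\<close>.
\<close>

definition act :: "'k \<times> nat set \<times> nat set \<Rightarrow> 'g \<Rightarrow> 'k \<times> nat set \<times> nat set" where
  "act = (\<lambda>(c, I, L) g.
     if g \<in> range a then
       (let i = inv_into UNIV a g in if i \<in> I \<union> L then (\<epsilon> * c, I, L) else (sa ^ card {j \<in> I. i < j} * c, insert i I, L))
     else
       (let i = inv_into UNIV b g in if i \<in> I \<union> L \<or> insert i L \<notin> K then (0, I, L) else (sb ^ card {j \<in> L. i < j} * c, I, insert i L)))"

lemma act_a: "act (c, I, L) (a i) = (if i \<in> I \<union> L then (\<epsilon> * c, I, L) else (sa ^ card {j \<in> I. i < j} * c, insert i I, L))"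
  using inj_a by (simp add: act_def inv_f_f inj_def)

lemma act_b: "act (c, I, L) (b i) = (if i \<in> I \<union> L \<or> insert i L \<notin> K then (0, I, L) else (sb ^ card {j \<in> L. i < j} * c, I, insert i L))"
proof -
  have "b i \<notin> range a" using a_neq_b[of _ i] by (metis rangeE)
  then show ?thesis using inj_b by (simp add: act_def inv_f_f inj_def)
qed

definition run :: "'k \<times> nat set \<times> nat set \<Rightarrow> 'g list \<Rightarrow> 'k \<times> nat set \<times> nat set" where
  "run s w = foldl act s w"

lemma run_simps [simp]: "run s [] = s" "run s (g # w) = run (act s g) w" "run s (u @ v) = run (run s u) v"
  by (simp_all add: run_def)

lemma act_scale: "act (k * c, I, L) g = (let (c', I', L') = act (c, I, L) g in (k * c', I', L'))"
  by (auto simp: act_def Let_def mult_ac)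

lemma run_scale: "run (k * c, I, L) w = (let (c', I', L') = run (c, I, L) w in (k * c', I', L'))"
proof (induction w arbitrary: c I L)
  case (Cons g w)
  obtain c' I' L' where "act (c, I, L) g = (c', I', L')" by (cases "act (c, I, L) g")
  then show ?case using Cons by (simp add: act_scale)
qed simp

definition coefficient :: "nat set \<Rightarrow> nat set \<Rightarrow> 'k \<times> nat set \<times> nat set \<Rightarrow> 'k" where
  "coefficient I0 L0 = (\<lambda>(c, I, L). if I = I0 \<and> L = L0 then c else 0)"

lemma coefficient_scale: "coefficient I0 L0 (run (k * c, I, L) w) = k * coefficient I0 L0 (run (c, I, L) w)"
  by (cases "run (c, I, L) w") (simp add: run_scale coefficient_def)

lemma coefficient_zero: "coefficient I0 L0 (run (0, I, L) w) = 0"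
  using coefficient_scale[of I0 L0 0 0 I L w] by simp

lemma run_b_faces:
  "run (c, I, L) (map b xs) = (c', I', L') \<Longrightarrow> xs \<noteq> [] \<Longrightarrow> c' = 0 \<or> L \<union> set xs \<in> K"
proof (induction xs arbitrary: c L)
  case (Cons i xs)
  show ?case
  proof (cases "i \<in> I \<union> L \<or> insert i L \<notin> K")
    case True
    then have "run (0, I, L) (map b xs) = (c', I', L')" using Cons.prems by (simp add: act_b)
    then have "c' = 0" using run_scale[of 0 0 I L "map b xs"] by (cases "run (0, I, L) (map b xs)") simp
    then show ?thesis by simp
  next
    case False
    then have r: "run (sb ^ card {j \<in> L. i < j} * c, I, insert i L) (map b xs) = (c', I', L')" using Cons.prems by (simp add: act_b)
    show ?thesis
    proof (cases "xs = []")
      case True then show ?thesis using False by simp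
    next
      case False
      then show ?thesis using Cons.IH[OF r] by simp
    qed
  qed
qed simp

lemma card_greater_insert:
  "finite I \<Longrightarrow> i \<notin> I \<Longrightarrow> card {k \<in> insert i I. j < k} = card {k \<in> I. j < k} + of_bool (j < i)"
proof -
  assume I: "finite I" "i \<notin> I"
  have "{k \<in> insert i I. j < k} = (if j < i then insert i {k \<in> I. j < k} else {k \<in> I. j < k})" by auto
  then show ?thesis using I by simp
qed

lemma sign_square: "sa * sa = 1" "sb * sb = 1"
  using signs by auto

lemma sign_square_left: "sa * (sa * x) = x" "sb * (sb * x) = x"
  by (simp_all only: sign_square mult.assoc[symmetric] mult_1)

lemma eps_sign: "sa * (\<epsilon> * x) = \<epsilon> * x" "\<epsilon> * (sa * x) = \<epsilon> * x" "\<epsilon> * (\<epsilon> * x) = \<epsilon> * x"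
  using \<epsilon> by auto

text \<open>
  Every defining relation holds for the action on signed monomials.  The index sets on the two sides may
  differ if the coefficients are zero.
\<close>

lemma relation_run:
  assumes rel: "relation x y k" and fin: "finite I" "finite L"
  obtains c1 c2 P Q where "run (c, I, L) x = (c1, P)" "run (c, I, L) y = (c2, Q)" "P = Q \<and> c1 = k * c2 \<or> c1 = 0 \<and> k * c2 = 0"
proof -
  have "\<exists>c1 c2 P Q. run (c, I, L) x = (c1, P) \<and> run (c, I, L) y = (c2, Q) \<and> (P = Q \<and> c1 = k * c2 \<or> c1 = 0 \<and> k * c2 = 0)"
    using rel
  proof cases
    case (aa i j)
    have "sa ^ card {k \<in> insert i I. j < k} * (sa ^ card {k \<in> I. i < k} * c) =
        sa * (sa ^ card {k \<in> insert j I. i < k} * (sa ^ card {k \<in> I. j < k} * c))" if "i \<notin> I" "j \<notin> I"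
    proof -
      have ij: "i < j \<or> j < i" using aa by linarith
      show ?thesis
        unfolding card_greater_insert[OF fin(1) that(1)] card_greater_insert[OF fin(1) that(2)]
        by (rule disjE[OF ij]) (simp_all add: mult_ac sign_square_left)
    qed
    note main = this
    have same: ?thesis if "run (c, I, L) x = (k * c2, P)" "run (c, I, L) y = (c2, P)" for c2 P
      using that by blast
    consider "i \<in> I \<union> L" "j \<in> I \<union> L" | "i \<in> I \<union> L" "j \<notin> I \<union> L" | "i \<notin> I \<union> L" "j \<in> I \<union> L" | "i \<notin> I \<union> L" "j \<notin> I \<union> L" by blast
    then show ?thesis
    proof cases
      case 1
      then show ?thesis by (intro same[of "\<epsilon> * (\<epsilon> * c)" "(I, L)"]) (auto simp: aa act_a eps_sign)
    next
      case 2
      then show ?thesis using aa \<epsilon>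
        by (intro same[of "\<epsilon> * (sa ^ card {k \<in> I. j < k} * c)" "(insert j I, L)"]) (auto simp: act_a)
    next
      case 3
      then show ?thesis using aa \<epsilon>
        by (intro same[of "sa ^ card {k \<in> I. i < k} * (\<epsilon> * c)" "(insert i I, L)"]) (auto simp: act_a)
    next
      case 4
      have "run (c, I, L) x = (sa ^ card {k \<in> insert i I. j < k} * (sa ^ card {k \<in> I. i < k} * c), insert i (insert j I), L)"
        using 4 aa by (simp add: act_a insert_commute del: insert_iff) simp
      moreover have "run (c, I, L) y = (sa ^ card {k \<in> insert j I. i < k} * (sa ^ card {k \<in> I. j < k} * c), insert i (insert j I), L)"
        using 4 aa by (simp add: act_a del: insert_iff) simp
      ultimately show ?thesis using main 4 aa(3) by (intro same) auto
    qed
  next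
    case (bb i j)
    have "sb ^ card {k \<in> insert i L. j < k} * (sb ^ card {k \<in> L. i < k} * c) =
        sb * (sb ^ card {k \<in> insert j L. i < k} * (sb ^ card {k \<in> L. j < k} * c))" if "i \<notin> L" "j \<notin> L"
    proof -
      have ij: "i < j \<or> j < i" using bb by linarith
      show ?thesis
        unfolding card_greater_insert[OF fin(2) that(1)] card_greater_insert[OF fin(2) that(2)]
        by (rule disjE[OF ij]) (simp_all add: mult_ac sign_square_left)
    qed
    moreover have "insert i L \<in> K \<and> insert j L \<in> K" if "insert j (insert i L) \<in> K" using that K_down by blast
    ultimately show ?thesis using bb by (auto simp: act_b insert_commute)
  next
    case (ab_comm i j)
    then show ?thesis by (auto simp: act_a act_b mult_ac)
  next
    case (a2 i)
    then show ?thesis by (auto simp: act_a)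
  next
    case (ba i)
    then show ?thesis by (auto simp: act_a act_b)
  next
    case (ab0 i)
    then show ?thesis by (auto simp: act_a act_b)
  next
    case (b2 i)
    then show ?thesis by (auto simp: act_b)
  next
    case (face \<sigma>)
    have fs: "finite \<sigma>" using face finite_subset by blast
    obtain c' I' L' where r: "run (c, I, L) x = (c', I', L')" by (cases "run (c, I, L) x")
    have "sorted_list_of_set \<sigma> \<noteq> []" using face K_empty fs by (metis sorted_list_of_set_eq_Nil_iff)
    from run_b_faces[OF r[unfolded face(1)] this] have "c' = 0"
      using face K_down[of "L \<union> \<sigma>" \<sigma>] fs by auto
    then show ?thesis using r face by auto
  qed
  then show ?thesis using that by blast
qed

lemma run_finite: "finite I \<Longrightarrow> finite L \<Longrightarrow> run (c, I, L) w = (c', I', L') \<Longrightarrow> w \<in> lists Gen \<Longrightarrow> finite I' \<and> finite L'"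
proof (induction w arbitrary: c I L)
  case (Cons g w)
  obtain i where i: "g = a i \<or> g = b i" using Cons.prems Gen_cases[of g] by auto
  obtain c1 I1 L1 where s: "act (c, I, L) g = (c1, I1, L1)" by (cases "act (c, I, L) g")
  then have "finite I1 \<and> finite L1" using i Cons.prems(1,2) by (elim disjE) (auto simp: act_a act_b split: if_splits)
  then show ?case using Cons.IH[of I1 L1 c1] Cons.prems s by simp
qed simp

text \<open>
  The coefficient of a fixed monomial, after a word has acted on the empty monomial, depends only on the class of the word in
  the presented algebra.  These functionals separate the monomials.
\<close>

lemma monomial_functional:
  "\<exists>\<phi>. linear_map signed_algebra scalar_module \<phi> \<and> (\<forall>w\<in>lists Gen. \<phi> (word_cl w) = coefficient I0 L0 (run (1, {}, {}) w))"
  unfolding signed_algebra_def word_cl_def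
proof (rule presented_functional[OF relators_closed])
  fix r u v assume "r \<in> relators" and uv: "u \<in> lists Gen" "v \<in> lists Gen"
  then obtain x y k where r: "r = word x - Poly_Mapping.single y k" "relation x y k" by (auto simp: relators_def)
  obtain c I L where s: "run (1, {}, {}) u = (c, I, L)" by (cases "run (1, {}, {}) u")
  have fin: "finite I" "finite L" using run_finite[OF _ _ s uv(1)] by auto
  obtain c1 c2 P Q where p: "run (c, I, L) x = (c1, P)" "run (c, I, L) y = (c2, Q)" "P = Q \<and> c1 = k * c2 \<or> c1 = 0 \<and> k * c2 = 0"
    using relation_run[OF r(2) fin] by metis
  have "coefficient I0 L0 (run (c1, P) v) = k * coefficient I0 L0 (run (c2, Q) v)"
  proof -
    obtain P1 P2 Q1 Q2 where PQ: "P = (P1, P2)" "Q = (Q1, Q2)" by (cases P; cases Q)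
    from p(3) show ?thesis
    proof
      assume "P = Q \<and> c1 = k * c2"
      then show ?thesis by (simp add: PQ coefficient_scale)
    next
      assume "c1 = 0 \<and> k * c2 = 0"
      then show ?thesis using coefficient_zero[of I0 L0 _ _ v] coefficient_scale[of I0 L0 k c2 Q1 Q2 v] by (simp add: PQ)
    qed
  qed
  then show "word_functional (\<lambda>w. coefficient I0 L0 (run (1, {}, {}) (u @ w @ v))) r = 0"
    by (simp add: r(1) word_functional_diff s p)
qed

definition mon_word :: "nat set \<Rightarrow> nat set \<Rightarrow> 'g list" where
  "mon_word I L = map a (sorted_list_of_set I) @ map b (sorted_list_of_set L)"

definition mon :: "nat set \<Rightarrow> nat set \<Rightarrow> ('g list \<Rightarrow>\<^sub>0 'k) set" where
  "mon I L = word_cl (mon_word I L)"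

lemma mon_word_closed: "I \<subseteq> {1..m} \<Longrightarrow> L \<subseteq> {1..m} \<Longrightarrow> mon_word I L \<in> lists Gen"
  using finite_subset[of I "{1..m}"] finite_subset[of L "{1..m}"] by (auto simp: mon_word_def subset_iff)

lemma mon_word_basis: "basis_index m K I L \<Longrightarrow> mon_word I L \<in> lists Gen"
  using K_subset[of L] by (intro mon_word_closed) (simp_all add: basis_index_def)

lemma run_sorted_a: "sorted_wrt (<) xs \<Longrightarrow> run (c, {}, {}) (map a xs) = (c, set xs, {})"
proof (induction xs rule: rev_induct)
  case (snoc x xs)
  then have lt: "\<forall>y\<in>set xs. y < x" by (simp add: sorted_wrt_append)
  then have e: "{j \<in> set xs. x < j} = {}" "x \<notin> set xs" by auto
  show ?case using snoc by (simp add: sorted_wrt_append act_a e del: Collect_empty_eq)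
qed simp

lemma run_sorted_b:
  "sorted_wrt (<) xs \<Longrightarrow> I \<inter> set xs = {} \<Longrightarrow> set xs \<in> K \<Longrightarrow> run (c, I, {}) (map b xs) = (c, I, set xs)"
proof (induction xs rule: rev_induct)
  case (snoc x xs)
  then have lt: "\<forall>y\<in>set xs. y < x" by (simp add: sorted_wrt_append)
  have e: "{j \<in> set xs. x < j} = {}" "x \<notin> set xs" using lt by auto
  have "set xs \<in> K" using snoc.prems(3) K_down by (metis set_append sup_ge1)
  then show ?case using snoc by (simp add: sorted_wrt_append act_b e del: Collect_empty_eq)
qed simp

lemma run_mon_word:
  assumes "basis_index m K I L" shows "run (1, {}, {}) (mon_word I L) = (1, I, L)"
proof -
  have f: "finite I" "finite L" "I \<inter> L = {}" "L \<in> K"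
    using assms K_subset[of L] by (auto simp: basis_index_def intro: finite_subset)
  then show ?thesis unfolding mon_word_def using run_sorted_a[of "sorted_list_of_set I" 1] run_sorted_b[of "sorted_list_of_set L" I 1]
    by simp
qed

lemma mon_coordinate:
  assumes "basis_index m K I L"
  shows "\<exists>\<phi>. (\<forall>x\<in>carrier signed_algebra. \<forall>y\<in>carrier signed_algebra. \<phi> (x \<oplus>\<^bsub>signed_algebra\<^esub> y) = \<phi> x + \<phi> y) \<and>
      (\<forall>c. \<forall>x\<in>carrier signed_algebra. \<phi> (c \<odot>\<^bsub>signed_algebra\<^esub> x) = c * \<phi> x) \<and>
      (\<forall>I' L'. basis_index m K I' L' \<longrightarrow> \<phi> (mon I' L') = of_bool (I = I' \<and> L = L'))"
proof -
  obtain \<phi> where \<phi>: "linear_map signed_algebra scalar_module \<phi>" "\<And>w. w \<in> lists Gen \<Longrightarrow> \<phi> (word_cl w) = coefficient I L (run (1, {}, {}) w)"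
    using monomial_functional by blast
  have "\<phi> (mon I' L') = of_bool (I = I' \<and> L = L')" if b: "basis_index m K I' L'" for I' L'
  proof -
    show ?thesis unfolding mon_def \<phi>(2)[OF mon_word_basis[OF b]] run_mon_word[OF b] coefficient_def
      by (cases "I = I' \<and> L = L'") auto
  qed
  then show ?thesis using linear_map_add[OF \<phi>(1)] linear_map_smult[OF \<phi>(1)] by (intro exI[of _ \<phi>]) simp
qed

subsection \<open>Products of monomials\<close>

definition sign_equal :: "('g list \<Rightarrow>\<^sub>0 'k) set \<Rightarrow> ('g list \<Rightarrow>\<^sub>0 'k) set \<Rightarrow> bool" where
  "sign_equal x y \<longleftrightarrow> x \<in> carrier signed_algebra \<and> y \<in> carrier signed_algebra \<and> (\<exists>c. (c = 1 \<or> c = - 1) \<and> x = c \<odot>\<^bsub>signed_algebra\<^esub> y)"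

lemma sign_equal_refl: "x \<in> carrier signed_algebra \<Longrightarrow> sign_equal x x"
  using kmodule.smult_one[OF kmodule_signed_algebra] by (auto simp: sign_equal_def)

lemma sign_equal_trans: "sign_equal x y \<Longrightarrow> sign_equal y z \<Longrightarrow> sign_equal x z"
  unfolding sign_equal_def using kmodule.smult_assoc[OF kmodule_signed_algebra, of z, symmetric] by auto

lemma sign_equal_zero: "sign_equal x \<zero>\<^bsub>signed_algebra\<^esub> \<Longrightarrow> x = \<zero>\<^bsub>signed_algebra\<^esub>"
  unfolding sign_equal_def using kmodule.smult_zero_right[OF kmodule_signed_algebra] by auto

lemma word_cl_closed: "w \<in> lists Gen \<Longrightarrow> word_cl w \<in> carrier signed_algebra"
  unfolding signed_algebra_def word_cl_def by (rule word_class_closed[OF relators_closed])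

lemma word_cl_relation: "relation x y c \<Longrightarrow> u \<in> lists Gen \<Longrightarrow> v \<in> lists Gen \<Longrightarrow> word_cl (u @ x @ v) = c \<odot>\<^bsub>signed_algebra\<^esub> word_cl (u @ y @ v)"
  unfolding signed_algebra_def word_cl_def using relation_words[of x y c] by (intro word_class_relation[OF relators_closed]) (auto simp: relators_def)

lemma word_cl_relation_zero:
  assumes "relation x y 0" "u \<in> lists Gen" "v \<in> lists Gen" shows "word_cl (u @ x @ v) = \<zero>\<^bsub>signed_algebra\<^esub>"
proof -
  have "u @ y @ v \<in> lists Gen" using relation_words[OF assms(1)] assms by simp
  then show ?thesis using word_cl_relation[OF assms] kmodule.smult_zero_left[OF kmodule_signed_algebra word_cl_closed] by simp
qed

definition index :: "'g \<Rightarrow> nat" where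
  "index g = (if g \<in> range a then inv_into UNIV a g else inv_into UNIV b g)"

lemma index_simps [simp]: "index (a i) = i" "index (b i) = i"
proof -
  have "b i \<notin> range a" using a_neq_b[of _ i] by (metis rangeE)
  then show "index (a i) = i" "index (b i) = i" using inj_a inj_b by (simp_all add: index_def inv_f_f inj_def)
qed

lemma sign_equal_swap:
  assumes g: "g \<in> Gen" "h \<in> Gen" "index g \<noteq> index h" and uv: "u \<in> lists Gen" "v \<in> lists Gen"
  shows "sign_equal (word_cl (u @ [g, h] @ v)) (word_cl (u @ [h, g] @ v))"
proof -
  have c: "word_cl (u @ [g, h] @ v) \<in> carrier signed_algebra" "word_cl (u @ [h, g] @ v) \<in> carrier signed_algebra" using g uv by (auto intro!: word_cl_closed)
  have "\<exists>c. (c = 1 \<or> c = - 1) \<and> (relation [g, h] [h, g] c \<or> relation [h, g] [g, h] c \<and> c = 1)"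
  proof -
    obtain i j where i: "i \<in> {1..m}" "g = a i \<or> g = b i" and j: "j \<in> {1..m}" "h = a j \<or> h = b j"
      using Gen_cases[OF g(1)] Gen_cases[OF g(2)] by blast
    have ij: "i \<noteq> j" using g(3) i(2) j(2) by auto
    note rel = relation.aa[OF i(1) j(1) ij] relation.bb[OF i(1) j(1) ij] relation.ab_comm[OF i(1) j(1) ij] relation.ab_comm[OF j(1) i(1) not_sym[OF ij]]
    from i(2) j(2) show ?thesis using rel signs by (elim disjE) metis+
  qed
  then obtain k where k: "k = 1 \<or> k = - 1" "relation [g, h] [h, g] k \<or> relation [h, g] [g, h] k \<and> k = 1" by blast
  from k(2) show ?thesis
  proof
    assume "relation [g, h] [h, g] k"
    from word_cl_relation[OF this uv] show ?thesis using c k(1) by (auto simp: sign_equal_def)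
  next
    assume r: "relation [h, g] [g, h] k \<and> k = 1"
    then have "relation [h, g] [g, h] 1" by metis
    from word_cl_relation[OF this uv] show ?thesis using c kmodule.smult_one[OF kmodule_signed_algebra] by (auto simp: sign_equal_def)
  qed
qed

text \<open>
  A letter can be moved past letters with other indices.  The next lemmas use this to bring a new letter to its place in a
  sorted monomial, or next to the letter with the same index.
\<close>

lemma sign_equal_move:
  assumes "w \<in> lists Gen" "g \<in> Gen" "\<forall>h\<in>set w. index h \<noteq> index g" "u \<in> lists Gen" "v \<in> lists Gen"
  shows "sign_equal (word_cl (u @ w @ [g] @ v)) (word_cl (u @ [g] @ w @ v))"
  using assms
proof (induction w arbitrary: v rule: rev_induct)
  case Nil then show ?case by (auto intro!: sign_equal_refl word_cl_closed)
next
  case (snoc h w)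
  have 1: "sign_equal (word_cl ((u @ w) @ [h, g] @ v)) (word_cl ((u @ w) @ [g, h] @ v))" using snoc.prems by (intro sign_equal_swap) auto
  have 2: "sign_equal (word_cl (u @ w @ [g] @ ([h] @ v))) (word_cl (u @ [g] @ w @ ([h] @ v)))" using snoc.prems by (intro snoc.IH) auto
  show ?case using sign_equal_trans[OF 1, of "word_cl (u @ [g] @ (w @ [h]) @ v)"] 2 by simp
qed

lemma sorted_split_member:
  assumes "finite I" "i \<in> I"
  obtains xs ys where "sorted_list_of_set I = xs @ [i] @ ys" "i \<notin> set xs" "i \<notin> set ys" "set xs \<union> set ys \<subseteq> I"
proof -
  have "i \<in> set (sorted_list_of_set I)" using assms by simp
  then obtain xs ys where s: "sorted_list_of_set I = xs @ i # ys" by (meson split_list)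
  have "distinct (xs @ i # ys)" "set (xs @ i # ys) = I" using assms(1) unfolding s[symmetric] by simp_all
  then show ?thesis using that[of xs ys] s by auto
qed

lemma sorted_split_insert:
  assumes "finite I" "i \<notin> I"
  obtains xs ys where "sorted_list_of_set I = xs @ ys" "sorted_list_of_set (insert i I) = xs @ [i] @ ys" "set xs \<union> set ys = I"
proof -
  obtain xs ys where s: "sorted_list_of_set (insert i I) = xs @ [i] @ ys" "i \<notin> set xs" "i \<notin> set ys"
    by (rule sorted_split_member[OF finite.insertI[OF assms(1)] insertI1]) blast
  have "sorted_list_of_set (insert i I - {i}) = remove1 i (sorted_list_of_set (insert i I))"
    by (rule sorted_list_of_set_remove) (use assms in simp)
  then have "sorted_list_of_set I = remove1 i (sorted_list_of_set (insert i I))" using assms(2) by simp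
  then have 1: "sorted_list_of_set I = xs @ ys" using s by (simp add: remove1_append)
  have "set (sorted_list_of_set I) = I" using assms by simp
  then show ?thesis using that[OF 1 s(1)] 1 by simp
qed

lemma sign_equal_step_a:
  assumes IL: "basis_index m K I L" and i: "i \<in> {1..m}" and v: "v \<in> lists Gen"
  shows "sign_equal (word_cl (mon_word I L @ [a i] @ v)) (if i \<in> I \<union> L then \<epsilon> \<odot>\<^bsub>signed_algebra\<^esub> word_cl (mon_word I L @ v) else word_cl (mon_word (insert i I) L @ v))"
proof -
  have IL': "I \<subseteq> {1..m}" "L \<subseteq> {1..m}" "I \<inter> L = {}" "finite I" "finite L"
    using IL K_subset by (auto simp: basis_index_def intro: finite_subset)
  have lI: "set (sorted_list_of_set I) = I" and lL: "set (sorted_list_of_set L) = L" using IL' by auto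
  consider (new) "i \<notin> I \<union> L" | (I) "i \<in> I" | (L) "i \<in> L" by blast
  then show ?thesis
  proof cases
    case new
    obtain xs ys where xy: "sorted_list_of_set I = xs @ ys" "sorted_list_of_set (insert i I) = xs @ [i] @ ys" "set xs \<union> set ys = I"
      using sorted_split_insert[of I i] IL' new by blast
    have "sign_equal (word_cl (map a xs @ (map a ys @ map b (sorted_list_of_set L)) @ [a i] @ v)) (word_cl (map a xs @ [a i] @ (map a ys @ map b (sorted_list_of_set L)) @ v))"
      using xy IL' i v lL new by (intro sign_equal_move) (auto simp: subset_iff)
    then show ?thesis using new xy by (simp add: mon_word_def)
  next
    case I
    obtain xs ys where xy: "sorted_list_of_set I = xs @ [i] @ ys" "i \<notin> set xs" "i \<notin> set ys" "set xs \<union> set ys \<subseteq> I"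
      using sorted_split_member[of I i] IL' I by blast
    have "sign_equal (word_cl ((map a xs @ [a i]) @ (map a ys @ map b (sorted_list_of_set L)) @ [a i] @ v)) (word_cl ((map a xs @ [a i]) @ [a i] @ (map a ys @ map b (sorted_list_of_set L)) @ v))"
      using xy IL' i v lL I by (intro sign_equal_move) (auto simp: subset_iff)
    moreover have "word_cl (map a xs @ [a i, a i] @ ((map a ys @ map b (sorted_list_of_set L)) @ v)) = \<epsilon> \<odot>\<^bsub>signed_algebra\<^esub> word_cl (map a xs @ [a i] @ ((map a ys @ map b (sorted_list_of_set L)) @ v))"
      using xy IL' i v lL by (intro word_cl_relation relation.a2) (auto simp: subset_iff)
    ultimately show ?thesis using I xy by (simp add: mon_word_def)
  next
    case L
    obtain xs ys where xy: "sorted_list_of_set L = xs @ [i] @ ys" "i \<notin> set xs" "i \<notin> set ys" "set xs \<union> set ys \<subseteq> L"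
      using sorted_split_member[of L i] IL' L by blast
    let ?u = "map a (sorted_list_of_set I) @ map b xs"
    have "sign_equal (word_cl ((?u @ [b i]) @ map b ys @ [a i] @ v)) (word_cl ((?u @ [b i]) @ [a i] @ map b ys @ v))"
      using xy IL' i v lI L by (intro sign_equal_move) (auto simp: subset_iff)
    moreover have "word_cl (?u @ [b i, a i] @ (map b ys @ v)) = \<epsilon> \<odot>\<^bsub>signed_algebra\<^esub> word_cl (?u @ [b i] @ (map b ys @ v))"
      using xy IL' i v lI by (intro word_cl_relation relation.ba) (auto simp: subset_iff)
    ultimately show ?thesis using L xy by (simp add: mon_word_def)
  qed
qed

lemma sign_equal_step_b:
  assumes IL: "basis_index m K I L" and i: "i \<in> {1..m}" and v: "v \<in> lists Gen"
  shows "sign_equal (word_cl (mon_word I L @ [b i] @ v)) (if i \<in> I \<union> L \<or> insert i L \<notin> K then \<zero>\<^bsub>signed_algebra\<^esub> else word_cl (mon_word I (insert i L) @ v))"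
proof -
  have IL': "I \<subseteq> {1..m}" "L \<subseteq> {1..m}" "I \<inter> L = {}" "finite I" "finite L"
    using IL K_subset by (auto simp: basis_index_def intro: finite_subset)
  have lI: "set (sorted_list_of_set I) = I" and lL: "set (sorted_list_of_set L) = L" using IL' by auto
  consider (new) "i \<notin> I \<union> L" | (I) "i \<in> I" | (L) "i \<in> L" by blast
  then show ?thesis
  proof cases
    case new
    obtain xs ys where xy: "sorted_list_of_set L = xs @ ys" "sorted_list_of_set (insert i L) = xs @ [i] @ ys" "set xs \<union> set ys = L"
      using sorted_split_insert[of L i] IL' new by blast
    let ?u = "map a (sorted_list_of_set I) @ map b xs"
    have p: "sign_equal (word_cl (?u @ map b ys @ [b i] @ v)) (word_cl (?u @ [b i] @ map b ys @ v))"
      using xy IL' i v lI new by (intro sign_equal_move) (auto simp: subset_iff)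
    show ?thesis
    proof (cases "insert i L \<in> K")
      case False
      have "word_cl (map a (sorted_list_of_set I) @ map b (sorted_list_of_set (insert i L)) @ v) = \<zero>\<^bsub>signed_algebra\<^esub>"
      proof (rule word_cl_relation_zero)
        show "relation (map b (sorted_list_of_set (insert i L))) [] 0"
          using False IL'(2) i by (intro relation.face) auto
        show "map a (sorted_list_of_set I) \<in> lists Gen" "v \<in> lists Gen" using IL' v lI by (auto simp: subset_iff)
      qed
      then show ?thesis using p False xy by (simp add: mon_word_def)
    qed (use p new xy in \<open>simp add: mon_word_def\<close>)
  next
    case I
    obtain xs ys where xy: "sorted_list_of_set I = xs @ [i] @ ys" "i \<notin> set xs" "i \<notin> set ys" "set xs \<union> set ys \<subseteq> I"
      using sorted_split_member[of I i] IL' I by blast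
    have "sign_equal (word_cl ((map a xs @ [a i]) @ (map a ys @ map b (sorted_list_of_set L)) @ [b i] @ v)) (word_cl ((map a xs @ [a i]) @ [b i] @ (map a ys @ map b (sorted_list_of_set L)) @ v))"
      using xy IL' i v lL I by (intro sign_equal_move) (auto simp: subset_iff)
    moreover have "word_cl (map a xs @ [a i, b i] @ ((map a ys @ map b (sorted_list_of_set L)) @ v)) = \<zero>\<^bsub>signed_algebra\<^esub>"
      using xy IL' i v lL by (intro word_cl_relation_zero[OF relation.ab0]) (auto simp: subset_iff)
    ultimately show ?thesis using I xy by (simp add: mon_word_def)
  next
    case L
    obtain xs ys where xy: "sorted_list_of_set L = xs @ [i] @ ys" "i \<notin> set xs" "i \<notin> set ys" "set xs \<union> set ys \<subseteq> L"
      using sorted_split_member[of L i] IL' L by blast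
    let ?u = "map a (sorted_list_of_set I) @ map b xs"
    have "sign_equal (word_cl ((?u @ [b i]) @ map b ys @ [b i] @ v)) (word_cl ((?u @ [b i]) @ [b i] @ map b ys @ v))"
      using xy IL' i v lI L by (intro sign_equal_move) (auto simp: subset_iff)
    moreover have "word_cl (?u @ [b i, b i] @ (map b ys @ v)) = \<zero>\<^bsub>signed_algebra\<^esub>"
      using xy IL' i v lI by (intro word_cl_relation_zero[OF relation.b2]) (auto simp: subset_iff)
    ultimately show ?thesis using L xy by (simp add: mon_word_def)
  qed
qed

text \<open>
  Absorbing the letters of \<open>w\<close> one after the other keeps the word sorted.
\<close>

lemma mon_word_reduce:
  assumes "basis_index m K I L" "w \<in> lists Gen"
  shows "word_cl (mon_word I L @ w) = \<zero>\<^bsub>signed_algebra\<^esub> \<or>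
    (\<exists>I' L'. basis_index m K I' L' \<and> I' \<union> L' = I \<union> L \<union> index ` set w \<and> sign_equal (word_cl (mon_word I L @ w)) (mon I' L'))"
  using assms
proof (induction w arbitrary: I L)
  case Nil
  show ?case using mon_word_basis[OF Nil(1)] Nil(1)
    by (intro disjI2 exI[of _ I] exI[of _ L]) (simp add: mon_def sign_equal_refl word_cl_closed)
next
  case (Cons g w)
  have w: "w \<in> lists Gen" using Cons.prems by simp
  obtain i where i: "i \<in> {1..m}" "g = a i \<or> g = b i" using Cons.prems Gen_cases[of g] by auto
  let ?x = "word_cl (mon_word I L @ g # w)"
  have stp: "?case" if b': "basis_index m K I' L'" and u: "I' \<union> L' = I \<union> L \<union> {i}" and p: "sign_equal ?x (word_cl (mon_word I' L' @ w))" for I' L'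
    using Cons.IH[OF b' w]
  proof
    assume "word_cl (mon_word I' L' @ w) = \<zero>\<^bsub>signed_algebra\<^esub>"
    then show ?thesis using p sign_equal_zero by auto
  next
    assume "\<exists>I'' L''. basis_index m K I'' L'' \<and> I'' \<union> L'' = I' \<union> L' \<union> index ` set w \<and> sign_equal (word_cl (mon_word I' L' @ w)) (mon I'' L'')"
    then obtain I'' L'' where "basis_index m K I'' L''" "I'' \<union> L'' = I' \<union> L' \<union> index ` set w" "sign_equal (word_cl (mon_word I' L' @ w)) (mon I'' L'')" by blast
    moreover have "I' \<union> L' \<union> index ` set w = I \<union> L \<union> index ` set (g # w)" using u i(2) by auto
    ultimately show ?thesis using sign_equal_trans[OF p] by metis
  qed
  from i(2) show ?case
  proof
    assume g: "g = a i"
    note st = sign_equal_step_a[OF Cons.prems(1) i(1) w]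
    show ?thesis
    proof (cases "i \<in> I \<union> L")
      case True
      then have p: "sign_equal ?x (\<epsilon> \<odot>\<^bsub>signed_algebra\<^esub> word_cl (mon_word I L @ w))" using st g by simp
      have "mon_word I L \<in> lists Gen" using Cons.prems(1) by (rule mon_word_basis)
      then have c: "word_cl (mon_word I L @ w) \<in> carrier signed_algebra" using w by (intro word_cl_closed) simp
      from \<epsilon>(1) show ?thesis
      proof
        assume "\<epsilon> = 0"
        then show ?thesis using p sign_equal_zero kmodule.smult_zero_left[OF kmodule_signed_algebra c] by auto
      next
        assume "\<epsilon> = 1"
        then have "sign_equal ?x (word_cl (mon_word I L @ w))" using p kmodule.smult_one[OF kmodule_signed_algebra c] by simp
        then show ?thesis using True by (intro stp[OF Cons.prems(1)]) auto
      qed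
    next
      case False
      then have "sign_equal ?x (word_cl (mon_word (insert i I) L @ w))" using st g by simp
      then show ?thesis using False Cons.prems(1) i(1) by (intro stp[of "insert i I" L]) (auto simp: basis_index_def)
    qed
  next
    assume g: "g = b i"
    note st = sign_equal_step_b[OF Cons.prems(1) i(1) w]
    show ?thesis
    proof (cases "i \<in> I \<union> L \<or> insert i L \<notin> K")
      case True
      then show ?thesis using st g sign_equal_zero by auto
    next
      case False
      then have "sign_equal ?x (word_cl (mon_word I (insert i L) @ w))" using st g by simp
      then show ?thesis using False Cons.prems(1) i(1) by (intro stp[of I "insert i L"]) (auto simp: basis_index_def)
    qed
  qed
qed

lemma mon_mult:
  assumes "basis_index m K I L" "basis_index m K I' L'"
  shows "mon I L \<otimes>\<^bsub>signed_algebra\<^esub> mon I' L' = word_cl (mon_word I L @ mon_word I' L')"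
proof -
  have "mon_word I L \<in> lists Gen" "mon_word I' L' \<in> lists Gen"
    using assms by (simp_all only: mon_word_basis)
  then show ?thesis unfolding mon_def signed_algebra_def word_cl_def by (rule word_class_mult[OF relators_closed])
qed

lemma mon_mult_monomial:
  assumes "basis_index m K I L" "basis_index m K I' L'"
  shows "mon I L \<otimes>\<^bsub>signed_algebra\<^esub> mon I' L' = \<zero>\<^bsub>signed_algebra\<^esub> \<or>
    (\<exists>I'' L'' c. basis_index m K I'' L'' \<and> I'' \<union> L'' = I \<union> L \<union> I' \<union> L' \<and> (c = 1 \<or> c = - 1) \<and>
      mon I L \<otimes>\<^bsub>signed_algebra\<^esub> mon I' L' = c \<odot>\<^bsub>signed_algebra\<^esub> mon I'' L'')"
proof -
  have f: "finite I'" "finite L'" "I' \<subseteq> {1..m}" "L' \<subseteq> {1..m}" using assms(2) K_subset by (auto simp: basis_index_def intro: finite_subset)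
  then have w: "mon_word I' L' \<in> lists Gen" by (intro mon_word_closed)
  have "index ` set (mon_word I' L') = I' \<union> L'" using f by (auto simp: mon_word_def image_Un image_image)
  then show ?thesis using mon_word_reduce[OF assms(1) w] unfolding mon_mult[OF assms] sign_equal_def by (metis Un_assoc)
qed

lemma sign_equal_append_a:
  assumes "distinct xs" "set xs \<subseteq> {1..m}" "set xs \<inter> (I \<union> L) = {}" "basis_index m K I L" "v \<in> lists Gen"
  shows "sign_equal (word_cl (mon_word I L @ map a xs @ v)) (word_cl (mon_word (I \<union> set xs) L @ v))"
  using assms
proof (induction xs arbitrary: I)
  case Nil
  then show ?case using mon_word_basis[of I L] by (auto intro!: sign_equal_refl word_cl_closed)
next
  case (Cons i xs)
  have 1: "sign_equal (word_cl (mon_word I L @ [a i] @ (map a xs @ v))) (word_cl (mon_word (insert i I) L @ map a xs @ v))"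
  proof -
    have w: "map a xs @ v \<in> lists Gen" using Cons.prems by (auto simp: subset_iff)
    have i: "i \<in> {1..m}" "i \<notin> I \<union> L" using Cons.prems by auto
    show ?thesis using sign_equal_step_a[OF Cons.prems(4) i(1) w] unfolding if_not_P[OF i(2)] .
  qed
  have 2: "sign_equal (word_cl (mon_word (insert i I) L @ map a xs @ v)) (word_cl (mon_word (insert i I \<union> set xs) L @ v))"
    using Cons.prems by (intro Cons.IH) (auto simp: basis_index_def)
  show ?case using sign_equal_trans[OF 1 2] by simp
qed

lemma sign_equal_append_b:
  assumes "distinct ys" "set ys \<subseteq> {1..m}" "set ys \<inter> (I \<union> L) = {}" "basis_index m K I L"
  shows "sign_equal (word_cl (mon_word I L @ map b ys)) (if L \<union> set ys \<in> K then mon I (L \<union> set ys) else \<zero>\<^bsub>signed_algebra\<^esub>)"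
  using assms
proof (induction ys arbitrary: L)
  case Nil
  then have "mon_word I L \<in> lists Gen" "L \<in> K" by (simp_all add: mon_word_basis del: in_lists_conv_set) (simp add: basis_index_def)
  then show ?case by (auto intro!: sign_equal_refl word_cl_closed simp: mon_def)
next
  case (Cons i ys)
  have w: "map b ys \<in> lists Gen" using Cons.prems by (auto simp: subset_iff)
  have i: "i \<in> {1..m}" "i \<notin> I \<union> L" using Cons.prems by auto
  note st = sign_equal_step_b[OF Cons.prems(4) i(1) w]
  show ?case
  proof (cases "insert i L \<in> K")
    case True
    have 1: "sign_equal (word_cl (mon_word I (insert i L) @ map b ys)) (if insert i L \<union> set ys \<in> K then mon I (insert i L \<union> set ys) else \<zero>\<^bsub>signed_algebra\<^esub>)"
      using Cons.prems True by (intro Cons.IH) (auto simp: basis_index_def)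
    have 2: "sign_equal (word_cl (mon_word I L @ b i # map b ys)) (word_cl (mon_word I (insert i L) @ map b ys))" using st i True by simp
    have e: "insert i L \<union> set ys = L \<union> set (i # ys)" by auto
    show ?thesis using sign_equal_trans[OF 2 1] unfolding e list.map .
  next
    case False
    then have "L \<union> set (i # ys) \<notin> K" using K_down[of "L \<union> set (i # ys)" "insert i L"] by auto
    then show ?thesis using st False by simp
  qed
qed

text \<open>
  With disjoint supports no letter meets another one with its index, so the product is zero only if the union of the
  faces is not a face.
\<close>

lemma mon_mult_disjoint:
  assumes IL: "basis_index m K I L" "basis_index m K I' L'" and dis: "(I \<union> L) \<inter> (I' \<union> L') = {}"
  shows "sign_equal (mon I L \<otimes>\<^bsub>signed_algebra\<^esub> mon I' L') (if L \<union> L' \<in> K then mon (I \<union> I') (L \<union> L') else \<zero>\<^bsub>signed_algebra\<^esub>)"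
proof -
  have f: "finite I'" "finite L'" "I' \<subseteq> {1..m}" "L' \<subseteq> {1..m}" "I' \<inter> L' = {}" using IL(2) K_subset by (auto simp: basis_index_def intro: finite_subset)
  have 1: "sign_equal (word_cl (mon_word I L @ map a (sorted_list_of_set I') @ map b (sorted_list_of_set L')))
      (word_cl (mon_word (I \<union> set (sorted_list_of_set I')) L @ map b (sorted_list_of_set L')))"
    using f dis IL by (intro sign_equal_append_a) (auto simp: subset_iff)
  have 2: "sign_equal (word_cl (mon_word (I \<union> I') L @ map b (sorted_list_of_set L')))
      (if L \<union> set (sorted_list_of_set L') \<in> K then mon (I \<union> I') (L \<union> set (sorted_list_of_set L')) else \<zero>\<^bsub>signed_algebra\<^esub>)"
    using f dis IL by (intro sign_equal_append_b) (auto simp: basis_index_def subset_iff)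
  have l': "set (sorted_list_of_set L') = L'" "set (sorted_list_of_set I') = I'" using f by simp_all
  show ?thesis using sign_equal_trans[OF 1[unfolded l'] 2[unfolded l']] unfolding mon_mult[OF IL] mon_word_def[of I' L'] .
qed

end


section \<open>The algebras of the two presentations\<close>

lemma genideal_eqI:
  assumes "S \<subseteq> carrier (free_algebra G)" "S' \<subseteq> carrier (free_algebra G)"
    and "S \<subseteq> genideal (free_algebra G) S'" "S' \<subseteq> genideal (free_algebra G) S"
  shows "genideal (free_algebra G) S = (genideal (free_algebra G) S' :: ('g list \<Rightarrow>\<^sub>0 'k::comm_ring_1) set)"
proof -
  have r: "ring (free_algebra G :: ('k, 'g list \<Rightarrow>\<^sub>0 'k) module)" by (rule ring_free_algebra)
  show ?thesis
    using ring.genideal_minimal[OF r ring.genideal_ideal[OF r assms(2)] assms(3)]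
      ring.genideal_minimal[OF r ring.genideal_ideal[OF r assms(1)] assms(4)] by blast
qed

lemma genideal_closed:
  fixes S :: "('g list \<Rightarrow>\<^sub>0 'k::comm_ring_1) set"
  assumes S: "S \<subseteq> carrier (free_algebra G)"
  shows "x \<in> S \<Longrightarrow> x \<in> genideal (free_algebra G) S"
    and "x \<in> genideal (free_algebra G) S \<Longrightarrow> y \<in> genideal (free_algebra G) S \<Longrightarrow> x + y \<in> genideal (free_algebra G) S"
    and "x \<in> genideal (free_algebra G) S \<Longrightarrow> - x \<in> genideal (free_algebra G) S"
    and "0 \<in> genideal (free_algebra G) S"
proof -
  have sub: "submodule (genideal (free_algebra G) S) scalars (free_algebra G)" by (rule submodule_relations[OF S])
  note * = sub[unfolded kmodule.submodule_iff[OF kmodule_free_algebra] free_algebra_simps]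
  show "x \<in> S \<Longrightarrow> x \<in> genideal (free_algebra G) S"
    using ring.genideal_self[OF ring_free_algebra S] by blast
  show "x \<in> genideal (free_algebra G) S \<Longrightarrow> y \<in> genideal (free_algebra G) S \<Longrightarrow> x + y \<in> genideal (free_algebra G) S"
    using * by blast
  have "scale_comb (- 1) x = - x" by (rule poly_mapping_eqI) simp
  then show "x \<in> genideal (free_algebra G) S \<Longrightarrow> - x \<in> genideal (free_algebra G) S"
    using * by metis
  show "0 \<in> genideal (free_algebra G) S" using * by blast
qed

lemma signed_monomials_B:
  "simplicial_complex_on m K \<Longrightarrow> signed_monomials m K Sm Tm (1 :: 'k::comm_ring_1) (- 1) 1"
  by unfold_locales auto

lemma signed_monomials_R:
  "simplicial_complex_on m K \<Longrightarrow> signed_monomials m K Om Ym (- 1 :: 'k::comm_ring_1) 1 0"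
  by unfold_locales auto

text \<open>
  The relations of \<open>B(K)\<close> are literally those of the common form.
\<close>

lemma B_relations_eq:
  assumes "simplicial_complex_on m K"
  shows "B_relations m K = (signed_monomials.relators m K Sm Tm 1 (- 1) 1 :: (B_gen list \<Rightarrow>\<^sub>0 'k::comm_ring_1) set)"
proof -
  interpret S: signed_monomials m K Sm Tm "1 :: 'k" "- 1" 1 by (rule signed_monomials_B[OF assms])
  have "S.relators \<subseteq> B_relations m K"
  proof
    fix r assume "r \<in> S.relators"
    then obtain x y c where r: "r = word x - Poly_Mapping.single y c" "S.relation x y c" by (auto simp: S.relators_def)
    from r(2) show "r \<in> B_relations m K"
      unfolding r(1)
      by (cases rule: S.relation.cases) (auto simp: B_relations_def single_uminus)
  qed
  moreover have "B_relations m K \<subseteq> S.relators"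
  proof
    fix r :: "B_gen list \<Rightarrow>\<^sub>0 'k" assume r: "r \<in> B_relations m K"
    have I: "word x - Poly_Mapping.single y c \<in> S.relators" if "S.relation x y c" for x y c
      using that by (auto simp: S.relators_def)
    have 1: "word [Sm i, Sm i] - word [Sm i] \<in> S.relators" "word [Tm i, Sm i] - word [Tm i] \<in> S.relators"
      "word [Sm i, Tm i] \<in> S.relators" "word [Tm i, Tm i] \<in> S.relators" if "i \<in> {1..m}" for i
      using I[OF S.relation.a2[OF that]] I[OF S.relation.ba[OF that]] I[OF S.relation.ab0[OF that]] I[OF S.relation.b2[OF that]] by simp_all
    have 2: "word (map Tm (sorted_list_of_set \<sigma>)) \<in> S.relators" if "\<sigma> \<subseteq> {1..m}" "\<sigma> \<notin> K" for \<sigma>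
      using I[OF S.relation.face[OF that]] by simp
    have 3: "word [Sm i, Sm j] - word [Sm j, Sm i] \<in> S.relators" "word [Tm i, Tm j] + word [Tm j, Tm i] \<in> S.relators"
      "word [Sm i, Tm j] - word [Tm j, Sm i] \<in> S.relators" if "i \<in> {1..m}" "j \<in> {1..m}" "i \<noteq> j" for i j
      using I[OF S.relation.aa[OF that]] I[OF S.relation.bb[OF that]] I[OF S.relation.ab_comm[OF that]] by (simp_all add: single_uminus)
    show "r \<in> S.relators" using r unfolding B_relations_def Un_iff mem_Collect_eq by (elim disjE exE conjE; simp only: 1 2 3 simp_thms)
  qed
  ultimately show ?thesis by blast
qed

text \<open>
  The commutation relations of \<open>R(K)\<close> include \<open>i = j\<close>, whereas the common form has \<open>y\<^sub>i \<omega>\<^sub>i = 0\<close> instead.  The latter follows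
  from \<open>\<omega>\<^sub>i y\<^sub>i = 0\<close> and commutation, and the former are consequences of the vanishing of all products of two letters
  with the same index.
\<close>

lemma R_ideal_eq:
  assumes K: "simplicial_complex_on m K"
  shows "genideal (free_algebra (Om ` {1..m} \<union> Ym ` {1..m})) (R_relations m K) =
    (genideal (free_algebra (Om ` {1..m} \<union> Ym ` {1..m})) (signed_monomials.relators m K Om Ym (- 1) 1 0) :: (R_gen list \<Rightarrow>\<^sub>0 'k::comm_ring_1) set)"
proof -
  interpret S: signed_monomials m K Om Ym "- 1 :: 'k" 1 0 by (rule signed_monomials_R[OF K])
  let ?G = "Om ` {1..m} \<union> Ym ` {1..m}"
  have G: "S.Gen = ?G" by (rule S.Gen_def)
  note Scl = genideal_closed[OF S.relators_closed[unfolded G]]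
  have I: "word x - Poly_Mapping.single y c \<in> genideal (free_algebra ?G) S.relators" if "S.relation x y c" for x y c
    by (rule Scl(1)) (use that in \<open>auto simp: S.relators_def\<close>)
  have oo: "word [Om i, Om i] \<in> genideal (free_algebra ?G) S.relators" "word [Om i, Ym i] \<in> genideal (free_algebra ?G) S.relators"
    "word [Ym i, Ym i] \<in> genideal (free_algebra ?G) S.relators" "word [Ym i, Om i] \<in> genideal (free_algebra ?G) S.relators" if "i \<in> {1..m}" for i
    using I[OF S.relation.a2[OF that]] I[OF S.relation.ba[OF that]] I[OF S.relation.ab0[OF that]] I[OF S.relation.b2[OF that]] by simp_all
  have fc: "word (map Ym (sorted_list_of_set \<sigma>)) \<in> genideal (free_algebra ?G) S.relators" if "\<sigma> \<subseteq> {1..m}" "\<sigma> \<notin> K" for \<sigma>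
    using I[OF S.relation.face[OF that]] by simp
  have cm: "word [Om i, Om j] + word [Om j, Om i] \<in> genideal (free_algebra ?G) S.relators"
    "word [Ym i, Ym j] - word [Ym j, Ym i] \<in> genideal (free_algebra ?G) S.relators"
    "word [Om i, Ym j] - word [Ym j, Om i] \<in> genideal (free_algebra ?G) S.relators" if ij: "i \<in> {1..m}" "j \<in> {1..m}" for i j
  proof -
    show "word [Om i, Om j] + word [Om j, Om i] \<in> genideal (free_algebra ?G) S.relators"
    proof (cases "i = j")
      case True then show ?thesis using Scl(2)[OF oo(1)[OF ij(1)] oo(1)[OF ij(1)]] by simp
    next
      case False then show ?thesis using I[OF S.relation.aa[OF ij False]] by (simp add: single_uminus)
    qed
    show "word [Ym i, Ym j] - word [Ym j, Ym i] \<in> genideal (free_algebra ?G) S.relators"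
    proof (cases "i = j")
      case True then show ?thesis using Scl(4) by simp
    next
      case False then show ?thesis using I[OF S.relation.bb[OF ij False]] by simp
    qed
    show "word [Om i, Ym j] - word [Ym j, Om i] \<in> genideal (free_algebra ?G) S.relators"
    proof (cases "i = j")
      case True then show ?thesis using Scl(2)[OF oo(2)[OF ij(1)] Scl(3)[OF oo(4)[OF ij(1)]]] by simp
    next
      case False then show ?thesis using I[OF S.relation.ab_comm[OF ij False]] by simp
    qed
  qed
  have sub1: "R_relations m K \<subseteq> genideal (free_algebra ?G) S.relators"
  proof
    fix r :: "R_gen list \<Rightarrow>\<^sub>0 'k" assume "r \<in> R_relations m K"
    then show "r \<in> genideal (free_algebra ?G) S.relators"
      unfolding R_relations_def Un_iff mem_Collect_eq by (elim disjE exE conjE; simp only: oo fc cm simp_thms)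
  qed
  have Rc: "(R_relations m K :: (R_gen list \<Rightarrow>\<^sub>0 'k) set) \<subseteq> carrier (free_algebra ?G)"
    by (rule subset_trans[OF sub1]) (rule submodule_relations[OF S.relators_closed[unfolded G], unfolded kmodule.submodule_iff[OF kmodule_free_algebra], THEN conjunct1])
  let ?RR = "R_relations m K :: (R_gen list \<Rightarrow>\<^sub>0 'k) set"
  note Rcl = genideal_closed[OF Rc]
  have R1: "word [Om i, Om i] \<in> genideal (free_algebra ?G) (?RR)" "word [Om i, Ym i] \<in> genideal (free_algebra ?G) (?RR)"
    "word [Ym i, Ym i] \<in> genideal (free_algebra ?G) (?RR)" if "i \<in> {1..m}" for i
    by (rule Rcl(1); use that in \<open>unfold R_relations_def Un_iff mem_Collect_eq, blast\<close>)+
  have R2: "word [Om i, Om j] + word [Om j, Om i] \<in> genideal (free_algebra ?G) (?RR)"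
    "word [Ym i, Ym j] - word [Ym j, Ym i] \<in> genideal (free_algebra ?G) (?RR)"
    "word [Om i, Ym j] - word [Ym j, Om i] \<in> genideal (free_algebra ?G) (?RR)" if "i \<in> {1..m}" "j \<in> {1..m}" for i j
    by (rule Rcl(1); use that in \<open>unfold R_relations_def Un_iff mem_Collect_eq, blast\<close>)+
  have R3: "word (map Ym (sorted_list_of_set \<sigma>)) \<in> genideal (free_algebra ?G) (?RR)" if "\<sigma> \<subseteq> {1..m}" "\<sigma> \<notin> K" for \<sigma>
    by (rule Rcl(1); use that in \<open>unfold R_relations_def Un_iff mem_Collect_eq, blast\<close>)
  have yo: "word [Ym i, Om i] \<in> genideal (free_algebra ?G) (?RR)" if "i \<in> {1..m}" for i
  proof -
    have "word [Om i, Ym i] + - (word [Om i, Ym i] - word [Ym i, Om i]) \<in> genideal (free_algebra ?G) (?RR)"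
      by (rule Rcl(2)[OF R1(2)[OF that] Rcl(3)[OF R2(3)[OF that that]]])
    then show ?thesis by simp
  qed
  have "S.relators \<subseteq> genideal (free_algebra ?G) (?RR)"
  proof
    fix r assume "r \<in> S.relators"
    then obtain x y c where r: "r = word x - Poly_Mapping.single y c" "S.relation x y c" by (auto simp: S.relators_def)
    from r(2) have "word x - Poly_Mapping.single y c \<in> genideal (free_algebra ?G) (?RR)"
    proof (cases rule: S.relation.cases)
      case (aa i j) then show ?thesis using R2(1)[of i j] by (simp add: single_uminus)
    next
      case (bb i j) then show ?thesis using R2(2)[of i j] by simp
    next
      case (ab_comm i j) then show ?thesis using R2(3)[of i j] by simp
    next
      case (a2 i) then show ?thesis using R1(1)[of i] by simp
    next
      case (ba i) then show ?thesis using yo[of i] by simp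
    next
      case (ab0 i) then show ?thesis using R1(2)[of i] by simp
    next
      case (b2 i) then show ?thesis using R1(3)[of i] by simp
    next
      case (face \<sigma>) then show ?thesis using R3[of \<sigma>] by simp
    qed
    then show "r \<in> genideal (free_algebra ?G) (?RR)" by (simp only: r(1))
  qed
  then show ?thesis using Rc S.relators_closed[unfolded G] sub1 by (intro genideal_eqI)
qed

lemma B_algebra_signed:
  assumes K: "simplicial_complex_on m K"
  shows "B_algebra m K = (signed_monomials.signed_algebra m K Sm Tm 1 (- 1) 1 :: ('k::comm_ring_1, _) module)"
    and "B_monomial m K = (signed_monomials.mon m K Sm Tm 1 (- 1) 1 :: nat set \<Rightarrow> nat set \<Rightarrow> (B_gen list \<Rightarrow>\<^sub>0 'k::comm_ring_1) set)"
proof -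
  interpret S: signed_monomials m K Sm Tm "1 :: 'k" "- 1" 1 by (rule signed_monomials_B[OF K])
  show "B_algebra m K = S.signed_algebra" by (simp add: B_algebra_def S.signed_algebra_def S.Gen_def B_relations_eq[OF K])
  show "B_monomial m K = S.mon"
    by (intro ext, unfold B_monomial_def Let_def S.mon_def S.word_cl_def word_class_def[OF S.relators_closed])
      (unfold S.mon_word_def S.Gen_def B_relations_eq[OF K], rule refl)
qed

lemma R_algebra_signed:
  assumes K: "simplicial_complex_on m K"
  shows "R_algebra m K = (signed_monomials.signed_algebra m K Om Ym (- 1) 1 0 :: ('k::comm_ring_1, _) module)"
    and "R_monomial m K = (signed_monomials.mon m K Om Ym (- 1) 1 0 :: nat set \<Rightarrow> nat set \<Rightarrow> (R_gen list \<Rightarrow>\<^sub>0 'k::comm_ring_1) set)"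
proof -
  interpret S: signed_monomials m K Om Ym "- 1 :: 'k" 1 0 by (rule signed_monomials_R[OF K])
  show "R_algebra m K = S.signed_algebra" unfolding R_algebra_def S.signed_algebra_def S.Gen_def presented_algebra_def R_ideal_eq[OF K] ..
  show "R_monomial m K = S.mon"
    by (intro ext, unfold R_monomial_def Let_def S.mon_def S.word_cl_def word_class_def[OF S.relators_closed])
      (unfold S.mon_word_def S.Gen_def R_ideal_eq[OF K], rule refl)
qed

section \<open>Pullback of cochains and homotopy invariance\<close>

definition pullback :: "'a topology \<Rightarrow> ('a \<Rightarrow> 'b) \<Rightarrow> ('b, 'k::comm_ring_1) cochain \<Rightarrow> ('a, 'k) cochain" where
  "pullback X g c = (\<lambda>n f. if singular_simplex n X f then c n (simplex_map n g f) else 0)"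

lemma cochains_pullback: "c \<in> cochains Y \<Longrightarrow> pullback X g c \<in> cochains X"
  by (rule cochains_degreewise[of c Y]) (auto simp: pullback_def)

lemma singular_face_simplex_map_commute:
  assumes "n \<noteq> 0" "k \<le> n"
  shows "singular_face n k (simplex_map n g f) = simplex_map (n - 1) g (singular_face n k f)"
  using assms simplical_face_in_standard_simplex[of n k]
  by (auto simp: singular_face_def simplex_map_def fun_eq_iff)

lemma coboundary_pullback:
  assumes g: "continuous_map X Y g"
  shows "coboundary X (pullback X g c) = pullback X g (coboundary Y c)"
proof (intro ext)
  fix n f
  show "coboundary X (pullback X g c) n f = pullback X g (coboundary Y c) n f"
    using singular_simplex_singular_face[of n X f] singular_simplex_simplex_map[OF _ g, of n f]
    by (auto simp: coboundary_def pullback_def singular_face_simplex_map_commute intro!: sum.cong)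
qed

lemma pullback_zero: "pullback X g (\<lambda>n f. 0) = (\<lambda>n f. 0)"
  by (auto simp: pullback_def fun_eq_iff)

lemma cocycles_pullback: "continuous_map X Y g \<Longrightarrow> c \<in> cocycles Y \<Longrightarrow> pullback X g c \<in> cocycles X"
  by (simp add: cocycles_eq cochains_pullback[of c Y] coboundary_pullback pullback_zero)

lemma coboundaries_pullback: "continuous_map X Y g \<Longrightarrow> c \<in> coboundaries Y \<Longrightarrow> pullback X g c \<in> coboundaries X"
proof -
  assume g: "continuous_map X Y g" and "c \<in> coboundaries Y"
  then obtain a where a: "a \<in> cochains Y" "c = coboundary Y a" by (auto simp: coboundaries_def)
  show "pullback X g c \<in> coboundaries X"
    unfolding a(2) coboundary_pullback[OF g, symmetric] coboundaries_def by (rule imageI) (rule cochains_pullback[OF a(1)])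
qed

text \<open>
  The affine map of simplices that sends the vertices \<open>i\<close> and \<open>i + 1\<close> to the vertex \<open>i\<close>.
\<close>

definition degeneracy :: "nat \<Rightarrow> (nat \<Rightarrow> real) \<Rightarrow> nat \<Rightarrow> real" where
  "degeneracy i x = (\<lambda>j. if j < i then x j else if j = i then x i + x (Suc i) else x (Suc j))"

text \<open>
  On a simplex, the total weight of the vertices from \<open>i\<close> on.
\<close>

definition height :: "nat \<Rightarrow> (nat \<Rightarrow> real) \<Rightarrow> real" where
  "height i x = 1 - (\<Sum>j<i. x j)"

lemma sum_degeneracy: "i \<le> n \<Longrightarrow> (\<Sum>j\<le>n. degeneracy i x j) = (\<Sum>j\<le>Suc n. x j)"
proof (induction n)
  case 0 then show ?case by (simp add: degeneracy_def)
next
  case (Suc n)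
  show ?case
  proof (cases "i = Suc n")
    case True
    have "(\<Sum>j\<le>n. degeneracy i x j) = (\<Sum>j\<le>n. x j)" by (rule sum.cong) (auto simp: True degeneracy_def)
    then show ?thesis by (simp add: True) (simp add: degeneracy_def)
  next
    case False
    then have "(\<Sum>j\<le>n. degeneracy i x j) = (\<Sum>j\<le>Suc n. x j)" using Suc by simp
    then show ?thesis using False Suc.prems by (simp add: degeneracy_def)
  qed
qed

lemma degeneracy_in_simplex:
  assumes x: "x \<in> standard_simplex (Suc n)" and i: "i \<le> n" shows "degeneracy i x \<in> standard_simplex n"
proof -
  have s: "(\<Sum>j\<le>n. degeneracy i x j) = 1" using x sum_degeneracy[OF i] by (simp add: standard_simplex_def)
  have nn: "0 \<le> degeneracy i x j" for j using x by (auto simp: standard_simplex_def degeneracy_def)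
  have z: "degeneracy i x j = 0" if "n < j" for j using x i that by (auto simp: standard_simplex_def degeneracy_def)
  have "degeneracy i x j \<le> 1" for j
  proof (cases "j \<le> n")
    case True
    have "degeneracy i x j \<le> (\<Sum>j\<le>n. degeneracy i x j)" using True nn by (intro member_le_sum) auto
    then show ?thesis using s by simp
  qed (use z in auto)
  then show ?thesis using s nn z by (simp add: standard_simplex_def)
qed

lemma sum_simplex_le_1: "x \<in> standard_simplex n \<Longrightarrow> (\<Sum>j<i. x j) \<le> 1"
proof -
  assume x: "x \<in> standard_simplex n"
  have "(\<Sum>j<i. x j) \<le> (\<Sum>j\<in>{..<i} \<union> {..n}. x j)"
    using x by (intro sum_mono2) (auto simp: standard_simplex_def)
  also have "\<dots> = (\<Sum>j\<le>n. x j)"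
    using x by (intro sum.mono_neutral_right) (auto simp: standard_simplex_def)
  also have "\<dots> = 1" using x by (simp add: standard_simplex_def)
  finally show ?thesis .
qed

lemma height_01: "x \<in> standard_simplex n \<Longrightarrow> height i x \<in> {0..1}"
  using sum_simplex_le_1[of x n i] by (auto simp: height_def standard_simplex_def intro: sum_nonneg)

lemma sum_simplical_face: "(\<Sum>j<Suc i. simplical_face k x j) = (if k \<le> i then (\<Sum>j<i. x j) else (\<Sum>j<Suc i. x j :: real))"
proof (induction i)
  case (Suc i)
  show ?case
  proof (cases "k \<le> i")
    case True then show ?thesis using Suc by (simp add: simplical_face_def)
  next
    case False then show ?thesis using Suc by (auto simp: simplical_face_def)
  qed
qed (auto simp: simplical_face_def)

lemma height_face: "height (Suc i) (simplical_face k x) = (if k \<le> i then height i x else height (Suc i) x)"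
  unfolding height_def sum_simplical_face by simp

lemma degeneracy_face:
  "k < i \<Longrightarrow> degeneracy i (simplical_face k x) = simplical_face k (degeneracy (i - 1) x)"
  "degeneracy i (simplical_face i x) = x"
  "degeneracy i (simplical_face (Suc i) x) = x"
  "Suc i < k \<Longrightarrow> degeneracy i (simplical_face k x) = simplical_face (k - 1) (degeneracy i x)"
proof -
  show "degeneracy i (simplical_face k x) = simplical_face k (degeneracy (i - 1) x)" if "k < i"
  proof
    fix j
    consider "j < k" | "j = k" | "k < j" "j < i" | "j = i" | "j > i" by linarith
    then show "degeneracy i (simplical_face k x) j = simplical_face k (degeneracy (i - 1) x) j"
      using that by cases (auto simp: degeneracy_def simplical_face_def)
  qed
  show "degeneracy i (simplical_face k x) = simplical_face (k - 1) (degeneracy i x)" if "Suc i < k"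
  proof
    fix j
    consider "j < i" | "j = i" | "i < j" "j < k - 1" | "j = k - 1" | "j > k - 1" using that by linarith
    then show "degeneracy i (simplical_face k x) j = simplical_face (k - 1) (degeneracy i x) j"
      using that by cases (auto simp: degeneracy_def simplical_face_def)
  qed
qed (auto simp: degeneracy_def simplical_face_def fun_eq_iff)

text \<open>
  The prism over a simplex is cut into simplices with vertices \<open>0, \<dots>, i\<close> at the bottom and \<open>i, \<dots>, n\<close> at the top; this is the
  homotopy \<open>h\<close> on the \<open>i\<close>-th of them.  Two consecutive ones meet in a slice.
\<close>

definition prism :: "(real \<times> 'a \<Rightarrow> 'b) \<Rightarrow> nat \<Rightarrow> nat \<Rightarrow> ((nat \<Rightarrow> real) \<Rightarrow> 'a) \<Rightarrow> (nat \<Rightarrow> real) \<Rightarrow> 'b" where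
  "prism h i n f = restrict (\<lambda>x. h (height (Suc i) x, f (degeneracy i x))) (standard_simplex (Suc n))"

definition slice :: "(real \<times> 'a \<Rightarrow> 'b) \<Rightarrow> nat \<Rightarrow> nat \<Rightarrow> ((nat \<Rightarrow> real) \<Rightarrow> 'a) \<Rightarrow> (nat \<Rightarrow> real) \<Rightarrow> 'b" where
  "slice h i n f = restrict (\<lambda>x. h (height i x, f x)) (standard_simplex n)"

lemma singular_simplex_prism:
  assumes h: "continuous_map (prod_topology (top_of_set {0..1::real}) X) Y h"
    and f: "singular_simplex n X f" and i: "i \<le> n"
  shows "singular_simplex (Suc n) Y (prism h i n f)"
proof -
  let ?PT = "powertop_real UNIV" and ?S = "\<lambda>n. subtopology (powertop_real UNIV) (standard_simplex n)"
  have proj: "continuous_map ?PT euclideanreal (\<lambda>x. x j)" for j :: nat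
    by (rule continuous_map_product_projection) simp
  have "continuous_map ?PT euclideanreal (\<lambda>x. degeneracy i x j)" for j
    unfolding degeneracy_def using proj by (auto intro!: continuous_map_add)
  then have "continuous_map ?PT ?PT (degeneracy i)" by (simp add: continuous_map_componentwise_UNIV)
  then have "continuous_map (?S (Suc n)) (?S n) (degeneracy i)"
    using degeneracy_in_simplex[OF _ i] by (intro continuous_map_into_subtopology continuous_map_from_subtopology) auto
  then have 1: "continuous_map (?S (Suc n)) X (\<lambda>x. f (degeneracy i x))"
    using f continuous_map_compose[of "?S (Suc n)" "?S n" "degeneracy i" X f] by (simp add: singular_simplex_def o_def)
  have "continuous_map ?PT euclideanreal (height (Suc i))"
    unfolding height_def[abs_def] using proj by (intro continuous_map_diff continuous_map_sum) auto
  then have 2: "continuous_map (?S (Suc n)) (top_of_set {0..1}) (height (Suc i))"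
    using height_01[of _ "Suc n" "Suc i"] by (intro continuous_map_into_subtopology continuous_map_from_subtopology) (auto simp del: atLeastAtMost_iff)
  have "continuous_map (?S (Suc n)) Y (\<lambda>x. h (height (Suc i) x, f (degeneracy i x)))"
    using continuous_map_compose[OF _ h, of "?S (Suc n)" "\<lambda>x. (height (Suc i) x, f (degeneracy i x))"] 1 2
    by (simp add: continuous_map_pairwise o_def)
  then show ?thesis by (simp add: singular_simplex_def prism_def)
qed

lemma face_prism:
  assumes "i \<le> n" "k \<le> Suc n"
  shows "k < i \<Longrightarrow> singular_face (Suc n) k (prism h i n f) = prism h (i - 1) (n - 1) (singular_face n k f)"
    and "Suc i < k \<Longrightarrow> singular_face (Suc n) k (prism h i n f) = prism h i (n - 1) (singular_face n (k - 1) f)"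
    and "k = i \<Longrightarrow> singular_face (Suc n) k (prism h i n f) = slice h i n f"
    and "k = Suc i \<Longrightarrow> singular_face (Suc n) k (prism h i n f) = slice h (Suc i) n f"
proof -
  have sf: "singular_face (Suc n) k (prism h i n f) x = (if x \<in> standard_simplex n then h (height (Suc i) (simplical_face k x), f (degeneracy i (simplical_face k x))) else undefined)" for x
    using simplical_face_in_standard_simplex[of "Suc n" k x] assms(2) by (auto simp: singular_face_def prism_def)
  show "singular_face (Suc n) k (prism h i n f) = prism h (i - 1) (n - 1) (singular_face n k f)" if "k < i"
  proof
    fix x
    obtain N I where n: "n = Suc N" "i = Suc I" "I \<le> N" using \<open>k < i\<close> assms that by (cases n; cases i) auto
    show "singular_face (Suc n) k (prism h i n f) x = prism h (i - 1) (n - 1) (singular_face n k f) x"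
      using degeneracy_in_simplex[of x N I] that unfolding sf
      by (auto simp: prism_def n singular_face_def height_face degeneracy_face(1))
  qed
  show "singular_face (Suc n) k (prism h i n f) = prism h i (n - 1) (singular_face n (k - 1) f)" if "Suc i < k"
  proof
    fix x
    obtain N where n: "n = Suc N" using \<open>Suc i < k\<close> assms by (cases n) auto
    have "i \<le> N" using \<open>Suc i < k\<close> assms(2) n by linarith
    then have d: "x \<in> standard_simplex n \<Longrightarrow> degeneracy i x \<in> standard_simplex N" using degeneracy_in_simplex[of x N i] n by simp
    show "singular_face (Suc n) k (prism h i n f) x = prism h i (n - 1) (singular_face n (k - 1) f) x"
    proof (cases "x \<in> standard_simplex n")
      case True
      then have "singular_face n (k - 1) f (degeneracy i x) = f (simplical_face (k - 1) (degeneracy i x))" using d by (simp add: singular_face_def n)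
      then show ?thesis unfolding sf using True that by (simp add: prism_def n height_face degeneracy_face(4) d singular_face_def)
    qed (unfold sf, simp add: prism_def n)
  qed
  show "k = i \<Longrightarrow> singular_face (Suc n) k (prism h i n f) = slice h i n f"
    using sf by (auto simp: fun_eq_iff slice_def height_face degeneracy_face)
  show "k = Suc i \<Longrightarrow> singular_face (Suc n) k (prism h i n f) = slice h (Suc i) n f"
    using sf by (auto simp: fun_eq_iff slice_def height_face degeneracy_face)
qed

lemma slice_ends:
  assumes "singular_simplex n X f"
  shows "slice h 0 n f = simplex_map n (\<lambda>x. h (1, x)) f" "slice h (Suc n) n f = simplex_map n (\<lambda>x. h (0, x)) f"
proof -
  show "slice h 0 n f = simplex_map n (\<lambda>x. h (1, x)) f"
    by (simp add: slice_def simplex_map_def height_def o_def)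
  have "height (Suc n) x = 0" if "x \<in> standard_simplex n" for x
    using that by (simp add: height_def standard_simplex_def lessThan_Suc_atMost)
  then show "slice h (Suc n) n f = simplex_map n (\<lambda>x. h (0, x)) f"
    by (auto simp: slice_def simplex_map_def fun_eq_iff)
qed

definition prism_cochain :: "'a topology \<Rightarrow> (real \<times> 'a \<Rightarrow> 'b) \<Rightarrow> ('b, 'k::comm_ring_1) cochain \<Rightarrow> ('a, 'k) cochain" where
  "prism_cochain X h c = (\<lambda>n f. if singular_simplex n X f then (\<Sum>i\<le>n. (-1) ^ i * c (Suc n) (prism h i n f)) else 0)"

lemma cochains_prism:
  assumes c: "c \<in> cochains Y" shows "prism_cochain X h c \<in> cochains X"
proof (rule cochainsI)
  have "{n. prism_cochain X h c n \<noteq> (\<lambda>_. 0)} \<subseteq> (\<lambda>n. n - 1) ` {n. c n \<noteq> (\<lambda>_. 0)}"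
  proof
    fix n assume "n \<in> {n. prism_cochain X h c n \<noteq> (\<lambda>_. 0)}"
    then have "prism_cochain X h c n \<noteq> (\<lambda>_. 0)" by simp
    then have "c (Suc n) \<noteq> (\<lambda>_. 0)" by (rule contrapos_nn) (simp add: prism_cochain_def fun_eq_iff)
    then show "n \<in> (\<lambda>n. n - 1) ` {n. c n \<noteq> (\<lambda>_. 0)}" by (intro image_eqI[of _ _ "Suc n"]) auto
  qed
  then show "finite {n. prism_cochain X h c n \<noteq> (\<lambda>_. 0)}"
    by (rule finite_subset) (rule finite_imageI[OF cochains_finite[OF c]])
qed (simp add: prism_cochain_def)

text \<open>
  In the sum of the faces of all pieces, the faces \<open>i\<close> and \<open>i + 1\<close> of the \<open>i\<close>-th piece are slices, which telescope to the
  two ends, and the others are the pieces of the prisms over the faces.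
\<close>

lemma prism_homotopy:
  assumes h: "continuous_map (prod_topology (top_of_set {0..1::real}) X) Y h" and f: "singular_simplex n X f"
  shows "coboundary X (prism_cochain X h c) n f + prism_cochain X h (coboundary Y c) n f =
    c n (simplex_map n (\<lambda>x. h (1, x)) f) - c n (simplex_map n (\<lambda>x. h (0, x)) f)"
proof -
  define A where "A i k = (-1) ^ (i + k) * c n (singular_face (Suc n) k (prism h i n f))" for i k
  have "prism_cochain X h (coboundary Y c) n f = (\<Sum>i\<le>n. (-1) ^ i * (\<Sum>k\<le>Suc n. (-1) ^ k * c n (singular_face (Suc n) k (prism h i n f))))"
    using f singular_simplex_prism[OF h f] by (simp add: prism_cochain_def coboundary_def del: sum.atMost_Suc)
  also have "\<dots> = (\<Sum>i\<le>n. \<Sum>k\<le>Suc n. A i k)"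
    by (simp add: A_def sum_distrib_left power_add mult.assoc del: sum.atMost_Suc)
  also have "\<dots> = (\<Sum>i\<le>n. ((\<Sum>k<i. A i k) + (\<Sum>k\<in>{i + 2..Suc n}. A i k)) + (A i i + A i (Suc i)))"
  proof (rule sum.cong[OF refl])
    fix i assume "i \<in> {..n}"
    then have "{..Suc n} = {..<i} \<union> {i + 2..Suc n} \<union> {i, Suc i}" by auto
    moreover have "sum (A i) ({..<i} \<union> {i + 2..Suc n} \<union> {i, Suc i}) = (sum (A i) {..<i} + sum (A i) {i + 2..Suc n}) + sum (A i) {i, Suc i}"
      by (subst sum.union_disjoint, simp, simp, force, subst sum.union_disjoint) auto
    ultimately show "sum (A i) {..Suc n} = ((\<Sum>k<i. A i k) + (\<Sum>k\<in>{i + 2..Suc n}. A i k)) + (A i i + A i (Suc i))" by simp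
  qed
  also have "\<dots> = ((\<Sum>i\<le>n. \<Sum>k<i. A i k) + (\<Sum>i\<le>n. \<Sum>k\<in>{i + 2..Suc n}. A i k)) + (\<Sum>i\<le>n. A i i + A i (Suc i))"
    by (simp only: sum.distrib)
  also have "(\<Sum>i\<le>n. A i i + A i (Suc i)) = (\<Sum>i\<le>n. c n (slice h i n f) - c n (slice h (Suc i) n f))"
    by (intro sum.cong refl) (simp add: A_def face_prism(3,4))
  also have "\<dots> = c n (slice h 0 n f) - c n (slice h (Suc n) n f)"
    by (rule sum_telescope)
  also have "\<dots> = c n (simplex_map n (\<lambda>x. h (1, x)) f) - c n (simplex_map n (\<lambda>x. h (0, x)) f)"
    by (simp only: slice_ends[OF f])
  also have "(\<Sum>i\<le>n. \<Sum>k<i. A i k) + (\<Sum>i\<le>n. \<Sum>k\<in>{i + 2..Suc n}. A i k) = - coboundary X (prism_cochain X h c) n f"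
  proof (cases n)
    case 0
    then show ?thesis by (simp add: coboundary_def)
  next
    case (Suc N)
    define B where "B i k = (-1) ^ (i + k) * c n (prism h i N (singular_face n k f))" for i k
    have "coboundary X (prism_cochain X h c) n f = (\<Sum>k\<le>n. (-1) ^ k * (\<Sum>i\<le>N. (-1) ^ i * c n (prism h i N (singular_face n k f))))"
      using f singular_simplex_singular_face[OF f] by (simp add: Suc coboundary_def prism_cochain_def del: sum.atMost_Suc)
    also have "\<dots> = (\<Sum>k\<le>n. \<Sum>i\<le>N. B i k)"
      by (simp add: B_def sum_distrib_left power_add mult_ac del: sum.atMost_Suc)
    also have "\<dots> = (\<Sum>i\<le>N. \<Sum>k\<le>n. B i k)" by (rule sum.swap)
    also have "\<dots> = (\<Sum>i\<le>N. (\<Sum>k\<le>i. B i k) + (\<Sum>k\<in>{Suc i..n}. B i k))"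
    proof (rule sum.cong[OF refl])
      fix i assume "i \<in> {..N}"
      then have "{..n} = {..i} \<union> {Suc i..n}" using Suc by auto
      then show "(\<Sum>k\<le>n. B i k) = (\<Sum>k\<le>i. B i k) + (\<Sum>k\<in>{Suc i..n}. B i k)"
        by (simp only:) (rule sum.union_disjoint, auto)
    qed
    also have "\<dots> = (\<Sum>i\<le>N. \<Sum>k\<le>i. B i k) + (\<Sum>i\<le>N. \<Sum>k\<in>{Suc i..n}. B i k)" by (rule sum.distrib)
    finally have cob: "coboundary X (prism_cochain X h c) n f = (\<Sum>i\<le>N. \<Sum>k\<le>i. B i k) + (\<Sum>i\<le>N. \<Sum>k\<in>{Suc i..n}. B i k)" .
    have "(\<Sum>i\<le>n. \<Sum>k<i. A i k) = (\<Sum>i\<le>N. \<Sum>k<Suc i. A (Suc i) k)"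
      unfolding Suc by (subst sum.atMost_Suc_shift) simp
    also have "\<dots> = (\<Sum>i\<le>N. \<Sum>k\<le>i. - B i k)"
    proof (intro sum.cong)
      fix i k assume "i \<in> {..N}" "k \<in> {..i}"
      then show "A (Suc i) k = - B i k"
        using face_prism(1)[of "Suc i" n k h f] Suc by (simp add: A_def B_def)
    qed (auto simp: lessThan_Suc_atMost)
    finally have 1: "(\<Sum>i\<le>n. \<Sum>k<i. A i k) = - (\<Sum>i\<le>N. \<Sum>k\<le>i. B i k)" by (simp only: sum_negf)
    have "(\<Sum>i\<le>n. \<Sum>k\<in>{i + 2..Suc n}. A i k) = (\<Sum>i\<le>N. \<Sum>k\<in>{i + 2..Suc n}. A i k)"
      unfolding Suc by (subst sum.atMost_Suc) simp
    also have "\<dots> = (\<Sum>i\<le>N. \<Sum>k\<in>{Suc i..n}. - B i k)"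
    proof (rule sum.cong[OF refl])
      fix i assume i: "i \<in> {..N}"
      have "{i + 2..Suc n} = Suc ` {Suc i..n}" by (simp add: image_Suc_atLeastAtMost)
      then have "(\<Sum>k\<in>{i + 2..Suc n}. A i k) = (\<Sum>k\<in>{Suc i..n}. A i (Suc k))"
        by (simp only:) (subst sum.reindex, auto)
      also have "\<dots> = (\<Sum>k\<in>{Suc i..n}. - B i k)"
      proof (rule sum.cong[OF refl])
        fix k assume "k \<in> {Suc i..n}"
        then show "A i (Suc k) = - B i k"
          using face_prism(2)[of i n "Suc k" h f] Suc i by (simp add: A_def B_def)
      qed
      finally show "(\<Sum>k\<in>{i + 2..Suc n}. A i k) = (\<Sum>k\<in>{Suc i..n}. - B i k)" .
    qed
    finally have 2: "(\<Sum>i\<le>n. \<Sum>k\<in>{i + 2..Suc n}. A i k) = - (\<Sum>i\<le>N. \<Sum>k\<in>{Suc i..n}. B i k)" by (simp only: sum_negf)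
    show ?thesis unfolding 1 2 cob by simp
  qed
  finally show ?thesis by simp
qed

lemma homotopic_pullback:
  fixes c :: "('b, 'k::comm_ring_1) cochain"
  assumes hom: "homotopic_with (\<lambda>x. True) X Y g0 g1" and c: "c \<in> cocycles Y"
  shows "(\<lambda>n f. pullback X g1 c n f - pullback X g0 c n f) \<in> coboundaries X"
proof -
  obtain h where h: "continuous_map (prod_topology (top_of_set {0..1::real}) X) Y h"
    and h01: "\<And>x. h (0, x) = g0 x" "\<And>x. h (1, x) = g1 x"
    using hom by (auto simp: homotopic_with_def)
  have "coboundary Y c = (\<lambda>n f. 0)" "c \<in> cochains Y" using c by (auto simp: cocycles_eq)
  then have "pullback X g1 c n f - pullback X g0 c n f = coboundary X (prism_cochain X h c) n f" for n f
    using prism_homotopy[OF h, of n f c] by (cases "singular_simplex n X f") (auto simp: pullback_def h01 prism_cochain_def coboundary_def)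
  then have "(\<lambda>n f. pullback X g1 c n f - pullback X g0 c n f) = coboundary X (prism_cochain X h c)" by (intro ext)
  moreover have "coboundary X (prism_cochain X h c) \<in> coboundaries X"
    unfolding coboundaries_def by (rule imageI) (rule cochains_prism[OF \<open>c \<in> cochains Y\<close>])
  ultimately show ?thesis by simp
qed

section \<open>Cocycles that vanish on small simplices\<close>

definition in_set :: "nat \<Rightarrow> 'a set \<Rightarrow> ((nat \<Rightarrow> real) \<Rightarrow> 'a) \<Rightarrow> bool" where
  "in_set n V f \<longleftrightarrow> f ` standard_simplex n \<subseteq> V"

text \<open>
  Such a cocycle vanishes on sufficiently fine subdivisions of every simplex.  Let \<open>D n\<close> be the chain homotopy from
  the identity to the \<open>n\<close>-fold subdivision; it preserves small chains.  For a simplex \<open>f\<close> let \<open>M f\<close> be so large that the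
  subdivisions of \<open>f\<close> from there on are small.  Then \<open>f\<close> equals its subdivision minus a boundary minus \<open>D (M f) (\<partial> f)\<close>,
  and \<open>\<phi>\<close> kills the first two terms.  So \<open>\<psi> f = - \<phi> (D (M f) f)\<close> has coboundary \<open>\<phi>\<close>, provided that \<open>\<phi> (D n f)\<close> no longer
  changes from \<open>n = M f\<close> on: the further terms of \<open>D n f\<close> are small.
\<close>

lemma small_cocycle_coboundary:
  fixes \<phi> :: "('a, 'k::comm_ring_1) cochain"
  assumes \<phi>: "\<phi> \<in> cocycles X" and V: "openin X V" "openin X W" "topspace X \<subseteq> V \<union> W"
    and van: "\<And>n f. singular_simplex n X f \<Longrightarrow> in_set n V f \<or> in_set n W f \<Longrightarrow> \<phi> n f = 0"
  shows "\<phi> \<in> coboundaries X"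
proof -
  define small where "small n z \<longleftrightarrow> singular_chain n X z \<and> (\<forall>f\<in>Poly_Mapping.keys z. in_set n V f \<or> in_set n W f)" for n and z :: "'a chain"
  have small_0: "cochain_eval (\<phi> n) z = 0" if "small n z" for n z
    unfolding cochain_eval_def using that van by (intro sum.neutral) (auto simp: small_def singular_chain_def)
  have small_split: "\<exists>z1 z2. z = z1 + z2 \<and> singular_chain n (subtopology X V) z1 \<and> singular_chain n (subtopology X W) z2" if "small n z" for n z
    using that[unfolded small_def singular_chain_def, THEN conjunct2] that[unfolded small_def singular_chain_def, THEN conjunct1]
  proof -
    assume s: "\<forall>f\<in>Poly_Mapping.keys z. in_set n V f \<or> in_set n W f" "Poly_Mapping.keys z \<subseteq> singular_simplex_set n X"
    let ?K = "{f \<in> Poly_Mapping.keys z. in_set n V f}"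
    define z1 where "z1 = (\<Sum>f\<in>?K. Poly_Mapping.single f (Poly_Mapping.lookup z f))"
    have l1: "Poly_Mapping.lookup z1 f = (if f \<in> ?K then Poly_Mapping.lookup z f else 0)" for f
      by (simp add: z1_def lookup_sum lookup_single when_def sum.delta)
    have "Poly_Mapping.keys z1 \<subseteq> ?K" by (auto simp: in_keys_iff l1 split: if_splits)
    then have 1: "singular_chain n (subtopology X V) z1"
      using s by (auto simp: singular_chain_def singular_simplex_subtopology in_set_def subset_iff)
    have "Poly_Mapping.keys (z - z1) \<subseteq> Poly_Mapping.keys z - ?K" by (auto simp: in_keys_iff l1 lookup_minus split: if_splits)
    then have "\<And>f. f \<in> Poly_Mapping.keys (z - z1) \<Longrightarrow> singular_simplex n X f \<and> in_set n W f" using s by (auto simp: subset_iff)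
    then have 2: "singular_chain n (subtopology X W) (z - z1)"
      by (auto simp: singular_chain_def singular_simplex_subtopology in_set_def subset_iff)
    show ?thesis using 1 2 by (intro exI[of _ z1] exI[of _ "z - z1"]) simp
  qed
  have smallI: "small n z" if "singular_chain n (subtopology X V) z \<or> singular_chain n (subtopology X W) z" for n z
    using that by (auto simp: small_def singular_chain_def singular_simplex_subtopology in_set_def subset_iff)
  have small_add: "small n (z + w)" if "small n z" "small n w" for n z w
    using that keys_add[of z w] singular_chain_add by (auto simp: small_def)
  obtain T :: "nat \<Rightarrow> 'a chain \<Rightarrow> 'a chain" where T:
      "\<And>p. T p 0 = 0" "\<And>p c1 c2. T p (c1 - c2) = T p c1 - T p c2"
      "\<And>p X c. singular_chain p X c \<Longrightarrow> singular_chain (Suc p) X (T p c)"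
      "\<And>p X c. singular_chain p X c \<Longrightarrow>
        chain_boundary (Suc p) (T p c) + T (p - Suc 0) (chain_boundary p c) = singular_subdivision p c - c"
    using chain_homotopic_singular_subdivision by blast
  let ?Sd = "\<lambda>p n. singular_subdivision p ^^ n"
  have T_add: "T p (c1 + c2) = T p c1 + T p c2" for p c1 c2
    using T(2)[of p "c1 + c2" c2] by (simp add: algebra_simps)
  have T_small: "small (Suc p) (T p z)" if "small p z" for p z
    using small_split[OF that] T(3) T_add smallI small_add by metis
  have Sd_chain: "singular_chain p Y (?Sd p n c)" if "singular_chain p Y c" for p n c and Y :: "'a topology"
    using that by (induction n) (auto simp: singular_chain_singular_subdivision)
  have Sd_diff: "?Sd p n (c1 - c2) = ?Sd p n c1 - ?Sd p n c2" for p n c1 c2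
    by (rule singular_subdivision_power_diff)
  have Sd_boundary: "?Sd (p - 1) n (chain_boundary p c) = chain_boundary p (?Sd p n c)" if "singular_chain p X c" for p n c
  proof (induction n)
    case (Suc n)
    have "?Sd (p - 1) (Suc n) (chain_boundary p c) = singular_subdivision (p - 1) (chain_boundary p (?Sd p n c))"
      using Suc by simp
    also have "\<dots> = chain_boundary p (singular_subdivision p (?Sd p n c))"
      using chain_boundary_singular_subdivision[OF Sd_chain[OF that]] by simp
    finally show ?case by simp
  qed simp
  define D where "D p n c = (\<Sum>i<n. T p (?Sd p i c))" for p n c
  have D_chain: "singular_chain (Suc p) X (D p n c)" if "singular_chain p X c" for p n c
    unfolding D_def by (intro singular_chain_sum T(3) Sd_chain that)
  have D_diff: "D p n (c1 - c2) = D p n c1 - D p n c2" for p n c1 c2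
    by (simp add: D_def Sd_diff T(2) sum_subtractf)
  have D_0: "D p n 0 = 0" for p n using D_diff[of p n 0 0] by simp
  have D_htpy: "chain_boundary (Suc p) (D p n c) + D (p - 1) n (chain_boundary p c) = ?Sd p n c - c" if c: "singular_chain p X c" for p n c
  proof (induction n)
    case (Suc n)
    have "chain_boundary (Suc p) (D p (Suc n) c) + D (p - 1) (Suc n) (chain_boundary p c) =
        (chain_boundary (Suc p) (D p n c) + D (p - 1) n (chain_boundary p c)) +
        (chain_boundary (Suc p) (T p (?Sd p n c)) + T (p - 1) (?Sd (p - 1) n (chain_boundary p c)))"
      by (simp add: D_def chain_boundary_add)
    also have "chain_boundary (Suc p) (T p (?Sd p n c)) + T (p - 1) (?Sd (p - 1) n (chain_boundary p c)) = ?Sd p (Suc n) c - ?Sd p n c"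
      using T(4)[OF Sd_chain[OF c], of n] Sd_boundary[OF c, of n] by simp
    finally show ?case using Suc by simp
  qed (simp add: D_def)
  have suff: "\<exists>n. \<forall>k\<ge>n. small p (?Sd p k (frag_of f))" if f: "singular_simplex p X f" for p f
  proof -
    have fc: "singular_chain p X (frag_of f)" using f by (simp add: singular_chain_of)
    obtain n where "\<And>k g. n \<le> k \<Longrightarrow> g \<in> Poly_Mapping.keys (?Sd p k (frag_of f)) \<Longrightarrow> \<exists>U\<in>{V, W}. g \<in> standard_simplex p \<rightarrow> U"
      using sufficient_iterated_singular_subdivision_exists[of "{V, W}" X p "frag_of f"] V fc by auto
    then show ?thesis using Sd_chain[OF fc] by (intro exI[of _ n]) (fastforce simp: small_def in_set_def)
  qed
  define M0 where "M0 p f = (LEAST n. \<forall>k\<ge>n. small p (?Sd p k (frag_of f)))" for p f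
  have M0: "small p (?Sd p k (frag_of f))" if "singular_simplex p X f" "M0 p f \<le> k" for p f k
    using LeastI_ex[OF suff[OF that(1)]] that(2) unfolding M0_def by blast
  \<comment> \<open>A number of subdivisions that also suffices for all iterated faces.\<close>
  define M where "M = rec_nat (M0 0) (\<lambda>p r f. max (M0 (Suc p) f) (Max ((\<lambda>k. r (singular_face (Suc p) k f)) ` {..Suc p})))"
  have M_ge: "M0 p f \<le> M p f" for p f by (cases p) (auto simp: M_def)
  have M_face: "M p (singular_face (Suc p) k f) \<le> M (Suc p) f" if "k \<le> Suc p" for p k f
  proof -
    have "M p (singular_face (Suc p) k f) \<le> Max ((\<lambda>k. M p (singular_face (Suc p) k f)) ` {..Suc p})"
      using that by (intro Max_ge) auto
    then show ?thesis by (simp add: M_def)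
  qed
  have D_stable: "cochain_eval (\<phi> (Suc p)) (D p n (frag_of f)) = cochain_eval (\<phi> (Suc p)) (D p (M p f) (frag_of f))"
    if f: "singular_simplex p X f" and n: "M p f \<le> n" for p f n
    using n
  proof (induction n rule: dec_induct)
    case (step n)
    have "small (Suc p) (T p (?Sd p n (frag_of f)))"
      using step(1) M_ge[of p f] by (intro T_small M0[OF f]) simp
    then show ?case using step small_0 by (simp add: D_def cochain_eval_add)
  qed simp
  define \<psi> where "\<psi> n f = (if singular_simplex n X f then - cochain_eval (\<phi> (Suc n)) (D n (M n f) (frag_of f)) else 0)" for n f
  have \<psi>c: "\<psi> \<in> cochains X"
  proof (rule cochainsI)
    have fin: "finite {n. \<phi> n \<noteq> (\<lambda>_. 0)}" using \<phi> by (simp add: cocycles_eq cochains_finite[of \<phi> X])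
    have "{n. \<psi> n \<noteq> (\<lambda>_. 0)} \<subseteq> (\<lambda>n. n - 1) ` {n. \<phi> n \<noteq> (\<lambda>_. 0)}"
    proof
      fix n assume "n \<in> {n. \<psi> n \<noteq> (\<lambda>_. 0)}"
      then have "\<psi> n \<noteq> (\<lambda>_. 0)" by simp
      then have "\<phi> (Suc n) \<noteq> (\<lambda>_. 0)" by (rule contrapos_nn) (simp add: \<psi>_def fun_eq_iff cochain_eval_def)
      then show "n \<in> (\<lambda>n. n - 1) ` {n. \<phi> n \<noteq> (\<lambda>_. 0)}" by (intro image_eqI[of _ _ "Suc n"]) auto
    qed
    then show "finite {n. \<psi> n \<noteq> (\<lambda>_. 0)}" by (rule finite_subset) (rule finite_imageI[OF fin])
  qed (simp add: \<psi>_def)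
  have "\<phi> n f = coboundary X \<psi> n f" for n f
  proof (cases "singular_simplex n X f")
    case False
    then show ?thesis using \<phi> by (simp add: cocycles_eq coboundary_def cochains_outside[of \<phi> X])
  next
    case f: True
    have fc: "singular_chain n X (frag_of f)" using f by (simp add: singular_chain_of)
    let ?m = "M n f"
    have cb: "coboundary X \<phi> = (\<lambda>n f. 0)" using \<phi> by (simp add: cocycles_eq)
    have "cochain_eval (\<phi> n) (chain_boundary (Suc n) (D n ?m (frag_of f))) = cochain_eval (coboundary X \<phi> (Suc n)) (D n ?m (frag_of f))"
      using coboundary_eval_chain[OF D_chain[OF fc], of \<phi> ?m] by simp
    also have "\<dots> = 0" unfolding cb by (simp add: cochain_eval_def)
    finally have z1: "cochain_eval (\<phi> n) (chain_boundary (Suc n) (D n ?m (frag_of f))) = 0" .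
    have z2: "cochain_eval (\<phi> n) (?Sd n ?m (frag_of f)) = 0"
      by (intro small_0 M0[OF f] M_ge)
    have "frag_of f = ?Sd n ?m (frag_of f) - chain_boundary (Suc n) (D n ?m (frag_of f)) - D (n - 1) ?m (chain_boundary n (frag_of f))"
      using D_htpy[OF fc, of ?m] by (simp add: algebra_simps)
    then have "cochain_eval (\<phi> n) (frag_of f) = cochain_eval (\<phi> n) (?Sd n ?m (frag_of f) - chain_boundary (Suc n) (D n ?m (frag_of f)) - D (n - 1) ?m (chain_boundary n (frag_of f)))"
      by (rule arg_cong)
    then have eq: "\<phi> n f = - cochain_eval (\<phi> n) (D (n - 1) ?m (chain_boundary n (frag_of f)))"
      by (simp add: cochain_eval_diff z1 z2)
    show ?thesis
    proof (cases n)
      case 0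
      then show ?thesis using eq by (simp add: chain_boundary_def D_0 coboundary_def)
    next
      case (Suc p)
      have D_minus: "D q k (- c) = - D q k c" for q k c using D_diff[of q k 0 c] by (simp add: D_0)
      have D_add: "D q k (c1 + c2) = D q k c1 + D q k c2" for q k c1 c2 using D_diff[of q k c1 "- c2"] by (simp add: D_minus)
      have D_sum: "D q k (sum g S) = (\<Sum>i\<in>S. D q k (g i))" for q k S and g :: "nat \<Rightarrow> 'a chain"
        by (induction S rule: infinite_finite_induct) (auto simp: D_add D_0)
      have D_sign: "D q k (frag_cmul ((-1) ^ j) c) = frag_cmul ((-1) ^ j) (D q k c)" for q k j c
        by (cases "even j") (simp_all add: D_minus)
      have face: "singular_simplex p X (singular_face n k f)" if "k \<le> n" for k
        using singular_simplex_singular_face[OF f, of k] that Suc by simp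
      have "cochain_eval (\<phi> n) (D (n - 1) ?m (chain_boundary n (frag_of f))) =
          (\<Sum>k\<le>n. (-1) ^ k * cochain_eval (\<phi> n) (D p ?m (frag_of (singular_face n k f))))"
        by (simp add: Suc chain_boundary_of D_sum D_sign cochain_eval_sum cochain_eval_cmul del: sum.atMost_Suc)
      also have "\<dots> = (\<Sum>k\<le>n. (-1) ^ k * cochain_eval (\<phi> n) (D p (M p (singular_face n k f)) (frag_of (singular_face n k f))))"
      proof (rule sum.cong[OF refl])
        fix k assume "k \<in> {..n}"
        then have k: "k \<le> n" by simp
        show "(-1) ^ k * cochain_eval (\<phi> n) (D p ?m (frag_of (singular_face n k f))) = (-1) ^ k * cochain_eval (\<phi> n) (D p (M p (singular_face n k f)) (frag_of (singular_face n k f)))"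
          using D_stable[OF face[OF k], of ?m] M_face[of k p f] k unfolding Suc by simp
      qed
      also have "\<dots> = (\<Sum>k\<le>n. - ((-1) ^ k * \<psi> p (singular_face n k f)))"
        using face by (intro sum.cong refl) (simp add: \<psi>_def Suc)
      also have "\<dots> = - (\<Sum>k\<le>n. (-1) ^ k * \<psi> p (singular_face n k f))" by (rule sum_negf)
      also have "(\<Sum>k\<le>n. (-1) ^ k * \<psi> p (singular_face n k f)) = coboundary X \<psi> n f"
        using f unfolding Suc by (simp only: coboundary_def if_True) simp
      finally show ?thesis using eq by simp
    qed
  qed
  then have "\<phi> = coboundary X \<psi>" by (intro ext)
  then show ?thesis using \<psi>c by (simp add: coboundaries_def)
qed

section \<open>Vanishing of cup products\<close>

lemma simplex_map_const_eq:
  assumes "in_set n V f" "\<And>x. x \<in> V \<Longrightarrow> k x = p"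
  shows "simplex_map n k f = simplex_map n (\<lambda>_. p) f"
  using assms by (auto simp: simplex_map_def in_set_def fun_eq_iff)

lemma in_set_front: "in_set n V f \<Longrightarrow> p \<le> n \<Longrightarrow> in_set p V (front_face p f)"
  using standard_simplex_mono[of p n] by (auto simp: in_set_def front_face_def)

lemma in_set_back: "in_set n V f \<Longrightarrow> p \<le> n \<Longrightarrow> in_set (n - p) V (back_face p (n - p) f)"
  using shift_coords_in_simplex[of _ "n - p" p] by (auto simp: in_set_def back_face_eq)

text \<open>
  A constant map factors through the basepoint, where a reduced class is zero.
\<close>

lemma reduced_const_coboundary:
  fixes c :: "('a, 'k::comm_ring_1) cochain"
  assumes c: "c \<in> reduced_cocycles X x0" and x0: "x0 \<in> topspace X"
  shows "pullback X (\<lambda>_. x0) c \<in> coboundaries X"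
proof -
  let ?P = "subtopology X {x0}"
  have k: "continuous_map X ?P (\<lambda>_. x0)" using x0 by (simp add: continuous_map_in_subtopology)
  have "pullback X (\<lambda>_. x0) c = pullback X (\<lambda>_. x0) (restrict_cochain ?P c)"
    using singular_simplex_simplex_map[OF _ k] by (auto simp: pullback_def restrict_cochain_def fun_eq_iff)
  then show ?thesis using coboundaries_pullback[OF k] c by (auto simp: reduced_cocycles_def)
qed

text \<open>
  Pull back along \<open>k\<close> and subtract the pullback along the constant map to \<open>p\<close>.  The first is cohomologous to the
  original cocycle and the second to zero, and they agree on simplices in \<open>V\<close>, where \<open>k\<close> is constant.
\<close>

lemma locally_vanishing_representative:
  fixes c :: "('a, 'k::comm_ring_1) cochain"
  assumes c: "c \<in> reduced_cocycles X x0" and x0: "x0 \<in> topspace X"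
    and k: "homotopic_with (\<lambda>x. True) X X id k" and V: "\<And>x. x \<in> V \<Longrightarrow> k x = p"
    and p: "homotopic_with (\<lambda>x. True) X X (\<lambda>_. x0) (\<lambda>_. p)"
  obtains c' where "c' \<in> cocycles X" "cohomology_class X c' = cohomology_class X c"
    "\<And>n f. singular_simplex n X f \<Longrightarrow> in_set n V f \<Longrightarrow> c' n f = 0"
proof -
  have cc: "c \<in> cocycles X" using c by (simp add: reduced_cocycles_def)
  note cont = homotopic_with_imp_continuous_maps[OF k] homotopic_with_imp_continuous_maps[OF p]
  have pk: "pullback X k c \<in> cocycles X" and pp: "pullback X (\<lambda>_. p) c \<in> cocycles X" and p0: "pullback X (\<lambda>_. x0) c \<in> cocycles X"
    using cont cocycles_pullback[OF _ cc] by blast+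
  define c' where "c' = (\<lambda>n f. pullback X k c n f - pullback X (\<lambda>_. p) c n f)"
  have c': "c' \<in> cocycles X"
    using cocycles_add[OF pk cocycles_smult[OF pp, of "- 1"]] by (simp add: c'_def)
  have "pullback X id c = c"
  proof (intro ext)
    fix n f show "pullback X id c n f = c n f"
      using cc cochains_outside[of c X n f] by (auto simp: pullback_def cocycles_eq simplex_map_id_gen[of n X f id] simp del: simplex_map_id)
  qed
  then have 1: "(\<lambda>n f. pullback X k c n f - c n f) \<in> coboundaries X" using homotopic_pullback[OF k cc] by simp
  have 2: "(\<lambda>n f. pullback X (\<lambda>_. p) c n f - pullback X (\<lambda>_. x0) c n f) \<in> coboundaries X" by (rule homotopic_pullback[OF p cc])
  have 3: "pullback X (\<lambda>_. x0) c \<in> coboundaries X" by (rule reduced_const_coboundary[OF c x0])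
  have 4: "pullback X (\<lambda>_. p) c \<in> coboundaries X" using coboundaries_closed(2)[OF 2 3] by simp
  have "(\<lambda>n f. c' n f - c n f) \<in> coboundaries X"
    using coboundaries_closed(2)[OF 1 coboundaries_closed(3)[OF 4, of "- 1"]] by (simp add: c'_def algebra_simps)
  then have "cohomology_class X c' = cohomology_class X c" by (simp add: cohomology_class_eq_iff[OF c' cc])
  moreover have "c' n f = 0" if "singular_simplex n X f" "in_set n V f" for n f
    using simplex_map_const_eq[OF that(2) V] by (simp add: c'_def pullback_def)
  ultimately show ?thesis using that c' by blast
qed

text \<open>
  On a simplex in \<open>V\<close> the front factor is zero, on a simplex in \<open>W\<close> the back factor.
\<close>

lemma cup_product_vanishes:
  fixes a b :: "('a, 'k::comm_ring_1) cochain set"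
  assumes x0: "x0 \<in> topspace X" and V: "openin X V" "openin X W" "topspace X \<subseteq> V \<union> W"
    and k: "homotopic_with (\<lambda>x. True) X X id k" "\<And>x. x \<in> V \<Longrightarrow> k x = p" "homotopic_with (\<lambda>x. True) X X (\<lambda>_. x0) (\<lambda>_. p)"
    and l: "homotopic_with (\<lambda>x. True) X X id l" "\<And>x. x \<in> W \<Longrightarrow> l x = q" "homotopic_with (\<lambda>x. True) X X (\<lambda>_. x0) (\<lambda>_. q)"
    and ab: "a \<in> carrier (reduced_cohomology X x0)" "b \<in> carrier (reduced_cohomology X x0)"
  shows "a \<otimes>\<^bsub>cohomology X\<^esub> b = \<zero>\<^bsub>cohomology X\<^esub>"
proof -
  obtain c d where c: "c \<in> reduced_cocycles X x0" "a = cohomology_class X c" and d: "d \<in> reduced_cocycles X x0" "b = cohomology_class X d"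
    using ab by (auto simp: reduced_carrier)
  obtain c' where c': "c' \<in> cocycles X" "cohomology_class X c' = cohomology_class X c"
    "\<And>n f. singular_simplex n X f \<Longrightarrow> in_set n V f \<Longrightarrow> c' n f = 0"
    using locally_vanishing_representative[OF c(1) x0 k] by metis
  obtain d' where d': "d' \<in> cocycles X" "cohomology_class X d' = cohomology_class X d"
    "\<And>n f. singular_simplex n X f \<Longrightarrow> in_set n W f \<Longrightarrow> d' n f = 0"
    using locally_vanishing_representative[OF d(1) x0 l] by metis
  have "cup X c' d' n f = 0" if f: "singular_simplex n X f" "in_set n V f \<or> in_set n W f" for n f
  proof -
    have "c' p (front_face p f) * d' (n - p) (back_face p (n - p) f) = 0" if "p \<le> n" for p
      using f(2)
    proof
      assume "in_set n V f"
      then show ?thesis using c'(3)[OF singular_simplex_front_face[OF f(1) that] in_set_front] that by simp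
    next
      assume "in_set n W f"
      moreover have "singular_simplex (n - p) X (back_face p (n - p) f)"
        using singular_simplex_back_face[of p "n - p" X f] f(1) that by simp
      ultimately show ?thesis using d'(3)[OF _ in_set_back] that by simp
    qed
    then show ?thesis by (simp add: cup_def)
  qed
  then have "cup X c' d' \<in> coboundaries X"
    by (intro small_cocycle_coboundary[OF cocycles_cup[OF c'(1) d'(1)] V])
  then show ?thesis
    using cohomology_mult[OF c'(1) d'(1)] c'(2) d'(2) c(2) d(2) cohomology_class_eq_zero_iff[OF cocycles_cup[OF c'(1) d'(1)]] by simp
qed

section \<open>Contracting a neighbourhood of a vertex of a CW-complex\<close>

abbreviation unit_interval :: "real topology" where "unit_interval \<equiv> top_of_set {0..1}"

definition rad :: "nat \<Rightarrow> (nat \<Rightarrow> real) \<Rightarrow> real" where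
  "rad n u = sqrt (\<Sum>i<n. (u i)\<^sup>2)"

definition scale :: "real \<Rightarrow> (nat \<Rightarrow> real) \<Rightarrow> nat \<Rightarrow> real" where
  "scale c u = (\<lambda>i. c * u i)"

abbreviation disk_boundary :: "nat \<Rightarrow> (nat \<Rightarrow> real) set" where
  "disk_boundary n \<equiv> disk n - open_disk n"

abbreviation boundary_topology :: "nat \<Rightarrow> (nat \<Rightarrow> real) topology" where
  "boundary_topology n \<equiv> subtopology (disk_topology n) (disk_boundary n)"

lemma rad_nonneg: "0 \<le> rad n u" by (simp add: rad_def sum_nonneg)

lemma rad_scale: "rad n (scale c u) = \<bar>c\<bar> * rad n u"
  by (simp add: rad_def scale_def power_mult_distrib flip: sum_distrib_left) (simp add: real_sqrt_mult)

lemma scale_1: "scale 1 u = u" by (simp add: scale_def)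

lemma disk_iff: "u \<in> disk n \<longleftrightarrow> u \<in> topspace (Euclidean_space n) \<and> rad n u \<le> 1"
  by (simp add: disk_def rad_def)

lemma open_disk_iff: "u \<in> open_disk n \<longleftrightarrow> u \<in> topspace (Euclidean_space n) \<and> rad n u < 1"
  by (simp add: open_disk_def rad_def)

lemma boundary_iff: "u \<in> disk_boundary n \<longleftrightarrow> u \<in> topspace (Euclidean_space n) \<and> rad n u = 1"
  by (auto simp: disk_iff open_disk_iff)

lemma disk_cases: "u \<in> disk n \<Longrightarrow> u \<in> open_disk n \<or> u \<in> disk_boundary n" by auto

lemma scale_Euclidean: "u \<in> topspace (Euclidean_space n) \<Longrightarrow> scale c u \<in> topspace (Euclidean_space n)"
  by (simp add: topspace_Euclidean_space scale_def)

lemma radial_boundary: "u \<in> disk n \<Longrightarrow> 0 < rad n u \<Longrightarrow> scale (1 / rad n u) u \<in> disk_boundary n"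
  unfolding boundary_iff rad_scale by (simp add: disk_iff scale_Euclidean)

lemma disk_topology_eq: "disk_topology n = subtopology (powertop_real UNIV) (disk n)"
proof -
  have "disk n \<subseteq> topspace (Euclidean_space n)" by (auto simp: disk_iff)
  then have "{x. \<forall>i\<ge>n. x i = 0} \<inter> disk n = disk n" by (auto simp: topspace_Euclidean_space)
  then show ?thesis by (simp add: Euclidean_space_def subtopology_subtopology)
qed

lemma topspace_disk: "topspace (disk_topology n) = disk n"
  by (simp add: disk_topology_eq)

lemma topspace_boundary: "topspace (boundary_topology n) = disk_boundary n"
  by (auto simp: disk_topology_eq)

lemma coordinate_continuous: "continuous_map (disk_topology n) euclideanreal (\<lambda>u. u i)"
  unfolding disk_topology_eq by (intro continuous_map_from_subtopology continuous_map_product_projection) simp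

lemma rad_continuous: "continuous_map (disk_topology n) euclideanreal (rad n)"
  unfolding rad_def[abs_def] by (intro continuous_map_sqrt continuous_map_sum continuous_map_real_pow coordinate_continuous) simp

lemma continuous_into_disk:
  assumes "\<And>i. continuous_map T euclideanreal (\<lambda>p. f p i)" "\<And>p. p \<in> topspace T \<Longrightarrow> f p \<in> disk n"
  shows "continuous_map T (disk_topology n) f"
  unfolding disk_topology_eq using assms by (intro continuous_map_into_subtopology) (auto simp: continuous_map_componentwise_UNIV)

lemma compact_disk: "compact_space (disk_topology n)"
proof -
  have "compactin (powertop_real UNIV) (PiE UNIV (\<lambda>_. {-1..1}))" by (simp add: compactin_PiE)
  moreover have "disk n \<subseteq> PiE UNIV (\<lambda>_. {-1..1})"
  proof
    fix u assume u: "u \<in> disk n"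
    have "\<bar>u i\<bar> \<le> 1" for i
    proof (cases "i < n")
      case True
      then have "(u i)\<^sup>2 \<le> (\<Sum>i<n. (u i)\<^sup>2)" by (intro member_le_sum) auto
      then have "(u i)\<^sup>2 \<le> 1" using u by (simp add: disk_def)
      then show ?thesis by (simp add: abs_square_le_1)
    next
      case False then show ?thesis using u by (simp add: disk_def topspace_Euclidean_space)
    qed
    then show "u \<in> PiE UNIV (\<lambda>_. {-1..1})" by (simp add: abs_le_iff PiE_UNIV_domain minus_le_iff)
  qed
  moreover have "closedin (powertop_real UNIV) (disk n)"
  proof -
    have "continuous_map (powertop_real UNIV) euclideanreal (\<lambda>x. \<Sum>i<n. (x i)\<^sup>2)"
      by (intro continuous_map_sum continuous_map_real_pow continuous_map_product_projection) auto
    then have "closedin (powertop_real UNIV) {x \<in> topspace (powertop_real UNIV). (\<Sum>i<n. (x i)\<^sup>2) \<in> {..1}}"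
      by (rule closedin_continuous_map_preimage) simp
    then have "closedin (powertop_real UNIV) (topspace (Euclidean_space n) \<inter> {x \<in> topspace (powertop_real UNIV). (\<Sum>i<n. (x i)\<^sup>2) \<in> {..1}})"
      by (rule closedin_Int[OF closedin_Euclidean_space])
    then show ?thesis by (simp add: disk_def Int_def)
  qed
  ultimately have "compactin (powertop_real UNIV) (disk n)" by (rule closed_compactin)
  then show ?thesis unfolding disk_topology_eq by (rule compact_space_subtopology)
qed

lemma unit_interval_facts: "compact_space unit_interval" "Hausdorff_space unit_interval" "locally_compact_space unit_interval"
  by (auto simp: compact_space_subtopology Hausdorff_space_subtopology intro: compact_imp_locally_compact_space)

locale CW_complex =
  fixes X :: "'a topology" and \<Phi> :: "nat \<Rightarrow> ((nat \<Rightarrow> real) \<Rightarrow> 'a) set"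
  assumes CW: "CW_structure X \<Phi>"
begin

lemma hausdorff: "Hausdorff_space X" using CW by (simp add: CW_structure_def)

lemma char_continuous: "\<phi> \<in> \<Phi> n \<Longrightarrow> continuous_map (disk_topology n) X \<phi>" using CW by (simp add: CW_structure_def)

lemma char_in: "\<phi> \<in> \<Phi> n \<Longrightarrow> u \<in> disk n \<Longrightarrow> \<phi> u \<in> topspace X"
  using continuous_map_funspace[OF char_continuous] topspace_disk[of n] by blast

lemma in_cell: "x \<in> topspace X \<Longrightarrow> \<exists>n \<phi> u. \<phi> \<in> \<Phi> n \<and> u \<in> open_disk n \<and> x = \<phi> u"
  using CW[unfolded CW_structure_def, THEN conjunct2, THEN conjunct2, THEN conjunct1] by auto

lemma open_cells_disjoint:
  assumes "\<phi> \<in> \<Phi> n" "\<phi>' \<in> \<Phi> n'" "u \<in> open_disk n" "u' \<in> open_disk n'" "\<phi> u = \<phi>' u'"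
  shows "n = n' \<and> \<phi> = \<phi>' \<and> u = u'"
proof -
  have inj: "inj_on \<phi> (open_disk n)" using CW assms(1) by (simp add: CW_structure_def)
  have "\<forall>n n'. \<forall>\<phi>\<in>\<Phi> n. \<forall>\<phi>'\<in>\<Phi> n'. (n, \<phi>) \<noteq> (n', \<phi>') \<longrightarrow> \<phi> ` open_disk n \<inter> \<phi>' ` open_disk n' = {}"
    by (rule CW[unfolded CW_structure_def, THEN conjunct2, THEN conjunct2, THEN conjunct2, THEN conjunct1])
  then have "(n, \<phi>) = (n', \<phi>')" using assms by blast
  then show ?thesis using inj assms by (auto dest: inj_onD)
qed

lemma boundary_finite:
  assumes "\<phi> \<in> \<Phi> n"
  obtains F where "finite F" "\<And>k \<psi>. (k, \<psi>) \<in> F \<Longrightarrow> k < n \<and> \<psi> \<in> \<Phi> k"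
    "\<And>u. u \<in> disk_boundary n \<Longrightarrow> \<exists>(k, \<psi>)\<in>F. \<phi> u \<in> \<psi> ` open_disk k"
proof -
  note B = CW[unfolded CW_structure_def, THEN conjunct2, THEN conjunct2, THEN conjunct2, THEN conjunct2, THEN conjunct1]
  obtain F where F: "finite F" "F \<subseteq> (SIGMA k:{..<n}. \<Phi> k)" "\<phi> ` disk_boundary n \<subseteq> (\<Union>(k, \<psi>)\<in>F. \<psi> ` open_disk k)"
    using bspec[OF spec[OF B, of n] assms] by (elim exE conjE)
  show ?thesis
  proof (rule that[OF F(1)])
    show "k < n \<and> \<psi> \<in> \<Phi> k" if "(k, \<psi>) \<in> F" for k \<psi> using subsetD[OF F(2) that] by simp
    show "\<exists>(k, \<psi>)\<in>F. \<phi> u \<in> \<psi> ` open_disk k" if "u \<in> disk_boundary n" for u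
      using subsetD[OF F(3) imageI[OF that]] by blast
  qed
qed

lemma closedin_weak:
  "A \<subseteq> topspace X \<Longrightarrow> (\<And>n \<phi>. \<phi> \<in> \<Phi> n \<Longrightarrow> closedin (disk_topology n) {x \<in> disk n. \<phi> x \<in> A}) \<Longrightarrow> closedin X A"
  using CW[unfolded CW_structure_def, THEN conjunct2, THEN conjunct2, THEN conjunct2, THEN conjunct2, THEN conjunct2] by blast

lemma closedin_char_image:
  assumes "\<phi> \<in> \<Phi> n" "closedin (disk_topology n) C" shows "closedin X (\<phi> ` C)"
  using compactin_imp_closedin[OF hausdorff image_compactin[OF closedin_compact_space[OF compact_disk assms(2)] char_continuous[OF assms(1)]]] .

lemma closedin_cell: "\<phi> \<in> \<Phi> n \<Longrightarrow> closedin X (\<phi> ` disk n)"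
  using closedin_char_image[of \<phi> n "disk n"] closedin_topspace[of "disk_topology n"] by (simp only: topspace_disk)

text \<open>
  A closed cell is compact and \<open>X\<close> is Hausdorff, so the characteristic map times the unit interval is a quotient map onto its
  image.
\<close>

lemma continuous_on_closed_cell:
  assumes \<psi>: "\<psi> \<in> \<Phi> k" and E: "continuous_map (prod_topology (disk_topology k) unit_interval) Z (\<lambda>(u, \<tau>). E (\<psi> u) \<tau>)"
  shows "continuous_map (prod_topology (subtopology X (\<psi> ` disk k)) unit_interval) Z (\<lambda>(x, \<tau>). E x \<tau>)"
proof -
  let ?D = "prod_topology (disk_topology k) unit_interval" and ?C = "prod_topology (subtopology X (\<psi> ` disk k)) unit_interval"
  let ?q = "\<lambda>(u, \<tau> :: real). (\<psi> u, \<tau>)"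
  have sub: "\<psi> ` disk k \<subseteq> topspace X" using char_in[OF \<psi>] by blast
  have "continuous_map (disk_topology k) (subtopology X (\<psi> ` disk k)) \<psi>"
    by (intro continuous_map_into_subtopology char_continuous[OF \<psi>]) (simp add: topspace_disk del: topspace_subtopology)
  then have "continuous_map ?D (subtopology X (\<psi> ` disk k)) (\<psi> \<circ> fst)"
    by (intro continuous_map_compose[OF continuous_map_fst])
  then have c: "continuous_map ?D ?C ?q"
    by (simp add: continuous_map_pairwise o_def case_prod_beta' continuous_map_snd)
  have "closed_map ?D ?C ?q"
    by (intro continuous_imp_closed_map_gen[OF _ _ c] Hausdorff_imp_kc_space)
      (simp_all add: compact_space_prod_topology Hausdorff_space_prod_topology compact_disk Hausdorff_space_subtopology hausdorff compact_space_subtopology)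
  moreover have "?q ` topspace ?D = topspace ?C"
    using sub topspace_disk[of k] by (auto simp del: topspace_subtopology simp: topspace_subtopology_subset image_iff)
  ultimately have "quotient_map ?D ?C ?q" by (intro continuous_closed_imp_quotient_map c)
  then show ?thesis by (rule continuous_compose_quotient_map) (use E in \<open>simp add: o_def case_prod_beta'\<close>)
qed

text \<open>
  Continuity on \<open>X \<times> [0, 1]\<close> by induction on cells: the boundary of a cell is covered by finitely many closed cells of lower
  dimension, on which continuity is already known.  To pass from the cells to the whole space, consider a point \<open>(x, t)\<close>
  of the preimage of an open set and a closed interval \<open>J\<close> around \<open>t\<close> such that \<open>{x} \<times> J\<close> lies in the preimage.  The set of
  points \<open>y\<close> such that \<open>{y} \<times> J\<close> leaves the preimage is closed in every cell, because projections along
  compact spaces are closed, hence closed in \<open>X\<close>.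
\<close>

lemma continuous_cellwise:
  assumes step: "\<And>n \<phi>. \<phi> \<in> \<Phi> n \<Longrightarrow>
      continuous_map (prod_topology (boundary_topology n) unit_interval) Z (\<lambda>(u, \<tau>). E (\<phi> u) \<tau>) \<Longrightarrow>
      continuous_map (prod_topology (disk_topology n) unit_interval) Z (\<lambda>(u, \<tau>). E (\<phi> u) \<tau>)"
  shows "continuous_map (prod_topology X unit_interval) Z (\<lambda>(x, \<tau>). E x \<tau>)"
proof -
  have cell: "continuous_map (prod_topology (disk_topology n) unit_interval) Z (\<lambda>(u, \<tau>). E (\<phi> u) \<tau>)" if "\<phi> \<in> \<Phi> n" for n \<phi>
    using that
  proof (induction n arbitrary: \<phi> rule: less_induct)
    case (less n \<phi>)
    obtain F where F: "finite F" "\<And>k \<psi>. (k, \<psi>) \<in> F \<Longrightarrow> k < n \<and> \<psi> \<in> \<Phi> k"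
      "\<And>u. u \<in> disk_boundary n \<Longrightarrow> \<exists>(k, \<psi>)\<in>F. \<phi> u \<in> \<psi> ` open_disk k"
      using boundary_finite[OF less.prems] by metis
    let ?B = "prod_topology (boundary_topology n) unit_interval"
    have \<phi>B: "continuous_map ?B X (\<phi> \<circ> fst)"
      by (intro continuous_map_compose[OF continuous_map_fst] continuous_map_from_subtopology char_continuous[OF less.prems])
    show ?case
    proof (rule step[OF less.prems], rule pasting_lemma_closed[OF F(1)])
      fix i assume i: "i \<in> F"
      obtain k \<psi> where k: "i = (k, \<psi>)" by (cases i)
      then have \<psi>: "k < n" "\<psi> \<in> \<Phi> k" using F(2) i by auto
      let ?T = "{p \<in> topspace ?B. (\<phi> \<circ> fst) p \<in> snd i ` disk (fst i)}"
      show "closedin ?B ?T"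
        using k by (intro closedin_continuous_map_preimage[OF \<phi>B]) (simp add: closedin_cell[OF \<psi>(2)])
      have "continuous_map (subtopology ?B ?T) (subtopology X (\<psi> ` disk k)) (\<phi> \<circ> fst)"
        by (rule continuous_map_into_subtopology[OF continuous_map_from_subtopology[OF \<phi>B]]) (simp add: k)
      moreover have "continuous_map (subtopology ?B ?T) unit_interval snd"
        by (rule continuous_map_from_subtopology[OF continuous_map_snd])
      ultimately have "continuous_map (subtopology ?B ?T) (prod_topology (subtopology X (\<psi> ` disk k)) unit_interval) (\<lambda>(u, \<tau>). (\<phi> u, \<tau>))"
        by (simp only: continuous_map_pairwise o_def case_prod_beta' fst_conv snd_conv)
      then have "continuous_map (subtopology ?B ?T) Z ((\<lambda>(x, \<tau>). E x \<tau>) \<circ> (\<lambda>(u, \<tau>). (\<phi> u, \<tau>)))"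
        by (rule continuous_map_compose) (rule continuous_on_closed_cell[OF \<psi>(2) less.IH[OF \<psi>]])
      then show "continuous_map (subtopology ?B ?T) Z (\<lambda>(u, \<tau>). E (\<phi> u) \<tau>)" by (simp only: o_def case_prod_beta' fst_conv snd_conv)
    next
      fix p assume p: "p \<in> topspace ?B"
      then have "fst p \<in> disk_boundary n" by (simp only: topspace_prod_topology topspace_boundary mem_Times_iff)
      then obtain k \<psi> where "(k, \<psi>) \<in> F" "\<phi> (fst p) \<in> \<psi> ` open_disk k" using F(3) by blast
      then have "(k, \<psi>) \<in> F" "\<phi> (fst p) \<in> \<psi> ` disk k" by (auto simp: disk_def open_disk_def image_iff)
      then show "\<exists>j. j \<in> F \<and> p \<in> {p \<in> topspace ?B. (\<phi> \<circ> fst) p \<in> snd j ` disk (fst j)} \<and> (\<lambda>(u, \<tau>). E (\<phi> u) \<tau>) p = (\<lambda>(u, \<tau>). E (\<phi> u) \<tau>) p"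
        using p by (intro exI[of _ "(k, \<psi>)"]) simp
    qed simp
  qed
  have fibre: "continuous_map unit_interval Z (\<lambda>\<tau>. E x \<tau>)" if "x \<in> topspace X" for x
  proof -
    obtain n \<phi> u where c: "\<phi> \<in> \<Phi> n" "u \<in> open_disk n" "x = \<phi> u" using in_cell[OF \<open>x \<in> topspace X\<close>] by blast
    then have "u \<in> topspace (disk_topology n)" unfolding topspace_disk by (simp add: disk_iff open_disk_iff)
    then have "continuous_map unit_interval (prod_topology (disk_topology n) unit_interval) (\<lambda>\<tau>. (u, \<tau>))"
      by (simp add: continuous_map_pairwise o_def del: topspace_subtopology)
    then show ?thesis using continuous_map_compose[OF _ cell[OF c(1)]] c(3) by (fastforce simp: o_def)
  qed
  show ?thesis
    unfolding continuous_map_def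
  proof (intro conjI allI impI)
    show "(\<lambda>(x, \<tau>). E x \<tau>) \<in> topspace (prod_topology X unit_interval) \<rightarrow> topspace Z"
      using continuous_map_funspace[OF fibre] by auto
    fix O' assume O': "openin Z O'"
    show "openin (prod_topology X unit_interval) {p \<in> topspace (prod_topology X unit_interval). (case p of (x, \<tau>) \<Rightarrow> E x \<tau>) \<in> O'}"
      unfolding openin_prod_topology_alt
    proof (intro allI impI)
      fix x t assume "(x, t) \<in> {p \<in> topspace (prod_topology X unit_interval). (case p of (x, \<tau>) \<Rightarrow> E x \<tau>) \<in> O'}"
      then have x: "x \<in> topspace X" and t: "t \<in> {0..1}" and E: "E x t \<in> O'" by auto
      have "openin unit_interval {\<tau> \<in> topspace unit_interval. E x \<tau> \<in> O'}" by (rule openin_continuous_map_preimage[OF fibre[OF x] O'])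
      then obtain e where e: "e > 0" "\<And>\<tau>. \<tau> \<in> {0..1} \<Longrightarrow> \<bar>\<tau> - t\<bar> < e \<Longrightarrow> E x \<tau> \<in> O'"
        using t E by (auto simp: openin_euclidean_subtopology_iff dist_real_def)
      \<comment> \<open>A closed subinterval keeps the projection along it closed.\<close>
      define J where "J = {0..1} \<inter> cball t (e / 2)"
      have J: "compact J" "J \<subseteq> {0..1}" "t \<in> J" using t e(1) by (auto simp: J_def)
      have JO: "E x \<tau> \<in> O'" if "\<tau> \<in> J" for \<tau>
      proof (rule e(2))
        have "\<bar>t - \<tau>\<bar> \<le> e / 2" using that by (simp add: J_def dist_real_def)
        then show "\<bar>\<tau> - t\<bar> < e" using e(1) by linarith
      qed (use that J(2) in blast)
      define A where "A = {y \<in> topspace X. \<exists>\<tau>\<in>J. E y \<tau> \<notin> O'}"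
      have "closedin X A"
      proof (rule closedin_weak)
        fix n \<phi> assume \<phi>: "\<phi> \<in> \<Phi> n"
        let ?P = "prod_topology (disk_topology n) (top_of_set J)"
        have TJ: "top_of_set J = subtopology unit_interval J" using J(2) by (simp add: subtopology_subtopology Int_absorb1)
        have PJ: "?P = subtopology (prod_topology (disk_topology n) unit_interval) (UNIV \<times> J)"
          unfolding TJ by (metis subtopology_Times subtopology_UNIV)
        have cJ: "continuous_map ?P Z (\<lambda>(u, \<tau>). E (\<phi> u) \<tau>)"
          unfolding PJ by (intro continuous_map_from_subtopology cell[OF \<phi>])
        have "closedin ?P {p \<in> topspace ?P. (\<lambda>(u, \<tau>). E (\<phi> u) \<tau>) p \<in> topspace Z - O'}"
          by (rule closedin_continuous_map_preimage[OF cJ]) (use O' in blast)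
        moreover have "closed_map ?P (disk_topology n) fst"
          by (rule closed_map_fst) (use J(1) in \<open>simp add: compact_space_subtopology\<close>)
        ultimately have "closedin (disk_topology n) (fst ` {p \<in> topspace ?P. (\<lambda>(u, \<tau>). E (\<phi> u) \<tau>) p \<in> topspace Z - O'})"
          by (simp only: closed_map_def)
        moreover have "fst ` {p \<in> topspace ?P. (\<lambda>(u, \<tau>). E (\<phi> u) \<tau>) p \<in> topspace Z - O'} = {u \<in> disk n. \<phi> u \<in> A}"
        proof -
          have "E (\<phi> u) \<tau> \<in> topspace Z" if "u \<in> disk n" "\<tau> \<in> J" for u \<tau>
            using continuous_map_funspace[OF fibre[OF char_in[OF \<phi> that(1)]]] J(2) that(2) by auto
          then have "{p \<in> topspace ?P. (\<lambda>(u, \<tau>). E (\<phi> u) \<tau>) p \<in> topspace Z - O'} = {(u, \<tau>). u \<in> disk n \<and> \<tau> \<in> J \<and> E (\<phi> u) \<tau> \<notin> O'}"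
            using topspace_disk[of n] by auto
          then show ?thesis using char_in[OF \<phi>] by (force simp: A_def image_iff)
        qed
        ultimately show "closedin (disk_topology n) {u \<in> disk n. \<phi> u \<in> A}" by simp
      qed (auto simp: A_def)
      then have 1: "openin X (topspace X - A)" by blast
      have 2: "openin unit_interval ({0..1} \<inter> ball t (e / 2))" by (simp add: openin_open_Int)
      have "(topspace X - A) \<times> ({0..1} \<inter> ball t (e / 2)) \<subseteq> {p \<in> topspace (prod_topology X unit_interval). (case p of (x, \<tau>) \<Rightarrow> E x \<tau>) \<in> O'}"
        by (auto simp: A_def J_def)
      moreover have "x \<in> topspace X - A" "t \<in> {0..1} \<inter> ball t (e / 2)" using x JO t e(1) by (auto simp: A_def)
      ultimately show "\<exists>U V. openin X U \<and> openin unit_interval V \<and> x \<in> U \<and> t \<in> V \<and> U \<times> V \<subseteq> {p \<in> topspace (prod_topology X unit_interval). (case p of (x, \<tau>) \<Rightarrow> E x \<tau>) \<in> O'}"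
        using 1 2 by blast
    qed
  qed
qed


definition chart :: "'a \<Rightarrow> nat \<times> ((nat \<Rightarrow> real) \<Rightarrow> 'a) \<times> (nat \<Rightarrow> real)" where
  "chart x = (SOME (n, \<phi>, u). \<phi> \<in> \<Phi> n \<and> u \<in> open_disk n \<and> \<phi> u = x)"

definition cell_dim :: "'a \<Rightarrow> nat" where "cell_dim x = fst (chart x)"
definition cell_map :: "'a \<Rightarrow> (nat \<Rightarrow> real) \<Rightarrow> 'a" where "cell_map x = fst (snd (chart x))"
definition cell_coord :: "'a \<Rightarrow> nat \<Rightarrow> real" where "cell_coord x = snd (snd (chart x))"
definition cell_rad :: "'a \<Rightarrow> real" where "cell_rad x = rad (cell_dim x) (cell_coord x)"

lemma chart_char:
  assumes "\<phi> \<in> \<Phi> n" "u \<in> open_disk n"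
  shows "cell_dim (\<phi> u) = n" "cell_map (\<phi> u) = \<phi>" "cell_coord (\<phi> u) = u" "cell_rad (\<phi> u) = rad n u"
proof -
  have "chart (\<phi> u) = (n, \<phi>, u)"
    unfolding chart_def
  proof (rule some_equality)
    fix c assume "case c of (n', \<phi>', u') \<Rightarrow> \<phi>' \<in> \<Phi> n' \<and> u' \<in> open_disk n' \<and> \<phi>' u' = \<phi> u"
    then show "c = (n, \<phi>, u)" using open_cells_disjoint[OF assms(1) _ assms(2)] by (cases c) force
  qed (use assms in simp)
  then show "cell_dim (\<phi> u) = n" "cell_map (\<phi> u) = \<phi>" "cell_coord (\<phi> u) = u" "cell_rad (\<phi> u) = rad n u"
    by (simp_all add: cell_dim_def cell_map_def cell_coord_def cell_rad_def)
qed

text \<open>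
  The collapse pushes the points of each open cell away from its centre: at time \<open>\<tau>\<close> the radius has been multiplied by \<open>1 + 2 \<tau>\<close>.
  A point that has reached the boundary of its cell moves on in the lower cell that contains the boundary point.  The time that
  it has for this motion is \<open>0\<close> at the moment of arrival and all of \<open>\<tau>\<close> if it started on the boundary, which makes
  the map continuous.  The factor \<open>2\<close> lets the points of radius greater than \<open>2/3\<close> have the whole time \<open>1\<close> for the lower cells.
  The comparison of dimensions ensures termination; it holds whenever it is tested (\<open>boundary_dim\<close>).
\<close>

function collapse :: "'a \<Rightarrow> real \<Rightarrow> 'a" where
  "collapse x \<tau> =
    (if (1 + 2 * \<tau>) * cell_rad x \<le> 1 then cell_map x (scale (1 + 2 * \<tau>) (cell_coord x))
     else if cell_dim (cell_map x (scale (1 / cell_rad x) (cell_coord x))) < cell_dim x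
     then collapse (cell_map x (scale (1 / cell_rad x) (cell_coord x))) (min \<tau> ((1 + 2 * \<tau>) * cell_rad x - 1))
     else x)"
  by auto
termination by (relation "measure (\<lambda>(x, \<tau>). cell_dim x)") auto

declare collapse.simps [simp del]

lemma collapse_0:
  assumes "x \<in> topspace X" shows "collapse x 0 = x"
proof -
  obtain n \<phi> u where c: "\<phi> \<in> \<Phi> n" "u \<in> open_disk n" "x = \<phi> u" using in_cell[OF assms] by blast
  then show ?thesis by (subst collapse.simps) (simp add: chart_char open_disk_iff scale_1)
qed

lemma boundary_dim:
  assumes "\<phi> \<in> \<Phi> n" "u \<in> disk_boundary n" shows "cell_dim (\<phi> u) < n"
proof -
  obtain F where F: "\<And>k \<psi>. (k, \<psi>) \<in> F \<Longrightarrow> k < n \<and> \<psi> \<in> \<Phi> k"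
      "\<And>u. u \<in> disk_boundary n \<Longrightarrow> \<exists>(k, \<psi>)\<in>F. \<phi> u \<in> \<psi> ` open_disk k"
    using boundary_finite[OF assms(1)] by metis
  then obtain k \<psi> v where k: "(k, \<psi>) \<in> F" "v \<in> open_disk k" "\<phi> u = \<psi> v" using assms(2) by blast
  then show ?thesis using F(1)[OF k(1)] chart_char(1)[of \<psi> k v] by simp
qed

text \<open>
  The recursive description holds on closed cells as well: a point of the boundary keeps its position and its time.
\<close>

lemma collapse_char:
  assumes \<phi>: "\<phi> \<in> \<Phi> n" and u: "u \<in> disk n" and \<tau>: "0 \<le> \<tau>"
  shows "collapse (\<phi> u) \<tau> = (if (1 + 2 * \<tau>) * rad n u \<le> 1 then \<phi> (scale (1 + 2 * \<tau>) u)
     else collapse (\<phi> (scale (1 / rad n u) u)) (min \<tau> ((1 + 2 * \<tau>) * rad n u - 1)))"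
  using disk_cases[OF u]
proof
  assume o: "u \<in> open_disk n"
  have "cell_dim (\<phi> (scale (1 / rad n u) u)) < n" if "\<not> (1 + 2 * \<tau>) * rad n u \<le> 1"
    by (rule boundary_dim[OF \<phi> radial_boundary[OF u]]) (use that rad_nonneg[of n u] in \<open>cases "rad n u = 0"; simp\<close>)
  then show ?thesis by (subst collapse.simps) (simp add: chart_char[OF \<phi> o])
next
  assume "u \<in> disk_boundary n"
  then have r: "rad n u = 1" unfolding boundary_iff by simp
  show ?thesis
  proof (cases "\<tau> = 0")
    case True then show ?thesis using r collapse_0[OF char_in[OF \<phi> u]] by (simp add: scale_1)
  next
    case False then show ?thesis using r \<tau> by (simp add: scale_1 min_def)
  qed
qed

lemma collapse_continuous: "continuous_map (prod_topology X unit_interval) X (\<lambda>(x, \<tau>). collapse x \<tau>)"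
proof (rule continuous_cellwise)
  fix n \<phi> assume \<phi>: "\<phi> \<in> \<Phi> n"
    and B: "continuous_map (prod_topology (boundary_topology n) unit_interval) X (\<lambda>(u, \<tau>). collapse (\<phi> u) \<tau>)"
  let ?D = "prod_topology (disk_topology n) unit_interval"
  have top: "topspace ?D = disk n \<times> {0..1}" using topspace_disk[of n] by simp
  have co: "continuous_map ?D euclideanreal (\<lambda>p. fst p i)" for i
    using continuous_map_compose[OF continuous_map_fst coordinate_continuous] by (simp add: o_def)
  have ra: "continuous_map ?D euclideanreal (\<lambda>p. rad n (fst p))"
    using continuous_map_compose[OF continuous_map_fst rad_continuous] by (simp add: o_def)
  have ti: "continuous_map ?D euclideanreal snd"
    using continuous_map_snd[of "disk_topology n" unit_interval] continuous_map_in_subtopology by blast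
  have cr: "continuous_map ?D euclideanreal (\<lambda>p. (1 + 2 * snd p) * rad n (fst p))"
    by (intro continuous_map_real_mult continuous_map_add ra ti continuous_map_const[THEN iffD2]) auto
  have "continuous_map ?D X (\<lambda>p. if (1 + 2 * snd p) * rad n (fst p) \<le> 1 then \<phi> (scale (1 + 2 * snd p) (fst p))
     else collapse (\<phi> (scale (1 / rad n (fst p)) (fst p))) (min (snd p) ((1 + 2 * snd p) * rad n (fst p) - 1)))"
  proof (rule continuous_map_cases_le[OF cr])
    let ?S = "subtopology ?D {p \<in> topspace ?D. (1 + 2 * snd p) * rad n (fst p) \<le> 1}"
    have "continuous_map ?S (disk_topology n) (\<lambda>p. scale (1 + 2 * snd p) (fst p))"
    proof (rule continuous_into_disk)
      show "continuous_map ?S euclideanreal (\<lambda>p. scale (1 + 2 * snd p) (fst p) i)" for i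
        unfolding scale_def by (intro continuous_map_from_subtopology continuous_map_real_mult continuous_map_add co ti continuous_map_const[THEN iffD2]) auto
      fix p assume "p \<in> topspace ?S"
      then have "fst p \<in> disk n" "0 \<le> snd p" "(1 + 2 * snd p) * rad n (fst p) \<le> 1" using top by auto
      then show "scale (1 + 2 * snd p) (fst p) \<in> disk n" unfolding disk_iff rad_scale by (simp add: scale_Euclidean)
    qed
    from continuous_map_compose[OF this char_continuous[OF \<phi>]]
    show "continuous_map ?S X (\<lambda>p. \<phi> (scale (1 + 2 * snd p) (fst p)))" by (simp only: o_def)
  next
    let ?S = "subtopology ?D {p \<in> topspace ?D. 1 \<le> (1 + 2 * snd p) * rad n (fst p)}"
    have S: "fst p \<in> disk n" "0 \<le> snd p" "snd p \<le> 1" "1 \<le> (1 + 2 * snd p) * rad n (fst p)" "0 < rad n (fst p)" if "p \<in> topspace ?S" for p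
    proof -
      show 1: "fst p \<in> disk n" "0 \<le> snd p" "snd p \<le> 1" "1 \<le> (1 + 2 * snd p) * rad n (fst p)" using that top by auto
      then show "0 < rad n (fst p)" using rad_nonneg[of n "fst p"] by (cases "rad n (fst p) = 0") auto
    qed
    have bd: "scale (1 / rad n (fst p)) (fst p) \<in> disk_boundary n" if "p \<in> topspace ?S" for p
      using radial_boundary S[OF that] by blast
    have "continuous_map ?S (disk_topology n) (\<lambda>p. scale (1 / rad n (fst p)) (fst p))"
    proof (rule continuous_into_disk)
      show "continuous_map ?S euclideanreal (\<lambda>p. scale (1 / rad n (fst p)) (fst p) i)" for i
        unfolding scale_def
      proof (intro continuous_map_real_mult continuous_map_real_divide)
        show "rad n (fst p) \<noteq> 0" if "p \<in> topspace ?S" for p using S(5)[OF that] by simp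
      qed (simp, (intro continuous_map_from_subtopology ra co)+)
      show "scale (1 / rad n (fst p)) (fst p) \<in> disk n" if "p \<in> topspace ?S" for p using bd[OF that] by blast
    qed
    then have 1: "continuous_map ?S (boundary_topology n) (\<lambda>p. scale (1 / rad n (fst p)) (fst p))"
      by (rule continuous_map_into_subtopology) (use bd in blast)
    have 2: "continuous_map ?S unit_interval (\<lambda>p. min (snd p) ((1 + 2 * snd p) * rad n (fst p) - 1))"
    proof (rule continuous_map_into_subtopology)
      show "continuous_map ?S euclideanreal (\<lambda>p. min (snd p) ((1 + 2 * snd p) * rad n (fst p) - 1))"
        by (intro continuous_map_from_subtopology continuous_map_real_min continuous_map_diff cr ti continuous_map_const[THEN iffD2]) auto
      show "(\<lambda>p. min (snd p) ((1 + 2 * snd p) * rad n (fst p) - 1)) \<in> topspace ?S \<rightarrow> {0..1}"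
      proof
        fix p assume "p \<in> topspace ?S"
        then show "min (snd p) ((1 + 2 * snd p) * rad n (fst p) - 1) \<in> {0..1}" using S[of p] unfolding atLeastAtMost_iff by linarith
      qed
    qed
    have "continuous_map ?S (prod_topology (boundary_topology n) unit_interval)
        (\<lambda>p. (scale (1 / rad n (fst p)) (fst p), min (snd p) ((1 + 2 * snd p) * rad n (fst p) - 1)))"
      using 1 2 by (simp only: continuous_map_pairwise o_def fst_conv snd_conv)
    from continuous_map_compose[OF this B]
    show "continuous_map ?S X (\<lambda>p. collapse (\<phi> (scale (1 / rad n (fst p)) (fst p))) (min (snd p) ((1 + 2 * snd p) * rad n (fst p) - 1)))"
      by (simp only: o_def case_prod_conv)
  next
    fix p assume "p \<in> topspace ?D" and e: "(1 + 2 * snd p) * rad n (fst p) = 1"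
    then have p: "fst p \<in> disk n" "0 \<le> snd p" using top by auto
    have r: "0 < rad n (fst p)" using e rad_nonneg[of n "fst p"] by (cases "rad n (fst p) = 0") auto
    have "1 / rad n (fst p) = 1 + 2 * snd p" using e r by (simp add: field_simps)
    moreover have "min (snd p) ((1 + 2 * snd p) * rad n (fst p) - 1) = 0" using e p by simp
    moreover have "\<phi> (scale (1 / rad n (fst p)) (fst p)) \<in> topspace X" using char_in[OF \<phi>] radial_boundary[OF p(1) r] by blast
    ultimately show "\<phi> (scale (1 + 2 * snd p) (fst p)) = collapse (\<phi> (scale (1 / rad n (fst p)) (fst p))) (min (snd p) ((1 + 2 * snd p) * rad n (fst p) - 1))"
      by (simp add: collapse_0)
  qed simp
  then show "continuous_map ?D X (\<lambda>(u, \<tau>). collapse (\<phi> u) \<tau>)"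
  proof (rule continuous_map_eq)
    fix p assume "p \<in> topspace ?D"
    then have "fst p \<in> disk n" "0 \<le> snd p" using top by auto
    from collapse_char[OF \<phi> this]
    show "(if (1 + 2 * snd p) * rad n (fst p) \<le> 1 then \<phi> (scale (1 + 2 * snd p) (fst p))
       else collapse (\<phi> (scale (1 / rad n (fst p)) (fst p))) (min (snd p) ((1 + 2 * snd p) * rad n (fst p) - 1))) = (case p of (u, \<tau>) \<Rightarrow> collapse (\<phi> u) \<tau>)"
      by (simp only: case_prod_beta')
  qed
qed

text \<open>
  A neighbourhood of a vertex that \<open>collapse\<close> moves into the vertex: the points that are pushed out of successive
  cells from radius greater than \<open>2/3\<close> until they arrive at \<open>x0\<close>.
\<close>

inductive_set star :: "'a \<Rightarrow> 'a set" for x0 where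
  base: "x0 \<in> star x0"
| step: "\<phi> \<in> \<Phi> n \<Longrightarrow> u \<in> open_disk n \<Longrightarrow> 2 / 3 < rad n u \<Longrightarrow> \<phi> (scale (1 / rad n u) u) \<in> star x0 \<Longrightarrow> \<phi> u \<in> star x0"

lemma open_disk_subset: "open_disk n \<subseteq> disk n" by (auto simp: disk_iff open_disk_iff)

lemma collapse_star:
  assumes v: "\<phi>0 \<in> \<Phi> 0" "z \<in> open_disk 0" "x0 = \<phi>0 z" and "x \<in> star x0"
  shows "collapse x 1 = x0"
  using assms(4)
proof (induction rule: star.induct)
  case base
  have "z = (\<lambda>_. 0)" using v(2) by (auto simp: open_disk_iff topspace_Euclidean_space)
  moreover from this have "scale 3 z = z" by (simp add: scale_def)
  ultimately show ?case using collapse_char[OF v(1), of z 1] v(2,3) open_disk_subset[of 0] by (auto simp: rad_def)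
next
  case (step \<phi> n u)
  have "u \<in> disk n" using step(2) open_disk_subset by blast
  then show ?case using collapse_char[OF step(1), of u 1] step by simp
qed

lemma star_char_iff:
  assumes v: "\<phi>0 \<in> \<Phi> 0" "z \<in> open_disk 0" "x0 = \<phi>0 z" and \<phi>: "\<phi> \<in> \<Phi> n" and n: "0 < n" and u: "u \<in> disk n"
  shows "\<phi> u \<in> star x0 \<longleftrightarrow> 2 / 3 < rad n u \<and> \<phi> (scale (1 / rad n u) u) \<in> star x0"
proof (cases "u \<in> open_disk n")
  case True
  show ?thesis
  proof
    assume "\<phi> u \<in> star x0"
    then show "2 / 3 < rad n u \<and> \<phi> (scale (1 / rad n u) u) \<in> star x0"
    proof cases
      case base
      then show ?thesis using open_cells_disjoint[OF \<phi> v(1) True v(2)] v(3) n by simp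
    next
      case (step \<phi>' n' u')
      then show ?thesis using open_cells_disjoint[OF \<phi> step(2) True step(3)] by simp
    qed
  qed (use star.step[OF \<phi> True] in blast)
next
  case False
  then have "rad n u = 1" using u by (auto simp: disk_iff open_disk_iff)
  then show ?thesis by (simp add: scale_1)
qed

text \<open>
  In a cell the set is an open shell over its part in the boundary.  That part is open by induction: its complement is covered
  by the finitely many compact sets in which the lower cells meet the complement.
\<close>

lemma star_open_in_cell:
  assumes v: "\<phi>0 \<in> \<Phi> 0" "z \<in> open_disk 0" "x0 = \<phi>0 z" and "\<phi> \<in> \<Phi> n"
  shows "openin (disk_topology n) {u \<in> disk n. \<phi> u \<in> star x0}"
  using assms(4)
proof (induction n arbitrary: \<phi> rule: less_induct)
  case (less n \<phi>)
  note \<phi> = less.prems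
  show ?case
  proof (cases "n = 0")
    case True
    have "u = (\<lambda>_. 0)" if "u \<in> disk 0" for u using that by (auto simp: disk_iff topspace_Euclidean_space)
    then have "{u \<in> disk n. \<phi> u \<in> star x0} = {} \<or> {u \<in> disk n. \<phi> u \<in> star x0} = disk n" using True by blast
    then show ?thesis using openin_topspace[of "disk_topology n"] topspace_disk[of n] by (elim disjE) (simp_all only: openin_empty)
  next
    case False
    obtain F where F: "finite F" "\<And>k \<psi>. (k, \<psi>) \<in> F \<Longrightarrow> k < n \<and> \<psi> \<in> \<Phi> k"
      "\<And>u. u \<in> disk_boundary n \<Longrightarrow> \<exists>(k, \<psi>)\<in>F. \<phi> u \<in> \<psi> ` open_disk k"
      using boundary_finite[OF \<phi>] by metis
    define C where "C = (\<Union>(k, \<psi>)\<in>F. \<psi> ` {w \<in> disk k. \<psi> w \<notin> star x0})"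
    have "closedin X C"
      unfolding C_def
    proof (rule closedin_Union)
      fix T assume "T \<in> (\<lambda>(k, \<psi>). \<psi> ` {w \<in> disk k. \<psi> w \<notin> star x0}) ` F"
      then obtain k \<psi> where k: "(k, \<psi>) \<in> F" "T = \<psi> ` {w \<in> disk k. \<psi> w \<notin> star x0}" by auto
      have "closedin (disk_topology k) (disk k - {w \<in> disk k. \<psi> w \<in> star x0})"
        using closedin_diff[OF closedin_topspace less.IH[of k \<psi>]] F(2)[OF k(1)] topspace_disk[of k] by (simp only:)
      moreover have "disk k - {w \<in> disk k. \<psi> w \<in> star x0} = {w \<in> disk k. \<psi> w \<notin> star x0}" by auto
      ultimately show "closedin X T" using closedin_char_image[of \<psi> k] F(2)[OF k(1)] k(2) by simp
    qed (use F(1) in simp)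
    have bcont: "continuous_map (boundary_topology n) X \<phi>" by (intro continuous_map_from_subtopology char_continuous[OF \<phi>])
    have "openin (boundary_topology n) {v \<in> topspace (boundary_topology n). \<phi> v \<in> topspace X - C}"
      using \<open>closedin X C\<close> by (intro openin_continuous_map_preimage[OF bcont]) blast
    moreover have "\<phi> v \<in> topspace X - C \<longleftrightarrow> \<phi> v \<in> star x0" if v: "v \<in> disk_boundary n" for v
    proof -
      have "\<phi> v \<in> C" if "\<phi> v \<notin> star x0"
      proof -
        obtain k \<psi> w where "(k, \<psi>) \<in> F" "w \<in> open_disk k" "\<phi> v = \<psi> w" using F(3)[OF v] by blast
        then show ?thesis using that open_disk_subset unfolding C_def by fastforce
      qed
      moreover have "\<phi> v \<notin> star x0" if "\<phi> v \<in> C" using that by (auto simp: C_def)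
      moreover have "\<phi> v \<in> topspace X" using char_in[OF \<phi>] v by blast
      ultimately show ?thesis by blast
    qed
    ultimately have ob: "openin (boundary_topology n) {v \<in> disk_boundary n. \<phi> v \<in> star x0}"
      unfolding topspace_boundary by (metis (no_types, lifting) Collect_cong)
    define D where "D = {u \<in> topspace (disk_topology n). rad n u \<in> {2/3<..}}"
    have oD: "openin (disk_topology n) D"
      unfolding D_def by (rule openin_continuous_map_preimage[OF rad_continuous]) simp
    let ?S = "subtopology (disk_topology n) D"
    have tS: "topspace ?S = D" using topspace_subtopology_subset[of D "disk_topology n"] by (auto simp: D_def)
    have D: "u \<in> disk n \<and> 0 < rad n u" if "u \<in> D" for u using that topspace_disk[of n] by (auto simp: D_def)
    have "continuous_map ?S (disk_topology n) (\<lambda>u. scale (1 / rad n u) u)"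
    proof (rule continuous_into_disk)
      show "continuous_map ?S euclideanreal (\<lambda>u. scale (1 / rad n u) u i)" for i
        unfolding scale_def
      proof (intro continuous_map_real_mult continuous_map_real_divide)
        show "rad n u \<noteq> 0" if "u \<in> topspace ?S" for u using D[of u] that unfolding tS by simp
      qed (simp, (intro continuous_map_from_subtopology rad_continuous coordinate_continuous)+)
      show "scale (1 / rad n u) u \<in> disk n" if "u \<in> topspace ?S" for u using radial_boundary[of u n] D[of u] that unfolding tS by blast
    qed
    then have "continuous_map ?S (boundary_topology n) (\<lambda>u. scale (1 / rad n u) u)"
      by (rule continuous_map_into_subtopology) (use radial_boundary D tS in blast)
    from openin_continuous_map_preimage[OF this ob]
    have "openin ?S {u \<in> D. scale (1 / rad n u) u \<in> {v \<in> disk_boundary n. \<phi> v \<in> star x0}}" unfolding tS .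
    then have "openin (disk_topology n) {u \<in> D. scale (1 / rad n u) u \<in> {v \<in> disk_boundary n. \<phi> v \<in> star x0}}"
      using oD openin_trans_full by blast
    moreover have "{u \<in> D. scale (1 / rad n u) u \<in> {v \<in> disk_boundary n. \<phi> v \<in> star x0}} = {u \<in> disk n. \<phi> u \<in> star x0}"
    proof (rule Set.set_eqI)
      fix u
      show "u \<in> {u \<in> D. scale (1 / rad n u) u \<in> {v \<in> disk_boundary n. \<phi> v \<in> star x0}} \<longleftrightarrow> u \<in> {u \<in> disk n. \<phi> u \<in> star x0}"
      proof (cases "u \<in> disk n")
        case True
        then have "u \<in> D \<longleftrightarrow> 2 / 3 < rad n u" using topspace_disk[of n] by (simp only: D_def mem_Collect_eq greaterThan_iff simp_thms)
        then show ?thesis using star_char_iff[OF v \<phi> _ True] False True radial_boundary[OF True] by auto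
      next
        case F: False
        then show ?thesis using D[of u] by blast
      qed
    qed
    ultimately show ?thesis by simp
  qed
qed

lemma star_subset:
  assumes "x0 \<in> topspace X" shows "star x0 \<subseteq> topspace X"
proof
  fix x assume "x \<in> star x0" then show "x \<in> topspace X"
    by cases (use assms char_in open_disk_subset in blast)+
qed

lemma vertex_neighbourhood_collapse:
  assumes v: "\<phi>0 \<in> \<Phi> 0" "z \<in> open_disk 0" "x0 = \<phi>0 z"
  shows "\<exists>G U. homotopic_with (\<lambda>_. True) X X id G \<and> openin X U \<and> x0 \<in> U \<and> (\<forall>x\<in>U. G x = x0)"
proof (intro exI conjI)
  have x0: "x0 \<in> topspace X" using char_in[OF v(1)] v(2,3) open_disk_subset[of 0] by blast
  have "closedin X (topspace X - star x0)"
  proof (rule closedin_weak)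
    fix n \<phi> assume \<phi>: "\<phi> \<in> \<Phi> n"
    have "closedin (disk_topology n) (disk n - {u \<in> disk n. \<phi> u \<in> star x0})"
      using closedin_diff[OF closedin_topspace star_open_in_cell[OF v \<phi>]] topspace_disk[of n] by (simp only:)
    moreover have "disk n - {u \<in> disk n. \<phi> u \<in> star x0} = {u \<in> disk n. \<phi> u \<in> topspace X - star x0}" using char_in[OF \<phi>] by auto
    ultimately show "closedin (disk_topology n) {u \<in> disk n. \<phi> u \<in> topspace X - star x0}" by simp
  qed auto
  then show "openin X (star x0)" using star_subset[OF x0] by (simp add: openin_closedin)
  show "x0 \<in> star x0" by (rule star.base)
  show "\<forall>x\<in>star x0. collapse x 1 = x0" using collapse_star[OF v] by blast
  have "continuous_map (prod_topology unit_interval X) X ((\<lambda>(x, \<tau>). collapse x \<tau>) \<circ> (\<lambda>(\<tau>, x). (x, \<tau>)))"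
    by (rule continuous_map_compose[OF _ collapse_continuous]) (simp add: continuous_map_pairwise o_def case_prod_beta' continuous_map_fst continuous_map_snd)
  then show "homotopic_with (\<lambda>_. True) X X id (\<lambda>x. collapse x 1)"
    by (subst homotopic_with) (auto simp: collapse_0 intro!: exI[of _ "(\<lambda>(x, \<tau>). collapse x \<tau>) \<circ> (\<lambda>(\<tau>, x). (x, \<tau>))"])
qed

end

section \<open>Cup products on suspensions\<close>

text \<open>
  A deformation of the interval that respects the identifications of the suspension deforms the suspension.
  Continuity on the product with the time interval holds because that interval is locally compact.
\<close>

lemma cylinder_deformation:
  fixes q :: "'b \<times> real \<Rightarrow> 'a" and g :: "real \<Rightarrow> real \<Rightarrow> real"
  assumes q: "quotient_map (cylinder Y) X q"
    and g: "continuous_on ({0..1} \<times> {0..1}) (\<lambda>p. g (fst p) (snd p))"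
      "\<And>\<tau> t. \<tau> \<in> {0..1} \<Longrightarrow> t \<in> {0..1} \<Longrightarrow> g \<tau> t \<in> {0..1}" "\<And>t. t \<in> {0..1} \<Longrightarrow> g 0 t = t"
    and comp: "\<And>\<tau> p p'. \<tau> \<in> {0..1} \<Longrightarrow> p \<in> topspace (cylinder Y) \<Longrightarrow> p' \<in> topspace (cylinder Y) \<Longrightarrow> q p = q p' \<Longrightarrow>
      q (fst p, g \<tau> (snd p)) = q (fst p', g \<tau> (snd p'))"
  obtains k where "homotopic_with (\<lambda>_. True) X X id k"
    "\<And>p. p \<in> topspace (cylinder Y) \<Longrightarrow> k (q p) = q (fst p, g 1 (snd p))"
proof -
  let ?IC = "prod_topology unit_interval (cylinder Y)" and ?IX = "prod_topology unit_interval X"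
  let ?f = "\<lambda>x. q (fst (snd x), g (fst x) (snd (snd x)))"
  have Q: "quotient_map ?IC ?IX (\<lambda>(x, y). (x, q y))"
    using unit_interval_facts by (intro quotient_map_prod_right q) auto
  have c1: "continuous_map ?IC Y (\<lambda>x. fst (snd x))"
    using continuous_map_compose[OF continuous_map_snd continuous_map_fst] by (simp only: o_def)
  have c2: "continuous_map ?IC unit_interval (\<lambda>x. snd (snd x))"
    using continuous_map_compose[OF continuous_map_snd continuous_map_snd] by (simp only: o_def)
  have "continuous_map ?IC (prod_topology unit_interval unit_interval) (\<lambda>x. (fst x, snd (snd x)))"
    using c2 continuous_map_fst[of unit_interval "cylinder Y"] by (simp only: continuous_map_pairwise o_def fst_conv snd_conv)
  moreover have "continuous_map (prod_topology unit_interval unit_interval) euclideanreal (\<lambda>p. g (fst p) (snd p))"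
    using g(1) by (simp add: prod_topology_subtopology_eu)
  ultimately have "continuous_map ?IC euclideanreal ((\<lambda>p. g (fst p) (snd p)) \<circ> (\<lambda>x. (fst x, snd (snd x))))"
    by (rule continuous_map_compose)
  then have "continuous_map ?IC unit_interval (\<lambda>x. g (fst x) (snd (snd x)))"
    unfolding o_def fst_conv snd_conv by (rule continuous_map_into_subtopology) (use g(2) in auto)
  then have "continuous_map ?IC (cylinder Y) (\<lambda>x. (fst (snd x), g (fst x) (snd (snd x))))"
    using c1 by (simp only: continuous_map_pairwise o_def fst_conv snd_conv)
  from continuous_map_compose[OF this quotient_imp_continuous_map[OF q]]
  have cf: "continuous_map ?IC X ?f" by (simp only: o_def)
  have cp: "?f x = ?f y" if "x \<in> topspace ?IC" "y \<in> topspace ?IC" "(\<lambda>(x, y). (x, q y)) x = (\<lambda>(x, y). (x, q y)) y" for x y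
    using comp[of "fst x" "snd x" "snd y"] that by (simp add: mem_Times_iff case_prod_beta')
  obtain h where h: "continuous_map ?IX X h" "\<And>x. x \<in> topspace ?IC \<Longrightarrow> h ((\<lambda>(x, y). (x, q y)) x) = ?f x"
  proof (rule quotient_map_lift_exists[OF Q cf cp])
    fix h assume h: "continuous_map ?IX X h" "\<And>x. x \<in> topspace ?IC \<Longrightarrow> h ((\<lambda>(x, y). (x, q y)) x) = ?f x"
    show thesis by (rule that[OF h])
  qed
  have hq: "h (\<tau>, q p) = q (fst p, g \<tau> (snd p))" if "\<tau> \<in> {0..1}" "p \<in> topspace (cylinder Y)" for \<tau> p
    using h(2)[of "(\<tau>, p)"] that by simp
  have surj: "\<exists>p\<in>topspace (cylinder Y). x = q p" if "x \<in> topspace X" for x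
    using q that unfolding quotient_map_def by blast
  show ?thesis
  proof (rule that[of "\<lambda>x. h (1, x)"])
    have "h (0, x) = x" if x: "x \<in> topspace X" for x
    proof -
      obtain p where p: "p \<in> topspace (cylinder Y)" "x = q p" using surj[OF x] by blast
      then have "snd p \<in> {0..1}" by auto
      then show ?thesis using hq[of 0 p] p g(3)[of "snd p"] by simp
    qed
    then show "homotopic_with (\<lambda>_. True) X X id (\<lambda>x. h (1, x))" using h(1) by (subst homotopic_with) auto
  qed (use hq in simp)
qed

text \<open>
  At time \<open>1\<close> these maps send the parts \<open>t \<ge> 1/3\<close> and \<open>t \<le> 2/3\<close> of the interval to the ends \<open>1\<close> and \<open>0\<close>.
\<close>

definition push_up :: "real \<Rightarrow> real \<Rightarrow> real" where "push_up \<tau> t = min ((1 + 2 * \<tau>) * t) 1"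
definition push_down :: "real \<Rightarrow> real \<Rightarrow> real" where "push_down \<tau> t = max 0 ((1 + 2 * \<tau>) * t - 2 * \<tau>)"

lemma push_up:
  "continuous_on S (\<lambda>p. push_up (fst p) (snd p))" "\<tau> \<in> {0..1} \<Longrightarrow> t \<in> {0..1} \<Longrightarrow> push_up \<tau> t \<in> {0..1}"
  "t \<in> {0..1} \<Longrightarrow> push_up 0 t = t" "push_up \<tau> 0 = 0" "\<tau> \<in> {0..1} \<Longrightarrow> push_up \<tau> 1 = 1" "1 / 3 \<le> t \<Longrightarrow> push_up 1 t = 1"
  by (auto simp: push_up_def intro!: continuous_intros)

lemma push_down:
  "continuous_on S (\<lambda>p. push_down (fst p) (snd p))" "\<tau> \<in> {0..1} \<Longrightarrow> t \<in> {0..1} \<Longrightarrow> push_down \<tau> t \<in> {0..1}"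
  "t \<in> {0..1} \<Longrightarrow> push_down 0 t = t" "\<tau> \<in> {0..1} \<Longrightarrow> push_down \<tau> 0 = 0" "push_down \<tau> 1 = 1" "t \<le> 2 / 3 \<Longrightarrow> push_down 1 t = 0"
proof -
  show "push_down \<tau> t \<in> {0..1}" if "\<tau> \<in> {0..1}" "t \<in> {0..1}"
  proof -
    have "(1 + 2 * \<tau>) * t \<le> (1 + 2 * \<tau>) * 1" using that by (intro mult_left_mono) auto
    then have "(1 + 2 * \<tau>) * t - 2 * \<tau> \<le> 1" by (simp add: algebra_simps)
    then show ?thesis by (simp add: push_down_def)
  qed
qed (auto simp: push_down_def intro!: continuous_intros)

text \<open>
  The two open sets are \<open>t > 1/3\<close> and \<open>t < 2/3\<close>; they are pushed to the two cone points.  The basepoint is joined to both by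
  a path along the cylinder.
\<close>

lemma unreduced_suspension_cup_vanishes:
  fixes a b :: "('a, 'k::comm_ring_1) cochain set"
  assumes x0: "x0 \<in> topspace X" and Y: "topspace Y \<noteq> {}" and "is_unreduced_suspension Y X"
    and ab: "a \<in> carrier (reduced_cohomology X x0)" "b \<in> carrier (reduced_cohomology X x0)"
  shows "a \<otimes>\<^bsub>cohomology X\<^esub> b = \<zero>\<^bsub>cohomology X\<^esub>"
proof -
  obtain q where q: "quotient_map (cylinder Y) X q" and
    rel: "\<And>p p'. p \<in> topspace (cylinder Y) \<Longrightarrow> p' \<in> topspace (cylinder Y) \<Longrightarrow>
      q p = q p' \<longleftrightarrow> p = p' \<or> (snd p = 0 \<and> snd p' = 0) \<or> (snd p = 1 \<and> snd p' = 1)"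
    using assms(3) unfolding is_unreduced_suspension_def by metis
  have cyl: "p \<in> topspace (cylinder Y) \<longleftrightarrow> fst p \<in> topspace Y \<and> snd p \<in> {0..1}" for p by (cases p) simp
  have comp: "q (fst p, g \<tau> (snd p)) = q (fst p', g \<tau> (snd p'))"
    if "p \<in> topspace (cylinder Y)" "p' \<in> topspace (cylinder Y)" "q p = q p'" "g \<tau> 0 = 0" "g \<tau> 1 = 1" for p p' \<tau> and g :: "real \<Rightarrow> real \<Rightarrow> real"
    using rel[OF that(1,2)] that rel[of "(fst p, 0)" "(fst p', 0)"] rel[of "(fst p, 1)" "(fst p', 1)"] by (auto simp: cyl simp del: topspace_prod_topology)
  obtain k where k: "homotopic_with (\<lambda>_. True) X X id k" "\<And>p. p \<in> topspace (cylinder Y) \<Longrightarrow> k (q p) = q (fst p, push_up 1 (snd p))"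
    by (rule cylinder_deformation[OF q push_up(1,2,3)]) (use comp push_up(4,5) in blast)+
  obtain l where l: "homotopic_with (\<lambda>_. True) X X id l" "\<And>p. p \<in> topspace (cylinder Y) \<Longrightarrow> l (q p) = q (fst p, push_down 1 (snd p))"
    by (rule cylinder_deformation[OF q push_down(1,2,3)]) (use comp push_down(4,5) in blast)+
  obtain y1 where y1: "y1 \<in> topspace Y" using Y by blast
  have surj: "\<exists>p\<in>topspace (cylinder Y). x = q p" if "x \<in> topspace X" for x
    using q that unfolding quotient_map_def by blast
  have qX: "q p \<in> topspace X" if "p \<in> topspace (cylinder Y)" for p
    using q that unfolding quotient_map_def by blast
  have path: "path_component_of X x0 (q (y1, e))" if e: "e = 0 \<or> e = 1" for e :: real
  proof -
    obtain p where p: "p \<in> topspace (cylinder Y)" "x0 = q p" using surj[OF x0] by blast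
    define c where "c s = (1 - s) * snd p + s * e" for s :: real
    have e01: "e \<in> {0..1}" "snd p \<in> {0..1}" using e p(1) by (auto simp: cyl)
    have c01: "c s \<in> {0..1}" if "s \<in> {0..1}" for s
      using convex_real_interval(5)[of 0 1, unfolded convex_def, rule_format, of "snd p" e "1 - s" s] e01 that by (simp add: c_def)
    have "continuous_map unit_interval euclideanreal c" by (simp add: c_def[abs_def] continuous_intros)
    then have "continuous_map unit_interval unit_interval c" by (rule continuous_map_into_subtopology) (use c01 in auto)
    then have "continuous_map unit_interval (cylinder Y) (\<lambda>s. (fst p, c s))"
      using p(1) by (simp add: continuous_map_pairwise o_def cyl del: topspace_prod_topology)
    from continuous_map_compose[OF this quotient_imp_continuous_map[OF q]]
    have "pathin X (\<lambda>s. q (fst p, c s))" by (simp only: o_def pathin_def)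
    moreover have "q (fst p, c 0) = x0" using p(2) by (simp add: c_def)
    moreover have "q (fst p, c 1) = q (y1, e)"
      using rel[of "(fst p, e)" "(y1, e)"] e p(1) y1 by (auto simp: c_def cyl simp del: topspace_prod_topology)
    ultimately show ?thesis unfolding path_component_of_def by blast
  qed
  have opq: "openin X A" if "A \<subseteq> topspace X" "openin (cylinder Y) {p \<in> topspace (cylinder Y). q p \<in> A}" for A
    using q that unfolding quotient_map_def by blast
  define V where "V = {x \<in> topspace X. \<exists>p\<in>topspace (cylinder Y). x = q p \<and> 1 / 3 < snd p}"
  define W where "W = {x \<in> topspace X. \<exists>p\<in>topspace (cylinder Y). x = q p \<and> snd p < 2 / 3}"
  have sndc: "continuous_map (cylinder Y) euclideanreal snd"
    using continuous_map_snd[of Y unit_interval] continuous_map_in_subtopology by blast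
  have "{p \<in> topspace (cylinder Y). q p \<in> V} = {p \<in> topspace (cylinder Y). snd p \<in> {1/3<..}}"
    using rel qX by (auto simp: V_def simp del: topspace_prod_topology)
  moreover have "openin (cylinder Y) {p \<in> topspace (cylinder Y). snd p \<in> {1/3<..}}"
    by (rule openin_continuous_map_preimage[OF sndc]) simp
  moreover have "V \<subseteq> topspace X" by (auto simp: V_def)
  ultimately have oV: "openin X V" using opq by simp
  have "{p \<in> topspace (cylinder Y). q p \<in> W} = {p \<in> topspace (cylinder Y). snd p \<in> {..<2/3}}"
    using rel qX by (auto simp: W_def simp del: topspace_prod_topology)
  moreover have "openin (cylinder Y) {p \<in> topspace (cylinder Y). snd p \<in> {..<2/3}}"
    by (rule openin_continuous_map_preimage[OF sndc]) simp
  moreover have "W \<subseteq> topspace X" by (auto simp: W_def)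
  ultimately have oW: "openin X W" using opq by simp
  show ?thesis
  proof (rule cup_product_vanishes[OF x0 oV oW _ k(1) _ _ l(1) _ _ ab])
    show "topspace X \<subseteq> V \<union> W"
    proof
      fix x assume x: "x \<in> topspace X"
      then obtain p where "p \<in> topspace (cylinder Y)" "x = q p" using surj by blast
      moreover have "1 / 3 < snd p \<or> snd p < 2 / 3" by linarith
      ultimately show "x \<in> V \<union> W" using x unfolding V_def W_def by blast
    qed
    show "k x = q (y1, 1)" if x: "x \<in> V" for x
    proof -
      obtain p where p: "p \<in> topspace (cylinder Y)" "x = q p" "1 / 3 < snd p" using x by (auto simp: V_def simp del: topspace_prod_topology)
      then show ?thesis using k(2)[OF p(1)] rel[of "(fst p, 1)" "(y1, 1)"] y1 push_up(6)[of "snd p"] by (simp add: cyl del: topspace_prod_topology)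
    qed
    show "l x = q (y1, 0)" if x: "x \<in> W" for x
    proof -
      obtain p where p: "p \<in> topspace (cylinder Y)" "x = q p" "snd p < 2 / 3" using x by (auto simp: W_def simp del: topspace_prod_topology)
      then show ?thesis using l(2)[OF p(1)] rel[of "(fst p, 0)" "(y1, 0)"] y1 push_down(6)[of "snd p"] by (simp add: cyl del: topspace_prod_topology)
    qed
    show "homotopic_with (\<lambda>x. True) X X (\<lambda>_. x0) (\<lambda>_. q (y1, 1))" "homotopic_with (\<lambda>x. True) X X (\<lambda>_. x0) (\<lambda>_. q (y1, 0))"
      unfolding homotopic_constant_maps using path by blast+
  qed
qed

text \<open>
  The set \<open>t > 1/3\<close> is not saturated here, since it contains part of the segment over \<open>y0\<close>.  Therefore the push is composed with
  a map that contracts a neighbourhood \<open>U\<close> of the basepoint, and the open sets are the preimages of \<open>U\<close> under the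
  two pushes.
\<close>

lemma reduced_suspension_cup_vanishes:
  fixes a b :: "('a, 'k::comm_ring_1) cochain set" and Y :: "'b topology"
  assumes X: "pointed_CW_complex X x0" and y0: "y0 \<in> topspace Y" and "is_reduced_suspension Y y0 X x0"
    and ab: "a \<in> carrier (reduced_cohomology X x0)" "b \<in> carrier (reduced_cohomology X x0)"
  shows "a \<otimes>\<^bsub>cohomology X\<^esub> b = \<zero>\<^bsub>cohomology X\<^esub>"
proof -
  let ?S = "UNIV \<times> {0, 1} \<union> {y0} \<times> UNIV :: ('b \<times> real) set"
  obtain q where q: "quotient_map (cylinder Y) X q" and x0: "q (y0, 0) = x0" and
    rel: "\<And>p p'. p \<in> topspace (cylinder Y) \<Longrightarrow> p' \<in> topspace (cylinder Y) \<Longrightarrow> q p = q p' \<longleftrightarrow> p = p' \<or> (p \<in> ?S \<and> p' \<in> ?S)"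
    using assms(3) unfolding is_reduced_suspension_def by metis
  have cyl: "p \<in> topspace (cylinder Y) \<longleftrightarrow> fst p \<in> topspace Y \<and> snd p \<in> {0..1}" for p by (cases p) simp
  have qS: "q p = x0" if "p \<in> topspace (cylinder Y)" "p \<in> ?S" for p
    using rel[OF that(1), of "(y0, 0)"] that y0 x0 by (simp add: cyl del: topspace_prod_topology)
  have comp: "q (fst p, g \<tau> (snd p)) = q (fst p', g \<tau> (snd p'))"
    if p: "p \<in> topspace (cylinder Y)" "p' \<in> topspace (cylinder Y)" "q p = q p'" and g: "g \<tau> 0 = 0" "g \<tau> 1 = 1"
      "\<And>t. t \<in> {0..1} \<Longrightarrow> g \<tau> t \<in> {0..1}" for p p' \<tau> and g :: "real \<Rightarrow> real \<Rightarrow> real"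
  proof -
    have S: "q (fst r, g \<tau> (snd r)) = x0" if "r \<in> topspace (cylinder Y)" "r \<in> ?S" for r
    proof (rule qS)
      have r: "fst r \<in> topspace Y" "snd r \<in> {0..1}" using that(1) by (simp_all only: cyl)
      then show "(fst r, g \<tau> (snd r)) \<in> topspace (cylinder Y)" using g(3) by (simp only: cyl fst_conv snd_conv simp_thms)
      show "(fst r, g \<tau> (snd r)) \<in> ?S" using that(2) g(1,2) by (cases r) auto
    qed
    consider "p = p'" | "p \<in> ?S" "p' \<in> ?S" using rel[OF p(1,2)] p(3) by blast
    then show ?thesis using S[OF p(1)] S[OF p(2)] by cases simp_all
  qed
  obtain k where k: "homotopic_with (\<lambda>_. True) X X id k" "\<And>p. p \<in> topspace (cylinder Y) \<Longrightarrow> k (q p) = q (fst p, push_up 1 (snd p))"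
    by (rule cylinder_deformation[OF q push_up(1,2,3)]) (use comp push_up(2,4,5) in blast)+
  obtain l where l: "homotopic_with (\<lambda>_. True) X X id l" "\<And>p. p \<in> topspace (cylinder Y) \<Longrightarrow> l (q p) = q (fst p, push_down 1 (snd p))"
    by (rule cylinder_deformation[OF q push_down(1,2,3)]) (use comp push_down(2,4,5) in blast)+
  obtain \<Phi> \<phi>0 z where \<Phi>: "CW_structure X \<Phi>" "\<phi>0 \<in> \<Phi> 0" "z \<in> open_disk 0" "x0 = \<phi>0 z"
    using X unfolding pointed_CW_complex_def by blast
  interpret CW_complex X \<Phi> by unfold_locales (rule \<Phi>(1))
  obtain G U where G: "homotopic_with (\<lambda>_. True) X X id G" "openin X U" "x0 \<in> U" "\<And>x. x \<in> U \<Longrightarrow> G x = x0"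
    using vertex_neighbourhood_collapse[OF \<Phi>(2,3,4)] by blast
  have x0X: "x0 \<in> topspace X" using G(2,3) openin_subset by blast
  have Gc: "homotopic_with (\<lambda>_. True) X X id (G \<circ> r)" if "homotopic_with (\<lambda>_. True) X X id r" for r
    using homotopic_with_compose_continuous_map_left[OF that, of X G "\<lambda>_. True"] homotopic_with_imp_continuous_maps[OF G(1)] homotopic_with_trans[OF G(1)]
    by (simp add: o_def)
  have op: "openin X {x \<in> topspace X. r x \<in> U}" if "homotopic_with (\<lambda>_. True) X X id r" for r
    using homotopic_with_imp_continuous_maps[OF that] G(2) by (blast intro: openin_continuous_map_preimage)
  show ?thesis
  proof (rule cup_product_vanishes[OF x0X op[OF k(1)] op[OF l(1)] _ Gc[OF k(1)] _ _ Gc[OF l(1)] _ _ ab])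
    show "topspace X \<subseteq> {x \<in> topspace X. k x \<in> U} \<union> {x \<in> topspace X. l x \<in> U}"
    proof
      fix x assume x: "x \<in> topspace X"
      then obtain p where p: "p \<in> topspace (cylinder Y)" "x = q p" using q unfolding quotient_map_def by blast
      have py: "fst p \<in> topspace Y" using p(1) by (simp only: cyl)
      consider "1 / 3 \<le> snd p" | "snd p \<le> 2 / 3" by linarith
      then have "k x = x0 \<or> l x = x0"
      proof cases
        case 1
        then show ?thesis using k(2)[OF p(1)] p(2) push_up(6) qS[of "(fst p, 1)"] py by (simp add: cyl del: topspace_prod_topology)
      next
        case 2
        then show ?thesis using l(2)[OF p(1)] p(2) push_down(6) qS[of "(fst p, 0)"] py by (simp add: cyl del: topspace_prod_topology)
      qed
      then show "x \<in> {x \<in> topspace X. k x \<in> U} \<union> {x \<in> topspace X. l x \<in> U}" using x G(3) by auto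
    qed
    show "homotopic_with (\<lambda>x. True) X X (\<lambda>_. x0) (\<lambda>_. x0)" "homotopic_with (\<lambda>x. True) X X (\<lambda>_. x0) (\<lambda>_. x0)"
      using x0X by simp_all
  qed (use G(4) in auto)
qed

theorem suspension_cup_vanishes:
  fixes a b :: "('a, 'k::comm_ring_1) cochain set"
  assumes "pointed_CW_complex X x0" "suspension_space X x0"
    and "a \<in> carrier (reduced_cohomology X x0)" "b \<in> carrier (reduced_cohomology X x0)"
  shows "a \<otimes>\<^bsub>cohomology X\<^esub> b = \<zero>\<^bsub>cohomology X\<^esub>"
proof -
  have "x0 \<in> topspace X"
  proof -
    obtain \<Phi> \<phi>0 z where \<Phi>: "CW_structure X \<Phi>" "\<phi>0 \<in> \<Phi> 0" "z \<in> open_disk 0" "x0 = \<phi>0 z"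
      using assms(1) unfolding pointed_CW_complex_def by blast
    interpret CW_complex X \<Phi> by unfold_locales (rule \<Phi>(1))
    show ?thesis using char_in[OF \<Phi>(2)] \<Phi>(3,4) open_disk_subset[of 0] by blast
  qed
  then show ?thesis
    using assms unreduced_suspension_cup_vanishes reduced_suspension_cup_vanishes unfolding suspension_space_def by metis
qed

section \<open>The comparison map\<close>

lemma sign_cases: "sign p = 1 \<or> sign p = (- 1 :: int)"
  by (simp add: sign_def)

lemma shuffle_sign_cases: "shuffle_sign I L = 1 \<or> shuffle_sign I L = - 1"
  unfolding shuffle_sign_def Let_def by (rule sign_cases)

lemma of_int_shuffle_sign: "(of_int (shuffle_sign I L) :: 'k::comm_ring_1) = 1 \<or> (of_int (shuffle_sign I L) :: 'k) = - 1"
  using shuffle_sign_cases[of I L] by auto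

lemma (in signed_monomials) monomial_algebra: "monomial_algebra m K signed_algebra mon"
proof (rule monomial_algebra.intro)
  show "K \<subseteq> Pow {1..m}" using K by (simp add: simplicial_complex_on_def)
  show "kmodule signed_algebra" by (rule kmodule_signed_algebra)
  show "mon I L \<in> carrier signed_algebra" if "basis_index m K I L" for I L
    unfolding mon_def by (rule word_cl_closed[OF mon_word_basis[OF that]])
qed (use mon_coordinate mon_mult_monomial in blast)+

lemma (in signed_monomials) mon_mult_disjoint_sign:
  assumes IL: "basis_index m K I L" "basis_index m K I' L'" and dis: "(I \<union> L) \<inter> (I' \<union> L') = {}"
  shows "if L \<union> L' \<in> K then \<exists>c. (c = 1 \<or> c = - 1) \<and> mon I L \<otimes>\<^bsub>signed_algebra\<^esub> mon I' L' = c \<odot>\<^bsub>signed_algebra\<^esub> mon (I \<union> I') (L \<union> L')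
    else mon I L \<otimes>\<^bsub>signed_algebra\<^esub> mon I' L' = \<zero>\<^bsub>signed_algebra\<^esub>"
  using mon_mult_disjoint[OF assms] sign_equal_zero by (cases "L \<union> L' \<in> K") (auto simp: sign_equal_def)

text \<open>
  In a module this is \<open>eq_up_to_sign\<close>; with a scalar \<open>\<plusminus>1\<close> it is visibly compatible with linear and bilinear maps.
\<close>

definition up_to_sign :: "('k::comm_ring_1, 'b) module \<Rightarrow> 'b \<Rightarrow> 'b \<Rightarrow> bool" where
  "up_to_sign M a b \<longleftrightarrow> (\<exists>c. (c = 1 \<or> c = - 1) \<and> a = c \<odot>\<^bsub>M\<^esub> b)"

lemma (in kmodule) up_to_sign_iff: "b \<in> carrier M \<Longrightarrow> up_to_sign M a b \<longleftrightarrow> eq_up_to_sign M a b"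
proof -
  assume b: "b \<in> carrier M"
  have "up_to_sign M a b \<longleftrightarrow> a = 1 \<odot> b \<or> a = (- 1) \<odot> b" unfolding up_to_sign_def by blast
  then show ?thesis by (simp only: eq_up_to_sign_def smult_one[OF b] smult_minus_one[OF b])
qed

lemma up_to_signI: "c = 1 \<or> c = - 1 \<Longrightarrow> up_to_sign M (c \<odot>\<^bsub>M\<^esub> b) b"
  by (auto simp: up_to_sign_def)

lemma (in kmodule) up_to_sign_sym:
  assumes "b \<in> carrier M" "up_to_sign M a b" shows "up_to_sign M b a"
proof -
  obtain c where c: "c = 1 \<or> c = - 1" "a = c \<odot> b" using assms(2) by (auto simp: up_to_sign_def)
  then have "b = c \<odot> a" using assms(1) smult_assoc[OF assms(1), of c c] by auto
  then show ?thesis using c(1) by (auto simp: up_to_sign_def)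
qed

lemma (in kmodule) up_to_sign_trans:
  assumes "d \<in> carrier M" "up_to_sign M a b" "up_to_sign M b d" shows "up_to_sign M a d"
proof -
  obtain c c' where c: "c = 1 \<or> c = - 1" "a = c \<odot> b" "c' = 1 \<or> c' = - 1" "b = c' \<odot> d"
    using assms(2,3) unfolding up_to_sign_def by blast
  then have "a = (c * c') \<odot> d" using smult_assoc[OF assms(1)] by simp
  moreover have "c * c' = 1 \<or> c * c' = - 1" using c(1,3) by auto
  ultimately show ?thesis unfolding up_to_sign_def by blast
qed

lemma (in kmodule) up_to_sign_refl: "b \<in> carrier M \<Longrightarrow> up_to_sign M b b"
  using up_to_signI[of 1 M b] by simp

lemma linear_up_to_sign: "linear_map M N f \<Longrightarrow> b \<in> carrier M \<Longrightarrow> up_to_sign M a b \<Longrightarrow> up_to_sign N (f a) (f b)"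
  unfolding up_to_sign_def using linear_map_smult[of M N f b] by blast

lemma bilinear_up_to_sign:
  assumes M: "kmodule M" and \<mu>: "bilinear_op M \<mu>" and ab: "a \<in> carrier M" "b \<in> carrier M"
    and s: "up_to_sign M a' a" "up_to_sign M b' b"
  shows "up_to_sign M (\<mu> a' b') (\<mu> a b)"
proof -
  interpret M: kmodule M by (rule M)
  obtain c c' where c: "c = 1 \<or> c = - 1" "a' = c \<odot>\<^bsub>M\<^esub> a" "c' = 1 \<or> c' = - 1" "b' = c' \<odot>\<^bsub>M\<^esub> b"
    using s unfolding up_to_sign_def by blast
  have l: "linear_map M M (\<mu> x)" and r: "linear_map M M (\<lambda>y. \<mu> y x)" if "x \<in> carrier M" for x
    using \<mu> that unfolding bilinear_op_def by blast+
  have cl: "\<mu> a b \<in> carrier M" by (rule linear_map_closed[OF l[OF ab(1)] ab(2)])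
  have "\<mu> a' b' = c' \<odot>\<^bsub>M\<^esub> \<mu> (c \<odot>\<^bsub>M\<^esub> a) b"
    unfolding c(2,4) by (rule linear_map_smult[OF l ab(2)]) (use ab in simp)
  also have "\<mu> (c \<odot>\<^bsub>M\<^esub> a) b = c \<odot>\<^bsub>M\<^esub> \<mu> a b" by (rule linear_map_smult[OF r[OF ab(2)] ab(1)])
  finally have "\<mu> a' b' = c' \<odot>\<^bsub>M\<^esub> (c \<odot>\<^bsub>M\<^esub> \<mu> a b)" .
  then have "\<mu> a' b' = (c' * c) \<odot>\<^bsub>M\<^esub> \<mu> a b" using M.smult_assoc[OF cl] by simp
  moreover have "c' * c = 1 \<or> c' * c = - 1" using c(1,3) by auto
  ultimately show ?thesis unfolding up_to_sign_def by blast
qed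

context monomial_algebra begin

lemma poly_algebra_simps:
  "carrier (poly_algebra m K X x0 A bmon bdeg) = carrier (PM X x0)"
  "ring.add (poly_algebra m K X x0 A bmon bdeg) = ring.add (PM X x0)"
  "smult (poly_algebra m K X x0 A bmon bdeg) = smult (PM X x0)"
  "monoid.mult (poly_algebra m K X x0 A bmon bdeg) = poly_mult m K X x0 A bmon bdeg"
  "eq_up_to_sign (poly_algebra m K X x0 A bmon bdeg) = eq_up_to_sign (PM X x0)"
  by (simp_all add: poly_algebra_def eq_up_to_sign_def a_inv_def fun_eq_iff)

lemma poly_mult_spec:
  "bilinear_op (PM X x0) (poly_mult m K X x0 A bmon bdeg)"
  "basis_index m K I L \<Longrightarrow> basis_index m K I' L' \<Longrightarrow> H_homogeneous m X x0 (I \<union> L) d \<eta> \<Longrightarrow> H_homogeneous m X x0 (I' \<union> L') d' \<eta>' \<Longrightarrow>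
    up_to_sign (PM X x0)
      (poly_mult m K X x0 A bmon bdeg (gen X x0 I L (H_pure m X x0 (I \<union> L) \<eta>)) (gen X x0 I' L' (H_pure m X x0 (I' \<union> L') \<eta>')))
      (pelem X x0 (I \<union> L \<union> I' \<union> L') (bmon I L \<otimes>\<^bsub>A\<^esub> bmon I' L')
        (H_pure m X x0 (I \<union> L \<union> I' \<union> L') (\<lambda>i\<in>{1..m}. \<eta> i \<otimes>\<^bsub>cohomology (X i)\<^esub> \<eta>' i)))"
proof -
  have sgn: "(- 1 :: 'k) ^ n = 1 \<or> (- 1 :: 'k) ^ n = - 1" for n by (cases "even n") simp_all
  note spec = someI_ex[OF poly_mult_exists[of X x0 bdeg], folded poly_mult_def]
  show "bilinear_op (PM X x0) (poly_mult m K X x0 A bmon bdeg)" by (rule conjunct1[OF spec])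
  assume "basis_index m K I L" "basis_index m K I' L'" "H_homogeneous m X x0 (I \<union> L) d \<eta>" "H_homogeneous m X x0 (I' \<union> L') d' \<eta>'"
  then show "up_to_sign (PM X x0)
      (poly_mult m K X x0 A bmon bdeg (gen X x0 I L (H_pure m X x0 (I \<union> L) \<eta>)) (gen X x0 I' L' (H_pure m X x0 (I' \<union> L') \<eta>')))
      (pelem X x0 (I \<union> L \<union> I' \<union> L') (bmon I L \<otimes>\<^bsub>A\<^esub> bmon I' L')
        (H_pure m X x0 (I \<union> L \<union> I' \<union> L') (\<lambda>i\<in>{1..m}. \<eta> i \<otimes>\<^bsub>cohomology (X i)\<^esub> \<eta>' i)))"
    using conjunct2[OF spec, rule_format, of I L I' L' d \<eta> d' \<eta>'] by (simp only: simp_thms) (rule up_to_signI, rule sgn)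
qed

end

locale disjoint_monomial_algebra = monomial_algebra +
  assumes disjoint_mult: "basis_index m K I L \<Longrightarrow> basis_index m K I' L' \<Longrightarrow> (I \<union> L) \<inter> (I' \<union> L') = {} \<Longrightarrow>
    if L \<union> L' \<in> K then \<exists>c. (c = 1 \<or> c = - 1) \<and> bmon I L \<otimes>\<^bsub>A\<^esub> bmon I' L' = c \<odot>\<^bsub>A\<^esub> bmon (I \<union> I') (L \<union> L')
    else bmon I L \<otimes>\<^bsub>A\<^esub> bmon I' L' = \<zero>\<^bsub>A\<^esub>"
begin

text \<open>
  The element to which, up to sign, the product of two elements with disjoint supports reduces.  It is described by
  index sets alone, which is why the two algebras agree.
\<close>

definition merged where
  "merged X x0 I L I' L' h = (if L \<union> L' \<in> K then gen X x0 (I \<union> I') (L \<union> L') h else \<zero>\<^bsub>PM X x0\<^esub>)"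

lemma merged_elem:
  assumes b: "basis_index m K I L" "basis_index m K I' L'" and dis: "(I \<union> L) \<inter> (I' \<union> L') = {}"
    and h: "h \<in> carrier (HT X x0 (I \<union> L \<union> I' \<union> L'))"
  shows "up_to_sign (PM X x0) (pelem X x0 (I \<union> L \<union> I' \<union> L') (bmon I L \<otimes>\<^bsub>A\<^esub> bmon I' L') h) (merged X x0 I L I' L' h)"
    and "merged X x0 I L I' L' h \<in> carrier (PM X x0)"
proof -
  interpret P: kmodule "PM X x0" by (rule kmodule_PM)
  let ?J = "I \<union> L \<union> I' \<union> L'"
  have J: "?J \<in> Pow {1..m}" using basis_index_subset[OF b(1)] basis_index_subset[OF b(2)] by auto
  have Jeq: "(I \<union> I') \<union> (L \<union> L') = ?J" by auto
  note lin = linear_elem_left[OF J h]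
  have "up_to_sign (PM X x0) (pelem X x0 ?J (bmon I L \<otimes>\<^bsub>A\<^esub> bmon I' L') h) (merged X x0 I L I' L' h) \<and> merged X x0 I L I' L' h \<in> carrier (PM X x0)"
  proof (cases "L \<union> L' \<in> K")
    case True
    then have b': "basis_index m K (I \<union> I') (L \<union> L')" using b dis by (auto simp: basis_index_def)
    obtain c where c: "c = 1 \<or> c = - 1" "bmon I L \<otimes>\<^bsub>A\<^esub> bmon I' L' = c \<odot>\<^bsub>A\<^esub> bmon (I \<union> I') (L \<union> L')"
      using disjoint_mult[OF b dis] True by auto
    note bm = bmon_support[OF b' Jeq]
    have "pelem X x0 ?J (bmon I L \<otimes>\<^bsub>A\<^esub> bmon I' L') h = c \<odot>\<^bsub>PM X x0\<^esub> pelem X x0 ?J (bmon (I \<union> I') (L \<union> L')) h"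
      unfolding c(2) using linear_map_smult[OF lin bm, of c] by simp
    moreover have "merged X x0 I L I' L' h = pelem X x0 ?J (bmon (I \<union> I') (L \<union> L')) h" unfolding merged_def Jeq using True by simp
    ultimately show ?thesis using up_to_signI[OF c(1)] linear_map_closed[OF lin bm] by simp
  next
    case False
    then have "bmon I L \<otimes>\<^bsub>A\<^esub> bmon I' L' = \<zero>\<^bsub>AJ ?J\<^esub>" using disjoint_mult[OF b dis] by simp
    then have "pelem X x0 ?J (bmon I L \<otimes>\<^bsub>A\<^esub> bmon I' L') h = \<zero>\<^bsub>PM X x0\<^esub>"
      using linear_map_zero[OF kmodule_support kmodule_PM lin] by simp
    then show ?thesis using False P.up_to_sign_refl[OF P.zero_closed] by (simp add: merged_def)
  qed
  then show "up_to_sign (PM X x0) (pelem X x0 (I \<union> L \<union> I' \<union> L') (bmon I L \<otimes>\<^bsub>A\<^esub> bmon I' L') h) (merged X x0 I L I' L' h)"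
    and "merged X x0 I L I' L' h \<in> carrier (PM X x0)" by blast+
qed

text \<open>
  A zero in the cohomology factor annihilates the element, whatever the monomials are.
\<close>

lemma elem_zero:
  assumes b: "basis_index m K I L" "basis_index m K I' L'"
  shows "pelem X x0 (I \<union> L \<union> I' \<union> L') (bmon I L \<otimes>\<^bsub>A\<^esub> bmon I' L') \<zero>\<^bsub>HT X x0 (I \<union> L \<union> I' \<union> L')\<^esub> = \<zero>\<^bsub>PM X x0\<^esub>"
proof -
  have J: "I \<union> L \<union> I' \<union> L' \<in> Pow {1..m}" using basis_index_subset[OF b(1)] basis_index_subset[OF b(2)] by auto
  show ?thesis by (rule linear_map_zero[OF kmodule_H_tensor kmodule_PM linear_elem_right[OF J bmon_mult_support[OF b]]])
qed

end

text \<open>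
  The comparison of two algebras with the same multiplication rule for disjoint supports, for an arbitrary choice of signs.
\<close>

locale monomial_comparison = C: disjoint_monomial_algebra m K A bmon + B: disjoint_monomial_algebra m K A' bmon'
  for m K and A :: "('k::comm_ring_1, 'r) module" and bmon and A' :: "('k, 's) module" and bmon' +
  fixes s :: "nat set \<Rightarrow> nat set \<Rightarrow> 'k"
  assumes s: "s I L = 1 \<or> s I L = - 1"
begin

lemma linear_map_poly_algebra:
  "linear_map (poly_algebra m K X x0 A bmon e) (poly_algebra m K X x0 A' bmon' e') f \<longleftrightarrow> linear_map (C.PM X x0) (B.PM X x0) f"
  unfolding linear_map_def C.poly_algebra_simps B.poly_algebra_simps ..

definition comparison where
  "comparison X x0 f \<longleftrightarrow> linear_map (C.PM X x0) (B.PM X x0) f \<and>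
    (\<forall>I L. \<forall>h\<in>carrier (C.HT X x0 (I \<union> L)). basis_index m K I L \<longrightarrow> f (C.gen X x0 I L h) = s I L \<odot>\<^bsub>B.PM X x0\<^esub> B.gen X x0 I L h)"

lemma comparison_exists: "\<exists>f. comparison X x0 f"
  unfolding comparison_def
  by (rule C.poly_extend[OF B.kmodule_PM]) (rule linear_map_pointwise_smult[OF B.kmodule_PM B.linear_gen])

text \<open>
  The inverse is given by the same signs, since they are their own inverses.
\<close>

lemma comparison_iso:
  assumes f: "comparison X x0 f" shows "linear_iso (C.PM X x0) (B.PM X x0) f"
proof -
  interpret CM: kmodule "C.PM X x0" by (rule C.kmodule_PM)
  interpret BM: kmodule "B.PM X x0" by (rule B.kmodule_PM)
  have lf: "linear_map (C.PM X x0) (B.PM X x0) f"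
    and fg: "\<And>I L h. basis_index m K I L \<Longrightarrow> h \<in> carrier (C.HT X x0 (I \<union> L)) \<Longrightarrow> f (C.gen X x0 I L h) = s I L \<odot>\<^bsub>B.PM X x0\<^esub> B.gen X x0 I L h"
    using f unfolding comparison_def by blast+
  have "\<exists>g. linear_map (B.PM X x0) (C.PM X x0) g \<and>
    (\<forall>I L. \<forall>h\<in>carrier (C.HT X x0 (I \<union> L)). basis_index m K I L \<longrightarrow> g (B.gen X x0 I L h) = s I L \<odot>\<^bsub>C.PM X x0\<^esub> C.gen X x0 I L h)"
    by (rule B.poly_extend[OF C.kmodule_PM]) (rule linear_map_pointwise_smult[OF C.kmodule_PM C.linear_gen])
  then obtain g where lg: "linear_map (B.PM X x0) (C.PM X x0) g"
    and gg: "\<And>I L h. basis_index m K I L \<Longrightarrow> h \<in> carrier (C.HT X x0 (I \<union> L)) \<Longrightarrow> g (B.gen X x0 I L h) = s I L \<odot>\<^bsub>C.PM X x0\<^esub> C.gen X x0 I L h"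
    by blast
  have ss: "s I L * s I L = 1" for I L using s[of I L] by auto
  have lid: "linear_map M M (\<lambda>x. x)" for M :: "('k, 'z) module" by (simp add: linear_map_def)
  have 1: "g (f x) = x" if "x \<in> carrier (C.PM X x0)" for x
  proof (rule C.poly_eqI[OF C.kmodule_PM linear_map_compose[OF lf lg] lid _ that])
    fix I L h assume b: "basis_index m K I L" and h: "h \<in> carrier (C.HT X x0 (I \<union> L))"
    note c = linear_map_closed[OF B.linear_gen[OF b] h] linear_map_closed[OF C.linear_gen[OF b] h]
    show "g (f (C.gen X x0 I L h)) = C.gen X x0 I L h"
      unfolding fg[OF b h] linear_map_smult[OF lg c(1)] gg[OF b h] CM.smult_assoc[OF c(2), symmetric] ss by (rule CM.smult_one[OF c(2)])
  qed
  have 2: "f (g x) = x" if "x \<in> carrier (B.PM X x0)" for x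
  proof (rule B.poly_eqI[OF B.kmodule_PM linear_map_compose[OF lg lf] lid _ that])
    fix I L h assume b: "basis_index m K I L" and h: "h \<in> carrier (C.HT X x0 (I \<union> L))"
    note c = linear_map_closed[OF B.linear_gen[OF b] h] linear_map_closed[OF C.linear_gen[OF b] h]
    show "f (g (B.gen X x0 I L h)) = B.gen X x0 I L h"
      unfolding gg[OF b h] linear_map_smult[OF lf c(2)] fg[OF b h] BM.smult_assoc[OF c(1), symmetric] ss by (rule BM.smult_one[OF c(1)])
  qed
  have "bij_betw f (carrier (C.PM X x0)) (carrier (B.PM X x0))"
    by (rule bij_betw_byWitness[of _ g]) (use 1 2 linear_map_closed[OF lf] linear_map_closed[OF lg] in auto)
  then show ?thesis using lf by (simp add: linear_iso_def)
qed

text \<open>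
  Up to sign, both sides are the element of the merged index sets if the supports are disjoint; if some factor of the
  cohomology class vanishes, both are zero.
\<close>

lemma comparison_mult:
  assumes f: "comparison X x0 f" and b: "basis_index m K I L" "basis_index m K I' L'"
    and \<eta>: "H_homogeneous m X x0 (I \<union> L) d \<eta>" "H_homogeneous m X x0 (I' \<union> L') d' \<eta>'"
    and dis: "(I \<union> L) \<inter> (I' \<union> L') = {} \<or> (\<exists>i\<in>{1..m}. \<eta> i \<otimes>\<^bsub>cohomology (X i)\<^esub> \<eta>' i = \<zero>\<^bsub>cohomology (X i)\<^esub>)"
  shows "up_to_sign (B.PM X x0)
    (f (poly_mult m K X x0 A bmon e (C.gen X x0 I L (H_pure m X x0 (I \<union> L) \<eta>)) (C.gen X x0 I' L' (H_pure m X x0 (I' \<union> L') \<eta>'))))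
    (poly_mult m K X x0 A' bmon' e' (f (C.gen X x0 I L (H_pure m X x0 (I \<union> L) \<eta>))) (f (C.gen X x0 I' L' (H_pure m X x0 (I' \<union> L') \<eta>'))))"
proof -
  interpret BM: kmodule "B.PM X x0" by (rule B.kmodule_PM)
  have lf: "linear_map (C.PM X x0) (B.PM X x0) f"
    and fg: "\<And>I L h. basis_index m K I L \<Longrightarrow> h \<in> carrier (C.HT X x0 (I \<union> L)) \<Longrightarrow> f (C.gen X x0 I L h) = s I L \<odot>\<^bsub>B.PM X x0\<^esub> B.gen X x0 I L h"
    using f unfolding comparison_def by blast+
  let ?J = "I \<union> L \<union> I' \<union> L'" and ?\<theta> = "\<lambda>i\<in>{1..m}. \<eta> i \<otimes>\<^bsub>cohomology (X i)\<^esub> \<eta>' i"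
  let ?h = "H_pure m X x0 (I \<union> L) \<eta>" and ?h' = "H_pure m X x0 (I' \<union> L') \<eta>'" and ?H = "H_pure m X x0 ?J ?\<theta>"
  let ?y = "C.pelem X x0 ?J (bmon I L \<otimes>\<^bsub>A\<^esub> bmon I' L') ?H" and ?y' = "B.pelem X x0 ?J (bmon' I L \<otimes>\<^bsub>A'\<^esub> bmon' I' L') ?H"
  note F = C.H_homogeneous_factors[OF \<eta>(1)] C.H_homogeneous_factors[OF \<eta>(2)]
  note hc = H_pure_closed[OF F(1)] H_pure_closed[OF F(2)]
  have \<theta>: "?\<theta> \<in> (\<Pi>\<^sub>E i\<in>{1..m}. carrier (H_factor X x0 ?J i))"
  proof (rule restrict_PiE_iff[THEN iffD2], rule ballI)
    fix i assume i: "i \<in> {1..m}"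
    show "\<eta> i \<otimes>\<^bsub>cohomology (X i)\<^esub> \<eta>' i \<in> carrier (H_factor X x0 ?J i)"
      using H_factor_mult[OF PiE_mem[OF F(1) i] PiE_mem[OF F(2) i]] by (simp only: Un_assoc)
  qed
  note Hc = H_pure_closed[OF \<theta>]
  have J: "?J \<in> Pow {1..m}" using C.basis_index_subset[OF b(1)] C.basis_index_subset[OF b(2)] by auto
  have yc: "?y \<in> carrier (C.PM X x0)" by (rule linear_map_closed[OF C.linear_elem_right[OF J C.bmon_mult_support[OF b]] Hc])
  have gc: "B.gen X x0 I L ?h \<in> carrier (B.PM X x0)" "B.gen X x0 I' L' ?h' \<in> carrier (B.PM X x0)"
    by (rule linear_map_closed[OF B.linear_gen[OF b(1)] hc(1)], rule linear_map_closed[OF B.linear_gen[OF b(2)] hc(2)])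
  have 1: "up_to_sign (B.PM X x0) (f (poly_mult m K X x0 A bmon e (C.gen X x0 I L ?h) (C.gen X x0 I' L' ?h'))) (f ?y)"
    by (rule linear_up_to_sign[OF lf yc C.poly_mult_spec(2)[OF b \<eta>]])
  have fgen: "up_to_sign (B.PM X x0) (f (C.gen X x0 I L h)) (B.gen X x0 I L h)"
    if "basis_index m K I L" "h \<in> carrier (C.HT X x0 (I \<union> L))" for I L h
    unfolding fg[OF that] by (rule up_to_signI[OF s])
  have y'c: "?y' \<in> carrier (B.PM X x0)" by (rule linear_map_closed[OF B.linear_elem_right[OF J B.bmon_mult_support[OF b]] Hc])
  have 2: "up_to_sign (B.PM X x0) (poly_mult m K X x0 A' bmon' e' (f (C.gen X x0 I L ?h)) (f (C.gen X x0 I' L' ?h'))) ?y'"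
    by (rule BM.up_to_sign_trans[OF y'c bilinear_up_to_sign[OF B.kmodule_PM B.poly_mult_spec(1) gc fgen[OF b(1) hc(1)] fgen[OF b(2) hc(2)]] B.poly_mult_spec(2)[OF b \<eta>]])
  have "\<exists>z\<in>carrier (B.PM X x0). up_to_sign (B.PM X x0) (f ?y) z \<and> up_to_sign (B.PM X x0) ?y' z"
  proof (cases "(I \<union> L) \<inter> (I' \<union> L') = {}")
    case True
    note cm = C.merged_elem[OF b True Hc] and bm = B.merged_elem[OF b True Hc]
    have "up_to_sign (B.PM X x0) (f (C.merged X x0 I L I' L' ?H)) (B.merged X x0 I L I' L' ?H)"
    proof (cases "L \<union> L' \<in> K")
      case True
      then have b': "basis_index m K (I \<union> I') (L \<union> L')" using b \<open>(I \<union> L) \<inter> (I' \<union> L') = {}\<close> by (auto simp: basis_index_def)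
      have "?J = (I \<union> I') \<union> (L \<union> L')" by auto
      then have "?H \<in> carrier (H_tensor m X x0 ((I \<union> I') \<union> (L \<union> L')))" using Hc by simp
      from fgen[OF b' this] show ?thesis using True by (simp only: C.merged_def B.merged_def if_True)
    next
      case False
      then show ?thesis using linear_map_zero[OF C.kmodule_PM B.kmodule_PM lf] BM.up_to_sign_refl[OF BM.zero_closed]
        by (simp only: C.merged_def B.merged_def if_False)
    qed
    then have "up_to_sign (B.PM X x0) (f ?y) (B.merged X x0 I L I' L' ?H)"
      by (rule BM.up_to_sign_trans[OF bm(2) linear_up_to_sign[OF lf cm(2) cm(1)]])
    then show ?thesis using bm by blast
  next
    case False
    then obtain i where i: "i \<in> {1..m}" "\<eta> i \<otimes>\<^bsub>cohomology (X i)\<^esub> \<eta>' i = \<zero>\<^bsub>cohomology (X i)\<^esub>" using dis by blast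
    have "?\<theta> i = \<zero>\<^bsub>cohomology (X i)\<^esub>" using i by simp
    then have H0: "?H = \<zero>\<^bsub>H_tensor m X x0 ?J\<^esub>" by (rule H_pure_zero[OF \<theta> i(1)])
    have "f ?y = \<zero>\<^bsub>B.PM X x0\<^esub>" "?y' = \<zero>\<^bsub>B.PM X x0\<^esub>"
      unfolding H0 C.elem_zero[OF b] B.elem_zero[OF b] by (rule linear_map_zero[OF C.kmodule_PM B.kmodule_PM lf], rule refl)
    then show ?thesis using BM.up_to_sign_refl[OF BM.zero_closed] by (intro bexI[OF _ BM.zero_closed]) (simp only: simp_thms)
  qed
  then obtain z where z: "z \<in> carrier (B.PM X x0)" "up_to_sign (B.PM X x0) (f ?y) z" "up_to_sign (B.PM X x0) ?y' z" by blast
  have zz: "up_to_sign (B.PM X x0) z (poly_mult m K X x0 A' bmon' e' (f (C.gen X x0 I L ?h)) (f (C.gen X x0 I' L' ?h')))"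
    by (rule BM.up_to_sign_sym[OF z(1) BM.up_to_sign_trans[OF z(1) 2 z(3)]])
  have mc: "poly_mult m K X x0 A' bmon' e' (f (C.gen X x0 I L ?h)) (f (C.gen X x0 I' L' ?h')) \<in> carrier (B.PM X x0)"
    using 2 y'c unfolding up_to_sign_def by auto
  show ?thesis by (rule BM.up_to_sign_trans[OF mc BM.up_to_sign_trans[OF z(1) 1 z(2)] zz])
qed

end

lemma (in signed_monomials) disjoint_monomial_algebra: "disjoint_monomial_algebra m K signed_algebra mon"
  by (rule disjoint_monomial_algebra.intro[OF monomial_algebra disjoint_monomial_algebra_axioms.intro]) (rule mon_mult_disjoint_sign)

lemma R_B_comparison:
  assumes K: "simplicial_complex_on m K"
  shows "monomial_comparison m K (R_algebra m K :: ('k::comm_ring_1, _) module) (R_monomial m K)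
    (B_algebra m K) (B_monomial m K) (\<lambda>I L. of_int (shuffle_sign I L))"
proof -
  interpret R: signed_monomials m K Om Ym "- 1 :: 'k" 1 0 by (rule signed_monomials_R[OF K])
  interpret T: signed_monomials m K Sm Tm "1 :: 'k" "- 1" 1 by (rule signed_monomials_B[OF K])
  have R: "disjoint_monomial_algebra m K (R_algebra m K :: ('k, _) module) (R_monomial m K)"
    unfolding R_algebra_signed[OF K] by (rule R.disjoint_monomial_algebra)
  have T: "disjoint_monomial_algebra m K (B_algebra m K :: ('k, _) module) (B_monomial m K)"
    unfolding B_algebra_signed[OF K] by (rule T.disjoint_monomial_algebra)
  show ?thesis
    by (rule monomial_comparison.intro[OF R T], rule monomial_comparison_axioms.intro, rule of_int_shuffle_sign)
qed

theorem proposition3p6: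
  fixes m :: nat and K :: "nat set set"
    and X :: "nat \<Rightarrow> 'a topology" and x0 :: "nat \<Rightarrow> 'a"
  assumes coeff: "bij (of_int :: int \<Rightarrow> 'k::comm_ring_1) \<or> (\<forall>a::'k. a \<noteq> 0 \<longrightarrow> (\<exists>b. a * b = 1))"
    and K: "simplicial_complex_on m K"
    and X: "\<forall>i\<in>{1..m}. pointed_CW_complex (X i) (x0 i)"
    and free: "\<forall>i\<in>{1..m}. is_free_module (cohomology (X i) :: ('k, ('a, 'k) cochain set) module)"
  shows
    "let C = C_algebra_X m K X x0 :: ('k, _) module;
         B = B_algebra_X m K X x0 :: ('k, _) module;
         f = f_X m K X x0;
         compatible = (\<lambda>I L I' L'. \<forall>d d' \<eta> \<eta>'.
           H_homogeneous m X x0 (I \<union> L) d \<eta> \<longrightarrow> H_homogeneous m X x0 (I' \<union> L') d' \<eta>' \<longrightarrow>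
           (let x = C_elem m K X x0 I L (H_pure m X x0 (I \<union> L) \<eta>);
                x' = C_elem m K X x0 I' L' (H_pure m X x0 (I' \<union> L') \<eta>')
            in eq_up_to_sign B (f (x \<otimes>\<^bsub>C\<^esub> x')) (f x \<otimes>\<^bsub>B\<^esub> f x')))
     in linear_iso C B f \<and>
        (\<forall>I L I' L'. basis_index m K I L \<longrightarrow> basis_index m K I' L' \<longrightarrow>
           (I \<union> L) \<inter> (I' \<union> L') = {} \<longrightarrow> compatible I L I' L') \<and>
        ((\<forall>i\<in>{1..m}. suspension_space (X i) (x0 i)) \<longrightarrow>
           (\<forall>I L I' L'. basis_index m K I L \<longrightarrow> basis_index m K I' L' \<longrightarrow> compatible I L I' L'))"
proof -
  interpret monomial_comparison m K "R_algebra m K :: ('k, _) module" "R_monomial m K" "B_algebra m K :: ('k, _) module" "B_monomial m K"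
      "\<lambda>I L. of_int (shuffle_sign I L)"
    by (rule R_B_comparison[OF K])
  define f where "f = (f_X m K X x0 :: _ \<Rightarrow> nat set \<Rightarrow> ((B_gen list \<Rightarrow>\<^sub>0 'k) set \<times> ((nat \<Rightarrow> ('a, 'k) cochain set) \<Rightarrow>\<^sub>0 'k) set \<Rightarrow>\<^sub>0 'k) set)"
  have "f = (SOME f. comparison X x0 f)"
    unfolding f_def f_X_def comparison_def C_elem_def B_elem_def C_algebra_X_def B_algebra_X_def linear_map_poly_algebra B.poly_algebra_simps ..
  then have f: "comparison X x0 f" using someI_ex[OF comparison_exists] by simp
  \<comment> \<open>The algebras and the modules that underlie them have the same linear maps.\<close>
  have iso: "linear_iso (C_algebra_X m K X x0) (B_algebra_X m K X x0) f"
    using comparison_iso[OF f] unfolding linear_iso_def C_algebra_X_def B_algebra_X_def linear_map_poly_algebra C.poly_algebra_simps B.poly_algebra_simps .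
  have mult: "eq_up_to_sign (B_algebra_X m K X x0 :: ('k, _) module)
      (f (C_elem m K X x0 I L (H_pure m X x0 (I \<union> L) \<eta>) \<otimes>\<^bsub>C_algebra_X m K X x0\<^esub> C_elem m K X x0 I' L' (H_pure m X x0 (I' \<union> L') \<eta>')))
      (f (C_elem m K X x0 I L (H_pure m X x0 (I \<union> L) \<eta>)) \<otimes>\<^bsub>B_algebra_X m K X x0\<^esub> f (C_elem m K X x0 I' L' (H_pure m X x0 (I' \<union> L') \<eta>')))"
    if b: "basis_index m K I L" "basis_index m K I' L'" and \<eta>: "H_homogeneous m X x0 (I \<union> L) d \<eta>" "H_homogeneous m X x0 (I' \<union> L') d' \<eta>'"
      and dis: "(I \<union> L) \<inter> (I' \<union> L') = {} \<or> (\<exists>i\<in>{1..m}. \<eta> i \<otimes>\<^bsub>cohomology (X i)\<^esub> \<eta>' i = \<zero>\<^bsub>cohomology (X i)\<^esub>)"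
    for I L I' L' d d' \<eta> \<eta>'
  proof -
    let ?x = "C.gen X x0 I L (H_pure m X x0 (I \<union> L) \<eta>)" and ?x' = "C.gen X x0 I' L' (H_pure m X x0 (I' \<union> L') \<eta>')"
    have cl: "?x \<in> carrier (C.PM X x0)" "?x' \<in> carrier (C.PM X x0)"
      using linear_map_closed[OF C.linear_gen[OF b(1)] H_pure_closed[OF C.H_homogeneous_factors[OF \<eta>(1)]]]
        linear_map_closed[OF C.linear_gen[OF b(2)] H_pure_closed[OF C.H_homogeneous_factors[OF \<eta>(2)]]] by blast+
    have lf: "linear_map (C.PM X x0) (B.PM X x0) f" using f by (simp add: comparison_def)
    have "linear_map (B.PM X x0) (B.PM X x0) (poly_mult m K X x0 (B_algebra m K) (B_monomial m K) B_degree (f ?x))"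
      using B.poly_mult_spec(1)[of X x0 B_degree] linear_map_closed[OF lf cl(1)] unfolding bilinear_op_def by blast
    from linear_map_closed[OF this linear_map_closed[OF lf cl(2)]]
    show ?thesis
      using comparison_mult[OF f b \<eta> dis, of R_degree B_degree]
      unfolding C_elem_def C_algebra_X_def B_algebra_X_def C.poly_algebra_simps B.poly_algebra_simps
      by (simp only: kmodule.up_to_sign_iff[OF B.kmodule_PM])
  qed
  have sus: "\<exists>i\<in>{1..m}. \<eta> i \<otimes>\<^bsub>cohomology (X i)\<^esub> \<eta>' i = \<zero>\<^bsub>cohomology (X i)\<^esub>"
    if S: "\<forall>i\<in>{1..m}. suspension_space (X i) (x0 i)" and b: "basis_index m K I L" "basis_index m K I' L'"
      and \<eta>: "H_homogeneous m X x0 (I \<union> L) d \<eta>" "H_homogeneous m X x0 (I' \<union> L') d' \<eta>'" and ne: "(I \<union> L) \<inter> (I' \<union> L') \<noteq> {}"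
    for I L I' L' d d' and \<eta> \<eta>' :: "nat \<Rightarrow> ('a, 'k) cochain set"
  proof -
    \<comment> \<open>At a common index both factors are reduced classes.\<close>
    obtain i where i: "i \<in> I \<union> L" "i \<in> I' \<union> L'" using ne by blast
    then have im: "i \<in> {1..m}" using C.basis_index_subset[OF b(1)] by blast
    have "\<eta> i \<in> carrier (reduced_cohomology (X i) (x0 i))" "\<eta>' i \<in> carrier (reduced_cohomology (X i) (x0 i))"
      using PiE_mem[OF C.H_homogeneous_factors[OF \<eta>(1)] im] PiE_mem[OF C.H_homogeneous_factors[OF \<eta>(2)] im] i by (simp_all add: H_factor_def)
    from suspension_cup_vanishes[OF bspec[OF X im] bspec[OF S im] this] show ?thesis using im by blast
  qed
  show ?thesis
    unfolding Let_def f_def[symmetric]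
  proof (intro conjI allI impI)
    show "linear_iso (C_algebra_X m K X x0) (B_algebra_X m K X x0) f" by (rule iso)
  next
    fix I L I' L' d d' and \<eta> \<eta>' :: "nat \<Rightarrow> ('a, 'k) cochain set"
    assume "basis_index m K I L" "basis_index m K I' L'" "(I \<union> L) \<inter> (I' \<union> L') = {}"
      "H_homogeneous m X x0 (I \<union> L) d \<eta>" "H_homogeneous m X x0 (I' \<union> L') d' \<eta>'"
    then show "eq_up_to_sign (B_algebra_X m K X x0 :: ('k, _) module)
      (f (C_elem m K X x0 I L (H_pure m X x0 (I \<union> L) \<eta>) \<otimes>\<^bsub>C_algebra_X m K X x0\<^esub> C_elem m K X x0 I' L' (H_pure m X x0 (I' \<union> L') \<eta>')))
      (f (C_elem m K X x0 I L (H_pure m X x0 (I \<union> L) \<eta>)) \<otimes>\<^bsub>B_algebra_X m K X x0\<^esub> f (C_elem m K X x0 I' L' (H_pure m X x0 (I' \<union> L') \<eta>')))"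
      by (intro mult disjI1)
  next
    fix I L I' L' d d' and \<eta> \<eta>' :: "nat \<Rightarrow> ('a, 'k) cochain set"
    assume S: "\<forall>i\<in>{1..m}. suspension_space (X i) (x0 i)"
      and b: "basis_index m K I L" "basis_index m K I' L'"
      and \<eta>: "H_homogeneous m X x0 (I \<union> L) d \<eta>" "H_homogeneous m X x0 (I' \<union> L') d' \<eta>'"
    show "eq_up_to_sign (B_algebra_X m K X x0 :: ('k, _) module)
      (f (C_elem m K X x0 I L (H_pure m X x0 (I \<union> L) \<eta>) \<otimes>\<^bsub>C_algebra_X m K X x0\<^esub> C_elem m K X x0 I' L' (H_pure m X x0 (I' \<union> L') \<eta>')))
      (f (C_elem m K X x0 I L (H_pure m X x0 (I \<union> L) \<eta>)) \<otimes>\<^bsub>B_algebra_X m K X x0\<^esub> f (C_elem m K X x0 I' L' (H_pure m X x0 (I' \<union> L') \<eta>')))"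
      by (rule mult[OF b \<eta>]) (use sus[OF S b \<eta>] in blast)
  qed
qed

end
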